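(* Let $s\in(0,1)$, $\gamma\in(1,2)$, $T>0$, and let $\mathscr{U}$ solve the extended problem $$\begin{cases}-\mathrm{div}(y^\alpha\mathbf{A}\nabla\mathscr{U})+y^\alpha c\,\mathscr{U}=0\ \text{ in }\mathcal{C}\times(0,T),\qquad \mathscr{U}=0\ \text{ on }\partial_L\mathcal{C}\times(0,T),\\ d_s\partial_t^\gamma\mathscr{U}+\partial_\nu^\alpha\mathscr{U}=d_sf\ \text{ on }(\Omega\times\{0\})\times(0,T),\\ \mathscr{U}=g,\quad\partial_t\mathscr{U}=h\ \text{ on }\Omega\times\{0\},\ t=0.\end{cases}$$ Let $0\le\theta<2\sqrt{\lambda_1}$, $0\le\sigma<s$, $0\le\nu<1+s$, and let $\mu>0$ be an arbitrary sufficiently small number ($0<\mu\ll1$). Then there exist $\kappa>1$ and $C>0$, with $C$ independent of $\ell$ and of the data $f,g,h$, such that for every integer $\ell\ge0$, $$\|\partial_y^{\ell+1}\mathscr{U}\|^2_{L^2(0,T;L^2(\omega_{\alpha+2\ell-2\sigma,\theta},\mathcal{C}))}\le C\kappa^{2(\ell+1)}((\ell+1)!)^2\left(\|g\|^2_{\mathbb{H}^{\sigma+s}(\Omega)}+\|h\|^2_{\mathbb{H}^{\sigma}(\Omega)}+\|f\|^2_{L^2(0,T;\mathbb{H}^{\sigma-s+2\mu s}(\Omega))}\right),$$ $$\|\nabla_{x'}\partial_y^{\ell+1}\mathscr{U}\|^2_{L^2(0,T;L^2(\omega_{\alpha+2(\ell+1)-2\nu,\theta},\mathcal{C}))}\le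 C\kappa^{2(\ell+1)}((\ell+1)!)^2\left(\|g\|^2_{\mathbb{H}^{\nu+s}(\Omega)}+\|h\|^2_{\mathbb{H}^{\nu}(\Omega)}+\|f\|^2_{L^2(0,T;\mathbb{H}^{\nu-s+2\mu s}(\Omega))}\right),$$ and $$\|\mathcal{L}_{x'}\partial_y^{\ell+1}\mathscr{U}\|^2_{L^2(0,T;L^2(\omega_{\alpha+2(\ell+1)-2\nu,\theta},\mathcal{C}))}\le C\kappa^{2(\ell+1)}((\ell+1)!)^2\left(\|g\|^2_{\mathbb{H}^{1+\nu+s}(\Omega)}+\|h\|^2_{\mathbb{H}^{1+\nu}(\Omega)}+\|f\|^2_{L^2(0,T;\mathbb{H}^{1+\nu-s+2\mu s}(\Omega))}\right),$$ each bound being understood whenever its right-hand side is finite.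
   Context: $\Omega\subset\mathbb{R}^n$ ($n\ge1$) is open, bounded and convex. $\mathcal{L}w=-\mathrm{div}(A\nabla w)+cw$ with homogeneous Dirichlet boundary conditions, where $0\le c\in L^\infty(\Omega)$ and $A$ is a Lipschitz ($C^{0,1}$), symmetric, uniformly positive definite matrix field on $\Omega$; $\mathcal{L}_{x'}$ denotes $\mathcal{L}$ acting in $x'\in\Omega$. $\{(\lambda_k,\varphi_k)\}_{k\ge1}\subset\mathbb{R}_+\times H_0^1(\Omega)$ are the eigenpairs of $\mathcal{L}$, with $\lambda_1$ the smallest eigenvalue and $\{\varphi_k\}$ an orthonormal basis of $L^2(\Omega)$. For $r\in\mathbb{R}$, $\|w\|_{\mathbb{H}^r(\Omega)}^2=\sum_k\lambda_k^r|w_k|^2$ for $w=\sum_kw_k\varphi_k$; $\mathbb{H}^r(\Omega)$ is the corresponding space, and for $r<0$ it is the dual of $\mathbb{H}^{-r}(\Omega)$ with $w_k=\langle w,\varphi_k\rangle$. Extension notation: $\mathcal{C}=\Omega\times(0,\infty)$ with points $(x',y)$; $\partial_L\mathcal{C}=\partial\Omega\times[0,\infty)$; $\alpha=1-2s$; $d_s=2^\alpha\Gamma(1-s)/\Gamma(s)$; $\mathbf{A}=\mathrm{diag}\{A,1\}$; $\partial_\nu^\alpha\mathscr{U}=-\lim_{y\downarrow0}y^\alpha\mathscr{U}_y$; $\partial_t^\gamma$ is the left-sided Caputo derivative $\frac1{\Gamma(2-\gamma)}\int_0^t(t-r)^{1-\gamma}\frac{d^2u(r)}{dr^2}\,dr$.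 The solution is $\mathscr{U}(x',y,t)=\sum_{k\ge1}u_k(t)\varphi_k(x')\psi_k(y)$. Here, with $E_{\gamma,\mu}(z)=\sum_{j\ge0}\frac{z^j}{\Gamma(\gamma j+\mu)}$ (Mittag-Leffler function) and $g_k,h_k,f_k(t)$ the coefficients of $g,h,f(\cdot,t)$ with respect to $\varphi_k$, $$u_k(t)=E_{\gamma,1}(-\lambda_k^st^\gamma)g_k+tE_{\gamma,2}(-\lambda_k^st^\gamma)h_k+\int_0^t(t-r)^{\gamma-1}E_{\gamma,\gamma}(-\lambda_k^s(t-r)^\gamma)f_k(r)\,dr,$$ and $\psi_k$ solves $\psi_k''+\frac\alpha y\psi_k'=\lambda_k\psi_k$ on $(0,\infty)$, $\psi_k(0)=1$, $\lim_{y\to\infty}\psi_k(y)=0$; explicitly $\psi_k(y)=c_s(\sqrt{\lambda_k}y)^sK_s(\sqrt{\lambda_k}y)$, $c_s=2^{1-s}/\Gamma(s)$, $K_s$ the modified Bessel function of the second kind. Weights: $\omega_{\beta,\theta}(y)=y^\beta e^{\theta y}$ and $\|v\|_{L^2(\omega_{\beta,\theta},\mathcal{C})}^2=\int_0^\infty\int_\Omega\omega_{\beta,\theta}(y)|v(x',y)|^2\,dx'\,dy$. *)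

theory Defs
  imports "HOL-Analysis.Analysis"
begin

section \<open>Lebesgue and Sobolev spaces\<close>

definition in_L2 :: "'a::euclidean_space set \<Rightarrow> ('a \<Rightarrow> 'b::euclidean_space) \<Rightarrow> bool" where
  "in_L2 D w \<longleftrightarrow> w \<in> borel_measurable (lebesgue_on D) \<and>
     integrable (lebesgue_on D) (\<lambda>x. (norm (w x))\<^sup>2)"

definition L2_tendsto ::
    "'a::euclidean_space set \<Rightarrow> (nat \<Rightarrow> 'a \<Rightarrow> 'b::euclidean_space) \<Rightarrow> ('a \<Rightarrow> 'b) \<Rightarrow> bool" where
  "L2_tendsto D w v \<longleftrightarrow> (\<forall>N. in_L2 D (w N)) \<and> in_L2 D v \<and>
     (\<lambda>N. \<integral>\<^sup>+x. ennreal ((norm (w N x - v x))\<^sup>2) \<partial>lebesgue_on D) \<longlonglongrightarrow> 0"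

primrec Ck :: "nat \<Rightarrow> ('a::euclidean_space \<Rightarrow> real) \<Rightarrow> bool" where
  "Ck 0 f \<longleftrightarrow> continuous_on UNIV f"
| "Ck (Suc k) f \<longleftrightarrow> (\<exists>G. (\<forall>x. GDERIV f x :> G x) \<and> (\<forall>e\<in>Basis. Ck k (\<lambda>x. G x \<bullet> e)))"

definition test_function :: "'a::euclidean_space set \<Rightarrow> ('a \<Rightarrow> real) \<Rightarrow> bool" where
  "test_function D \<eta> \<longleftrightarrow> (\<forall>k. Ck k \<eta>) \<and>
     compact (closure {x. \<eta> x \<noteq> 0}) \<and> closure {x. \<eta> x \<noteq> 0} \<subseteq> D"

definition grad :: "('a::euclidean_space \<Rightarrow> real) \<Rightarrow> 'a \<Rightarrow> 'a" where
  "grad \<eta> x = (THE D. GDERIV \<eta> x :> D)"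

definition locally_integrable :: "'a::euclidean_space set \<Rightarrow> ('a \<Rightarrow> real) \<Rightarrow> bool" where
  "locally_integrable D u \<longleftrightarrow> (\<forall>K. compact K \<and> K \<subseteq> D \<longrightarrow> integrable (lebesgue_on K) u)"

definition weak_deriv ::
    "'a::euclidean_space set \<Rightarrow> 'a \<Rightarrow> ('a \<Rightarrow> real) \<Rightarrow> ('a \<Rightarrow> real) \<Rightarrow> bool" where
  "weak_deriv D e u v \<longleftrightarrow> locally_integrable D u \<and> locally_integrable D v \<and>
     (\<forall>\<eta>. test_function D \<eta> \<longrightarrow>
        (\<integral>x. u x * (grad \<eta> x \<bullet> e) \<partial>lebesgue_on D) = - (\<integral>x. v x * \<eta> x \<partial>lebesgue_on D))"

primrec weak_deriv_iter ::
    "'a::euclidean_space set \<Rightarrow> 'a \<Rightarrow> nat \<Rightarrow> ('a \<Rightarrow> real) \<Rightarrow> ('a \<Rightarrow> real) \<Rightarrow> bool" where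
  "weak_deriv_iter D e 0 u v \<longleftrightarrow> (AE x in lebesgue_on D. u x = v x)"
| "weak_deriv_iter D e (Suc j) u v \<longleftrightarrow>
     (\<exists>w. weak_deriv_iter D e j u w \<and> weak_deriv D e w v)"

definition weak_grad ::
    "'a::euclidean_space set \<Rightarrow> ('a \<Rightarrow> real) \<Rightarrow> ('a \<Rightarrow> 'a) \<Rightarrow> bool" where
  "weak_grad D u G \<longleftrightarrow> (\<forall>e\<in>Basis. weak_deriv D e u (\<lambda>x. G x \<bullet> e))"

text \<open>\<open>H\<^sub>0\<^sup>1\<close> is the closure of the test functions in the \<open>H\<^sup>1\<close> norm.\<close>

definition H10 :: "'a::euclidean_space set \<Rightarrow> ('a \<Rightarrow> real) \<Rightarrow> bool" where
  "H10 D u \<longleftrightarrow> (\<exists>G \<eta>. weak_grad D u G \<and> (\<forall>j. test_function D (\<eta> j)) \<and>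
     L2_tendsto D \<eta> u \<and> L2_tendsto D (\<lambda>j. grad (\<eta> j)) G)"


section \<open>The elliptic operator and its spectral decomposition\<close>

definition admissible_coefficients ::
    "(real^'n) set \<Rightarrow> (real^'n \<Rightarrow> real^'n^'n) \<Rightarrow> (real^'n \<Rightarrow> real) \<Rightarrow> bool" where
  "admissible_coefficients \<Omega> A c \<longleftrightarrow>
     (\<exists>L. L-lipschitz_on \<Omega> A) \<and>
     (\<forall>x\<in>\<Omega>. transpose (A x) = A x) \<and>
     (\<exists>a>0. \<forall>x\<in>\<Omega>. \<forall>\<xi>. a * (norm \<xi>)\<^sup>2 \<le> \<xi> \<bullet> (A x *v \<xi>)) \<and>
     c \<in> borel_measurable (lebesgue_on \<Omega>) \<and>
     (\<exists>M. AE x in lebesgue_on \<Omega>. 0 \<le> c x \<and> c x \<le> M)"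

text \<open>\<open>elliptic_eq \<Omega> A c w v\<close>: \<open>w\<close> vanishes on the boundary and
  \<open>- div (A \<nabla>w) + c w = v\<close> in \<open>\<Omega>\<close>, in the weak sense.\<close>

definition elliptic_eq ::
    "(real^'n) set \<Rightarrow> (real^'n \<Rightarrow> real^'n^'n) \<Rightarrow> (real^'n \<Rightarrow> real) \<Rightarrow>
     (real^'n \<Rightarrow> real) \<Rightarrow> (real^'n \<Rightarrow> real) \<Rightarrow> bool" where
  "elliptic_eq \<Omega> A c w v \<longleftrightarrow> H10 \<Omega> w \<and> in_L2 \<Omega> v \<and>
     (\<exists>G. weak_grad \<Omega> w G \<and>
       (\<forall>\<eta>. test_function \<Omega> \<eta> \<longrightarrow>
          (\<integral>x. (A x *v G x) \<bullet> grad \<eta> x + c x * w x * \<eta> x \<partial>lebesgue_on \<Omega>)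
            = (\<integral>x. v x * \<eta> x \<partial>lebesgue_on \<Omega>)))"

definition coeff ::
    "'a::euclidean_space set \<Rightarrow> (nat \<Rightarrow> 'a \<Rightarrow> real) \<Rightarrow> ('a \<Rightarrow> real) \<Rightarrow> nat \<Rightarrow> real" where
  "coeff D \<phi> w k = (\<integral>x. w x * \<phi> k x \<partial>lebesgue_on D)"

text \<open>Eigenpairs are indexed from \<open>0\<close>, so \<open>lam 0\<close> is the smallest eigenvalue.\<close>

definition eigenbasis ::
    "(real^'n) set \<Rightarrow> (real^'n \<Rightarrow> real^'n^'n) \<Rightarrow> (real^'n \<Rightarrow> real) \<Rightarrow>
     (nat \<Rightarrow> real) \<Rightarrow> (nat \<Rightarrow> real^'n \<Rightarrow> real) \<Rightarrow> bool" where
  "eigenbasis \<Omega> A c lam \<phi> \<longleftrightarrow>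
     (\<forall>k. 0 < lam k \<and> lam 0 \<le> lam k) \<and>
     (\<forall>k. elliptic_eq \<Omega> A c (\<phi> k) (\<lambda>x. lam k * \<phi> k x)) \<and>
     (\<forall>j k. (\<integral>x. \<phi> j x * \<phi> k x \<partial>lebesgue_on \<Omega>) = (if j = k then 1 else 0)) \<and>
     (\<forall>w. in_L2 \<Omega> w \<longrightarrow> L2_tendsto \<Omega> (\<lambda>N x. \<Sum>k<N. coeff \<Omega> \<phi> w k * \<phi> k x) w)"

text \<open>The squared \<open>\<H>\<^sup>r\<close> norm, as a function of the coefficient sequence.\<close>

definition Hnorm2 :: "(nat \<Rightarrow> real) \<Rightarrow> real \<Rightarrow> (nat \<Rightarrow> real) \<Rightarrow> ennreal" where
  "Hnorm2 lam r w = (\<Sum>k. ennreal (lam k powr r * (w k)\<^sup>2))"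

text \<open>The space \<open>\<H>\<^sup>r\<close> for \<open>r \<ge> 0\<close>, and \<open>\<H>\<^sup>-\<^sup>r\<close> as its dual. A function
  \<open>w\<close> in \<open>L\<^sup>2\<close> is identified with the functional \<open>v \<mapsto> \<integral> w v\<close>; a functional \<open>F\<close>
  has the coefficients \<open>F (\<phi> k)\<close>.\<close>

definition Hspace ::
    "'a::euclidean_space set \<Rightarrow> (nat \<Rightarrow> real) \<Rightarrow> (nat \<Rightarrow> 'a \<Rightarrow> real) \<Rightarrow> real \<Rightarrow> ('a \<Rightarrow> real) set" where
  "Hspace D lam \<phi> r = {v. in_L2 D v \<and> Hnorm2 lam r (coeff D \<phi> v) < \<infinity>}"

definition Hdual ::
    "'a::euclidean_space set \<Rightarrow> (nat \<Rightarrow> real) \<Rightarrow> (nat \<Rightarrow> 'a \<Rightarrow> real) \<Rightarrow> real \<Rightarrow>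
     (('a \<Rightarrow> real) \<Rightarrow> real) set" where
  "Hdual D lam \<phi> r = {F.
     (\<forall>v\<in>Hspace D lam \<phi> r. \<forall>w\<in>Hspace D lam \<phi> r. F (\<lambda>x. v x + w x) = F v + F w) \<and>
     (\<forall>a. \<forall>v\<in>Hspace D lam \<phi> r. F (\<lambda>x. a * v x) = a * F v) \<and>
     (\<exists>M. \<forall>v\<in>Hspace D lam \<phi> r.
        \<bar>F v\<bar> \<le> M * sqrt (enn2real (Hnorm2 lam r (coeff D \<phi> v))))}"

text \<open>The squared norm of \<open>L\<^sup>2(0,T;\<H>\<^sup>r)\<close>.\<close>

definition L2Hnorm2 ::
    "real \<Rightarrow> (nat \<Rightarrow> real) \<Rightarrow> (nat \<Rightarrow> 'a \<Rightarrow> real) \<Rightarrow> real \<Rightarrow>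
     (real \<Rightarrow> ('a \<Rightarrow> real) \<Rightarrow> real) \<Rightarrow> ennreal" where
  "L2Hnorm2 T lam \<phi> r f =
     (\<integral>\<^sup>+t. Hnorm2 lam r (\<lambda>k. f t (\<phi> k)) \<partial>lebesgue_on {0<..<T})"

text \<open>Measurable families of functionals in \<open>\<H>\<^sup>-\<^sup>s\<close>, with \<open>t\<close> in \<open>(0,T)\<close>. As \<open>\<H>\<^sup>s\<close> is a
  separable Hilbert space, weak and strong measurability agree. For \<open>r \<ge> -s\<close> such a
  family is in \<open>L\<^sup>2(0,T;\<H>\<^sup>r)\<close> iff \<open>L2Hnorm2 T lam \<phi> r f\<close> is finite.\<close>

definition source_family ::
    "'a::euclidean_space set \<Rightarrow> real \<Rightarrow> (nat \<Rightarrow> real) \<Rightarrow> (nat \<Rightarrow> 'a \<Rightarrow> real) \<Rightarrow> real \<Rightarrow>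
     (real \<Rightarrow> ('a \<Rightarrow> real) \<Rightarrow> real) \<Rightarrow> bool" where
  "source_family D T lam \<phi> s f \<longleftrightarrow>
     (AE t in lebesgue_on {0<..<T}. f t \<in> Hdual D lam \<phi> s) \<and>
     (\<forall>v\<in>Hspace D lam \<phi> s. (\<lambda>t. f t v) \<in> borel_measurable (lebesgue_on {0<..<T}))"


section \<open>The solution of the extended problem\<close>

definition mittag_leffler :: "real \<Rightarrow> real \<Rightarrow> real \<Rightarrow> real" where
  "mittag_leffler \<gamma> \<mu> z = (\<Sum>j. z ^ j / Gamma (\<gamma> * real j + \<mu>))"

definition wave_coeff ::
    "real \<Rightarrow> real \<Rightarrow> real \<Rightarrow> real \<Rightarrow> real \<Rightarrow> (real \<Rightarrow> real) \<Rightarrow> real \<Rightarrow> real" where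
  "wave_coeff s \<gamma> l gk hk fk t =
     mittag_leffler \<gamma> 1 (- (l powr s * t powr \<gamma>)) * gk
     + t * mittag_leffler \<gamma> 2 (- (l powr s * t powr \<gamma>)) * hk
     + (LINT r:{0..t}|lebesgue.
          (t - r) powr (\<gamma> - 1) * mittag_leffler \<gamma> \<gamma> (- (l powr s * (t - r) powr \<gamma>)) * fk r)"

text \<open>The boundary value problem below has exactly one solution on \<open>[0,\<infinity>)\<close>, namely
  \<open>c\<^sub>s (\<surd>l y)\<^sup>s K\<^sub>s(\<surd>l y)\<close>; the values for negative arguments are irrelevant.\<close>

definition extension_profile :: "real \<Rightarrow> real \<Rightarrow> (real \<Rightarrow> real) \<Rightarrow> bool" where
  "extension_profile s l \<psi> \<longleftrightarrow>
     (\<exists>\<psi>' \<psi>''. \<forall>y>0. (\<psi> has_real_derivative \<psi>' y) (at y) \<and>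
        (\<psi>' has_real_derivative \<psi>'' y) (at y) \<and>
        \<psi>'' y + (1 - 2 * s) / y * \<psi>' y = l * \<psi> y) \<and>
     \<psi> 0 = 1 \<and> (\<psi> \<longlongrightarrow> 1) (at_right 0) \<and> (\<psi> \<longlongrightarrow> 0) at_top"

definition cyl_measurable ::
    "'a::euclidean_space set \<Rightarrow> real \<Rightarrow> ('a \<Rightarrow> real \<Rightarrow> real \<Rightarrow> 'b::euclidean_space) \<Rightarrow> bool" where
  "cyl_measurable D T V \<longleftrightarrow>
     (\<lambda>(x, y, t). V x y t) \<in> borel_measurable (lebesgue_on (D \<times> {0<..} \<times> {0<..<T}))"

text \<open>\<open>U x y t\<close> is the sum of the series of \<open>u\<^sub>k(t) \<phi>\<^sub>k(x) \<psi>\<^sub>k(y)\<close>, with convergence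
  in \<open>L\<^sup>2(D)\<close> for almost all \<open>t\<close> and \<open>y\<close>. This representation is what is meant by the
  solution: for sources that are only square integrable in time, the \<open>u\<^sub>k\<close> need not have
  the second derivative that the Caputo derivative of order \<open>\<gamma> \<in> (1,2)\<close> refers to.\<close>

definition extended_solution ::
    "'a::euclidean_space set \<Rightarrow> real \<Rightarrow> (nat \<Rightarrow> real) \<Rightarrow> (nat \<Rightarrow> 'a \<Rightarrow> real) \<Rightarrow> (nat \<Rightarrow> real \<Rightarrow> real) \<Rightarrow>
     real \<Rightarrow> real \<Rightarrow> (real \<Rightarrow> ('a \<Rightarrow> real) \<Rightarrow> real) \<Rightarrow> ('a \<Rightarrow> real) \<Rightarrow> ('a \<Rightarrow> real) \<Rightarrow>
     ('a \<Rightarrow> real \<Rightarrow> real \<Rightarrow> real) \<Rightarrow> bool" where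
  "extended_solution D T lam \<phi> \<psi> s \<gamma> f g h U \<longleftrightarrow>
     cyl_measurable D T U \<and>
     (AE t in lebesgue_on {0<..<T}. AE y in lebesgue_on {0<..}.
        L2_tendsto D
          (\<lambda>N x. \<Sum>k<N. wave_coeff s \<gamma> (lam k) (coeff D \<phi> g k) (coeff D \<phi> h k) (\<lambda>r. f r (\<phi> k)) t
                          * \<phi> k x * \<psi> k y)
          (\<lambda>x. U x y t))"


section \<open>Derivatives and weighted norms on the cylinder\<close>

definition dy_power ::
    "'a::euclidean_space set \<Rightarrow> real \<Rightarrow> nat \<Rightarrow> ('a \<Rightarrow> real \<Rightarrow> real \<Rightarrow> real) \<Rightarrow>
     ('a \<Rightarrow> real \<Rightarrow> real \<Rightarrow> real) \<Rightarrow> bool" where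
  "dy_power D T j U V \<longleftrightarrow> cyl_measurable D T V \<and>
     (AE t in lebesgue_on {0<..<T}.
        weak_deriv_iter (D \<times> {0<..}) (0, 1) j (\<lambda>(x, y). U x y t) (\<lambda>(x, y). V x y t))"

definition grad_x ::
    "'a::euclidean_space set \<Rightarrow> real \<Rightarrow> ('a \<Rightarrow> real \<Rightarrow> real \<Rightarrow> real) \<Rightarrow>
     ('a \<Rightarrow> real \<Rightarrow> real \<Rightarrow> 'a) \<Rightarrow> bool" where
  "grad_x D T V G \<longleftrightarrow> cyl_measurable D T G \<and>
     (AE t in lebesgue_on {0<..<T}. AE y in lebesgue_on {0<..}.
        weak_grad D (\<lambda>x. V x y t) (\<lambda>x. G x y t))"

definition elliptic_x ::
    "(real^'n) set \<Rightarrow> (real^'n \<Rightarrow> real^'n^'n) \<Rightarrow> (real^'n \<Rightarrow> real) \<Rightarrow> real \<Rightarrow>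
     (real^'n \<Rightarrow> real \<Rightarrow> real \<Rightarrow> real) \<Rightarrow> (real^'n \<Rightarrow> real \<Rightarrow> real \<Rightarrow> real) \<Rightarrow> bool" where
  "elliptic_x \<Omega> A c T V W \<longleftrightarrow> cyl_measurable \<Omega> T W \<and>
     (AE t in lebesgue_on {0<..<T}. AE y in lebesgue_on {0<..}.
        elliptic_eq \<Omega> A c (\<lambda>x. V x y t) (\<lambda>x. W x y t))"

text \<open>The squared norm of \<open>L\<^sup>2(0,T;L\<^sup>2(\<omega>\<^bsub>\<beta>,\<theta>\<^esub>, D \<times> (0,\<infinity>)))\<close>.\<close>

definition wnorm2 ::
    "'a::euclidean_space set \<Rightarrow> real \<Rightarrow> real \<Rightarrow> real \<Rightarrow>
     ('a \<Rightarrow> real \<Rightarrow> real \<Rightarrow> 'b::euclidean_space) \<Rightarrow> ennreal" where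
  "wnorm2 D T \<beta> \<theta> V =
     (\<integral>\<^sup>+t. (\<integral>\<^sup>+y. (\<integral>\<^sup>+x. ennreal (y powr \<beta> * exp (\<theta> * y) * (norm (V x y t))\<^sup>2)
        \<partial>lebesgue_on D) \<partial>lebesgue_on {0<..}) \<partial>lebesgue_on {0<..<T})"

definition data_norm2 ::
    "'a::euclidean_space set \<Rightarrow> real \<Rightarrow> (nat \<Rightarrow> real) \<Rightarrow> (nat \<Rightarrow> 'a \<Rightarrow> real) \<Rightarrow> real \<Rightarrow> real \<Rightarrow> real \<Rightarrow>
     (real \<Rightarrow> ('a \<Rightarrow> real) \<Rightarrow> real) \<Rightarrow> ('a \<Rightarrow> real) \<Rightarrow> ('a \<Rightarrow> real) \<Rightarrow> ennreal" where
  "data_norm2 D T lam \<phi> s \<mu> r f g h =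
     Hnorm2 lam (r + s) (coeff D \<phi> g) + Hnorm2 lam r (coeff D \<phi> h)
     + L2Hnorm2 T lam \<phi> (r - s + 2 * \<mu> * s) f"

end

theory Submission
  imports Defs "HOL-Complex_Analysis.Complex_Analysis" "HOL-Real_Asymp.Real_Asymp"
begin

text \<open>The solution separates: its \<open>y\<close>-derivatives, and their images under the gradient and the
  operator in \<open>x\<close>, are series of \<open>u\<^sub>k(t) \<lambda>\<^sub>k\<^bsup>m/2\<^esup> \<psi>\<^sub>k\<^bsup>(j)\<^esup>(y)\<close>, with \<open>m = 0, 1, 2\<close>, against a system in
  \<open>L\<^sup>2\<close> that satisfies a Bessel inequality: the eigenfunctions are orthonormal, and their gradients are orthogonal
  in the energy form. So the weighted norms reduce to sums over \<open>k\<close> of a time integral times a \<open>y\<close> integral.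

  All profiles are dilations \<open>\<psi>\<^sub>k(y) = P(\<surd>\<lambda>\<^sub>k y)\<close> of one function, for which the differentiated Bessel
  equation gives \<open>\<bar>P\<^bsup>(j)\<^esup>(z)\<bar> \<le> C \<kappa>\<^sup>j j! z\<^bsup>2s-j\<^esup> e\<^bsup>-bz\<^esup>\<close> with any \<open>b < 1\<close>. Hence the factor
  \<open>\<kappa>\<^bsup>2j\<^esup> (j!)\<^sup>2\<close>, a power of \<open>\<lambda>\<^sub>k\<close>, and the restriction on \<open>\<theta>\<close>. In time, a contour integral
  gives \<open>\<bar>E(-x)\<bar> \<le> M min(1, 1/x)\<close>; the interpolated bound \<open>x\<^bsup>\<mu>-1\<^esup>\<close> turns the convolution with the source
  into one with the integrable kernel \<open>r\<^bsup>\<gamma>\<mu>-1\<^esup>\<close>, and Young's inequality applies.\<close>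

text \<open>The hypotheses on \<open>\<sigma>\<close> and \<open>\<nu>\<close> are integrability at
  \<open>y = 0\<close>. There the weighted square of the \<open>j\<close>-th profile derivative is
  bounded by a multiple of \<open>y powr (p - 1)\<close>; with \<open>j = l + 1\<close> this means
  \<open>p = 2 * s - 2 * \<sigma>\<close> in the first bound and
  \<open>p = 2 + 2 * s - 2 * \<nu>\<close> in the other two. The exponent is free of
  \<open>l\<close>, so one constant serves all orders. Dilation leaves the power
  \<open>m + 2 * s - p / 2\<close> of \<open>lam k\<close>, in each bound \<open>r + s\<close> for
  the index \<open>r\<close> of the data norm. In time, the decay \<open>1 / x\<close> itself would
  give the kernel \<open>1 / t\<close>, which is not integrable; this is why the source pays
  \<open>2 * \<mu> * s\<close>. The obstacle is the meaning of the derivatives. \<open>U\<close> is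
  known only up to null sets, as a limit in \<open>x\<close> for almost all \<open>y\<close> and
  \<open>t\<close>, while \<open>dy_power\<close> asks for weak derivatives on the whole cylinder.
  So jointly measurable fields are built for all orders, with tail estimates at almost every
  \<open>(t, y)\<close>, and each is shown to be the weak derivative of its predecessor by passing
  to the limit on slabs away from \<open>y = 0\<close>, where the profile derivatives are
  bounded.\<close>

lemma powr_le_exp:
  fixes y p c :: real
  assumes "0 < y" "0 \<le> p" "0 < c"
  shows "y powr p * exp (- c * y) \<le> (if p = 0 then 1 else (p / c) powr p)"
proof (cases "p = 0")
  case True
  then show ?thesis using assms by simp
next
  case False
  then have p: "0 < p" using assms by simp
  \<comment> \<open>The product is largest at \<open>y = p / c\<close>; the tangent of
    \<open>ln\<close> at the corresponding argument 1 replaces the search for the maximum. The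
    surplus factor \<open>exp (- p)\<close> is dropped below.\<close>
  have "ln (y * c / p) \<le> y * c / p - 1"
    using assms p by (intro ln_le_minus_one) auto
  then have "p * ln (y * c / p) \<le> p * (y * c / p - 1)"
    using p by (intro mult_left_mono) auto
  also have "\<dots> = y * c - p" using p by (simp add: field_simps)
  finally have "p * ln y - c * y \<le> p * ln (p / c) - p"
    using assms p by (simp add: ln_mult ln_div algebra_simps)
  then have "exp (p * ln y - c * y) \<le> exp (p * ln (p / c))"
    using p by simp
  then show ?thesis
    using assms p by (simp add: powr_def exp_diff exp_minus field_simps)
qed

lemma powr_exp_bounded:
  fixes p c :: real
  assumes "0 \<le> p" "0 < c"
  shows "\<exists>K>0. \<forall>y>0. y powr p * exp (- c * y) \<le> K"
  using powr_le_exp[OF _ assms]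
  by (intro exI[of _ "if p = 0 then 1 else (p / c) powr p"]) (use assms in auto)

subsection \<open>Primitives on strips\<close>

definition strip :: "real \<Rightarrow> complex set" where
  "strip d = {w. \<bar>Im w\<bar> < d}"

lemma open_strip: "open (strip d)"
  unfolding strip_def by (intro open_Collect_less continuous_intros)

lemma convex_strip: "convex (strip d)"
proof -
  have "strip d = {w. Im w < d} \<inter> {w. Im w > - d}" by (auto simp: strip_def)
  then show ?thesis by (simp add: convex_Int convex_halfspace_Im_lt convex_halfspace_Im_gt)
qed

lemma Complex_in_strip [simp]: "Complex x y \<in> strip d \<longleftrightarrow> \<bar>y\<bar> < d"
  by (simp add: strip_def)

lemma has_real_derivative_Im_horizontal:
  assumes "(F has_field_derivative D) (at (Complex x y))"
  shows "((\<lambda>u. Im (F (Complex u y))) has_real_derivative Im D) (at x)"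
proof -
  have "((\<lambda>u. Complex u y) has_vector_derivative 1) (at x)"
    unfolding has_vector_derivative_def has_derivative_def
    by (auto intro!: bounded_linear_of_real tendsto_eq_intros simp: Complex_eq scaleR_conv_of_real)
  from field_vector_diff_chain_at[OF this, of F D] assms
  have "((\<lambda>u. F (Complex u y)) has_vector_derivative D) (at x)"
    by (simp add: o_def)
  then have "((\<lambda>u. Im (F (Complex u y))) has_vector_derivative Im D) (at x)"
    by (rule bounded_linear.has_vector_derivative[OF bounded_linear_Im])
  then show ?thesis by (simp add: has_real_derivative_iff_has_vector_derivative)
qed

lemma has_vector_derivative_horizontal:
  assumes "(F has_field_derivative D) (at (Complex x y))"
  shows "((\<lambda>u. F (Complex u y)) has_vector_derivative D) (at x)"
proof -
  have "((\<lambda>u. Complex u y) has_vector_derivative 1) (at x)"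
    unfolding has_vector_derivative_def has_derivative_def
    by (auto intro!: bounded_linear_of_real tendsto_eq_intros simp: Complex_eq scaleR_conv_of_real)
  from field_vector_diff_chain_at[OF this, of F D] assms
  show ?thesis by (simp add: o_def)
qed

text \<open>The imaginary part of a primitive has derivative 0 along the real axis, so a shift makes
  it vanish there. Reality on the axis makes the lower half of a symmetric contour the conjugate of
  the upper half; hence only imaginary parts at positive heights occur later.\<close>

lemma strip_primitive:
  assumes "0 < d" and "\<Phi> holomorphic_on strip d" and "\<And>x. Im (\<Phi> (Complex x 0)) = 0"
  obtains F where "\<And>w. w \<in> strip d \<Longrightarrow> (F has_field_derivative \<Phi> w) (at w)"
    and "\<And>x. Im (F (Complex x 0)) = 0"
proof -
  obtain F0 where F0: "\<And>w. w \<in> strip d \<Longrightarrow> (F0 has_field_derivative \<Phi> w) (at w within strip d)"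
    using holomorphic_convex_primitive'[OF convex_strip open_strip assms(2)] by blast
  define F where "F w = F0 w - F0 0" for w
  have F: "(F has_field_derivative \<Phi> w) (at w)" if "w \<in> strip d" for w
    using F0[OF that] that unfolding F_def
    by (auto intro!: derivative_eq_intros simp: at_within_open[OF _ open_strip])
  have "((\<lambda>u. Im (F (Complex u 0))) has_real_derivative 0) (at x)" for x
    using has_real_derivative_Im_horizontal[OF F, of x 0] assms by simp
  then have "Im (F (Complex x 0)) = Im (F (Complex 0 0))" for x
    using DERIV_isconst_all[of "\<lambda>u. Im (F (Complex u 0))" x 0] by simp
  moreover have "Complex 0 0 = 0" by (simp add: complex_eq_iff)
  then have "F (Complex 0 0) = 0" by (simp add: F_def)
  ultimately have "Im (F (Complex x 0)) = 0" for x by simp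
  then show ?thesis using that[of F] F by blast
qed

text \<open>Contour integrals appear throughout as differences of primitives, so this plays the part
  of the length estimate on a vertical segment.\<close>

lemma vertical_bound:
  assumes F: "\<And>w. w \<in> strip d \<Longrightarrow> (F has_field_derivative \<Phi> w) (at w)"
    and "0 \<le> y1" "y1 \<le> y2" "y2 < d"
    and B: "\<And>y. y1 \<le> y \<Longrightarrow> y \<le> y2 \<Longrightarrow> norm (\<Phi> (Complex x y)) \<le> B"
  shows "norm (F (Complex x y2) - F (Complex x y1)) \<le> B * (y2 - y1)"
proof -
  let ?S = "{w. Re w = x \<and> y1 \<le> Im w \<and> Im w \<le> y2}"
  have *: "?S = {w. Re w \<ge> x} \<inter> {w. Re w \<le> x} \<inter> {w. Im w \<ge> y1} \<inter> {w. Im w \<le> y2}" by auto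
  have cv: "convex ?S"
    unfolding * by (intro convex_Int convex_halfspace_Im_ge convex_halfspace_Im_le
        convex_halfspace_Re_ge convex_halfspace_Re_le)
  have "norm (F (Complex x y2) - F (Complex x y1)) \<le> B * norm (Complex x y2 - Complex x y1)"
  proof (rule field_differentiable_bound[OF cv, of F \<Phi>])
    fix z assume z: "z \<in> ?S"
    then have "z = Complex x (Im z)" by (simp add: complex_eq_iff)
    then show "norm (\<Phi> z) \<le> B" using B[of "Im z"] z by (metis (mono_tags, lifting) mem_Collect_eq)
    have "z \<in> strip d" using z assms by (auto simp: strip_def)
    then show "(F has_field_derivative \<Phi> z) (at z within ?S)"
      using F has_field_derivative_at_within by blast
  qed (use assms in auto)
  also have "norm (Complex x y2 - Complex x y1) = y2 - y1"
    using assms by (simp add: cmod_def)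
  finally show ?thesis .
qed

text \<open>The majorant enters through its own primitive \<open>B\<close>, so a bounded
  \<open>B\<close> controls the integral over a half line uniformly in the right end.\<close>

lemma horizontal_bound:
  assumes F: "\<And>w. w \<in> strip d \<Longrightarrow> (F has_field_derivative \<Phi> w) (at w)"
    and "\<bar>y\<bar> < d" "x1 \<le> x2"
    and B: "\<And>x. (B has_real_derivative B' x) (at x)"
    and le: "\<And>x. x1 \<le> x \<Longrightarrow> x \<le> x2 \<Longrightarrow> norm (\<Phi> (Complex x y)) \<le> B' x"
  shows "norm (F (Complex x2 y) - F (Complex x1 y)) \<le> B x2 - B x1"
proof (cases "x1 = x2")
  case False
  have 1: "((\<lambda>u. F (Complex u y)) has_vector_derivative \<Phi> (Complex x y)) (at x)" for x
    by (rule has_vector_derivative_horizontal[OF F]) (use assms in simp)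
  show ?thesis
  proof (rule differentiable_bound_general[where f' = "\<lambda>x. \<Phi> (Complex x y)" and \<phi>' = B'])
    show "x1 < x2" using False assms by simp
    show "continuous_on {x1..x2} B"
      using B by (meson DERIV_continuous_on has_field_derivative_at_within)
    show "continuous_on {x1..x2} (\<lambda>u. F (Complex u y))"
      using 1 by (meson continuous_at_imp_continuous_on has_vector_derivative_continuous)
    show "\<And>x. x1 < x \<Longrightarrow> x < x2 \<Longrightarrow> (B has_vector_derivative B' x) (at x)"
      using B by (simp add: has_real_derivative_iff_has_vector_derivative)
  qed (use 1 le in auto)
qed simp

subsection \<open>Hankel's integral for the reciprocal Gamma function\<close>

text \<open>With \<open>p = exp w\<close>, the integral of \<open>exp p / p powr a\<close> over a Hankel contour becomes an integral of
  \<open>hankel a\<close> over two horizontal lines, hence a limit of the imaginary part of a primitive.\<close>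

definition hankel :: "real \<Rightarrow> complex \<Rightarrow> complex" where
  "hankel a w = exp (exp w + of_real (1 - a) * w)"

lemma norm_hankel: "norm (hankel a (Complex x y)) = exp (exp x * cos y + (1 - a) * x)"
  by (simp add: hankel_def Re_exp)

lemma norm_hankel_le: "norm (hankel a (Complex x y)) \<le> exp (exp x + (1 - a) * x)"
  unfolding norm_hankel by (simp add: mult_left_le)

lemma hankel_real: "Im (hankel a (Complex x 0)) = 0"
  by (simp add: hankel_def Im_exp)

lemma hankel_pi: "Im (hankel a (Complex x pi)) = exp (- exp x + (1 - a) * x) * sin ((1 - a) * pi)"
  by (simp add: hankel_def Im_exp Re_exp)

lemma holomorphic_hankel [holomorphic_intros]: "hankel a holomorphic_on S"
  unfolding hankel_def by (intro holomorphic_intros)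

text \<open>Half width 4 leaves room for the line at height \<open>pi\<close>. The normalisation on
  the real axis fixes the primitive up to a real constant, which does not affect imaginary
  parts.\<close>

definition hankel_prim :: "real \<Rightarrow> (complex \<Rightarrow> complex) \<Rightarrow> bool" where
  "hankel_prim a F \<longleftrightarrow> (\<forall>w\<in>strip 4. (F has_field_derivative hankel a w) (at w)) \<and>
     (\<forall>x. Im (F (Complex x 0)) = 0)"

lemma hankel_prim_exists: "\<exists>F. hankel_prim a F"
  using strip_primitive[of 4 "hankel a"] hankel_real unfolding hankel_prim_def
  by (metis holomorphic_hankel zero_less_numeral)

text \<open>For \<open>p < 1\<close> the integrand of Euler's integral is unbounded at 0; continuity
  of \<open>G\<close> at 0 and derivatives in the interior suffice for the fundamental theorem on
  \<open>{0..u}\<close>, and integrability lets \<open>u\<close> tend to infinity.\<close>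

lemma Gamma_FTC:
  fixes G :: "real \<Rightarrow> real"
  assumes "0 < p" and G: "continuous_on {0..} G"
    and D: "\<And>u. 0 < u \<Longrightarrow> (G has_real_derivative C * (u powr (p - 1) / exp u)) (at u)"
  shows "(G \<longlongrightarrow> G 0 + C * Gamma p) at_top"
proof -
  define f where "f t = indicator {0..} t * t powr (p - 1) / exp t" for t :: real
  have [measurable]: "f \<in> borel_measurable lborel" unfolding f_def by measurable
  have "has_bochner_integral lborel f (Gamma p)"
  proof (rule has_bochner_integral_nn_integral)
    show "(\<integral>\<^sup>+x. ennreal (f x) \<partial>lborel) = ennreal (Gamma p)"
      using Gamma_conv_nn_integral_real[OF assms(1)] unfolding f_def by simp
  qed (use assms in \<open>auto simp: f_def Gamma_real_nonneg\<close>)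
  then have f: "integrable lborel f" and I: "integral\<^sup>L lborel f = Gamma p"
    by (auto simp: has_bochner_integral_iff)
  have *: "(\<integral>t. indicator {..u} t *\<^sub>R f t \<partial>lborel) * C = G u - G 0" if "0 < u" for u
  proof -
    have "((\<lambda>t. C * (t powr (p - 1) / exp t)) has_integral G u - G 0) {0..u}"
      using that continuous_on_subset[OF G] D
      by (intro fundamental_theorem_of_calculus_interior)
        (auto simp: has_real_derivative_iff_has_vector_derivative)
    moreover have "((\<lambda>t. indicator {..u} t *\<^sub>R f t) has_integral
        (\<integral>t. indicator {..u} t *\<^sub>R f t \<partial>lborel)) UNIV"
      by (intro has_integral_integral_lborel integrable_mult_indicator f) auto
    then have "((\<lambda>t. C * (indicator {..u} t *\<^sub>R f t)) has_integral
        C * (\<integral>t. indicator {..u} t *\<^sub>R f t \<partial>lborel)) UNIV"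
      by (rule has_integral_mult_right)
    then have "((\<lambda>t. if t \<in> {0..u} then C * (t powr (p - 1) / exp t) else 0) has_integral
        C * (\<integral>t. indicator {..u} t *\<^sub>R f t \<partial>lborel)) UNIV"
      by (rule has_integral_eq[rotated]) (auto simp: f_def indicator_def)
    then have "((\<lambda>t. C * (t powr (p - 1) / exp t)) has_integral
        C * (\<integral>t. indicator {..u} t *\<^sub>R f t \<partial>lborel)) {0..u}"
      by (simp only: has_integral_restrict_UNIV)
    ultimately show ?thesis
      using has_integral_unique by (metis mult.commute)
  qed
  have "((\<lambda>u. \<integral>t. indicator {..u} t *\<^sub>R f t \<partial>lborel) \<longlongrightarrow> Gamma p) at_top"
    using tendsto_integral_at_top[of lborel f] f I by simp
  then have "((\<lambda>u. G 0 + (\<integral>t. indicator {..u} t *\<^sub>R f t \<partial>lborel) * C) \<longlongrightarrow> G 0 + Gamma p * C) at_top"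
    by (intro tendsto_intros)
  then have "(G \<longlongrightarrow> G 0 + Gamma p * C) at_top"
  proof (rule Lim_transform_eventually)
    show "\<forall>\<^sub>F u in at_top. G 0 + (\<integral>t. indicator {..u} t *\<^sub>R f t \<partial>lborel) * C = G u"
      using eventually_gt_at_top[of 0] by eventually_elim (simp add: * del: real_scaleR_def)
  qed
  then show ?thesis by (simp add: mult.commute)
qed

lemma Gamma_reflection_real:
  assumes "0 < a" "a < 1"
  shows "sin ((1 - a) * pi) * Gamma (1 - a) = pi / Gamma (a::real)"
proof -
  have "complex_of_real (Gamma a * Gamma (1 - a)) = of_real (pi / sin (pi * a))"
  proof -
    have "Gamma (1 - complex_of_real a) = of_real (Gamma (1 - a))"
      using Gamma_complex_of_real[of "1 - a"] by simp
    moreover have "sin (complex_of_real pi * complex_of_real a) = of_real (sin (pi * a))"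
      by (simp only: of_real_mult[symmetric] sin_of_real)
    ultimately show ?thesis
      using Gamma_reflection_complex[of "of_real a"] by (simp add: Gamma_complex_of_real)
  qed
  then have "Gamma a * Gamma (1 - a) = pi / sin (pi * a)" by (simp only: of_real_eq_iff)
  moreover have "0 < sin (pi * a)" using assms by (intro sin_gt_zero) auto
  moreover have "sin ((1 - a) * pi) = sin (pi * a)"
    using sin_pi_minus[of "pi * a"] by (simp add: algebra_simps)
  moreover have "0 < Gamma a" using assms by (simp add: Gamma_real_pos)
  ultimately show ?thesis by (simp add: field_simps)
qed

text \<open>On the line at height \<open>pi\<close> the substitution \<open>u = exp x\<close> turns
  the imaginary part of \<open>hankel a\<close> into \<open>sin ((1 - a) * pi)\<close> times the
  integrand of \<open>Gamma (1 - a)\<close>, and the reflection formula converts the product to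
  \<open>pi / Gamma a\<close>. For \<open>a < 1\<close> the left end contributes nothing.\<close>

lemma hankel_limit_less_1:
  assumes F: "hankel_prim a F" and "0 < a" "a < 1"
  shows "((\<lambda>X. Im (F (Complex X pi))) \<longlongrightarrow> pi / Gamma a) at_top"
proof -
  have FD: "\<And>w. w \<in> strip 4 \<Longrightarrow> (F has_field_derivative hankel a w) (at w)"
    and F0: "\<And>x. Im (F (Complex x 0)) = 0"
    using F unfolding hankel_prim_def by auto
  have pi4: "pi < 4" using pi_less_4 .
  define G where "G u = (if u = 0 then 0 else Im (F (Complex (ln u) pi)))" for u
  have D: "(G has_real_derivative sin ((1 - a) * pi) * (u powr ((1 - a) - 1) / exp u)) (at u)"
    if "0 < u" for u
  proof -
    have "((\<lambda>x. Im (F (Complex x pi))) has_real_derivative Im (hankel a (Complex (ln u) pi))) (at (ln u))"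
      using pi4 by (intro has_real_derivative_Im_horizontal FD) auto
    then have "((\<lambda>u. Im (F (Complex (ln u) pi))) has_real_derivative
        Im (hankel a (Complex (ln u) pi)) * (1 / u)) (at u)"
      by (rule DERIV_chain2) (use that in \<open>auto intro!: derivative_eq_intros\<close>)
    moreover have "Im (hankel a (Complex (ln u) pi)) * (1 / u) =
        sin ((1 - a) * pi) * (u powr ((1 - a) - 1) / exp u)"
      using that by (simp add: hankel_pi powr_def exp_add exp_diff exp_minus left_diff_distrib field_simps)
    ultimately have "((\<lambda>u. Im (F (Complex (ln u) pi))) has_real_derivative
        sin ((1 - a) * pi) * (u powr ((1 - a) - 1) / exp u)) (at u)" by simp
    then show ?thesis
      by (rule has_field_derivative_transform_within_open[of _ _ _ "{0<..}"])
        (use that in \<open>auto simp: G_def\<close>)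
  qed
  \<comment> \<open>\<open>F\<close> is real at height 0, so \<open>G u\<close> is at most a
    vertical increment; as \<open>a < 1\<close> it vanishes with \<open>u\<close>, which makes
    \<open>G\<close> continuous at 0.\<close>
  have bd: "\<bar>G u\<bar> \<le> exp u * u powr (1 - a) * pi" if "0 < u" for u
  proof -
    have "norm (F (Complex (ln u) pi) - F (Complex (ln u) 0)) \<le> exp (exp (ln u) + (1 - a) * ln u) * (pi - 0)"
      using pi4 norm_hankel_le by (intro vertical_bound[OF FD]) auto
    moreover have "\<bar>G u\<bar> \<le> norm (F (Complex (ln u) pi) - F (Complex (ln u) 0))"
      using abs_Im_le_cmod[of "F (Complex (ln u) pi) - F (Complex (ln u) 0)"] that F0
      by (simp add: G_def)
    ultimately show ?thesis using that by (simp add: exp_add powr_def)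
  qed
  have "((\<lambda>u. exp u * u powr (1 - a) * pi) \<longlongrightarrow> 0) (at_right 0)"
    using assms by real_asymp
  then have "(G \<longlongrightarrow> 0) (at_right 0)"
    by (rule Lim_null_comparison[rotated])
      (use bd in \<open>auto simp: eventually_at_right_less eventually_at_filter\<close>)
  then have "continuous (at 0 within {0..}) G"
    by (simp add: continuous_within G_def at_within_Ici_at_right)
  moreover have "continuous (at u within {0..}) G" if "0 < u" for u
    using D[OF that] by (meson DERIV_continuous continuous_at_imp_continuous_at_within)
  ultimately have "continuous_on {0..} G"
    unfolding continuous_on_eq_continuous_within by (metis atLeast_iff order_le_less)
  from Gamma_FTC[OF _ this D] assms
  have "(G \<longlongrightarrow> sin ((1 - a) * pi) * Gamma (1 - a)) at_top" by (simp add: G_def)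
  then have "(G \<longlongrightarrow> pi / Gamma a) at_top"
    using Gamma_reflection_real assms by simp
  then have "((\<lambda>x. G (exp x)) \<longlongrightarrow> pi / Gamma a) at_top"
    by (rule filterlim_compose[OF _ exp_at_top])
  then show ?thesis by (simp add: G_def)
qed

text \<open>Here the sine factor is 0 and \<open>Im F\<close> is constant along the height
  \<open>pi\<close>. Its value is found at the left end, where \<open>hankel 1\<close> tends to 1,
  so that \<open>Im F\<close> rises by \<open>pi\<close> between the heights 0 and
  \<open>pi\<close>.\<close>

lemma hankel_limit_1:
  assumes F: "hankel_prim 1 F"
  shows "((\<lambda>X. Im (F (Complex X pi))) \<longlongrightarrow> pi) at_top"
proof -
  have FD: "\<And>w. w \<in> strip 4 \<Longrightarrow> (F has_field_derivative hankel 1 w) (at w)"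
    and F0: "\<And>x. Im (F (Complex x 0)) = 0"
    using F unfolding hankel_prim_def by auto
  have pi4: "pi < 4" using pi_less_4 .
  have "((\<lambda>x. Im (F (Complex x pi))) has_real_derivative 0) (at x)" for x
    using has_real_derivative_Im_horizontal[OF FD, of x pi] pi4 by (simp add: hankel_pi)
  then have const: "Im (F (Complex x pi)) = Im (F (Complex y pi))" for x y
    using DERIV_isconst_all[of "\<lambda>x. Im (F (Complex x pi))" x y] by simp
  have bd: "\<bar>Im (F (Complex 0 pi)) - pi\<bar> \<le> exp 1 * exp x * pi" if "x \<le> 0" for x
  proof -
    have 1: "norm (hankel 1 (Complex x y) - 1) \<le> exp 1 * exp x" for y
    proof -
      have "norm (exp (exp (Complex x y)) - exp 0) \<le> exp 1 * norm (exp (Complex x y) - 0)"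
      proof (rule field_differentiable_bound[of "cball 0 1" exp exp])
        fix z :: complex assume "z \<in> cball 0 1"
        then show "norm (exp z) \<le> exp 1"
          using complex_Re_le_cmod[of z] by simp
      qed (use that in \<open>auto intro!: derivative_eq_intros\<close>)
      then show ?thesis by (simp add: hankel_def)
    qed
    have "norm ((F (Complex x pi) - Complex x pi) - (F (Complex x 0) - Complex x 0)) \<le> exp 1 * exp x * (pi - 0)"
      by (rule vertical_bound[where \<Phi> = "\<lambda>w. hankel 1 w - 1" and d = 4])
        (use pi4 1 in \<open>auto intro!: derivative_eq_intros FD\<close>)
    moreover have "\<bar>Im ((F (Complex x pi) - Complex x pi) - (F (Complex x 0) - Complex x 0))\<bar>
        \<le> norm ((F (Complex x pi) - Complex x pi) - (F (Complex x 0) - Complex x 0))"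
      by (rule abs_Im_le_cmod)
    ultimately show ?thesis using F0 const[of x 0] by simp
  qed
  have "((\<lambda>x. exp 1 * exp x * pi) \<longlongrightarrow> 0) at_bot" by real_asymp
  then have "\<bar>Im (F (Complex 0 pi)) - pi\<bar> \<le> 0"
    by (rule tendsto_lowerbound) (use bd in \<open>auto simp: eventually_at_bot_linorder\<close>)
  then show ?thesis using const[of _ 0] by simp
qed

text \<open>Integration by parts: \<open>R\<close> has the derivative
  \<open>hankel a w - a * hankel (a + 1) w\<close>, the contour form of
  \<open>Gamma (a + 1) = a * Gamma a\<close>. \<open>R\<close> is real on the real axis and dies out
  at the right end.\<close>

lemma hankel_limit_Suc:
  assumes "0 < a" and F: "hankel_prim a F"
    and lim: "((\<lambda>X. Im (F (Complex X pi))) \<longlongrightarrow> pi / Gamma a) at_top"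
    and F': "hankel_prim (a + 1) F'"
  shows "((\<lambda>X. Im (F' (Complex X pi))) \<longlongrightarrow> pi / Gamma (a + 1)) at_top"
proof -
  define R where "R w = exp (exp w - of_real a * w)" for w :: complex
  have pi4: "pi < 4" using pi_less_4 .
  have "\<exists>k. \<forall>w\<in>strip 4. R w - F w + of_real a * F' w = k"
  proof (rule has_field_derivative_zero_constant[OF convex_strip])
    fix w assume w: "w \<in> strip 4"
    have "(R has_field_derivative (exp w - of_real a) * R w) (at w)"
      unfolding R_def by (auto intro!: derivative_eq_intros)
    then have "((\<lambda>w. R w - F w + of_real a * F' w) has_field_derivative
       ((exp w - of_real a) * R w - hankel a w + of_real a * hankel (a + 1) w)) (at w)"
      using F F' w unfolding hankel_prim_def by (auto intro!: derivative_eq_intros)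
    moreover have "(exp w - of_real a) * R w - hankel a w + of_real a * hankel (a + 1) w = 0"
    proof -
      have 1: "hankel a w = exp w * R w"
        unfolding R_def hankel_def exp_add[symmetric] by (simp add: algebra_simps)
      have 2: "hankel (a + 1) w = R w"
        by (simp add: R_def hankel_def left_diff_distrib)
      show ?thesis unfolding 1 2 by (simp add: left_diff_distrib)
    qed
    ultimately show "((\<lambda>w. R w - F w + of_real a * F' w) has_field_derivative 0) (at w within strip 4)"
      using has_field_derivative_at_within by metis
  qed
  then obtain k where k: "\<And>w. w \<in> strip 4 \<Longrightarrow> R w - F w + of_real a * F' w = k" by blast
  have "Im k = 0"
    using k[of "Complex 0 0"] F F' by (auto simp: hankel_prim_def R_def Im_exp)
  then have eq: "Im (F' (Complex X pi)) = (Im (F (Complex X pi)) - Im (R (Complex X pi))) / a" for X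
  proof -
    have "Im (R (Complex X pi) - F (Complex X pi) + of_real a * F' (Complex X pi)) = 0"
      using k[of "Complex X pi"] pi4 \<open>Im k = 0\<close> by simp
    then show ?thesis using assms(1) by (simp add: field_simps)
  qed
  have "norm (R (Complex X pi)) = exp (- exp X - a * X)" for X
    by (simp add: R_def Re_exp)
  then have "norm (Im (R (Complex X pi))) \<le> exp (- exp X - a * X)" for X
    using abs_Im_le_cmod[of "R (Complex X pi)"] by simp
  moreover have "((\<lambda>X. exp (- exp X - a * X)) \<longlongrightarrow> 0) at_top" using assms(1) by real_asymp
  ultimately have "((\<lambda>X. Im (R (Complex X pi))) \<longlongrightarrow> 0) at_top"
    by (rule Lim_null_comparison[OF always_eventually[OF allI]])
  then have "((\<lambda>X. Im (F' (Complex X pi))) \<longlongrightarrow> (pi / Gamma a - 0) / a) at_top"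
    unfolding eq using lim assms(1) by (intro tendsto_intros) auto
  moreover have "Gamma (a + 1) = a * Gamma a"
    using assms by (intro Gamma_plus1) (auto elim!: nonpos_Ints_cases)
  ultimately show ?thesis by (simp add: mult.commute)
qed

text \<open>For \<open>a > 1\<close> the integrand grows at the left end, so larger parameters are
  reached from \<open>(0, 1]\<close> in unit steps.\<close>

lemma hankel_limit_pi:
  assumes "0 < a" "hankel_prim a F"
  shows "((\<lambda>X. Im (F (Complex X pi))) \<longlongrightarrow> pi / Gamma a) at_top"
proof -
  have "\<forall>a F. 0 < a \<and> a \<le> real n + 1 \<and> hankel_prim a F \<longrightarrow>
      ((\<lambda>X. Im (F (Complex X pi))) \<longlongrightarrow> pi / Gamma a) at_top" for n
  proof (induction n)
    case 0
    show ?case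
    proof (intro allI impI, elim conjE)
      fix a F assume "0 < a" "a \<le> real 0 + 1" "hankel_prim a F"
      then show "((\<lambda>X. Im (F (Complex X pi))) \<longlongrightarrow> pi / Gamma a) at_top"
        using hankel_limit_less_1[of a F] hankel_limit_1[of F] by (cases "a = 1") auto
    qed
  next
    case (Suc n)
    show ?case
    proof (intro allI impI, elim conjE)
      fix a F assume a: "0 < a" "a \<le> real (Suc n) + 1" "hankel_prim a F"
      show "((\<lambda>X. Im (F (Complex X pi))) \<longlongrightarrow> pi / Gamma a) at_top"
      proof (cases "a \<le> real n + 1")
        case True
        then show ?thesis using Suc a by blast
      next
        case False
        obtain F1 where F1: "hankel_prim (a - 1) F1" using hankel_prim_exists by blast
        then have "((\<lambda>X. Im (F1 (Complex X pi))) \<longlongrightarrow> pi / Gamma (a - 1)) at_top"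
          using Suc a False by auto
        from hankel_limit_Suc[OF _ F1 this, of F] show ?thesis using a False by auto
      qed
    qed
  qed
  moreover have "a \<le> real (nat \<lceil>a\<rceil>) + 1" by linarith
  ultimately show ?thesis using assms by blast
qed

text \<open>At heights beyond \<open>pi / 2\<close> the cosine is negative and
  \<open>hankel a\<close> decays doubly exponentially to the right, so lowering the contour does not
  change the limit. Heights below \<open>pi\<close> occur because the strip used for the
  Mittag-Leffler function is narrower.\<close>

lemma hankel_limit:
  assumes "0 < a" "hankel_prim a F" "pi / 2 < \<delta>" "\<delta> \<le> pi"
  shows "((\<lambda>X. Im (F (Complex X \<delta>))) \<longlongrightarrow> pi / Gamma a) at_top"
proof -
  have FD: "\<And>w. w \<in> strip 4 \<Longrightarrow> (F has_field_derivative hankel a w) (at w)"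
    using assms unfolding hankel_prim_def by auto
  define c where "c = cos \<delta>"
  have c: "c < 0"
    unfolding c_def using assms by (intro cos_lt_zero_pi) auto
  have "norm (F (Complex X pi) - F (Complex X \<delta>)) \<le> exp (exp X * c + (1 - a) * X) * (pi - \<delta>)" for X
  proof (rule vertical_bound[where d = 4, OF FD])
    fix y assume "\<delta> \<le> y" "y \<le> pi"
    then have "cos y \<le> c" unfolding c_def using assms pi_gt_zero by (intro cos_monotone_0_pi_le) auto
    then show "norm (hankel a (Complex X y)) \<le> exp (exp X * c + (1 - a) * X)"
      by (simp add: norm_hankel)
  qed (use assms pi_less_4 pi_gt_zero in \<open>auto intro: order_trans\<close>)
  then have "\<bar>Im (F (Complex X pi)) - Im (F (Complex X \<delta>))\<bar> \<le> exp (exp X * c + (1 - a) * X) * (pi - \<delta>)" for X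
    by (metis abs_Im_le_cmod minus_complex.simps(2) order_trans)
  moreover have "((\<lambda>X. exp (exp X * c + (1 - a) * X) * (pi - \<delta>)) \<longlongrightarrow> 0) at_top"
    using c by real_asymp
  ultimately have "((\<lambda>X. Im (F (Complex X pi)) - Im (F (Complex X \<delta>))) \<longlongrightarrow> 0) at_top"
    using Lim_null_comparison[OF always_eventually] by (metis (no_types, lifting) real_norm_def)
  from tendsto_diff[OF hankel_limit_pi[OF assms(1,2)] this] show ?thesis by simp
qed

subsection \<open>The Mittag-Leffler function on the negative axis\<close>

text \<open>An obtuse ray from the origin is nearest to \<open>- L\<close> at the foot of the
  perpendicular, at distance \<open>L * sin \<bar>\<theta>\<bar>\<close>; an acute one at the
  origin, at distance \<open>L\<close>. This keeps the denominators away from 0.\<close>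

lemma cmod_rcis_add_ge:
  fixes r L \<theta> \<eta> :: real
  assumes "0 \<le> r" "0 \<le> L" "pi / 2 \<le> \<eta>" "\<eta> \<le> pi" "\<bar>\<theta>\<bar> \<le> \<eta>"
  shows "L * sin \<eta> \<le> cmod (of_real r * cis \<theta> + of_real L)"
proof -
  have sq: "(cmod (of_real r * cis \<theta> + of_real L))\<^sup>2 = r\<^sup>2 + 2 * r * L * cos \<theta> + L\<^sup>2"
  proof -
    have "(cmod (of_real r * cis \<theta> + of_real L))\<^sup>2 = (r * cos \<theta> + L)\<^sup>2 + (r * sin \<theta>)\<^sup>2"
      by (simp add: cmod_power2)
    also have "\<dots> = r\<^sup>2 + 2 * r * L * cos \<theta> + L\<^sup>2"
      using sin_cos_squared_add[of \<theta>] by algebra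
    finally show ?thesis .
  qed
  have sin0: "0 \<le> sin \<eta>" using assms pi_gt_zero by (intro sin_ge_zero) auto
  show ?thesis
  proof (rule power2_le_imp_le)
    show "(L * sin \<eta>)\<^sup>2 \<le> (cmod (of_real r * cis \<theta> + of_real L))\<^sup>2"
    proof (cases "\<bar>\<theta>\<bar> \<le> pi / 2")
      case True
      then have "0 \<le> cos \<theta>" by (intro cos_ge_zero) auto
      moreover have "(L * sin \<eta>)\<^sup>2 \<le> L\<^sup>2"
        using assms sin0 by (intro power_mono) (auto simp: mult_left_le)
      ultimately show ?thesis unfolding sq using assms
        by (smt (verit) mult_nonneg_nonneg zero_le_power2)
    next
      case False
      have "sin (pi - \<bar>\<theta>\<bar>) \<ge> sin (pi - \<eta>)"
        using assms False by (intro sin_monotone_2pi_le) auto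
      then have "sin \<eta> \<le> sin \<bar>\<theta>\<bar>" by simp
      then have "(L * sin \<eta>)\<^sup>2 \<le> (L * sin \<bar>\<theta>\<bar>)\<^sup>2"
        using assms sin0 by (intro power_mono mult_left_mono) auto
      also have "\<dots> = L\<^sup>2 * (sin \<theta>)\<^sup>2"
        by (simp add: power_mult_distrib abs_if)
      also have "\<dots> \<le> L\<^sup>2 * (sin \<theta>)\<^sup>2 + (r + L * cos \<theta>)\<^sup>2" by simp
      also have "\<dots> = r\<^sup>2 + 2 * r * L * cos \<theta> + L\<^sup>2"
        using sin_cos_squared_add[of \<theta>] by algebra
      finally show ?thesis unfolding sq .
    qed
  qed simp
qed

lemma exp_Complex: "exp (Complex x y) = of_real (exp x) * cis y"
  by (simp add: exp_eq_polar)

text \<open>In the strip of half width \<open>pi / \<gamma>\<close> the quotient of \<open>hankel (\<beta> - \<gamma>)\<close> and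
  \<open>exp (\<gamma> w) + L\<close> has no poles. The geometric expansion of its integral over a Hankel contour yields the partial
  sums, while moving the contour to \<open>Re w \<rightarrow> -\<infinity>\<close> bounds the integral by a multiple of \<open>1 / L\<close>.\<close>

lemma mittag_leffler_partial_sums:
  fixes \<gamma> \<beta> :: real
  assumes "1 < \<gamma>" "\<gamma> < 2" "0 < \<beta>" "\<beta> \<le> 2" "\<beta> < 1 + \<gamma>"
  obtains M where "\<And>L. 0 < L \<Longrightarrow>
    \<exists>C. \<forall>n. \<bar>\<Sum>j<n. (- L) ^ j / Gamma (\<gamma> * real j + \<beta>)\<bar> \<le> M / L + C * (1 / 2) ^ n
      \<and> \<bar>(- L) ^ n / Gamma (\<gamma> * real n + \<beta>)\<bar> \<le> C * (1 / 2) ^ n"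
proof -
  define d where "d = pi / \<gamma>"
  \<comment> \<open>Above \<open>pi / 2\<close>, so that the horizontal integrals converge, and
    below \<open>d\<close>, so that the contour keeps a positive distance from the poles, which have
    height \<open>d\<close> or more.\<close>
  define \<delta> where "\<delta> = (pi / 2 + d) / 2"
  define q where "q = 1 - \<beta> + \<gamma>"
  have d: "pi / 2 < d" "d < pi" unfolding d_def using assms by (auto simp: field_simps)
  then have \<delta>: "pi / 2 < \<delta>" "\<delta> < d" "0 < \<delta>" unfolding \<delta>_def using pi_gt_zero by auto
  then have \<delta>pi: "\<delta> < pi" "\<delta> < 4" using d pi_less_4 by auto
  have q: "0 < q" unfolding q_def using assms by auto
  define \<eta> where "\<eta> = \<gamma> * \<delta>"
  have "\<gamma> * d = pi" unfolding d_def using assms by simp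
  moreover have "\<delta> \<le> \<gamma> * \<delta>" using \<delta> assms by simp
  ultimately have \<eta>: "pi / 2 \<le> \<eta>" "\<eta> < pi"
    unfolding \<eta>_def using \<delta> assms mult_strict_left_mono[of \<delta> d \<gamma>] by linarith+
  define S where "S = sin \<eta>"
  have S: "0 < S" unfolding S_def using \<eta> pi_gt_zero by (intro sin_gt_zero) auto
  define c where "c = - cos \<delta>"
  have c: "0 < c" unfolding c_def using \<delta> \<delta>pi cos_lt_zero_pi[of \<delta>] by auto
  obtain K1 where K1: "\<And>y. 0 < y \<Longrightarrow> y powr (2 * q) * exp (- c * y) \<le> K1"
    using powr_exp_bounded[of "2 * q" c] q c by auto
  obtain K2 where K2: "0 < K2" "\<And>y. 0 < y \<Longrightarrow> y powr (2 - \<beta>) * exp (- c * y) \<le> K2"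
    using powr_exp_bounded[of "2 - \<beta>" c] assms c by auto
  \<comment> \<open>Makes \<open>exp (exp x * cos \<delta> + q * x)\<close> at most the derivative
    of \<open>- K / (1 + exp (q * x))\<close>, a bounded function; \<open>2 + 2 * K1\<close> comes
    from \<open>(1 + e)^2 \<le> 2 + 2 * e^2\<close>.\<close>
  define K where "K = (2 + 2 * K1) / q"
  have K0: "0 \<le> K" unfolding K_def using K1[of 1] q by (auto intro!: divide_nonneg_nonneg) (smt (verit) exp_gt_zero)
  have expgw: "exp (of_real \<gamma> * Complex x y) = of_real (exp (\<gamma> * x)) * cis (\<gamma> * y)" for x y
  proof -
    have "of_real \<gamma> * Complex x y = Complex (\<gamma> * x) (\<gamma> * y)" by (simp add: complex_eq_iff)
    then show ?thesis by (simp add: exp_Complex)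
  qed
  have lower: "L * S \<le> cmod (exp (of_real \<gamma> * Complex x y) + of_real L)"
    if "0 < L" "\<bar>y\<bar> \<le> \<delta>" for L x y
    unfolding expgw S_def
  proof (rule cmod_rcis_add_ge)
    show "\<bar>\<gamma> * y\<bar> \<le> \<eta>" unfolding \<eta>_def using that assms by (simp add: abs_mult mult_left_mono)
  qed (use that \<eta> in auto)
  \<comment> \<open>Up to the boundary of the open strip no single angle works, so each point takes
    its own angle \<open>e < pi\<close>; only nonvanishing is claimed.\<close>
  have nz: "exp (of_real \<gamma> * w) + of_real L \<noteq> 0" if "0 < L" "w \<in> strip d" for L w
  proof -
    obtain x y where w: "w = Complex x y" by (cases w)
    define e where "e = max (pi / 2) \<bar>\<gamma> * y\<bar>"
    have "\<gamma> * \<bar>y\<bar> < \<gamma> * d" using that assms by (simp add: w)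
    then have "\<bar>\<gamma> * y\<bar> < pi" using assms \<open>\<gamma> * d = pi\<close> by (simp add: abs_mult)
    then have e: "pi / 2 \<le> e" "e < pi" "\<bar>\<gamma> * y\<bar> \<le> e"
      unfolding e_def using pi_gt_zero by auto
    have "L * sin e \<le> cmod (exp (of_real \<gamma> * w) + of_real L)"
      unfolding w expgw by (rule cmod_rcis_add_ge) (use that e in auto)
    moreover have "0 < L * sin e" using e that pi_gt_zero by (intro mult_pos_pos sin_gt_zero) auto
    ultimately show ?thesis by (metis norm_zero not_less)
  qed
  have *: "\<exists>C. \<forall>n. \<bar>\<Sum>j<n. (- L) ^ j / Gamma (\<gamma> * real j + \<beta>)\<bar>
        \<le> ((\<delta> * exp 1 + K) / (S * pi)) / L + C * (1 / 2) ^ n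
      \<and> \<bar>(- L) ^ n / Gamma (\<gamma> * real n + \<beta>)\<bar> \<le> C * (1 / 2) ^ n" if L: "0 < L" for L
  proof -
    define \<Psi> where "\<Psi> w = hankel (\<beta> - \<gamma>) w / (exp (of_real \<gamma> * w) + of_real L)" for w
    have "\<Psi> holomorphic_on strip d"
      unfolding \<Psi>_def using nz L by (intro holomorphic_intros) auto
    moreover have "Im (\<Psi> (Complex x 0)) = 0" for x
    proof -
      have "Im (exp (of_real \<gamma> * Complex x 0) + of_real L) = 0" unfolding expgw by simp
      then show ?thesis
        unfolding \<Psi>_def using hankel_real[of "\<beta> - \<gamma>" x] by (metis Reals_divide complex_is_Real_iff)
    qed
    ultimately obtain F where F: "\<And>w. w \<in> strip d \<Longrightarrow> (F has_field_derivative \<Psi> w) (at w)"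
      and F0: "\<And>x. Im (F (Complex x 0)) = 0"
      using strip_primitive[of d \<Psi>] d pi_gt_zero by (metis less_trans pi_half_gt_zero)
    have \<Psi>le: "cmod (\<Psi> (Complex x y)) \<le> exp (exp x * cos y + q * x) / (L * S)"
      if "\<bar>y\<bar> \<le> \<delta>" for x y
      unfolding \<Psi>_def norm_divide norm_hankel
      by (intro frac_le) (use lower[OF L that] L S in \<open>auto simp: q_def algebra_simps\<close>)
    \<comment> \<open>The corner of this contour is at \<open>Re w = 0\<close> whatever
      \<open>L\<close> is, so \<open>L\<close> enters only through the factor \<open>1 / L\<close>
      that comes from \<open>lower\<close>.\<close>
    have Fbound: "\<bar>Im (F (Complex X \<delta>))\<bar> \<le> (\<delta> * exp 1 + K) / (L * S)" if "0 \<le> X" for X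
    proof -
      have "norm (F (Complex 0 \<delta>) - F (Complex 0 0)) \<le> exp 1 / (L * S) * (\<delta> - 0)"
      proof (rule vertical_bound[OF F])
        fix y assume "0 \<le> y" "y \<le> \<delta>"
        then have "cmod (\<Psi> (Complex 0 y)) \<le> exp (cos y) / (L * S)" using \<Psi>le[of y 0] by simp
        also have "\<dots> \<le> exp 1 / (L * S)" using L S by (intro divide_right_mono) auto
        finally show "cmod (\<Psi> (Complex 0 y)) \<le> exp 1 / (L * S)" .
      qed (use \<delta> in auto)
      moreover have "norm (F (Complex X \<delta>) - F (Complex 0 \<delta>))
          \<le> (- K / (1 + exp (q * X))) / (L * S) - (- K / (1 + exp (q * 0))) / (L * S)"
      proof (rule horizontal_bound[OF F, where B' = "\<lambda>x. (K * q * exp (q * x) / (1 + exp (q * x))\<^sup>2) / (L * S)"])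
        fix x
        have pos: "1 + exp (q * x) \<noteq> 0" by (smt (verit) exp_gt_zero)
        have "((\<lambda>x. - K / (1 + exp (q * x))) has_real_derivative
            K * q * exp (q * x) / (1 + exp (q * x))\<^sup>2) (at x)"
          using pos by (auto intro!: derivative_eq_intros simp: power2_eq_square)
        then show "((\<lambda>x. - K / (1 + exp (q * x)) / (L * S)) has_real_derivative
            K * q * exp (q * x) / (1 + exp (q * x))\<^sup>2 / (L * S)) (at x)"
          by (rule DERIV_cdivide)
        have "(1 + exp (q * x))\<^sup>2 * exp (- c * exp x) \<le> (2 + 2 * (exp x powr (2 * q))) * exp (- c * exp x)"
        proof -
          have "(1 + exp (q * x))\<^sup>2 \<le> 2 + 2 * (exp (q * x))\<^sup>2"
            using sum_squares_bound[of 1 "exp (q * x)"] by (simp add: power2_sum)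
          also have "(exp (q * x))\<^sup>2 = exp x powr (2 * q)"
            by (simp add: powr_def mult.assoc flip: exp_double)
          finally show ?thesis by (intro mult_right_mono) auto
        qed
        also have "\<dots> = 2 * exp (- c * exp x) + 2 * (exp x powr (2 * q) * exp (- c * exp x))"
          by (simp add: algebra_simps)
        also have "\<dots> \<le> 2 * 1 + 2 * K1"
          using c K1[of "exp x"] by (intro add_mono mult_left_mono) auto
        also have "\<dots> = K * q" unfolding K_def using q by simp
        finally have "exp (- c * exp x) \<le> K * q / (1 + exp (q * x))\<^sup>2"
          using pos by (simp add: field_simps)
        then have "exp (- c * exp x) * exp (q * x) \<le> K * q / (1 + exp (q * x))\<^sup>2 * exp (q * x)"
          by (rule mult_right_mono) simp
        then have "exp (exp x * cos \<delta> + q * x) \<le> K * q * exp (q * x) / (1 + exp (q * x))\<^sup>2"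
          by (simp add: c_def exp_add mult.commute)
        then have "exp (exp x * cos \<delta> + q * x) / (L * S) \<le> K * q * exp (q * x) / (1 + exp (q * x))\<^sup>2 / (L * S)"
          using L S by (intro divide_right_mono) auto
        then show "cmod (\<Psi> (Complex x \<delta>)) \<le> K * q * exp (q * x) / (1 + exp (q * x))\<^sup>2 / (L * S)"
          using \<Psi>le[of \<delta> x] \<delta> by auto
      qed (use \<delta> that in auto)
      moreover have "(- K / (1 + exp (q * X))) / (L * S) - (- K / (1 + exp (q * 0))) / (L * S) \<le> K / (L * S)"
      proof -
        have "0 \<le> K / (1 + exp (q * X)) / (L * S)"
          using K0 L S by (intro divide_nonneg_nonneg add_nonneg_nonneg) auto
        moreover have "K / 2 / (L * S) \<le> K / (L * S)"
          using K0 L S by (intro divide_right_mono) auto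
        ultimately show ?thesis by simp
      qed
      ultimately have "norm (F (Complex 0 \<delta>) - F (Complex 0 0)) + norm (F (Complex X \<delta>) - F (Complex 0 \<delta>))
          \<le> (\<delta> * exp 1 + K) / (L * S)" by (simp add: add_divide_distrib mult.commute)
      moreover have "\<bar>Im (F (Complex X \<delta>))\<bar> \<le> norm (F (Complex 0 \<delta>) - F (Complex 0 0)) + norm (F (Complex X \<delta>) - F (Complex 0 \<delta>))"
      proof -
        have "\<bar>Im (F (Complex X \<delta>))\<bar> = \<bar>Im (F (Complex X \<delta>) - F (Complex 0 0))\<bar>" using F0 by simp
        also have "\<dots> \<le> norm ((F (Complex 0 \<delta>) - F (Complex 0 0)) + (F (Complex X \<delta>) - F (Complex 0 \<delta>)))"
          using abs_Im_le_cmod[of "F (Complex X \<delta>) - F (Complex 0 0)"] by simp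
        finally show ?thesis using norm_triangle_ineq order_trans by blast
      qed
      ultimately show ?thesis by linarith
    qed
    have "\<forall>j. \<exists>F. hankel_prim (\<gamma> * real j + \<beta>) F" using hankel_prim_exists by blast
    from choice[OF this] obtain H where "\<forall>j. hankel_prim (\<gamma> * real j + \<beta>) (H j)" ..
    then have H: "\<And>j. hankel_prim (\<gamma> * real j + \<beta>) (H j)" ..
    \<comment> \<open>To the right of \<open>x0\<close> the ratio of the geometric series has
      modulus at most \<open>1 / 2\<close>. This corner depends on \<open>L\<close>, but only
      \<open>C\<close> feels it, and the contribution of \<open>C\<close> vanishes as
      \<open>n\<close> grows.\<close>
    define x0 where "x0 = ln (2 * L) / \<gamma>"
    have x0: "L * exp (- \<gamma> * x) \<le> 1 / 2" if "x0 \<le> x" for x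
    proof -
      have "ln (2 * L) \<le> \<gamma> * x" using that assms by (simp add: x0_def field_simps)
      then have "2 * L \<le> exp (\<gamma> * x)" using L by (metis exp_le_cancel_iff exp_ln mult_pos_pos zero_less_numeral)
      then show ?thesis by (simp add: exp_minus field_simps)
    qed
    define C where "C = 2 * (exp (exp x0 + (1 - \<beta>) * x0) * \<delta> + K2 * exp (- x0))"
    have C0: "0 \<le> C" unfolding C_def using \<delta> K2 by auto
    have rem: "\<bar>Im (F (Complex X \<delta>)) - (\<Sum>j<n. (- L) ^ j * Im (H j (Complex X \<delta>)))\<bar> \<le> C * (1 / 2) ^ n"
      if X: "x0 \<le> X" for X n
    proof -
      define R where "R w = F w - (\<Sum>j<n. of_real ((- L) ^ j) * H j w)" for w
      define \<rho> where "\<rho> w = \<Psi> w - (\<Sum>j<n. of_real ((- L) ^ j) * hankel (\<gamma> * real j + \<beta>) w)" for w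
      have R: "(R has_field_derivative \<rho> w) (at w)" if "w \<in> strip d" for w
      proof -
        have "w \<in> strip 4" using that d pi_less_4 by (auto simp: strip_def)
        then show ?thesis unfolding R_def \<rho>_def
          using H that by (auto intro!: derivative_eq_intros F simp: hankel_prim_def mult.commute)
      qed
      have \<rho>: "cmod (\<rho> (Complex x y)) \<le> exp (exp x * cos y + (1 - \<beta>) * x) * (2 * (1 / 2) ^ n)"
        if "\<bar>y\<bar> < d" "x0 \<le> x" for x y
      proof -
        define w where "w = Complex x y"
        \<comment> \<open>The ratio of the geometric series: \<open>\<Psi> w\<close> equals
          \<open>hankel \<beta> w / (1 - z)\<close>, and each factor \<open>z\<close> raises the
          parameter of \<open>hankel\<close> by \<open>\<gamma>\<close> and contributes a factor
          \<open>- L\<close>.\<close>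
        define z where "z = - of_real L * exp (- of_real \<gamma> * w)"
        have nzw: "exp (of_real \<gamma> * w) + of_real L \<noteq> 0" using nz[OF L] that by (simp add: w_def)
        have zle: "cmod z \<le> 1 / 2"
          using x0[OF that(2)] L by (simp add: z_def norm_mult w_def)
        then have z1: "z \<noteq> 1" by auto
        have 1: "\<Psi> w = hankel \<beta> w / (1 - z)"
        proof -
          have h1: "hankel (\<beta> - \<gamma>) w = hankel \<beta> w * exp (of_real \<gamma> * w)"
            unfolding hankel_def exp_add[symmetric] by (simp add: algebra_simps)
          have h2: "exp (of_real \<gamma> * w) + of_real L = exp (of_real \<gamma> * w) * (1 - z)"
            by (simp add: z_def ring_distribs mult.assoc mult.left_commute flip: exp_add)
          show ?thesis unfolding \<Psi>_def h1 h2 by simp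
        qed
        have 2: "of_real ((- L) ^ j) * hankel (\<gamma> * real j + \<beta>) w = hankel \<beta> w * z ^ j" for j
        proof -
          have "hankel (\<gamma> * real j + \<beta>) w = hankel \<beta> w * exp (of_nat j * (- of_real \<gamma> * w))"
            unfolding hankel_def exp_add[symmetric] by (simp add: algebra_simps)
          also have "exp (of_nat j * (- of_real \<gamma> * w)) = exp (- of_real \<gamma> * w) ^ j"
            by (rule exp_of_nat_mult)
          finally show ?thesis by (simp add: z_def power_mult_distrib flip: power_mult_distrib)
        qed
        have "\<rho> w = hankel \<beta> w * (1 / (1 - z) - (\<Sum>j<n. z ^ j))"
          unfolding \<rho>_def 1 2 by (simp add: sum_distrib_left ring_distribs)
        also have "1 / (1 - z) - (\<Sum>j<n. z ^ j) = z ^ n / (1 - z)"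
          using z1 by (simp add: sum_gp_strict field_simps)
        finally have "cmod (\<rho> w) = exp (exp x * cos y + (1 - \<beta>) * x) * (cmod z ^ n / cmod (1 - z))"
          by (simp add: norm_mult norm_divide norm_power norm_hankel w_def)
        moreover have "cmod z ^ n / cmod (1 - z) \<le> (1 / 2) ^ n / (1 / 2)"
        proof (intro frac_le power_mono)
          show "1 / 2 \<le> cmod (1 - z)" using norm_triangle_ineq2[of 1 z] zle by simp
        qed (use zle in auto)
        ultimately have "cmod (\<rho> w) \<le> exp (exp x * cos y + (1 - \<beta>) * x) * ((1 / 2) ^ n / (1 / 2))"
          by (simp only: mult_left_mono exp_ge_zero)
        then show ?thesis by (simp add: w_def mult_ac)
      qed
      have "norm (R (Complex x0 \<delta>) - R (Complex x0 0)) \<le> exp (exp x0 + (1 - \<beta>) * x0) * (2 * (1 / 2) ^ n) * (\<delta> - 0)"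
      proof (rule vertical_bound[OF R])
        fix y assume "0 \<le> y" "y \<le> \<delta>"
        then have "cmod (\<rho> (Complex x0 y)) \<le> exp (exp x0 * cos y + (1 - \<beta>) * x0) * (2 * (1 / 2) ^ n)"
          using \<delta> by (intro \<rho>) auto
        also have "\<dots> \<le> exp (exp x0 + (1 - \<beta>) * x0) * (2 * (1 / 2) ^ n)"
          by (intro mult_right_mono) (auto simp: mult_left_le)
        finally show "cmod (\<rho> (Complex x0 y)) \<le> exp (exp x0 + (1 - \<beta>) * x0) * (2 * (1 / 2) ^ n)" .
      qed (use \<delta> in auto)
      moreover have "norm (R (Complex X \<delta>) - R (Complex x0 \<delta>)) \<le>
          - K2 * exp (- X) * (2 * (1 / 2) ^ n) - (- K2 * exp (- x0) * (2 * (1 / 2) ^ n))"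
      proof (rule horizontal_bound[OF R, where B' = "\<lambda>x. K2 * exp (- x) * (2 * (1 / 2) ^ n)"])
        fix x
        show "((\<lambda>x. - K2 * exp (- x) * (2 * (1 / 2) ^ n)) has_real_derivative
            K2 * exp (- x) * (2 * (1 / 2) ^ n)) (at x)"
          by (auto intro!: derivative_eq_intros)
        assume "x0 \<le> x"
        \<comment> \<open>As \<open>\<beta> \<le> 2\<close>, the double exponential absorbs the
          power of \<open>exp x\<close> with one factor \<open>exp (- x)\<close> to spare, whose
          primitive is explicit.\<close>
        have "exp (exp x * cos \<delta> + (1 - \<beta>) * x) = (exp x powr (2 - \<beta>) * exp (- c * exp x)) * exp (- x)"
          by (simp add: powr_def c_def ring_distribs mult.commute flip: exp_add)
        also have "\<dots> \<le> K2 * exp (- x)" by (intro mult_right_mono K2) auto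
        finally have "exp (exp x * cos \<delta> + (1 - \<beta>) * x) * (2 * (1 / 2) ^ n) \<le> K2 * exp (- x) * (2 * (1 / 2) ^ n)"
          by (rule mult_right_mono) simp
        moreover have "cmod (\<rho> (Complex x \<delta>)) \<le> exp (exp x * cos \<delta> + (1 - \<beta>) * x) * (2 * (1 / 2) ^ n)"
          using \<delta> \<open>x0 \<le> x\<close> by (intro \<rho>) auto
        ultimately show "cmod (\<rho> (Complex x \<delta>)) \<le> K2 * exp (- x) * (2 * (1 / 2) ^ n)"
          by (rule order_trans[rotated])
      qed (use \<delta> X in auto)
      moreover have "0 \<le> K2 * exp (- X) * (2 * (1 / 2) ^ n)" using K2 by simp
      ultimately have "norm (R (Complex x0 \<delta>) - R (Complex x0 0)) + norm (R (Complex X \<delta>) - R (Complex x0 \<delta>)) \<le> C * (1 / 2) ^ n"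
        by (simp add: C_def algebra_simps)
      moreover have "\<bar>Im (R (Complex X \<delta>))\<bar> \<le> norm (R (Complex x0 \<delta>) - R (Complex x0 0)) + norm (R (Complex X \<delta>) - R (Complex x0 \<delta>))"
      proof -
        have "Im (R (Complex x0 0)) = 0" using F0 H by (simp add: R_def hankel_prim_def)
        then have "\<bar>Im (R (Complex X \<delta>))\<bar> = \<bar>Im (R (Complex X \<delta>) - R (Complex x0 0))\<bar>" by simp
        also have "\<dots> \<le> norm ((R (Complex x0 \<delta>) - R (Complex x0 0)) + (R (Complex X \<delta>) - R (Complex x0 \<delta>)))"
          using abs_Im_le_cmod[of "R (Complex X \<delta>) - R (Complex x0 0)"] by simp
        finally show ?thesis using norm_triangle_ineq order_trans by blast
      qed
      moreover have "Im (R (Complex X \<delta>)) = Im (F (Complex X \<delta>)) - (\<Sum>j<n. (- L) ^ j * Im (H j (Complex X \<delta>)))"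
        by (simp add: R_def)
      ultimately show ?thesis by linarith
    qed
    define s where "s n = (\<Sum>j<n. (- L) ^ j / Gamma (\<gamma> * real j + \<beta>))" for n
    have lim: "((\<lambda>X. \<Sum>j<n. (- L) ^ j * Im (H j (Complex X \<delta>))) \<longlongrightarrow> pi * s n) at_top" for n
    proof -
      have "((\<lambda>X. \<Sum>j<n. (- L) ^ j * Im (H j (Complex X \<delta>))) \<longlongrightarrow>
          (\<Sum>j<n. (- L) ^ j * (pi / Gamma (\<gamma> * real j + \<beta>)))) at_top"
        by (intro tendsto_intros hankel_limit H) (use assms \<delta> \<delta>pi in \<open>auto intro: add_nonneg_pos\<close>)
      then show ?thesis by (simp add: s_def sum_distrib_left mult.commute)
    qed
    have 1: "\<bar>pi * s n\<bar> \<le> (\<delta> * exp 1 + K) / (L * S) + C * (1 / 2) ^ n" for n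
    proof (rule tendsto_upperbound[OF tendsto_rabs[OF lim]])
      show "\<forall>\<^sub>F X in at_top. \<bar>\<Sum>j<n. (- L) ^ j * Im (H j (Complex X \<delta>))\<bar> \<le> (\<delta> * exp 1 + K) / (L * S) + C * (1 / 2) ^ n"
        using eventually_ge_at_top[of "max 0 x0"]
      proof eventually_elim
        case (elim X)
        then show ?case using rem[of X n] Fbound[of X] by linarith
      qed
    qed simp
    \<comment> \<open>Two successive remainders bound a single term; this is the source of the
      summability of the Mittag-Leffler series.\<close>
    have 2: "\<bar>pi * s (Suc n) - pi * s n\<bar> \<le> 2 * C * (1 / 2) ^ n" for n
    proof (rule tendsto_upperbound[OF tendsto_rabs[OF tendsto_diff[OF lim lim]]])
      show "\<forall>\<^sub>F X in at_top. \<bar>(\<Sum>j<Suc n. (- L) ^ j * Im (H j (Complex X \<delta>))) -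
          (\<Sum>j<n. (- L) ^ j * Im (H j (Complex X \<delta>)))\<bar> \<le> 2 * C * (1 / 2) ^ n"
        using eventually_ge_at_top[of x0]
      proof eventually_elim
        case (elim X)
        have "C * (1 / 2) ^ Suc n \<le> C * (1 / 2) ^ n" using C0 by (intro mult_left_mono) auto
        then show ?case using rem[of X n] rem[of X "Suc n"] elim by linarith
      qed
    qed simp
    show ?thesis
    proof (intro exI[of _ "2 * C / pi"] allI conjI)
      fix n
      have "pi * \<bar>s n\<bar> \<le> (\<delta> * exp 1 + K) / (L * S) + C * (1 / 2) ^ n" using 1[of n] by (simp add: abs_mult)
      then have "\<bar>s n\<bar> \<le> ((\<delta> * exp 1 + K) / (L * S) + C * (1 / 2) ^ n) / pi" by (simp add: field_simps)
      also have "\<dots> = (\<delta> * exp 1 + K) / (S * pi) / L + C / pi * (1 / 2) ^ n"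
        by (simp add: add_divide_distrib mult.commute mult.left_commute)
      also have "\<dots> \<le> (\<delta> * exp 1 + K) / (S * pi) / L + 2 * C / pi * (1 / 2) ^ n"
        using C0 by (intro add_left_mono mult_right_mono divide_right_mono) auto
      finally show "\<bar>\<Sum>j<n. (- L) ^ j / Gamma (\<gamma> * real j + \<beta>)\<bar> \<le>
          (\<delta> * exp 1 + K) / (S * pi) / L + 2 * C / pi * (1 / 2) ^ n" by (simp add: s_def)
      have "pi * \<bar>s (Suc n) - s n\<bar> \<le> 2 * C * (1 / 2) ^ n"
        using 2[of n] by (simp add: abs_mult flip: right_diff_distrib)
      then have "\<bar>s (Suc n) - s n\<bar> \<le> 2 * C / pi * (1 / 2) ^ n" by (simp add: field_simps)
      then show "\<bar>(- L) ^ n / Gamma (\<gamma> * real n + \<beta>)\<bar> \<le> 2 * C / pi * (1 / 2) ^ n"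
        by (simp add: s_def)
    qed
  qed
  show ?thesis by (rule that[OF *])
qed

text \<open>Letting \<open>n\<close> tend to infinity in the partial sums gives
  \<open>M / x\<close>; for \<open>x \<le> 1\<close> the absolutely convergent series at
  \<open>x = 1\<close> dominates. Interpolation yields every power \<open>x powr (- p)\<close> with
  \<open>0 \<le> p \<le> 1\<close>, so that each term of the solution can choose its own
  \<open>p\<close>.\<close>

lemma mittag_leffler_bound:
  fixes \<gamma> \<beta> :: real
  assumes "1 < \<gamma>" "\<gamma> < 2" "0 < \<beta>" "\<beta> \<le> 2" "\<beta> < 1 + \<gamma>"
  shows "\<exists>M>0. (\<forall>x\<ge>0. \<bar>mittag_leffler \<gamma> \<beta> (- x)\<bar> \<le> M) \<and>
    (\<forall>x>0. \<forall>p. 0 \<le> p \<and> p \<le> 1 \<longrightarrow> \<bar>mittag_leffler \<gamma> \<beta> (- x)\<bar> \<le> M * x powr (- p))"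
proof -
  obtain M where M: "\<And>L. 0 < L \<Longrightarrow>
    \<exists>C. \<forall>n. \<bar>\<Sum>j<n. (- L) ^ j / Gamma (\<gamma> * real j + \<beta>)\<bar> \<le> M / L + C * (1 / 2) ^ n
      \<and> \<bar>(- L) ^ n / Gamma (\<gamma> * real n + \<beta>)\<bar> \<le> C * (1 / 2) ^ n"
    using mittag_leffler_partial_sums[OF assms] by blast
  have summ: "summable (\<lambda>n. norm ((- L) ^ n / Gamma (\<gamma> * real n + \<beta>)))" if "0 < L" for L
  proof -
    from M[OF that] obtain C where "\<And>n. \<bar>(- L) ^ n / Gamma (\<gamma> * real n + \<beta>)\<bar> \<le> C * (1 / 2) ^ n"
      by blast
    then have "norm (norm ((- L) ^ n / Gamma (\<gamma> * real n + \<beta>))) \<le> C * (1 / 2) ^ n" for n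
      by simp
    moreover have "summable (\<lambda>n. C * (1 / 2 :: real) ^ n)"
      by (intro summable_mult summable_geometric) simp
    ultimately show ?thesis by (rule summable_comparison_test'[rotated])
  qed
  have large: "\<bar>mittag_leffler \<gamma> \<beta> (- L)\<bar> \<le> M / L" if L: "0 < L" for L
  proof -
    obtain C where C: "\<And>n. \<bar>\<Sum>j<n. (- L) ^ j / Gamma (\<gamma> * real j + \<beta>)\<bar> \<le> M / L + C * (1 / 2) ^ n"
      using M[OF L] by blast
    have "(\<lambda>n. \<Sum>j<n. (- L) ^ j / Gamma (\<gamma> * real j + \<beta>)) \<longlonglongrightarrow> mittag_leffler \<gamma> \<beta> (- L)"
      unfolding mittag_leffler_def using summable_norm_cancel[OF summ[OF L]] by (rule summable_LIMSEQ)
    from tendsto_rabs[OF this] 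
    have "(\<lambda>n. \<bar>\<Sum>j<n. (- L) ^ j / Gamma (\<gamma> * real j + \<beta>)\<bar>) \<longlonglongrightarrow> \<bar>mittag_leffler \<gamma> \<beta> (- L)\<bar>" .
    moreover have "(\<lambda>n. M / L + C * (1 / 2) ^ n) \<longlonglongrightarrow> M / L + C * 0"
      by (intro tendsto_intros LIMSEQ_power_zero) simp
    ultimately show ?thesis using C LIMSEQ_le by (metis (no_types, lifting) add.right_neutral mult_zero_right)
  qed
  define N where "N = (\<Sum>n. norm ((- 1) ^ n / Gamma (\<gamma> * real n + \<beta>)))"
  have small: "\<bar>mittag_leffler \<gamma> \<beta> (- L)\<bar> \<le> N" if "0 \<le> L" "L \<le> 1" for L
  proof -
    have le: "norm ((- L) ^ n / Gamma (\<gamma> * real n + \<beta>)) \<le> norm ((- 1) ^ n / Gamma (\<gamma> * real n + \<beta>))" for n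
      using that by (simp add: norm_divide norm_power divide_right_mono power_le_one)
    have s: "summable (\<lambda>n. norm ((- L) ^ n / Gamma (\<gamma> * real n + \<beta>)))"
      by (rule summable_comparison_test'[OF summ[of 1], of 0]) (use le in auto)
    have "norm (mittag_leffler \<gamma> \<beta> (- L)) \<le> (\<Sum>n. norm ((- L) ^ n / Gamma (\<gamma> * real n + \<beta>)))"
      unfolding mittag_leffler_def by (rule summable_norm[OF s])
    also have "\<dots> \<le> N" unfolding N_def by (rule suminf_le[OF le s summ]) simp
    finally show ?thesis by simp
  qed
  have N0: "0 \<le> N" using small[of 0] by simp
  define K where "K = max N M + 1"
  have 1: "\<bar>mittag_leffler \<gamma> \<beta> (- x)\<bar> \<le> K" if "0 \<le> x" for x
  proof (cases "x \<le> 1")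
    case True
    then show ?thesis using small[of x] that by (simp add: K_def)
  next
    case False
    then have "M / x \<le> max N M / 1" using N0 by (intro frac_le) auto
    then show ?thesis using large[of x] False by (simp add: K_def)
  qed
  have 2: "\<bar>mittag_leffler \<gamma> \<beta> (- x)\<bar> \<le> K * x powr (- p)" if "0 < x" "0 \<le> p" "p \<le> 1" for x p
  proof (cases "x \<le> 1")
    case True
    then have "1 \<le> x powr (- p)"
      using powr_mono'[of "- p" 0 x] that True by simp
    then have "K * 1 \<le> K * x powr (- p)" using N0 by (intro mult_left_mono) (auto simp: K_def)
    then show ?thesis using 1[of x] that by simp
  next
    case False
    have "M / x \<le> K / x" using that by (intro divide_right_mono) (auto simp: K_def)
    also have "\<dots> = K * x powr (- 1)" using that by (simp add: powr_minus divide_inverse)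
    also have "\<dots> \<le> K * x powr (- p)" using that False N0
      by (intro mult_left_mono powr_mono) (auto simp: K_def)
    finally show ?thesis using large[of x] that by simp
  qed
  show ?thesis by (intro exI[of _ K]) (use 1 2 N0 in \<open>auto simp: K_def\<close>)
qed

subsection \<open>The extension profile\<close>

text \<open>At a positive interior maximum \<open>w' = 0\<close>, hence \<open>w'' > 0\<close>, and
  \<open>w\<close> would increase further to the right. Boundary values enter only as eventual upper
  bounds, so a singular end such as 0 and the end at infinity are treated alike.\<close>

lemma ode_max_principle:
  fixes w w' w'' b :: "real \<Rightarrow> real"
  assumes w: "\<And>x. a < x \<Longrightarrow> (w has_real_derivative w' x) (at x)"
    and w': "\<And>x. a < x \<Longrightarrow> (w' has_real_derivative w'' x) (at x)"
    and ineq: "\<And>x. a < x \<Longrightarrow> m * w x \<le> w'' x + b x * w' x" and "0 < m"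
    and left: "\<And>e. 0 < e \<Longrightarrow> \<forall>\<^sub>F x in at_right a. w x < e"
    and right: "\<And>e. 0 < e \<Longrightarrow> \<forall>\<^sub>F x in at_top. w x < e"
    and "a < x"
  shows "w x \<le> 0"
proof (rule ccontr)
  assume "\<not> w x \<le> 0"
  then have pos: "0 < w x" by simp
  obtain p0 where p0: "a < p0" "\<And>y. a < y \<Longrightarrow> y < p0 \<Longrightarrow> w y < w x"
    using left[OF pos] by (auto simp: eventually_at_right_field)
  obtain q0 where q0: "\<And>y. q0 \<le> y \<Longrightarrow> w y < w x"
    using right[OF pos] by (auto simp: eventually_at_top_linorder)
  obtain p where p: "a < p" "p < p0" "p < x" using p0 assms dense[of a "min p0 x"] by auto
  define q where "q = max q0 (x + 1)"
  have "continuous_on {p..q} w"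
    using p by (intro continuous_at_imp_continuous_on ballI) (auto intro: DERIV_isCont[OF w])
  moreover have "{p..q} \<noteq> {}" using p by (auto simp: q_def)
  ultimately obtain \<xi> where \<xi>: "\<xi> \<in> {p..q}" "\<And>y. y \<in> {p..q} \<Longrightarrow> w y \<le> w \<xi>"
    using continuous_attains_sup[of "{p..q}" w] by auto
  have "w x \<le> w \<xi>" using \<xi> p by (auto simp: q_def)
  moreover have "w p < w x" "w q < w x" using p0 p q0 by (auto simp: q_def)
  ultimately have in': "p < \<xi>" "\<xi> < q" "0 < w \<xi>" using \<xi>(1) pos by (auto simp: order.order_iff_strict)
  then have "a < \<xi>" using p by simp
  have "w y \<le> w \<xi>" if "\<bar>\<xi> - y\<bar> < min (\<xi> - p) (q - \<xi>)" for y
    by (rule \<xi>(2)) (use that in \<open>auto simp: abs_less_iff\<close>)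
  then have "w' \<xi> = 0"
    by (intro DERIV_local_max[OF w[OF \<open>a < \<xi>\<close>], of "min (\<xi> - p) (q - \<xi>)"]) (use in' in auto)
  moreover have "0 < m * w \<xi>" using in' assms by simp
  ultimately have "0 < w'' \<xi>" using ineq[OF \<open>a < \<xi>\<close>] by simp
  \<comment> \<open>\<open>w''\<close> is known only pointwise; its sign at the maximum makes
    \<open>w'\<close> positive just to the right of it.\<close>
  from DERIV_pos_inc_right[OF w'[OF \<open>a < \<xi>\<close>] this] obtain d
    where d: "0 < d" "\<And>h. 0 < h \<Longrightarrow> h < d \<Longrightarrow> 0 < w' (\<xi> + h)" using \<open>w' \<xi> = 0\<close> by auto
  define h where "h = min d (q - \<xi>) / 2"
  have h: "0 < h" "h < d" "\<xi> + h < q" using d in' by (auto simp: h_def min_def field_simps)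
  have "w \<xi> < w (\<xi> + h)"
  proof (rule DERIV_pos_imp_increasing_open[where f = w])
    fix y assume y: "\<xi> < y" "y < \<xi> + h"
    then show "\<exists>z. (w has_real_derivative z) (at y) \<and> 0 < z"
      using w[of y] d(2)[of "y - \<xi>"] \<open>a < \<xi>\<close> h by auto
  next
    show "continuous_on {\<xi>..\<xi> + h} w"
      using \<open>a < \<xi>\<close> by (intro continuous_at_imp_continuous_on ballI) (auto intro: DERIV_isCont[OF w])
  qed (use h in auto)
  then show False using \<xi>(2)[of "\<xi> + h"] in' h by auto
qed

section \<open>Dilation, comparison and uniqueness of the profiles\<close>

lemma extension_profile_scale:
  assumes "extension_profile s l \<psi>" "0 < r"
  shows "extension_profile s (l * r\<^sup>2) (\<lambda>y. \<psi> (r * y))"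
proof -
  from assms(1) obtain \<psi>' \<psi>'' where D: "\<And>y. 0 < y \<Longrightarrow> (\<psi> has_real_derivative \<psi>' y) (at y)"
      "\<And>y. 0 < y \<Longrightarrow> (\<psi>' has_real_derivative \<psi>'' y) (at y)"
      "\<And>y. 0 < y \<Longrightarrow> \<psi>'' y + (1 - 2 * s) / y * \<psi>' y = l * \<psi> y"
    and lim: "\<psi> 0 = 1" "(\<psi> \<longlongrightarrow> 1) (at_right 0)" "(\<psi> \<longlongrightarrow> 0) at_top"
    unfolding extension_profile_def by blast
  have lin: "((\<lambda>y. r * y) has_real_derivative r) (at y)" for y
    by (auto intro!: derivative_eq_intros)
  have 1: "((\<lambda>y. \<psi> (r * y)) has_real_derivative r * \<psi>' (r * y)) (at y)" if "0 < y" for y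
    using DERIV_chain2[OF D(1) lin, of y] that assms by (simp add: mult.commute)
  have 2: "((\<lambda>y. r * \<psi>' (r * y)) has_real_derivative r\<^sup>2 * \<psi>'' (r * y)) (at y)" if "0 < y" for y
    using DERIV_cmult[OF DERIV_chain2[OF D(2) lin, of y], of r] that assms
    by (simp add: power2_eq_square mult_ac)
  have 3: "r\<^sup>2 * \<psi>'' (r * y) + (1 - 2 * s) / y * (r * \<psi>' (r * y)) = l * r\<^sup>2 * \<psi> (r * y)" if "0 < y" for y
  proof -
    have "r\<^sup>2 * \<psi>'' (r * y) + (1 - 2 * s) / y * (r * \<psi>' (r * y))
        = r\<^sup>2 * (\<psi>'' (r * y) + (1 - 2 * s) / (r * y) * \<psi>' (r * y))"
      using that assms by (simp add: field_simps power2_eq_square)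
    also have "\<dots> = r\<^sup>2 * (l * \<psi> (r * y))" using D(3)[of "r * y"] that assms by simp
    finally show ?thesis by simp
  qed
  have 4: "((\<lambda>y. \<psi> (r * y)) \<longlongrightarrow> 1) (at_right 0)"
  proof (rule filterlim_compose[OF lim(2)])
    show "LIM y at_right 0. r * y :> at_right 0" using assms by real_asymp
  qed
  have 5: "((\<lambda>y. \<psi> (r * y)) \<longlongrightarrow> 0) at_top"
    by (rule filterlim_compose[OF lim(3)]) (use assms in real_asymp)
  show ?thesis unfolding extension_profile_def
    by (intro conjI exI[of _ "\<lambda>y. r * \<psi>' (r * y)"] exI[of _ "\<lambda>y. r\<^sup>2 * \<psi>'' (r * y)"] allI impI)
      (use 1 2 3 4 5 lim in auto)
qed

lemma extension_profile_le:
  assumes "extension_profile s l \<psi>" "extension_profile s l \<eta>" "0 < l" "0 < y"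
  shows "\<psi> y \<le> \<eta> y"
proof -
  from assms(1) obtain \<psi>' \<psi>'' where D: "\<And>y. 0 < y \<Longrightarrow> (\<psi> has_real_derivative \<psi>' y) (at y)"
      "\<And>y. 0 < y \<Longrightarrow> (\<psi>' has_real_derivative \<psi>'' y) (at y)"
      "\<And>y. 0 < y \<Longrightarrow> \<psi>'' y + (1 - 2 * s) / y * \<psi>' y = l * \<psi> y"
    and lim: "(\<psi> \<longlongrightarrow> 1) (at_right 0)" "(\<psi> \<longlongrightarrow> 0) at_top"
    unfolding extension_profile_def by blast
  from assms(2) obtain \<eta>' \<eta>'' where E: "\<And>y. 0 < y \<Longrightarrow> (\<eta> has_real_derivative \<eta>' y) (at y)"
      "\<And>y. 0 < y \<Longrightarrow> (\<eta>' has_real_derivative \<eta>'' y) (at y)"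
      "\<And>y. 0 < y \<Longrightarrow> \<eta>'' y + (1 - 2 * s) / y * \<eta>' y = l * \<eta> y"
    and lim': "(\<eta> \<longlongrightarrow> 1) (at_right 0)" "(\<eta> \<longlongrightarrow> 0) at_top"
    unfolding extension_profile_def by blast
  have "\<psi> y - \<eta> y \<le> 0"
  proof (rule ode_max_principle[of 0 "\<lambda>y. \<psi> y - \<eta> y" "\<lambda>y. \<psi>' y - \<eta>' y" "\<lambda>y. \<psi>'' y - \<eta>'' y" l
        "\<lambda>y. (1 - 2 * s) / y"])
    fix e :: real assume "0 < e"
    show "\<forall>\<^sub>F x in at_right 0. \<psi> x - \<eta> x < e"
      using order_tendstoD(2)[OF tendsto_diff[OF lim(1) lim'(1)], of e] \<open>0 < e\<close> by simp
    show "\<forall>\<^sub>F x in at_top. \<psi> x - \<eta> x < e"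
      using order_tendstoD(2)[OF tendsto_diff[OF lim(2) lim'(2)], of e] \<open>0 < e\<close> by simp
  next
    fix x :: real assume "0 < x"
    then show "l * (\<psi> x - \<eta> x) \<le> \<psi>'' x - \<eta>'' x + (1 - 2 * s) / x * (\<psi>' x - \<eta>' x)"
      using D(3)[of x] E(3)[of x] by (simp add: right_diff_distrib)
  qed (use assms D E in \<open>auto intro!: derivative_eq_intros\<close>)
  then show ?thesis by simp
qed

text \<open>Comparison in both directions. This is what identifies every profile with a dilation of
  a single one, whose bounds are then derived from the equation.\<close>

lemma extension_profile_unique:
  assumes "extension_profile s l \<psi>" "extension_profile s l \<eta>" "0 < l" "0 \<le> y"
  shows "\<psi> y = \<eta> y"
proof (cases "y = 0")
  case True
  then show ?thesis using assms by (simp add: extension_profile_def)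
next
  case False
  then show ?thesis using extension_profile_le[OF assms(1,2,3)] extension_profile_le[OF assms(2,1,3)] assms(4)
    by (simp add: antisym)
qed

text \<open>The flux \<open>z powr \<alpha> * P'\<close>, with \<open>\<alpha> = 1 - 2 * s\<close>,
  has the derivative \<open>z powr \<alpha> * P\<close>. Its sign and size give the monotonicity of
  \<open>P\<close>, the behaviour of \<open>P'\<close> at 0, and the control of \<open>P'\<close> by
  values of \<open>P\<close> far out. The exponential rate comes from comparison, where
  \<open>a < 1\<close> leaves room to absorb the first-order term.\<close>

lemma extension_profile_decay:
  assumes P: "extension_profile s 1 P" and s: "0 < s" "s < 1" and a: "0 < a" "a < 1"
  obtains P' K W where
    "\<And>z. 0 < z \<Longrightarrow> (P has_real_derivative P' z) (at z)"
    "\<And>z. 0 < z \<Longrightarrow> (P' has_real_derivative P z - (1 - 2 * s) / z * P' z) (at z)"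
    "\<And>z. 0 < z \<Longrightarrow> 0 \<le> P z \<and> P z \<le> 1"
    "\<And>z. 0 < z \<Longrightarrow> P z \<le> K * exp (- a * z)"
    "\<And>z. 0 < z \<Longrightarrow> \<bar>P' z\<bar> \<le> W * z powr (2 * s - 1)"
    "\<And>z. 2 \<le> z \<Longrightarrow> \<bar>P' z\<bar> \<le> 2 * P (z - 1)"
proof -
  define \<alpha> where "\<alpha> = 1 - 2 * s"
  have \<alpha>: "- 1 < \<alpha>" "\<alpha> < 1" using s by (auto simp: \<alpha>_def)
  from P obtain P' P'' where D: "\<And>y. 0 < y \<Longrightarrow> (P has_real_derivative P' y) (at y)"
      "\<And>y. 0 < y \<Longrightarrow> (P' has_real_derivative P'' y) (at y)"
      and ode: "\<And>y. 0 < y \<Longrightarrow> P'' y + \<alpha> / y * P' y = P y"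
    and lim: "(P \<longlongrightarrow> 1) (at_right 0)" "(P \<longlongrightarrow> 0) at_top"
    unfolding extension_profile_def \<alpha>_def by auto
  have D2: "(P' has_real_derivative P z - (1 - 2 * s) / z * P' z) (at z)" if "0 < z" for z
  proof -
    have "P z - (1 - 2 * s) / z * P' z = P'' z" using ode[OF that] unfolding \<alpha>_def by linarith
    then show ?thesis using D(2)[OF that] by simp
  qed
  have nonneg: "0 \<le> P z" if "0 < z" for z
  proof -
    have "- P z \<le> 0"
    proof (rule ode_max_principle[of 0 "\<lambda>y. - P y" "\<lambda>y. - P' y" "\<lambda>y. - P'' y" 1 "\<lambda>y. \<alpha> / y"])
      fix e :: real assume "0 < e"
      show "\<forall>\<^sub>F x in at_right 0. - P x < e"
        using order_tendstoD(2)[OF tendsto_minus[OF lim(1)], of e] \<open>0 < e\<close> by simp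
      show "\<forall>\<^sub>F x in at_top. - P x < e"
        using order_tendstoD(2)[OF tendsto_minus[OF lim(2)], of e] \<open>0 < e\<close> by simp
    next
      fix x :: real assume "0 < x"
      then show "1 * - P x \<le> - P'' x + \<alpha> / x * - P' x" using ode[of x] by simp
    qed (use that D in \<open>auto intro!: derivative_eq_intros\<close>)
    then show ?thesis by simp
  qed
  define w where "w z = z powr \<alpha> * P' z" for z
  have w: "(w has_real_derivative z powr \<alpha> * P z) (at z)" if "0 < z" for z
  proof -
    have "(w has_real_derivative (\<alpha> * z powr (\<alpha> - 1)) * P' z + z powr \<alpha> * P'' z) (at z)"
      unfolding w_def using that D(2)[OF that] by (auto intro!: derivative_eq_intros)
    moreover have "(\<alpha> * z powr (\<alpha> - 1)) * P' z + z powr \<alpha> * P'' z = z powr \<alpha> * P z"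
      using that ode[OF that] by (simp add: powr_diff field_simps flip: ode[OF that])
    ultimately show ?thesis by simp
  qed
  have w_mono: "w x \<le> w y" if "0 < x" "x \<le> y" for x y
    by (rule DERIV_nonneg_imp_nondecreasing[OF that(2)])
      (use w nonneg that in \<open>meson less_le_trans mult_nonneg_nonneg powr_ge_zero\<close>)
  \<comment> \<open>A positive flux would stay positive, since \<open>w\<close> is nondecreasing,
    and \<open>P\<close> would increase from there on instead of tending to 0.\<close>
  have w_nonpos: "w z \<le> 0" if "0 < z" for z
  proof (rule ccontr)
    assume "\<not> w z \<le> 0"
    have P'pos: "0 < P' y" if "z \<le> y" for y
    proof -
      have "0 < y powr \<alpha> * P' y" using w_mono[of z y] that \<open>0 < z\<close> \<open>\<not> w z \<le> 0\<close> by (simp add: w_def)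
      then show ?thesis using \<open>0 < z\<close> that by (simp add: zero_less_mult_iff)
    qed
    have inc: "P x \<le> P y" if "z \<le> x" "x \<le> y" for x y
      by (rule DERIV_nonneg_imp_nondecreasing[OF that(2)])
        (use D P'pos that \<open>0 < z\<close> in \<open>meson less_imp_le less_le_trans order_trans\<close>)
    have "P z < P (z + 1)"
    proof (rule DERIV_pos_imp_increasing[of z])
      fix x assume "z \<le> x"
      then show "\<exists>y. (P has_real_derivative y) (at x) \<and> 0 < y"
        using D(1)[of x] P'pos[of x] \<open>0 < z\<close> by auto
    qed simp
    then have pos: "0 < P (z + 1)" using nonneg[OF \<open>0 < z\<close>] by simp
    have "P (z + 1) \<le> 0"
      by (rule tendsto_lowerbound[OF lim(2)])
        (use inc in \<open>auto intro!: eventually_mono[OF eventually_ge_at_top[of "z + 1"]]\<close>)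
    then show False using pos by simp
  qed
  have P'_nonpos: "P' z \<le> 0" if "0 < z" for z
    using w_nonpos[OF that] that by (simp add: w_def mult_le_0_iff)
  have dec: "P y \<le> P x" if "0 < x" "x \<le> y" for x y
    by (rule DERIV_nonpos_imp_nonincreasing[OF that(2)])
      (use D P'_nonpos that in \<open>meson less_le_trans\<close>)
  have le1: "P z \<le> 1" if "0 < z" for z
    by (rule tendsto_lowerbound[OF lim(1)])
      (use dec that in \<open>auto simp: eventually_at_right_field intro!: exI[of _ z]\<close>)
  \<comment> \<open>On \<open>(0, 1]\<close> the flux changes by at most the integral of
    \<open>z powr \<alpha>\<close>, which is \<open>1 / (\<alpha> + 1)\<close>; beyond 1 it lies
    between \<open>w 1\<close> and 0.\<close>
  define W where "W = \<bar>w 1\<bar> + 1 / (\<alpha> + 1)"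
  have W: "\<bar>w z\<bar> \<le> W" if "0 < z" for z
  proof (cases "1 \<le> z")
    case True
    then show ?thesis using w_mono[of 1 z] w_nonpos[OF that] w_nonpos[of 1] \<alpha>
      by (simp add: W_def) (smt (verit) divide_pos_pos)
  next
    case False
    have "w 1 - 1 powr (\<alpha> + 1) / (\<alpha> + 1) \<le> w z - z powr (\<alpha> + 1) / (\<alpha> + 1)"
    proof (rule DERIV_nonpos_imp_nonincreasing[of z 1 "\<lambda>z. w z - z powr (\<alpha> + 1) / (\<alpha> + 1)"])
      fix x assume "z \<le> x" "x \<le> 1"
      then have x: "0 < x" using that by simp
      have "((\<lambda>z. w z - z powr (\<alpha> + 1) / (\<alpha> + 1)) has_real_derivative
          (x powr \<alpha> * P x - x powr \<alpha>)) (at x)"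
        using w[OF x] x \<alpha> by (auto intro!: derivative_eq_intros)
      moreover have "x powr \<alpha> * P x - x powr \<alpha> \<le> 0"
        using le1[OF x] nonneg[OF x] by (simp add: mult_left_le)
      ultimately show "\<exists>y. ((\<lambda>z. w z - z powr (\<alpha> + 1) / (\<alpha> + 1)) has_real_derivative y) (at x) \<and> y \<le> 0"
        by blast
    qed (use False in auto)
    moreover have "0 \<le> z powr (\<alpha> + 1) / (\<alpha> + 1)" using \<alpha> by simp
    ultimately have "w 1 - 1 / (\<alpha> + 1) \<le> w z" unfolding powr_one_eq_one by linarith
    then show ?thesis using w_nonpos[OF that] w_nonpos[of 1] unfolding W_def by linarith
  qed
  have P'bd: "\<bar>P' z\<bar> \<le> W * z powr (2 * s - 1)" if "0 < z" for z
  proof -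
    have "\<bar>P' z\<bar> = \<bar>w z\<bar> * z powr (2 * s - 1)"
      using that by (simp add: w_def abs_mult \<alpha>_def flip: powr_add)
    also have "\<dots> \<le> W * z powr (2 * s - 1)" using W[OF that] by (intro mult_right_mono) auto
    finally show ?thesis .
  qed
  \<comment> \<open>The mean value theorem gives a slope of size at most \<open>P (z - 1)\<close>
    between \<open>z - 1\<close> and \<open>z\<close>, and \<open>\<bar>w\<bar>\<close> does not
    increase. The factor 2 covers the ratio of the weights when \<open>\<alpha> < 0\<close>.\<close>
  have P'far: "\<bar>P' z\<bar> \<le> 2 * P (z - 1)" if z: "2 \<le> z" for z
  proof -
    obtain \<xi> where \<xi>: "z - 1 < \<xi>" "\<xi> < z" "P z - P (z - 1) = (z - (z - 1)) * P' \<xi>"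
      using MVT2[of "z - 1" z P P'] D z by auto
    have pos: "0 < \<xi>" "0 < z" using \<xi> z by auto
    have "\<bar>w z\<bar> \<le> \<bar>w \<xi>\<bar>" using w_mono[of \<xi> z] w_nonpos pos \<xi> by (smt (verit))
    then have "z powr \<alpha> * \<bar>P' z\<bar> \<le> \<xi> powr \<alpha> * \<bar>P' \<xi>\<bar>" by (simp add: w_def abs_mult)
    also have "\<bar>P' \<xi>\<bar> \<le> P (z - 1)"
      using \<xi> nonneg[of z] pos P'_nonpos[of \<xi>] by auto
    finally have "z powr \<alpha> * \<bar>P' z\<bar> \<le> \<xi> powr \<alpha> * P (z - 1)" by (simp add: mult_left_mono)
    also have "\<xi> powr \<alpha> \<le> 2 * z powr \<alpha>"
    proof (cases "0 \<le> \<alpha>")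
      case True
      have "\<xi> powr \<alpha> \<le> z powr \<alpha>" using True \<xi> pos by (intro powr_mono2) auto
      then show ?thesis by (smt (verit) powr_ge_zero)
    next
      case False
      have "\<xi> powr \<alpha> \<le> (z / 2) powr \<alpha>" using False \<xi> z by (intro powr_mono2') auto
      also have "\<dots> = z powr \<alpha> * 2 powr (- \<alpha>)" using pos by (simp add: powr_divide powr_minus field_simps)
      also have "\<dots> \<le> z powr \<alpha> * 2 powr 1" using \<alpha> by (intro mult_left_mono powr_mono) auto
      finally show ?thesis by (simp add: mult.commute)
    qed
    finally have "z powr \<alpha> * \<bar>P' z\<bar> \<le> z powr \<alpha> * (2 * P (z - 1))"
      using nonneg[of "z - 1"] z by (simp add: mult_right_mono mult_ac)
    then show ?thesis using pos by simp
  qed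
  \<comment> \<open>Beyond \<open>Z\<close> the first-order term, at most \<open>a / x\<close> times
    the exponential, is outweighed by \<open>1 - a\<^sup>2\<close>: there
    \<open>exp (- a * x)\<close> is a supersolution.\<close>
  define Z where "Z = a / (1 - a\<^sup>2)"
  have a2: "a\<^sup>2 < 1" using a by (simp add: power_less_one_iff abs_square_less_1)
  have Z: "0 < Z" unfolding Z_def using a a2 by simp
  have dec1: "P z - exp (a * Z) * exp (- a * z) \<le> 0" if "Z < z" for z
  proof (rule ode_max_principle[of Z "\<lambda>z. P z - exp (a * Z) * exp (- a * z)"
        "\<lambda>z. P' z + a * (exp (a * Z) * exp (- a * z))"
        "\<lambda>z. P'' z - a\<^sup>2 * (exp (a * Z) * exp (- a * z))" 1 "\<lambda>z. \<alpha> / z"])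
    fix x assume x: "Z < x"
    then have "0 < x" using Z by simp
    show "((\<lambda>z. P z - exp (a * Z) * exp (- a * z)) has_real_derivative
        P' x + a * (exp (a * Z) * exp (- a * x))) (at x)"
      using D(1)[OF \<open>0 < x\<close>] by (auto intro!: derivative_eq_intros)
    show "((\<lambda>z. P' z + a * (exp (a * Z) * exp (- a * z))) has_real_derivative
        P'' x - a\<^sup>2 * (exp (a * Z) * exp (- a * x))) (at x)"
      using D(2)[OF \<open>0 < x\<close>] by (auto intro!: derivative_eq_intros simp: power2_eq_square)
    have "a * (- \<alpha>) / x \<le> a / x"
      using \<alpha> a \<open>0 < x\<close> mult_left_mono[of "- \<alpha>" 1 a] by (intro divide_right_mono) auto
    also have "\<dots> \<le> 1 - a\<^sup>2" using x a2 \<open>0 < x\<close> by (simp add: Z_def field_simps)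
    finally have "0 \<le> 1 - a\<^sup>2 + a * \<alpha> / x" by simp
    then have "0 \<le> (1 - a\<^sup>2 + a * \<alpha> / x) * (exp (a * Z) * exp (- a * x))" by (intro mult_nonneg_nonneg) auto
    then show "1 * (P x - exp (a * Z) * exp (- a * x)) \<le>
        P'' x - a\<^sup>2 * (exp (a * Z) * exp (- a * x)) + \<alpha> / x * (P' x + a * (exp (a * Z) * exp (- a * x)))"
      using ode[OF \<open>0 < x\<close>] by (simp add: ring_distribs mult_ac)
  next
    fix e :: real assume "0 < e"
    have "isCont P Z" using D(1)[OF Z] by (rule DERIV_isCont)
    then have "((\<lambda>z. P z - exp (a * Z) * exp (- a * z)) \<longlongrightarrow> P Z - exp (a * Z) * exp (- a * Z)) (at_right Z)"
      by (intro tendsto_intros) (auto simp: isCont_def filterlim_at_split)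
    moreover have "P Z - exp (a * Z) * exp (- a * Z) < e"
      using le1[OF Z] \<open>0 < e\<close> by (simp flip: exp_add)
    ultimately show "\<forall>\<^sub>F x in at_right Z. P x - exp (a * Z) * exp (- a * x) < e"
      by (rule order_tendstoD)
    have "((\<lambda>x. exp (a * Z) * exp (- a * x)) \<longlongrightarrow> 0) at_top" using a by real_asymp
    from tendsto_diff[OF lim(2) this] show "\<forall>\<^sub>F x in at_top. P x - exp (a * Z) * exp (- a * x) < e"
      by (rule order_tendstoD) (use \<open>0 < e\<close> in simp)
  qed (use that in auto)
  have decay: "P z \<le> exp (a * Z) * exp (- a * z)" if "0 < z" for z
  proof (cases "Z < z")
    case True
    then show ?thesis using dec1[of z] by simp
  next
    case False
    then have "1 \<le> exp (a * Z) * exp (- a * z)" using a by (simp flip: exp_add add: mult_left_mono)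
    then show ?thesis using le1[OF that] by simp
  qed
  show ?thesis
    by (rule that[of P' "exp (a * Z)" W]) (use D(1) D2 nonneg le1 decay P'bd P'far in auto)
qed

text \<open>The recursion is the \<open>m\<close>-fold differentiated equation
  \<open>z P'' + \<alpha> P' = z P\<close>.\<close>

fun profile_deriv :: "(real \<Rightarrow> real) \<Rightarrow> (real \<Rightarrow> real) \<Rightarrow> real \<Rightarrow> nat \<Rightarrow> real \<Rightarrow> real" where
  "profile_deriv P P' \<alpha> 0 = P"
| "profile_deriv P P' \<alpha> (Suc 0) = P'"
| "profile_deriv P P' \<alpha> (Suc (Suc m)) = (\<lambda>z. (- (real m + \<alpha>) * profile_deriv P P' \<alpha> (Suc m) z
     + z * profile_deriv P P' \<alpha> m z + real m * profile_deriv P P' \<alpha> (m - 1) z) / z)"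

text \<open>Writing the recursion as \<open>z * D (k + 2) = N z\<close> and differentiating
  \<open>N z / z\<close> reproduces the recursion one order up. Three lower orders enter, hence the
  complete induction.\<close>

lemma profile_deriv_DERIV:
  assumes P: "\<And>z. 0 < z \<Longrightarrow> (P has_real_derivative P' z) (at z)"
    "\<And>z. 0 < z \<Longrightarrow> (P' has_real_derivative P z - \<alpha> / z * P' z) (at z)"
    and "0 < z"
  shows "(profile_deriv P P' \<alpha> m has_real_derivative profile_deriv P P' \<alpha> (Suc m) z) (at z)"
  using \<open>0 < z\<close>
proof (induction m arbitrary: z rule: less_induct)
  case (less m)
  consider "m = 0" | "m = 1" | k where "m = Suc (Suc k)" by (metis One_nat_def not0_implies_Suc)
  then show ?case
  proof cases
    case 1
    then show ?thesis using P less by simp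
  next
    case 2
    have "(- \<alpha> * P' z + z * P z) / z = P z - \<alpha> / z * P' z" using less by (simp add: field_simps)
    then show ?thesis using P(2)[of z] less 2 by simp
  next
    case (3 k)
    let ?D = "profile_deriv P P' \<alpha>"
    have d1: "(?D (Suc k) has_real_derivative ?D (Suc (Suc k)) z) (at z)"
      and d2: "(?D k has_real_derivative ?D (Suc k) z) (at z)"
      using less 3 by (simp_all del: profile_deriv.simps)
    \<comment> \<open>For \<open>k = 0\<close> the truncated index \<open>k - 1\<close> meets the
      factor 0.\<close>
    have d3: "((\<lambda>z. real k * ?D (k - 1) z) has_real_derivative real k * ?D k z) (at z)"
    proof (cases k)
      case (Suc i)
      then have "(?D i has_real_derivative ?D (Suc i) z) (at z)"
        using less 3 by (simp del: profile_deriv.simps)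
      then show ?thesis using Suc by (simp add: DERIV_cmult del: profile_deriv.simps of_nat_Suc)
    qed simp
    define N where "N z = - (real k + \<alpha>) * ?D (Suc k) z + z * ?D k z + real k * ?D (k - 1) z" for z
    have "(N has_real_derivative (- (real k + \<alpha>) * ?D (Suc (Suc k)) z
        + (1 * ?D k z + ?D (Suc k) z * z) + real k * ?D k z)) (at z)"
      unfolding N_def by (intro DERIV_add DERIV_cmult DERIV_mult d1 d2 d3 DERIV_ident)
    then have "((\<lambda>z. N z / z) has_real_derivative ((- (real k + \<alpha>) * ?D (Suc (Suc k)) z
        + (1 * ?D k z + ?D (Suc k) z * z) + real k * ?D k z) * z - N z * 1) / (z * z)) (at z)"
      using less by (intro DERIV_divide DERIV_ident) auto
    moreover have Nz: "N z = z * ?D (Suc (Suc k)) z" using less by (simp add: N_def)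
    have "((- (real k + \<alpha>) * ?D (Suc (Suc k)) z
        + (1 * ?D k z + ?D (Suc k) z * z) + real k * ?D k z) * z - N z * 1) / (z * z) = ?D (Suc (Suc (Suc k))) z"
      unfolding Nz profile_deriv.simps(3)[of P P' \<alpha> "Suc k"] using less.prems
      by (simp add: field_simps del: profile_deriv.simps)
    ultimately show ?thesis unfolding 3 N_def by (simp only: profile_deriv.simps(3))
  qed
qed

text \<open>The bound on the derivatives is proved with partial sums in place of the exponential: passing to a longer
  partial sum pays for the factor \<open>z\<^sup>2\<close> in the recursion by a quadratic factor in \<open>m\<close>.\<close>

lemma exp_partial_sum_shift:
  fixes x :: real
  assumes "0 \<le> x"
  shows "x\<^sup>2 * (\<Sum>j\<le>m. x ^ j / fact j) \<le> real ((m + 1) * (m + 2)) * (\<Sum>j\<le>m + 2. x ^ j / fact j)"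
proof -
  have "x\<^sup>2 * (\<Sum>j\<le>m. x ^ j / fact j) = (\<Sum>j\<le>m. real ((j + 1) * (j + 2)) * (x ^ (j + 2) / fact (j + 2)))"
    unfolding sum_distrib_left
  proof (intro sum.cong refl)
    fix j
    define c where "c = real ((j + 1) * (j + 2))"
    have "(fact (j + 2) :: real) = c * fact j" by (simp add: algebra_simps c_def)
    moreover have "c \<noteq> 0" unfolding c_def of_nat_eq_0_iff by simp
    ultimately have "x\<^sup>2 * (x ^ j / fact j) = c * (x ^ (j + 2) / fact (j + 2))"
      by (simp add: power2_eq_square del: fact_Suc)
    then show "x\<^sup>2 * (x ^ j / fact j) = real ((j + 1) * (j + 2)) * (x ^ (j + 2) / fact (j + 2))"
      unfolding c_def .
  qed
  also have "\<dots> \<le> (\<Sum>j\<le>m. real ((m + 1) * (m + 2)) * (x ^ (j + 2) / fact (j + 2)))"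
    using assms by (intro sum_mono mult_right_mono of_nat_mono mult_mono) auto
  also have "\<dots> = real ((m + 1) * (m + 2)) * (\<Sum>j\<in>(\<lambda>j. j + 2) ` {..m}. x ^ j / fact j)"
    by (subst sum.reindex) (auto simp: sum_distrib_left inj_on_def)
  also have "\<dots> \<le> real ((m + 1) * (m + 2)) * (\<Sum>j\<le>m + 2. x ^ j / fact j)"
    using assms by (intro mult_left_mono sum_mono2) auto
  finally show ?thesis .
qed

text \<open>A statement at one fixed \<open>z\<close>, so that \<open>M\<close> may depend on
  \<open>z\<close>; it will carry the power and the exponential decay of the profile. Once the
  recursion is multiplied by the power of \<open>z\<close> that matches the order, order 0 appears
  only with a factor \<open>z\<^sup>2\<close>, which is the form of the assumption on
  \<open>D 0\<close>.\<close>

lemma profile_deriv_bound: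
  fixes P P' :: "real \<Rightarrow> real" and z \<epsilon> M \<alpha> :: real
  defines "D \<equiv> \<lambda>m. profile_deriv P P' \<alpha> m z"
  assumes z: "0 < z" and e: "0 < \<epsilon>" "\<epsilon> \<le> 1" and al: "\<bar>\<alpha>\<bar> \<le> 1"
    and M0: "z\<^sup>2 * \<bar>D 0\<bar> \<le> M" and M1: "z * \<bar>D 1\<bar> \<le> M" and m: "1 \<le> m"
  shows "z ^ m * \<bar>D m\<bar> \<le> (2 / \<epsilon>) ^ m * fact m * M * exp (\<epsilon> * z)"
proof -
  define p where "p m = (\<Sum>j\<le>m. (\<epsilon> * z) ^ j / fact j)" for m :: nat
  \<comment> \<open>Since \<open>\<epsilon> \<le> 1\<close> this is at least 2, so
    \<open>\<kappa> + \<kappa>\<^sup>2 / 2 \<le> \<kappa>\<^sup>2\<close> and the three terms of the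
    recursion fit into the next order; \<open>1 / \<epsilon>\<^sup>2 = \<kappa>\<^sup>2 / 4\<close>
    is the price of each shift of the partial sum.\<close>
  define \<kappa> where "\<kappa> = 2 / \<epsilon>"
  have \<kappa>: "2 \<le> \<kappa>" "1 / \<epsilon>\<^sup>2 = \<kappa>\<^sup>2 / 4" using e by (auto simp: \<kappa>_def field_simps)
  have pmono: "p i \<le> p j" if "i \<le> j" for i j
    unfolding p_def using that z e by (intro sum_mono2) auto
  have p1: "1 \<le> p i" for i using pmono[of 0 i] by (simp add: p_def)
  then have p0: "0 \<le> p i" for i using zero_le_one order_trans by blast
  have shift: "z\<^sup>2 * p i \<le> real ((i + 1) * (i + 2)) * (\<kappa>\<^sup>2 / 4) * p (i + 2)" for i
  proof -
    have "(\<epsilon> * z)\<^sup>2 * p i \<le> real ((i + 1) * (i + 2)) * p (i + 2)"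
      unfolding p_def using z e by (intro exp_partial_sum_shift) auto
    then have "z\<^sup>2 * p i \<le> real ((i + 1) * (i + 2)) * p (i + 2) * (1 / \<epsilon>\<^sup>2)"
      using e by (simp add: field_simps power_mult_distrib)
    then show ?thesis unfolding \<kappa> by (simp only: mult_ac)
  qed
  have M: "0 \<le> M" using M1 z by (smt (verit) mult_nonneg_nonneg abs_ge_zero)
  \<comment> \<open>The second part is the shifted form that the higher orders consume. It is
    claimed for \<open>m = 0\<close> as well, where it comes from \<open>M0\<close>.\<close>
  have main: "(1 \<le> m \<longrightarrow> z ^ m * \<bar>D m\<bar> \<le> \<kappa> ^ m * fact m * M * p m) \<and>
      z\<^sup>2 * (z ^ m * \<bar>D m\<bar>) \<le> \<kappa> ^ m * fact (m + 2) * (\<kappa>\<^sup>2 / 4) * M * p (m + 2)" for m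
  proof (induction m rule: less_induct)
    case (less m)
    have Q: "z ^ m * \<bar>D m\<bar> \<le> \<kappa> ^ m * fact m * M * p m" if m1: "1 \<le> m"
    proof (cases "m = 1")
      case True
      have "z * \<bar>D 1\<bar> \<le> 1 * M * 1" using M1 by simp
      also have "\<dots> \<le> \<kappa> * M * p 1" using \<kappa> M p1 by (intro mult_mono) auto
      finally show ?thesis using True by simp
    next
      case False
      then obtain k where k: "m = Suc (Suc k)" using m1 by (metis One_nat_def not0_implies_Suc not_one_le_zero)
      have IH1: "z ^ Suc k * \<bar>D (Suc k)\<bar> \<le> \<kappa> ^ Suc k * fact (Suc k) * M * p (Suc k)"
        and IH2: "z\<^sup>2 * (z ^ k * \<bar>D k\<bar>) \<le> \<kappa> ^ k * fact (k + 2) * (\<kappa>\<^sup>2 / 4) * M * p (k + 2)"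
        using less.IH[of "Suc k"] less.IH[of k] k by simp_all
      have IH3: "real k * (z\<^sup>2 * (z ^ (k - 1) * \<bar>D (k - 1)\<bar>)) \<le> \<kappa> ^ k * fact (k + 2) * (\<kappa>\<^sup>2 / 4) * M * p (k + 2)"
      proof (cases k)
        case 0
        then show ?thesis using M p0[of "Suc (Suc 0)"] by (simp add: mult_nonneg_nonneg)
      next
        case (Suc i)
        have "z\<^sup>2 * (z ^ i * \<bar>D i\<bar>) \<le> \<kappa> ^ i * fact (i + 2) * (\<kappa>\<^sup>2 / 4) * M * p (i + 2)"
          using less.IH[of i] k Suc by simp
        then have "real k * (z\<^sup>2 * (z ^ i * \<bar>D i\<bar>)) \<le> real k * (\<kappa> ^ i * fact (i + 2) * (\<kappa>\<^sup>2 / 4) * M * p (i + 2))"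
          by (rule mult_left_mono) simp
        also have "\<dots> = \<kappa> ^ i * (real k * fact (i + 2)) * (\<kappa>\<^sup>2 / 4) * M * p (i + 2)" by (simp only: mult_ac)
        also have "\<dots> \<le> \<kappa> ^ k * fact (k + 2) * (\<kappa>\<^sup>2 / 4) * M * p (k + 2)"
        proof (intro mult_mono)
          show "\<kappa> ^ i \<le> \<kappa> ^ k" using \<kappa> Suc by (intro power_increasing) auto
          have "real k * fact (i + 2) \<le> real (k + 2) * fact (k + 1)" using Suc by (intro mult_mono) auto
          then show "real k * fact (i + 2) \<le> fact (k + 2)" by simp
          show "p (i + 2) \<le> p (k + 2)" using Suc by (intro pmono) auto
        qed (use \<kappa> M p1 in \<open>auto intro: order_trans[OF _ p1] mult_nonneg_nonneg\<close>)
        finally show ?thesis using Suc by simp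
      qed
      have rec: "z ^ Suc (Suc k) * D (Suc (Suc k)) = - (real k + \<alpha>) * (z ^ Suc k * D (Suc k))
          + z\<^sup>2 * (z ^ k * D k) + real k * (z\<^sup>2 * (z ^ (k - 1) * D (k - 1)))"
      proof -
        have "z ^ Suc (Suc k) * D (Suc (Suc k)) = z ^ Suc k * (- (real k + \<alpha>) * D (Suc k) + z * D k + real k * D (k - 1))"
          unfolding D_def using z by simp
        moreover have *: "real k * (z\<^sup>2 * (z ^ (k - 1) * D (k - 1))) = real k * (z ^ Suc k * D (k - 1))"
          by (cases k) (simp_all add: power2_eq_square mult_ac)
        ultimately show ?thesis unfolding * by (simp add: algebra_simps power2_eq_square)
      qed
      have "z ^ m * \<bar>D m\<bar> = \<bar>z ^ m * D m\<bar>" using z by (simp add: abs_mult)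
      also have "\<dots> \<le> \<bar>- (real k + \<alpha>) * (z ^ Suc k * D (Suc k))\<bar>
          + \<bar>z\<^sup>2 * (z ^ k * D k)\<bar> + \<bar>real k * (z\<^sup>2 * (z ^ (k - 1) * D (k - 1)))\<bar>"
        unfolding k rec by linarith
      also have "\<dots> = \<bar>real k + \<alpha>\<bar> * (z ^ Suc k * \<bar>D (Suc k)\<bar>)
          + z\<^sup>2 * (z ^ k * \<bar>D k\<bar>) + real k * (z\<^sup>2 * (z ^ (k - 1) * \<bar>D (k - 1)\<bar>))"
        using z by (simp only: abs_mult abs_minus_cancel) simp
      also have "\<dots> \<le> real (k + 2) * (\<kappa> ^ Suc k * fact (Suc k) * M * p (k + 2))
          + \<kappa> ^ k * fact (k + 2) * (\<kappa>\<^sup>2 / 4) * M * p (k + 2) + \<kappa> ^ k * fact (k + 2) * (\<kappa>\<^sup>2 / 4) * M * p (k + 2)"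
      proof -
        have "\<kappa> ^ Suc k * fact (Suc k) * M * p (Suc k) \<le> \<kappa> ^ Suc k * fact (Suc k) * M * p (k + 2)"
          using \<kappa> M by (intro mult_left_mono pmono) auto
        then have "z ^ Suc k * \<bar>D (Suc k)\<bar> \<le> \<kappa> ^ Suc k * fact (Suc k) * M * p (k + 2)" using IH1 by linarith
        then have "\<bar>real k + \<alpha>\<bar> * (z ^ Suc k * \<bar>D (Suc k)\<bar>) \<le>
            real (k + 2) * (\<kappa> ^ Suc k * fact (Suc k) * M * p (k + 2))"
          by (rule mult_mono[rotated]) (use al z in auto)
        then show ?thesis using IH2 IH3 by linarith
      qed
      also have "\<dots> = (\<kappa> + \<kappa>\<^sup>2 / 2) * (\<kappa> ^ k * fact (k + 2) * M * p (k + 2))"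
        by (simp add: algebra_simps)
      also have "\<dots> \<le> \<kappa>\<^sup>2 * (\<kappa> ^ k * fact (k + 2) * M * p (k + 2))"
      proof (rule mult_right_mono)
        have "2 * \<kappa> \<le> \<kappa> * \<kappa>" using \<kappa>(1) by (intro mult_right_mono) auto
        then show "\<kappa> + \<kappa>\<^sup>2 / 2 \<le> \<kappa>\<^sup>2" unfolding power2_eq_square by linarith
      qed (use \<kappa> M p1[of "k + 2"] in auto)
      finally show ?thesis unfolding k by (simp add: power2_eq_square mult_ac)
    qed
    moreover have "z\<^sup>2 * (z ^ m * \<bar>D m\<bar>) \<le> \<kappa> ^ m * fact (m + 2) * (\<kappa>\<^sup>2 / 4) * M * p (m + 2)"
    proof (cases "m = 0")
      case True
      have "z\<^sup>2 * \<bar>D 0\<bar> \<le> 2 * 1 * M * 1" using M0 M by simp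
      also have "\<dots> \<le> 2 * (\<kappa>\<^sup>2 / 4) * M * p 2"
        using \<kappa> M p1 power_mono[of 2 \<kappa> 2] by (intro mult_mono) auto
      finally show ?thesis using True by (simp add: numeral_2_eq_2)
    next
      case False
      then have "z\<^sup>2 * (z ^ m * \<bar>D m\<bar>) \<le> z\<^sup>2 * (\<kappa> ^ m * fact m * M * p m)"
        using Q by (intro mult_left_mono) auto
      also have "\<dots> = (\<kappa> ^ m * fact m * M) * (z\<^sup>2 * p m)" by (simp only: mult_ac)
      also have "\<dots> \<le> (\<kappa> ^ m * fact m * M) * (real ((m + 1) * (m + 2)) * (\<kappa>\<^sup>2 / 4) * p (m + 2))"
        using \<kappa> M by (intro mult_left_mono shift) auto
      also have "\<dots> = \<kappa> ^ m * fact (m + 2) * (\<kappa>\<^sup>2 / 4) * M * p (m + 2)"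
        by (simp add: algebra_simps)
      finally show ?thesis .
    qed
    ultimately show ?case by blast
  qed
  have "z ^ m * \<bar>D m\<bar> \<le> \<kappa> ^ m * fact m * M * p m" using main m by blast
  moreover have "p m \<le> exp (\<epsilon> * z)"
  proof -
    have "(\<lambda>j. (\<epsilon> * z) ^ j / fact j) sums exp (\<epsilon> * z)"
      using exp_converges[of "\<epsilon> * z"] by (simp add: divide_inverse_commute)
    moreover have "p m \<le> (\<Sum>j. (\<epsilon> * z) ^ j / fact j)"
      unfolding p_def using z e sums_summable[OF calculation] by (intro sum_le_suminf) auto
    ultimately show ?thesis by (simp add: sums_iff)
  qed
  ultimately have "z ^ m * \<bar>D m\<bar> \<le> \<kappa> ^ m * fact m * M * exp (\<epsilon> * z)"
    using \<kappa> M by (elim order_trans) (intro mult_left_mono, auto)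
  then show ?thesis unfolding \<kappa>_def .
qed

lemma extension_profile_bounds:
  assumes P: "extension_profile s 1 P" and s: "0 < s" "s < 1" and b: "0 < b" "b < 1"
  obtains D C \<kappa> where "D 0 = P" "1 < \<kappa>" "0 < C"
    "\<And>m z. 0 < z \<Longrightarrow> (D m has_real_derivative D (Suc m) z) (at z)"
    "\<And>z. 0 < z \<Longrightarrow> \<bar>P z\<bar> \<le> 1"
    "\<And>z. 0 < z \<Longrightarrow> \<bar>P z\<bar> \<le> C * exp (- b * z)"
    "\<And>m z. 1 \<le> m \<Longrightarrow> 0 < z \<Longrightarrow> \<bar>D m z\<bar> \<le> C * \<kappa> ^ m * fact m * (z powr (2 * s - real m) * exp (- b * z))"
proof -
  \<comment> \<open>Three rates \<open>b < a' < a < 1\<close>, an \<open>\<epsilon>\<close> apart: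
    the step from \<open>a\<close> to \<open>a'\<close> absorbs powers of \<open>z\<close>, the step
    from \<open>a'\<close> to \<open>b\<close> the factor \<open>exp (\<epsilon> * z)\<close> of the
    derivative bound.\<close>
  define \<epsilon> where "\<epsilon> = (1 - b) / 3"
  define a' where "a' = b + \<epsilon>"
  define a where "a = a' + \<epsilon>"
  have e: "0 < \<epsilon>" "\<epsilon> \<le> 1" using b by (auto simp: \<epsilon>_def)
  have a: "0 < a" "a < 1" "a - a' = \<epsilon>" "b < a'" using b e by (auto simp: a_def a'_def \<epsilon>_def field_simps)
  from extension_profile_decay[OF P s a(1,2)] obtain P' K W where
    P1: "\<And>z. 0 < z \<Longrightarrow> (P has_real_derivative P' z) (at z)"
    "\<And>z. 0 < z \<Longrightarrow> (P' has_real_derivative P z - (1 - 2 * s) / z * P' z) (at z)"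
    and P01: "\<And>z. 0 < z \<Longrightarrow> 0 \<le> P z \<and> P z \<le> 1"
    and PK: "\<And>z. 0 < z \<Longrightarrow> P z \<le> K * exp (- a * z)"
    and PW: "\<And>z. 0 < z \<Longrightarrow> \<bar>P' z\<bar> \<le> W * z powr (2 * s - 1)"
    and P2: "\<And>z. 2 \<le> z \<Longrightarrow> \<bar>P' z\<bar> \<le> 2 * P (z - 1)"
    by blast
  obtain K' where K': "0 < K'" "\<And>y. 0 < y \<Longrightarrow> y powr (2 - 2 * s) * exp (- \<epsilon> * y) \<le> K'"
    using powr_exp_bounded[of "2 - 2 * s" \<epsilon>] s e by auto
  have "0 \<le> K * exp (- a * 1)" using P01[of 1] PK[of 1] by linarith
  then have K0: "0 \<le> K" by (simp add: zero_le_mult_iff)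
  have W0: "0 \<le> W" using PW[of 1] by simp
  define C where "C = K * K' + W * exp (2 * a') + 2 * K * exp a * K' + K + 1"
  have C: "0 < C" unfolding C_def using K0 K' W0 by (intro add_nonneg_pos add_nonneg_nonneg mult_nonneg_nonneg) auto
  have expa: "exp (- a * z) = exp (- \<epsilon> * z) * exp (- a' * z)" for z
    by (simp add: a_def algebra_simps flip: exp_add)
  have M0: "z\<^sup>2 * \<bar>P z\<bar> \<le> C * (z powr (2 * s) * exp (- a' * z))" if z: "0 < z" for z
  proof -
    have "z\<^sup>2 * \<bar>P z\<bar> \<le> z\<^sup>2 * (K * exp (- a * z))" using PK P01 z by (intro mult_left_mono) auto
    also have "z\<^sup>2 * (K * exp (- a * z)) =
        K * (z powr (2 - 2 * s) * exp (- \<epsilon> * z)) * (z powr (2 * s) * exp (- a' * z))"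
    proof -
      have "z\<^sup>2 = z powr (2 * s) * z powr (2 - 2 * s)" using z by (simp flip: powr_add)
      then show ?thesis unfolding expa by (simp only: mult_ac)
    qed
    also have "\<dots> \<le> K * K' * (z powr (2 * s) * exp (- a' * z))"
      using K'(2)[OF z] K0 by (intro mult_right_mono mult_left_mono) auto
    also have "\<dots> \<le> C * (z powr (2 * s) * exp (- a' * z))"
      using K0 K' W0 by (intro mult_right_mono) (auto simp: C_def)
    finally show ?thesis .
  qed
  \<comment> \<open>Up to 2 the flux bound has the exact power \<open>z powr (2 * s)\<close>; beyond
    2 the decay of \<open>P (z - 1)\<close> takes over.\<close>
  have M1: "z * \<bar>P' z\<bar> \<le> C * (z powr (2 * s) * exp (- a' * z))" if z: "0 < z" for z
  proof (cases "z \<le> 2")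
    case True
    have "z * \<bar>P' z\<bar> \<le> z * (W * z powr (2 * s - 1))" using PW z by (intro mult_left_mono) auto
    also have "\<dots> = W * z powr (2 * s) * 1" using z by (simp add: powr_diff)
    also have "\<dots> \<le> W * z powr (2 * s) * (exp (2 * a') * exp (- a' * z))"
    proof (intro mult_left_mono)
      have "0 \<le> a' * (2 - z)" using True a b by (intro mult_nonneg_nonneg) auto
      then have "1 \<le> exp (a' * (2 - z))" by simp
      also have "\<dots> = exp (2 * a') * exp (- a' * z)" by (simp add: algebra_simps flip: exp_add)
      finally show "1 \<le> exp (2 * a') * exp (- a' * z)" .
    qed (use W0 in auto)
    also have "\<dots> = W * exp (2 * a') * (z powr (2 * s) * exp (- a' * z))" by simp
    also have "\<dots> \<le> C * (z powr (2 * s) * exp (- a' * z))"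
      using K0 K' W0 by (intro mult_right_mono) (auto simp: C_def)
    finally show ?thesis .
  next
    case False
    have "z * \<bar>P' z\<bar> \<le> z * (2 * P (z - 1))" using P2[of z] False by (intro mult_left_mono) auto
    also have "\<dots> \<le> z * (2 * (K * exp (- a * (z - 1))))" using PK[of "z - 1"] False by (intro mult_left_mono) auto
    also have "\<dots> = 2 * K * exp a * (z * exp (- a * z))" by (simp add: algebra_simps flip: exp_add)
    also have "\<dots> = 2 * K * exp a * (z powr (2 * s) * (z powr (1 - 2 * s) * exp (- \<epsilon> * z)) * exp (- a' * z))"
      unfolding expa using z by (simp add: powr_diff)
    also have "\<dots> \<le> 2 * K * exp a * (z powr (2 * s) * K' * exp (- a' * z))"
    proof (intro mult_left_mono mult_right_mono)
      have "z powr (1 - 2 * s) \<le> z powr (2 - 2 * s)" using False by (intro powr_mono) auto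
      then have "z powr (1 - 2 * s) * exp (- \<epsilon> * z) \<le> z powr (2 - 2 * s) * exp (- \<epsilon> * z)"
        by (rule mult_right_mono) simp
      then show "z powr (1 - 2 * s) * exp (- \<epsilon> * z) \<le> K'" using K'(2)[OF z] by linarith
    qed (use K0 in auto)
    also have "\<dots> = 2 * K * exp a * K' * (z powr (2 * s) * exp (- a' * z))" by simp
    also have "\<dots> \<le> C * (z powr (2 * s) * exp (- a' * z))"
      using K0 K' W0 by (intro mult_right_mono) (auto simp: C_def)
    finally show ?thesis .
  qed
  have bd: "\<bar>profile_deriv P P' (1 - 2 * s) m z\<bar> \<le>
      C * (2 / \<epsilon>) ^ m * fact m * (z powr (2 * s - real m) * exp (- b * z))" if "1 \<le> m" "0 < z" for m z
  proof -
    have "z ^ m * \<bar>profile_deriv P P' (1 - 2 * s) m z\<bar> \<le>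
        (2 / \<epsilon>) ^ m * fact m * (C * (z powr (2 * s) * exp (- a' * z))) * exp (\<epsilon> * z)"
      by (rule profile_deriv_bound) (use that e s M0 M1 in auto)
    also have "\<dots> = C * (2 / \<epsilon>) ^ m * fact m * (z powr (2 * s) * exp (- b * z))"
      by (simp add: a'_def algebra_simps flip: exp_add)
    finally have "\<bar>profile_deriv P P' (1 - 2 * s) m z\<bar> \<le>
        C * (2 / \<epsilon>) ^ m * fact m * (z powr (2 * s) * exp (- b * z)) / z ^ m"
      using that by (simp only: pos_le_divide_eq zero_less_power mult.commute)
    also have "\<dots> = C * (2 / \<epsilon>) ^ m * fact m * (z powr (2 * s - real m) * exp (- b * z))"
      using that by (simp add: powr_diff powr_realpow)
    finally show ?thesis .
  qed
  show ?thesis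
  proof (rule that[of "profile_deriv P P' (1 - 2 * s)" "2 / \<epsilon>" C])
    show "1 < 2 / \<epsilon>" using e by (simp add: field_simps)
    show "\<And>z. 0 < z \<Longrightarrow> \<bar>P z\<bar> \<le> 1" using P01 by auto
    fix z :: real assume z: "0 < z"
    have "\<bar>P z\<bar> \<le> K * exp (- a * z)" using P01[OF z] PK[OF z] by simp
    also have "\<dots> \<le> C * exp (- b * z)"
    proof (intro mult_mono)
      show "exp (- a * z) \<le> exp (- b * z)"
        using a e z by (simp add: mult_right_mono)
    qed (use K0 K' W0 in \<open>auto simp: C_def\<close>)
    finally show "\<bar>P z\<bar> \<le> C * exp (- b * z)" .
  qed (use C bd profile_deriv_DERIV[OF P1] in auto)
qed

subsection \<open>Lebesgue measure on Borel sets\<close>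

lemma sets_lebesgue_borel: "S \<in> sets borel \<Longrightarrow> S \<inter> space lebesgue \<in> sets lebesgue"
  by (simp add: sets_completionI_sets)

lemma AE_lebesgue_on_iff:
  fixes S :: "'a::euclidean_space set"
  assumes "S \<in> sets borel"
  shows "(AE x in lebesgue_on S. P x) \<longleftrightarrow> (AE x in lborel. x \<in> S \<longrightarrow> P x)"
  using AE_restrict_space_iff[OF sets_lebesgue_borel[OF assms]] AE_completion_iff by blast

lemma nn_integral_lebesgue_on:
  fixes S :: "'a::euclidean_space set"
  assumes "S \<in> sets borel"
  shows "(\<integral>\<^sup>+x. f x \<partial>lebesgue_on S) = (\<integral>\<^sup>+x. f x * indicator S x \<partial>lborel)"
  using nn_integral_restrict_space[OF sets_lebesgue_borel[OF assms]] by (simp add: nn_integral_completion)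

lemma integral_lebesgue_on_borel:
  fixes S :: "'a::euclidean_space set" and f :: "'a \<Rightarrow> 'b::{banach, second_countable_topology}"
  assumes S: "S \<in> sets borel" and f: "f \<in> borel_measurable borel"
  shows "(\<integral>x. f x \<partial>lebesgue_on S) = (\<integral>x. indicator S x *\<^sub>R f x \<partial>lborel)"
proof -
  have "(\<integral>x. f x \<partial>lebesgue_on S) = (\<integral>x. indicator S x *\<^sub>R f x \<partial>lebesgue)"
    using integral_restrict_space[OF sets_lebesgue_borel[OF S]] by blast
  also have "\<dots> = (\<integral>x. indicator S x *\<^sub>R f x \<partial>lborel)"
  proof (rule integral_completion)
    have [measurable]: "f \<in> borel_measurable lborel" "S \<in> sets lborel" using S f by auto
    show "(\<lambda>x. indicator S x *\<^sub>R f x) \<in> borel_measurable lborel" by measurable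
  qed
  finally show ?thesis .
qed

lemma borel_measurable_lebesgue_on_borel:
  fixes f :: "'a::euclidean_space \<Rightarrow> 'b::topological_space"
  assumes "f \<in> borel_measurable borel"
  shows "f \<in> borel_measurable (lebesgue_on S)"
  using assms by (intro measurable_restrict_space1 measurable_completion) simp

lemma borel_measurable_lebesgue_on_iff:
  fixes f :: "'a::euclidean_space \<Rightarrow> 'b::euclidean_space"
  assumes "S \<in> sets borel"
  shows "f \<in> borel_measurable (lebesgue_on S) \<longleftrightarrow>
     (\<lambda>x. indicator S x *\<^sub>R f x) \<in> borel_measurable lebesgue"
  using borel_measurable_restrict_space_iff[OF sets_lebesgue_borel[OF assms]] by blast

text \<open>Lebesgue measure on a product space is a completion and not a product measure, so
  iterated integrals are taken of Borel versions. Extension by 0 lets the integrals run over the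
  whole space.\<close>

lemma borel_version:
  fixes f :: "'a::euclidean_space \<Rightarrow> 'b::euclidean_space"
  assumes f: "f \<in> borel_measurable (lebesgue_on S)" and S: "S \<in> sets borel"
  obtains g where "g \<in> borel_measurable borel" "AE x in lborel. x \<in> S \<longrightarrow> f x = g x"
    "\<And>x. x \<notin> S \<Longrightarrow> g x = 0"
proof -
  let ?f = "\<lambda>x. indicator S x *\<^sub>R f x"
  have "?f \<in> borel_measurable lebesgue" using f borel_measurable_lebesgue_on_iff[OF S] by blast
  then have "\<exists>g'\<in>borel_measurable lborel. AE x in lborel. ?f x \<bullet> i = g' x" for i
    by (intro completion_ex_borel_measurable_real borel_measurable_inner borel_measurable_const)
  then have "\<forall>i. \<exists>g'. g' \<in> borel_measurable lborel \<and> (AE x in lborel. ?f x \<bullet> i = g' x)"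
    unfolding Bex_def by blast
  from choice[OF this] obtain g' where g'': "\<And>i. g' i \<in> borel_measurable lborel"
      "\<And>i. AE x in lborel. ?f x \<bullet> i = g' i x"
    by blast
  then have g': "\<And>i. g' i \<in> borel_measurable borel" by simp
  define g where "g x = indicator S x *\<^sub>R (\<Sum>i\<in>Basis. g' i x *\<^sub>R i)" for x
  have "AE x in lborel. \<forall>i\<in>Basis. ?f x \<bullet> i = g' i x"
    using g''(2) by (subst AE_ball_countable) (auto intro: countable_finite)
  then have "AE x in lborel. x \<in> S \<longrightarrow> f x = g x"
  proof eventually_elim
    case (elim x)
    have "f x = g x" if "x \<in> S"
    proof -
      have "g x = (\<Sum>i\<in>Basis. (f x \<bullet> i) *\<^sub>R i)" using elim that by (auto simp: g_def intro!: sum.cong)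
      then show ?thesis by (simp add: euclidean_representation)
    qed
    then show ?case by blast
  qed
  moreover have "g \<in> borel_measurable borel" unfolding g_def using g' S by measurable
  ultimately show ?thesis using that[of g] by (simp add: g_def)
qed

text \<open>A function that is not integrable has Bochner integral 0, so the bound covers it too,
  and a convolution can be estimated before it is known to converge.\<close>

lemma ennreal_abs_integral_le: "ennreal \<bar>integral\<^sup>L M f\<bar> \<le> (\<integral>\<^sup>+x. ennreal \<bar>f x\<bar> \<partial>M)"
  for f :: "'a \<Rightarrow> real"
  using integral_norm_bound_ennreal[of M f] not_integrable_integral_eq[of M f]
  by (cases "integrable M f") auto

lemma nn_integral_powr_from_0:
  assumes "0 < p" "0 \<le> c"
  shows "(\<integral>\<^sup>+x. ennreal (indicator {0<..<c} x * x powr (p - 1)) \<partial>lborel) = ennreal (c powr p / p)"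
proof -
  have "((\<lambda>x. x powr (p - 1)) has_integral c powr (p - 1 + 1) / (p - 1 + 1)) {0..c}"
    using assms by (intro has_integral_powr_from_0) auto
  from nn_integral_has_integral_lebesgue[OF _ this]
  have "(\<integral>\<^sup>+x. ennreal (indicator {0..c} x * x powr (p - 1)) \<partial>lborel) = ennreal (c powr p / p)" by simp
  moreover have "(\<integral>\<^sup>+x. ennreal (indicator {0<..<c} x * x powr (p - 1)) \<partial>lborel) =
      (\<integral>\<^sup>+x. ennreal (indicator {0..c} x * x powr (p - 1)) \<partial>lborel)"
    by (intro nn_integral_cong_AE AE_I[where N = "{0, c}"])
      (auto simp: indicator_def emeasure_lborel_countable split: if_splits)
  ultimately show ?thesis by simp
qed

subsection \<open>The time-dependent coefficients\<close>

lemma borel_measurable_mittag_leffler [measurable]: "mittag_leffler \<gamma> \<beta> \<in> borel_measurable borel"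
  unfolding mittag_leffler_def[abs_def] by measurable

text \<open>Cauchy-Schwarz with \<open>K\<close> split into \<open>sqrt K * sqrt K\<close> leaves
  \<open>f\<^sup>2\<close> under the kernel; Fubini and translation invariance then produce the
  second factor of the integral of \<open>K\<close>.\<close>

lemma young_convolution_L2:
  fixes K f :: "real \<Rightarrow> real"
  assumes [measurable]: "K \<in> borel_measurable borel" "f \<in> borel_measurable borel"
    and K: "\<And>r. 0 \<le> K r"
  shows "(\<integral>\<^sup>+t. (\<integral>\<^sup>+r. ennreal (K (t - r) * \<bar>f r\<bar>) \<partial>lborel)\<^sup>2 \<partial>lborel)
     \<le> (\<integral>\<^sup>+r. ennreal (K r) \<partial>lborel)\<^sup>2 * (\<integral>\<^sup>+r. ennreal ((f r)\<^sup>2) \<partial>lborel)"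
proof -
  let ?N = "\<integral>\<^sup>+r. ennreal (K r) \<partial>lborel"
  have shift: "(\<integral>\<^sup>+r. ennreal (K (t - r)) \<partial>lborel) = ?N" for t
    using nn_integral_real_affine[of "\<lambda>r. ennreal (K r)" "-1" t] by simp
  have shift': "(\<integral>\<^sup>+t. ennreal (K (t - r)) \<partial>lborel) = ?N" for r
    using nn_integral_real_affine[of "\<lambda>r. ennreal (K r)" "1" "- r"] by simp
  have cs: "(\<integral>\<^sup>+r. ennreal (K (t - r) * \<bar>f r\<bar>) \<partial>lborel)\<^sup>2 \<le> ?N * (\<integral>\<^sup>+r. ennreal (K (t - r) * (f r)\<^sup>2) \<partial>lborel)" for t
  proof -
    have "(\<integral>\<^sup>+r. ennreal (K (t - r) * \<bar>f r\<bar>) \<partial>lborel) =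
        (\<integral>\<^sup>+r. ennreal (sqrt (K (t - r))) * ennreal (sqrt (K (t - r)) * \<bar>f r\<bar>) \<partial>lborel)"
      using K by (intro nn_integral_cong) (simp flip: ennreal_mult' mult.assoc)
    also have "\<dots>\<^sup>2 \<le> (\<integral>\<^sup>+r. (ennreal (sqrt (K (t - r))))\<^sup>2 \<partial>lborel) *
        (\<integral>\<^sup>+r. (ennreal (sqrt (K (t - r)) * \<bar>f r\<bar>))\<^sup>2 \<partial>lborel)"
      by (rule Cauchy_Schwarz_nn_integral) measurable
    also have "\<dots> = ?N * (\<integral>\<^sup>+r. ennreal (K (t - r) * (f r)\<^sup>2) \<partial>lborel)"
      using K by (simp add: ennreal_power power_mult_distrib shift)
    finally show ?thesis .
  qed
  have "(\<integral>\<^sup>+t. (\<integral>\<^sup>+r. ennreal (K (t - r) * \<bar>f r\<bar>) \<partial>lborel)\<^sup>2 \<partial>lborel)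
      \<le> (\<integral>\<^sup>+t. ?N * (\<integral>\<^sup>+r. ennreal (K (t - r) * (f r)\<^sup>2) \<partial>lborel) \<partial>lborel)"
    by (intro nn_integral_mono cs)
  also have "\<dots> = ?N * (\<integral>\<^sup>+t. (\<integral>\<^sup>+r. ennreal (K (t - r) * (f r)\<^sup>2) \<partial>lborel) \<partial>lborel)"
    by (rule nn_integral_cmult) measurable
  also have "(\<integral>\<^sup>+t. (\<integral>\<^sup>+r. ennreal (K (t - r) * (f r)\<^sup>2) \<partial>lborel) \<partial>lborel) =
      (\<integral>\<^sup>+r. (\<integral>\<^sup>+t. ennreal (K (t - r) * (f r)\<^sup>2) \<partial>lborel) \<partial>lborel)"
    by (rule lborel_pair.Fubini') measurable
  also have "\<dots> = (\<integral>\<^sup>+r. ?N * ennreal ((f r)\<^sup>2) \<partial>lborel)"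
    using K by (intro nn_integral_cong) (simp add: ennreal_mult nn_integral_multc shift')
  also have "\<dots> = ?N * (\<integral>\<^sup>+r. ennreal ((f r)\<^sup>2) \<partial>lborel)"
    by (rule nn_integral_cmult) measurable
  finally show ?thesis by (simp add: power2_eq_square mult.assoc)
qed

text \<open>The right side has an integrand that is jointly Borel in \<open>(t, r)\<close>, which
  gives measurability in \<open>t\<close> and permits Young's inequality. The end points 0 and
  \<open>t\<close> are dropped as null sets.\<close>

lemma wave_coeff_borel:
  fixes f :: "real \<Rightarrow> real"
  assumes "0 < T" and [measurable]: "fb \<in> borel_measurable borel"
    and f: "f \<in> borel_measurable (lebesgue_on {0<..<T})"
    and eq: "AE r in lborel. r \<in> {0<..<T} \<longrightarrow> f r = fb r"
    and t: "0 < t" "t < T"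
  shows "(LINT r:{0..t}|lebesgue.
          (t - r) powr (\<gamma> - 1) * mittag_leffler \<gamma> \<gamma> (- (l powr s * (t - r) powr \<gamma>)) * f r)
     = (\<integral>r. indicator {0<..<t} r * ((t - r) powr (\<gamma> - 1) * mittag_leffler \<gamma> \<gamma> (- (l powr s * (t - r) powr \<gamma>)) * fb r) \<partial>lborel)"
proof -
  let ?k = "\<lambda>r. (t - r) powr (\<gamma> - 1) * mittag_leffler \<gamma> \<gamma> (- (l powr s * (t - r) powr \<gamma>))"
  have k: "?k \<in> borel_measurable borel" by measurable
  have fS: "(\<lambda>r. indicator {0<..<T} r *\<^sub>R f r) \<in> borel_measurable lebesgue"
    using f borel_measurable_lebesgue_on_iff[of "{0<..<T}" f] by simp
  have "(LINT r:{0..t}|lebesgue. ?k r * f r) = (\<integral>r. indicator {0<..<t} r * (?k r * f r) \<partial>lebesgue)"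
    unfolding set_lebesgue_integral_def
    by (rule integral_discrete_difference[where X = "{0, t}"]) (auto simp: indicator_def)
  also have "\<dots> = (\<integral>r. (indicator {0<..<t} r * ?k r) * (indicator {0<..<T} r *\<^sub>R f r) \<partial>lebesgue)"
    using t by (intro Bochner_Integration.integral_cong) (auto simp: indicator_def)
  also have "\<dots> = (\<integral>r. indicator {0<..<t} r * (?k r * fb r) \<partial>lebesgue)"
  proof (rule integral_cong_AE)
    have m1: "(\<lambda>r. indicator {0<..<t} r * ?k r) \<in> borel_measurable lebesgue"
      by (intro measurable_completion) simp
    show "(\<lambda>r. (indicator {0<..<t} r * ?k r) * (indicator {0<..<T} r *\<^sub>R f r)) \<in> borel_measurable lebesgue"
      by (intro borel_measurable_times m1 fS)
    show "(\<lambda>r. indicator {0<..<t} r * (?k r * fb r)) \<in> borel_measurable lebesgue"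
      by (intro measurable_completion) simp
    show "AE r in lebesgue. (indicator {0<..<t} r * ?k r) * (indicator {0<..<T} r *\<^sub>R f r)
        = indicator {0<..<t} r * (?k r * fb r)"
      unfolding AE_completion_iff using eq by eventually_elim (use t in \<open>auto simp: indicator_def\<close>)
  qed
  also have "\<dots> = (\<integral>r. indicator {0<..<t} r * (?k r * fb r) \<partial>lborel)"
    by (rule integral_completion) simp
  finally show ?thesis .
qed

lemma wave_coeff_measurable:
  assumes "0 < T" and f: "f \<in> borel_measurable (lebesgue_on {0<..<T})"
  obtains u where "u \<in> borel_measurable borel"
    "\<And>t. 0 < t \<Longrightarrow> t < T \<Longrightarrow> wave_coeff s \<gamma> l g h f t = u t"
proof -
  obtain fb where fb[measurable]: "fb \<in> borel_measurable borel"
    and eq: "AE r in lborel. r \<in> {0<..<T} \<longrightarrow> f r = fb r"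
    using borel_version[OF f] by (metis borel_open open_greaterThanLessThan)
  define u where "u t = mittag_leffler \<gamma> 1 (- (l powr s * t powr \<gamma>)) * g
     + t * mittag_leffler \<gamma> 2 (- (l powr s * t powr \<gamma>)) * h
     + (\<integral>r. indicator {0<..<t} r * ((t - r) powr (\<gamma> - 1) * mittag_leffler \<gamma> \<gamma> (- (l powr s * (t - r) powr \<gamma>)) * fb r) \<partial>lborel)" for t
  have [measurable]: "(\<lambda>(t :: real, r). indicator {0<..<t} r :: real) \<in> borel_measurable (borel \<Otimes>\<^sub>M borel)"
  proof -
    have "(\<lambda>(t :: real, r). indicator {0<..<t} r :: real) = (\<lambda>p. if 0 < snd p \<and> snd p < fst p then 1 else 0)"
      by (auto simp: indicator_def fun_eq_iff)
    also have "\<dots> \<in> borel_measurable (borel \<Otimes>\<^sub>M borel)" by measurable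
    finally show ?thesis .
  qed
  have "u \<in> borel_measurable borel" unfolding u_def[abs_def] by measurable
  moreover have "wave_coeff s \<gamma> l g h f t = u t" if "0 < t" "t < T" for t
    unfolding wave_coeff_def u_def wave_coeff_borel[OF assms(1) fb f eq that] ..
  ultimately show ?thesis using that by blast
qed

lemma square_sum3_le:
  fixes x y z :: real
  shows "(x + y + z)\<^sup>2 \<le> 3 * x\<^sup>2 + 3 * y\<^sup>2 + 3 * z\<^sup>2"
proof -
  have "0 \<le> (x - y)\<^sup>2 + (y - z)\<^sup>2 + (x - z)\<^sup>2" by simp
  then show ?thesis by (simp add: power2_eq_square algebra_simps)
qed

text \<open>The three terms use the Mittag-Leffler bounds with \<open>p = 0\<close>,
  \<open>1 / 2\<close> and \<open>1 - \<mu>\<close>. The resulting powers 0, \<open>- s\<close> and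
  \<open>2 * \<mu> * s - 2 * s\<close> of \<open>l\<close> are what must be added to
  \<open>r + s\<close> to obtain the Sobolev indices \<open>r + s\<close>, \<open>r\<close> and
  \<open>r - s + 2 * \<mu> * s\<close> of the data.\<close>

lemma wave_coeff_L2_bound:
  fixes s \<gamma> T \<mu> :: real
  assumes \<gamma>: "1 < \<gamma>" "\<gamma> < 2" and "0 < T" and \<mu>: "0 < \<mu>" "\<mu> < 1"
  obtains C where "0 < C" "\<And>l g h f. 0 < l \<Longrightarrow> f \<in> borel_measurable (lebesgue_on {0<..<T}) \<Longrightarrow>
     (\<integral>\<^sup>+t. ennreal ((wave_coeff s \<gamma> l g h f t)\<^sup>2) \<partial>lebesgue_on {0<..<T})
       \<le> ennreal C * (ennreal (g\<^sup>2) + ennreal (l powr (- s) * h\<^sup>2)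
          + ennreal (l powr (2 * \<mu> * s - 2 * s)) * (\<integral>\<^sup>+t. ennreal ((f t)\<^sup>2) \<partial>lebesgue_on {0<..<T}))"
proof -
  obtain M1 where M1: "0 < M1" "\<And>x. 0 \<le> x \<Longrightarrow> \<bar>mittag_leffler \<gamma> 1 (- x)\<bar> \<le> M1"
    using mittag_leffler_bound[of \<gamma> 1] \<gamma> by auto
  obtain M2 where M2: "0 < M2" "\<And>x p. 0 < x \<Longrightarrow> 0 \<le> p \<Longrightarrow> p \<le> 1 \<Longrightarrow> \<bar>mittag_leffler \<gamma> 2 (- x)\<bar> \<le> M2 * x powr (- p)"
    using mittag_leffler_bound[of \<gamma> 2] \<gamma> by auto
  obtain M3 where M3: "0 < M3" "\<And>x p. 0 < x \<Longrightarrow> 0 \<le> p \<Longrightarrow> p \<le> 1 \<Longrightarrow> \<bar>mittag_leffler \<gamma> \<gamma> (- x)\<bar> \<le> M3 * x powr (- p)"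
    using mittag_leffler_bound[of \<gamma> \<gamma>] \<gamma> by auto
  define q where "q = \<gamma> * \<mu>"
  have q: "0 < q" using \<gamma> \<mu> by (simp add: q_def)
  define N where "N = M3 * (T powr q / q)"
  have N: "0 < N" using M3 q \<open>0 < T\<close> by (simp add: N_def)
  define A1 where "A1 = 3 * M1\<^sup>2 * T"
  define A2 where "A2 = 3 * M2\<^sup>2 * T powr (2 - \<gamma>) * T"
  define A3 where "A3 = 3 * N\<^sup>2"
  define C where "C = A1 + A2 + A3"
  have A: "0 \<le> A1" "0 \<le> A2" "0 < A3" using \<open>0 < T\<close> N by (auto simp: A1_def A2_def A3_def)
  have S: "{0<..<T} \<in> sets borel" by simp
  have main: "(\<integral>\<^sup>+t. ennreal ((wave_coeff s \<gamma> l g h f t)\<^sup>2) \<partial>lebesgue_on {0<..<T})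
       \<le> ennreal C * (ennreal (g\<^sup>2) + ennreal (l powr (- s) * h\<^sup>2)
          + ennreal (l powr (2 * \<mu> * s - 2 * s)) * (\<integral>\<^sup>+t. ennreal ((f t)\<^sup>2) \<partial>lebesgue_on {0<..<T}))"
    if l: "0 < l" and f: "f \<in> borel_measurable (lebesgue_on {0<..<T})" for l g h f
  proof -
    obtain fb where fb[measurable]: "fb \<in> borel_measurable borel"
      and eq: "AE r in lborel. r \<in> {0<..<T} \<longrightarrow> f r = fb r"
      and fb0: "\<And>r. r \<notin> {0<..<T} \<Longrightarrow> fb r = 0"
      using borel_version[OF f S] by blast
    have fint: "(\<integral>\<^sup>+t. ennreal ((f t)\<^sup>2) \<partial>lebesgue_on {0<..<T}) = (\<integral>\<^sup>+t. ennreal ((fb t)\<^sup>2) \<partial>lborel)"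
      unfolding nn_integral_lebesgue_on[OF S]
      by (intro nn_integral_cong_AE) (use eq fb0 in \<open>auto elim!: eventually_mono simp: indicator_def\<close>)
    define L where "L = l powr (- s * (1 - \<mu>))"
    have L: "0 < L" using l by (simp add: L_def)
    have L2: "L\<^sup>2 = l powr (2 * \<mu> * s - 2 * s)"
      unfolding L_def using l by (simp add: power2_eq_square algebra_simps flip: powr_add)
    define k where "k r = r powr (\<gamma> - 1) * mittag_leffler \<gamma> \<gamma> (- (l powr s * r powr \<gamma>))" for r
    define K where "K r = M3 * L * (indicator {0<..<T} r * r powr (q - 1))" for r
    have K0: "0 \<le> K r" for r using M3 L by (simp add: K_def)
    have [measurable]: "K \<in> borel_measurable borel" unfolding K_def[abs_def] by measurable
    \<comment> \<open>With \<open>p = 1 - \<mu>\<close> the power of \<open>r\<close> is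
      \<open>\<gamma> - 1 - \<gamma> * (1 - \<mu>) = q - 1\<close>, which is integrable at 0 because
      \<open>q > 0\<close>.\<close>
    have kK: "\<bar>k r\<bar> \<le> K r" if "0 < r" "r < T" for r
    proof -
      have "\<bar>k r\<bar> \<le> r powr (\<gamma> - 1) * (M3 * (l powr s * r powr \<gamma>) powr (- (1 - \<mu>)))"
        unfolding k_def abs_mult using that l \<mu> by (intro mult_mono M3) auto
      also have "(l powr s * r powr \<gamma>) powr (- (1 - \<mu>)) = L * r powr (- \<gamma> * (1 - \<mu>))"
        using l that by (simp add: powr_mult powr_powr L_def algebra_simps)
      also have "r powr (\<gamma> - 1) * (M3 * (L * r powr (- \<gamma> * (1 - \<mu>)))) = M3 * L * (r powr (\<gamma> - 1) * r powr (- \<gamma> * (1 - \<mu>)))"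
        by simp
      also have "r powr (\<gamma> - 1) * r powr (- \<gamma> * (1 - \<mu>)) = r powr (q - 1)"
        by (simp add: q_def algebra_simps flip: powr_add)
      finally show ?thesis using that by (simp add: K_def)
    qed
    have Kint: "(\<integral>\<^sup>+r. ennreal (K r) \<partial>lborel) = ennreal (N * L)"
    proof -
      have "(\<integral>\<^sup>+r. ennreal (K r) \<partial>lborel) =
          (\<integral>\<^sup>+r. ennreal (M3 * L) * ennreal (indicator {0<..<T} r * r powr (q - 1)) \<partial>lborel)"
        unfolding K_def using M3 L by (simp add: ennreal_mult)
      also have "\<dots> = ennreal (M3 * L) * (\<integral>\<^sup>+r. ennreal (indicator {0<..<T} r * r powr (q - 1)) \<partial>lborel)"
        by (rule nn_integral_cmult) measurable
      also have "\<dots> = ennreal (M3 * L) * ennreal (T powr q / q)"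
        using q \<open>0 < T\<close> by (subst nn_integral_powr_from_0) auto
      also have "\<dots> = ennreal (N * L)" using M3 L q by (simp add: N_def mult_ac flip: ennreal_mult)
      finally show ?thesis .
    qed
    define I where "I t = (LINT r:{0..t}|lebesgue.
          (t - r) powr (\<gamma> - 1) * mittag_leffler \<gamma> \<gamma> (- (l powr s * (t - r) powr \<gamma>)) * f r)" for t
    define J where "J t = (\<integral>\<^sup>+r. ennreal (K (t - r) * \<bar>fb r\<bar>) \<partial>lborel)" for t
    have IJ: "ennreal ((I t)\<^sup>2) \<le> (J t)\<^sup>2" if t: "0 < t" "t < T" for t
    proof -
      have "I t = (\<integral>r. indicator {0<..<t} r * (k (t - r) * fb r) \<partial>lborel)"
        unfolding I_def k_def by (rule wave_coeff_borel[OF \<open>0 < T\<close> fb f eq t])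
      then have "ennreal \<bar>I t\<bar> \<le> (\<integral>\<^sup>+r. ennreal \<bar>indicator {0<..<t} r * (k (t - r) * fb r)\<bar> \<partial>lborel)"
        using ennreal_abs_integral_le by simp
      also have "\<dots> \<le> J t"
        unfolding J_def
      proof (intro nn_integral_mono ennreal_leI)
        fix r
        show "\<bar>indicator {0<..<t} r * (k (t - r) * fb r)\<bar> \<le> K (t - r) * \<bar>fb r\<bar>"
          using kK[of "t - r"] K0[of "t - r"] t by (auto simp: indicator_def abs_mult intro!: mult_right_mono)
      qed
      finally have "(ennreal \<bar>I t\<bar>)\<^sup>2 \<le> (J t)\<^sup>2" by (intro power_mono) auto
      then show ?thesis by (simp add: ennreal_power)
    qed
    have pt: "(wave_coeff s \<gamma> l g h f t)\<^sup>2 \<le> 3 * M1\<^sup>2 * g\<^sup>2 + 3 * M2\<^sup>2 * T powr (2 - \<gamma>) * (l powr (- s) * h\<^sup>2) + 3 * (I t)\<^sup>2"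
      if t: "0 < t" "t < T" for t
    proof -
      let ?a = "mittag_leffler \<gamma> 1 (- (l powr s * t powr \<gamma>)) * g"
      let ?b = "t * mittag_leffler \<gamma> 2 (- (l powr s * t powr \<gamma>)) * h"
      have "wave_coeff s \<gamma> l g h f t = ?a + ?b + I t" by (simp add: wave_coeff_def I_def)
      moreover have "(?a + ?b + I t)\<^sup>2 \<le> 3 * ?a\<^sup>2 + 3 * ?b\<^sup>2 + 3 * (I t)\<^sup>2"
        by (rule square_sum3_le)
      moreover have "?a\<^sup>2 \<le> M1\<^sup>2 * g\<^sup>2"
      proof -
        have "\<bar>mittag_leffler \<gamma> 1 (- (l powr s * t powr \<gamma>))\<bar>\<^sup>2 \<le> M1\<^sup>2" by (intro power_mono M1) auto
        then show ?thesis by (simp add: power_mult_distrib mult_right_mono)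
      qed
      moreover have "?b\<^sup>2 \<le> M2\<^sup>2 * T powr (2 - \<gamma>) * (l powr (- s) * h\<^sup>2)"
      proof -
        have pos: "0 < l powr s * t powr \<gamma>" using l t by simp
        \<comment> \<open>Squared, the choice \<open>p = 1 / 2\<close> gives
          \<open>t powr (- \<gamma>)\<close>, and \<open>t\<^sup>2 * t powr (- \<gamma>)\<close>
          stays bounded on \<open>(0, T)\<close> as \<open>\<gamma> < 2\<close>.\<close>
        have "\<bar>mittag_leffler \<gamma> 2 (- (l powr s * t powr \<gamma>))\<bar>\<^sup>2 \<le> (M2 * (l powr s * t powr \<gamma>) powr (- (1/2)))\<^sup>2"
          using M2(2)[OF pos, of "1/2"] by (intro power_mono) auto
        also have "\<dots> = M2\<^sup>2 * (l powr (- s) * t powr (- \<gamma>))"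
        proof -
          have "((l powr s * t powr \<gamma>) powr (- (1/2)))\<^sup>2 = (l powr s * t powr \<gamma>) powr (- 1)"
            by (simp add: power2_eq_square flip: powr_add)
          also have "\<dots> = l powr (- s) * t powr (- \<gamma>)"
            using pos by (simp add: powr_minus)
          finally show ?thesis by (simp only: power_mult_distrib)
        qed
        finally have "t\<^sup>2 * \<bar>mittag_leffler \<gamma> 2 (- (l powr s * t powr \<gamma>))\<bar>\<^sup>2 \<le> t\<^sup>2 * (M2\<^sup>2 * (l powr (- s) * t powr (- \<gamma>)))"
          by (rule mult_left_mono) simp
        also have "\<dots> = M2\<^sup>2 * l powr (- s) * t powr (2 - \<gamma>)"
          using t by (simp add: powr_diff powr_minus field_simps)
        also have "\<dots> \<le> M2\<^sup>2 * l powr (- s) * T powr (2 - \<gamma>)"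
          using t \<gamma> by (intro mult_left_mono powr_mono2) auto
        finally have "t\<^sup>2 * \<bar>mittag_leffler \<gamma> 2 (- (l powr s * t powr \<gamma>))\<bar>\<^sup>2 * h\<^sup>2 \<le> M2\<^sup>2 * l powr (- s) * T powr (2 - \<gamma>) * h\<^sup>2"
          by (rule mult_right_mono) simp
        then show ?thesis by (simp add: power_mult_distrib mult_ac)
      qed
      ultimately show ?thesis by simp
    qed
    define B where "B = 3 * M1\<^sup>2 * g\<^sup>2 + 3 * M2\<^sup>2 * T powr (2 - \<gamma>) * (l powr (- s) * h\<^sup>2)"
    have B: "0 \<le> B" using \<open>0 < T\<close> by (auto simp: B_def)
    have [measurable]: "J \<in> borel_measurable borel" unfolding J_def[abs_def] by measurable
    have "(\<integral>\<^sup>+t. ennreal ((wave_coeff s \<gamma> l g h f t)\<^sup>2) \<partial>lebesgue_on {0<..<T})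
        \<le> (\<integral>\<^sup>+t. ennreal B * indicator {0<..<T} t + 3 * (J t)\<^sup>2 \<partial>lborel)"
      unfolding nn_integral_lebesgue_on[OF S]
    proof (intro nn_integral_mono)
      fix t
      show "ennreal ((wave_coeff s \<gamma> l g h f t)\<^sup>2) * indicator {0<..<T} t \<le> ennreal B * indicator {0<..<T} t + 3 * (J t)\<^sup>2"
      proof (cases "t \<in> {0<..<T}")
        case True
        then have "ennreal ((wave_coeff s \<gamma> l g h f t)\<^sup>2) \<le> ennreal (B + 3 * (I t)\<^sup>2)"
          using pt[of t] by (intro ennreal_leI) (simp add: B_def)
        also have "\<dots> = ennreal B + 3 * ennreal ((I t)\<^sup>2)"
          using B by (simp add: ennreal_mult)
        also have "\<dots> \<le> ennreal B + 3 * (J t)\<^sup>2"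
          using IJ[of t] True by (intro add_left_mono mult_left_mono) auto
        finally show ?thesis using True by simp
      qed simp
    qed
    also have "\<dots> = ennreal B * ennreal T + 3 * (\<integral>\<^sup>+t. (J t)\<^sup>2 \<partial>lborel)"
      using \<open>0 < T\<close> by (subst nn_integral_add) (auto simp: nn_integral_cmult)
    also have "\<dots> \<le> ennreal B * ennreal T + 3 * ((ennreal (N * L))\<^sup>2 * (\<integral>\<^sup>+t. ennreal ((fb t)\<^sup>2) \<partial>lborel))"
      unfolding J_def Kint[symmetric]
      by (intro add_left_mono mult_left_mono young_convolution_L2) (use K0 in auto)
    also have "ennreal B * ennreal T + 3 * ((ennreal (N * L))\<^sup>2 * (\<integral>\<^sup>+t. ennreal ((fb t)\<^sup>2) \<partial>lborel))
        = ennreal A1 * ennreal (g\<^sup>2) + ennreal A2 * ennreal (l powr (- s) * h\<^sup>2)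
          + ennreal A3 * (ennreal (L\<^sup>2) * (\<integral>\<^sup>+t. ennreal ((fb t)\<^sup>2) \<partial>lborel))"
    proof -
      have "ennreal B * ennreal T = ennreal (A1 * g\<^sup>2 + A2 * (l powr (- s) * h\<^sup>2))"
        using B \<open>0 < T\<close> by (simp add: B_def A1_def A2_def algebra_simps flip: ennreal_mult)
      also have "\<dots> = ennreal A1 * ennreal (g\<^sup>2) + ennreal A2 * ennreal (l powr (- s) * h\<^sup>2)"
        using A by (simp add: ennreal_mult)
      finally have 1: "ennreal B * ennreal T = ennreal A1 * ennreal (g\<^sup>2) + ennreal A2 * ennreal (l powr (- s) * h\<^sup>2)" .
      have "3 * ((ennreal (N * L))\<^sup>2 * x) = ennreal A3 * (ennreal (L\<^sup>2) * x)" for x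
        using N L by (simp add: A3_def ennreal_mult ennreal_power power_mult_distrib mult.assoc)
      then show ?thesis unfolding 1 by simp
    qed
    also have "\<dots> \<le> ennreal C * ennreal (g\<^sup>2) + ennreal C * ennreal (l powr (- s) * h\<^sup>2)
          + ennreal C * (ennreal (L\<^sup>2) * (\<integral>\<^sup>+t. ennreal ((fb t)\<^sup>2) \<partial>lborel))"
      using A by (intro add_mono mult_right_mono ennreal_leI) (auto simp: C_def)
    finally show ?thesis unfolding fint L2 by (simp add: distrib_left)
  qed
  show ?thesis by (rule that[of C]) (use A main in \<open>auto simp: C_def\<close>)
qed

subsection \<open>Square integrable functions\<close>

text \<open>Extended real values allow estimates before square integrability is known.\<close>

definition sqn :: "'a::euclidean_space set \<Rightarrow> ('a \<Rightarrow> 'b::euclidean_space) \<Rightarrow> ennreal" where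
  "sqn D w = (\<integral>\<^sup>+x. ennreal ((norm (w x))\<^sup>2) \<partial>lebesgue_on D)"

lemma in_L2_iff: "in_L2 D w \<longleftrightarrow> w \<in> borel_measurable (lebesgue_on D) \<and> sqn D w < \<infinity>"
  unfolding in_L2_def sqn_def by (auto simp: integrable_iff_bounded)

lemma in_L2_measurable [measurable_dest]: "in_L2 D w \<Longrightarrow> w \<in> borel_measurable (lebesgue_on D)"
  by (simp add: in_L2_iff)

lemma in_L2_finite: "in_L2 D w \<Longrightarrow> sqn D w < \<infinity>"
  by (simp add: in_L2_iff)

lemma L2_tendsto_iff:
  "L2_tendsto D w v \<longleftrightarrow> (\<forall>N. in_L2 D (w N)) \<and> in_L2 D v \<and> (\<lambda>N. sqn D (\<lambda>x. w N x - v x)) \<longlonglongrightarrow> 0"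
  unfolding L2_tendsto_def sqn_def ..

lemma sqn_cong_AE: "AE x in lebesgue_on D. f x = g x \<Longrightarrow> sqn D f = sqn D g"
  unfolding sqn_def by (intro nn_integral_cong_AE) (auto elim: eventually_mono)

lemma sqn_add_le:
  assumes "f \<in> borel_measurable (lebesgue_on D)" "g \<in> borel_measurable (lebesgue_on D)"
  shows "sqn D (\<lambda>x. f x + g x) \<le> 2 * sqn D f + 2 * sqn D g"
proof -
  have "(norm (a + b))\<^sup>2 \<le> 2 * (norm a)\<^sup>2 + 2 * (norm b)\<^sup>2" for a b :: 'b
  proof -
    have "(norm (a + b))\<^sup>2 \<le> (norm a + norm b)\<^sup>2" by (intro power_mono norm_triangle_ineq) auto
    also have "\<dots> \<le> 2 * (norm a)\<^sup>2 + 2 * (norm b)\<^sup>2"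
      using sum_squares_bound[of "norm a" "norm b"] by (simp add: power2_sum)
    finally show ?thesis .
  qed
  then have "sqn D (\<lambda>x. f x + g x) \<le> (\<integral>\<^sup>+x. ennreal (2 * (norm (f x))\<^sup>2 + 2 * (norm (g x))\<^sup>2) \<partial>lebesgue_on D)"
    unfolding sqn_def by (intro nn_integral_mono ennreal_leI)
  also have "\<dots> = (\<integral>\<^sup>+x. 2 * ennreal ((norm (f x))\<^sup>2) + 2 * ennreal ((norm (g x))\<^sup>2) \<partial>lebesgue_on D)"
    by (simp add: ennreal_mult)
  also have "\<dots> = 2 * sqn D f + 2 * sqn D g"
    using assms unfolding sqn_def by (subst nn_integral_add) (auto simp: nn_integral_cmult)
  finally show ?thesis .
qed

lemma sqn_scaleR:
  assumes "f \<in> borel_measurable (lebesgue_on D)"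
  shows "sqn D (\<lambda>x. c *\<^sub>R f x) = ennreal (c\<^sup>2) * sqn D f"
  using assms unfolding sqn_def
  by (subst nn_integral_cmult[symmetric]) (auto simp: power_mult_distrib ennreal_mult)

lemma sqn_diff_le:
  assumes "f \<in> borel_measurable (lebesgue_on D)" "g \<in> borel_measurable (lebesgue_on D)"
  shows "sqn D (\<lambda>x. f x - g x) \<le> 2 * sqn D f + 2 * sqn D g"
proof -
  have "sqn D (\<lambda>x. - g x) = sqn D g" by (simp add: sqn_def)
  then show ?thesis using sqn_add_le[of f D "\<lambda>x. - g x"] assms by simp
qed

lemma sqn_triangle:
  assumes "f \<in> borel_measurable (lebesgue_on D)" "g \<in> borel_measurable (lebesgue_on D)"
    "h \<in> borel_measurable (lebesgue_on D)"
  shows "sqn D (\<lambda>x. f x - h x) \<le> 2 * sqn D (\<lambda>x. f x - g x) + 2 * sqn D (\<lambda>x. g x - h x)"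
  using sqn_add_le[of "\<lambda>x. f x - g x" D "\<lambda>x. g x - h x"] assms by simp

lemma ennreal_lt_top_lincomb: "(a::ennreal) < \<infinity> \<Longrightarrow> b < \<infinity> \<Longrightarrow> 2 * a + 2 * b < \<infinity>"
  by (simp add: ennreal_mult_less_top)

lemma in_L2_add: "in_L2 D f \<Longrightarrow> in_L2 D g \<Longrightarrow> in_L2 D (\<lambda>x. f x + g x)"
  unfolding in_L2_iff
  by (intro conjI order.strict_trans1[OF sqn_add_le] ennreal_lt_top_lincomb borel_measurable_add) auto

lemma in_L2_diff: "in_L2 D f \<Longrightarrow> in_L2 D g \<Longrightarrow> in_L2 D (\<lambda>x. f x - g x)"
  unfolding in_L2_iff
  by (intro conjI order.strict_trans1[OF sqn_diff_le] ennreal_lt_top_lincomb borel_measurable_diff) auto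

lemma in_L2_scaleR: "in_L2 D f \<Longrightarrow> in_L2 D (\<lambda>x. c *\<^sub>R f x)"
  unfolding in_L2_iff by (auto simp: sqn_scaleR ennreal_mult_less_top)

lemma in_L2_cmult: "in_L2 D f \<Longrightarrow> in_L2 D (\<lambda>x. c * f x :: real)"
  using in_L2_scaleR[of D f c] by simp

lemma in_L2_zero: "in_L2 D (\<lambda>x. 0)"
  by (simp add: in_L2_def)

lemma in_L2_sum: "(\<And>k. k \<in> I \<Longrightarrow> in_L2 D (f k)) \<Longrightarrow> in_L2 D (\<lambda>x. \<Sum>k\<in>I. f k x)"
  by (induction I rule: infinite_finite_induct) (auto intro: in_L2_add in_L2_zero)

lemma in_L2_bounded_mult:
  assumes f: "in_L2 D f" and g: "g \<in> borel_measurable (lebesgue_on D)"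
    and le: "AE x in lebesgue_on D. norm (g x) \<le> K * norm (f x)"
  shows "in_L2 D g" "sqn D g \<le> ennreal (K\<^sup>2) * sqn D f"
proof -
  have "sqn D g \<le> (\<integral>\<^sup>+x. ennreal (K\<^sup>2) * ennreal ((norm (f x))\<^sup>2) \<partial>lebesgue_on D)"
    unfolding sqn_def
  proof (intro nn_integral_mono_AE, use le in eventually_elim)
    case (elim x)
    then have "(norm (g x))\<^sup>2 \<le> (K * norm (f x))\<^sup>2" by (intro power_mono) auto
    then show ?case by (simp add: power_mult_distrib flip: ennreal_mult)
  qed
  also have "\<dots> = ennreal (K\<^sup>2) * sqn D f" using in_L2_measurable[OF f] unfolding sqn_def by (intro nn_integral_cmult) measurable
  finally show 1: "sqn D g \<le> ennreal (K\<^sup>2) * sqn D f" .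
  then show "in_L2 D g" using f g unfolding in_L2_iff
    by (auto simp: ennreal_mult_less_top intro: le_less_trans)
qed

lemma L2_inner_bound:
  assumes f: "in_L2 D f" and g: "in_L2 D g"
  shows "integrable (lebesgue_on D) (\<lambda>x. f x \<bullet> g x)"
    and "ennreal ((\<integral>x. f x \<bullet> g x \<partial>lebesgue_on D)\<^sup>2) \<le> sqn D f * sqn D g"
proof -
  have [measurable]: "f \<in> borel_measurable (lebesgue_on D)" "g \<in> borel_measurable (lebesgue_on D)"
    using f g by measurable
  have *: "(\<integral>\<^sup>+x. ennreal \<bar>f x \<bullet> g x\<bar> \<partial>lebesgue_on D)\<^sup>2 \<le> sqn D f * sqn D g"
  proof -
    have "(\<integral>\<^sup>+x. ennreal \<bar>f x \<bullet> g x\<bar> \<partial>lebesgue_on D) \<le> (\<integral>\<^sup>+x. ennreal (norm (f x)) * ennreal (norm (g x)) \<partial>lebesgue_on D)"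
      by (intro nn_integral_mono) (simp add: Cauchy_Schwarz_ineq2 flip: ennreal_mult)
    then have "(\<integral>\<^sup>+x. ennreal \<bar>f x \<bullet> g x\<bar> \<partial>lebesgue_on D)\<^sup>2 \<le>
        (\<integral>\<^sup>+x. ennreal (norm (f x)) * ennreal (norm (g x)) \<partial>lebesgue_on D)\<^sup>2"
      by (intro power_mono) auto
    also have "\<dots> \<le> (\<integral>\<^sup>+x. (ennreal (norm (f x)))\<^sup>2 \<partial>lebesgue_on D) * (\<integral>\<^sup>+x. (ennreal (norm (g x)))\<^sup>2 \<partial>lebesgue_on D)"
      by (rule Cauchy_Schwarz_nn_integral) measurable
    finally show ?thesis by (simp add: sqn_def ennreal_power)
  qed
  also have "\<dots> < \<infinity>" using in_L2_finite[OF f] in_L2_finite[OF g] by (simp add: ennreal_mult_less_top)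
  finally have fin: "(\<integral>\<^sup>+x. ennreal \<bar>f x \<bullet> g x\<bar> \<partial>lebesgue_on D) < \<infinity>"
    by (auto simp: power2_eq_square ennreal_mult_less_top)
  show "integrable (lebesgue_on D) (\<lambda>x. f x \<bullet> g x)"
    unfolding integrable_iff_bounded using fin by auto
  have "ennreal ((\<integral>x. f x \<bullet> g x \<partial>lebesgue_on D)\<^sup>2) = (ennreal \<bar>\<integral>x. f x \<bullet> g x \<partial>lebesgue_on D\<bar>)\<^sup>2"
    by (simp add: ennreal_power)
  also have "\<dots> \<le> (\<integral>\<^sup>+x. ennreal \<bar>f x \<bullet> g x\<bar> \<partial>lebesgue_on D)\<^sup>2"
    by (intro power_mono ennreal_abs_integral_le) auto
  finally show "ennreal ((\<integral>x. f x \<bullet> g x \<partial>lebesgue_on D)\<^sup>2) \<le> sqn D f * sqn D g" using * by (rule order_trans)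
qed

lemma tendsto_of_ennreal_square:
  fixes a :: "nat \<Rightarrow> real"
  assumes "\<And>n. ennreal ((a n - b)\<^sup>2) \<le> x n" "x \<longlonglongrightarrow> 0"
  shows "a \<longlonglongrightarrow> b"
proof -
  have "(\<lambda>n. ennreal ((a n - b)\<^sup>2)) \<longlonglongrightarrow> 0"
    by (rule tendsto_sandwich[OF _ _ tendsto_const assms(2)]) (use assms in auto)
  then have "(\<lambda>n. (a n - b)\<^sup>2) \<longlonglongrightarrow> 0" by (simp add: ennreal_0[symmetric] del: ennreal_0)
  then have "(\<lambda>n. sqrt ((a n - b)\<^sup>2)) \<longlonglongrightarrow> sqrt 0" by (rule tendsto_real_sqrt)
  then have "(\<lambda>n. a n - b) \<longlonglongrightarrow> 0" by (simp add: tendsto_rabs_zero_iff)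
  then show ?thesis by (simp add: LIM_zero_iff)
qed

lemma L2_tendsto_inner:
  assumes w: "L2_tendsto D w v" and g: "in_L2 D g"
  shows "(\<lambda>N. \<integral>x. w N x \<bullet> g x \<partial>lebesgue_on D) \<longlonglongrightarrow> (\<integral>x. v x \<bullet> g x \<partial>lebesgue_on D)"
proof (rule tendsto_of_ennreal_square)
  fix N
  have L: "in_L2 D (w N)" "in_L2 D v" using w by (auto simp: L2_tendsto_iff)
  have "(\<integral>x. w N x \<bullet> g x \<partial>lebesgue_on D) - (\<integral>x. v x \<bullet> g x \<partial>lebesgue_on D)
      = (\<integral>x. (w N x - v x) \<bullet> g x \<partial>lebesgue_on D)"
    unfolding inner_diff_left using L g by (intro Bochner_Integration.integral_diff[symmetric] L2_inner_bound)
  then show "ennreal (((\<integral>x. w N x \<bullet> g x \<partial>lebesgue_on D) - (\<integral>x. v x \<bullet> g x \<partial>lebesgue_on D))\<^sup>2)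
      \<le> sqn D (\<lambda>x. w N x - v x) * sqn D g"
    using L2_inner_bound(2)[OF in_L2_diff[OF L] g] by simp
next
  have "(\<lambda>N. sqn D g * sqn D (\<lambda>x. w N x - v x)) \<longlonglongrightarrow> sqn D g * 0"
    using w in_L2_finite[OF g] by (intro ennreal_tendsto_cmult) (auto simp: L2_tendsto_iff)
  then show "(\<lambda>N. sqn D (\<lambda>x. w N x - v x) * sqn D g) \<longlonglongrightarrow> 0" by (simp add: mult.commute)
qed

lemma L2_tendsto_mult:
  fixes w :: "nat \<Rightarrow> 'a::euclidean_space \<Rightarrow> real"
  assumes w: "L2_tendsto D w v" and g: "in_L2 D g"
  shows "(\<lambda>N. \<integral>x. w N x * g x \<partial>lebesgue_on D) \<longlonglongrightarrow> (\<integral>x. v x * g x \<partial>lebesgue_on D)"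
  using L2_tendsto_inner[OF w g] by simp

lemma L2_tendsto_component:
  assumes "L2_tendsto D w v" "e \<in> Basis"
  shows "L2_tendsto D (\<lambda>N x. w N x \<bullet> e) (\<lambda>x. v x \<bullet> e)"
proof -
  have L: "in_L2 D (w N)" "in_L2 D v" for N using assms by (auto simp: L2_tendsto_iff)
  have c: "in_L2 D (\<lambda>x. f x \<bullet> e)" "sqn D (\<lambda>x. f x \<bullet> e) \<le> sqn D f" if "in_L2 D f" for f
  proof -
    have "f \<in> borel_measurable (lebesgue_on D)" using that by measurable
    then have "(\<lambda>x. f x \<bullet> e) \<in> borel_measurable (lebesgue_on D)" by measurable
    from in_L2_bounded_mult[OF that this, of 1] assms(2)
    show "in_L2 D (\<lambda>x. f x \<bullet> e)" "sqn D (\<lambda>x. f x \<bullet> e) \<le> sqn D f"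
      by (auto simp: Basis_le_norm)
  qed
  have "(\<lambda>N. sqn D (\<lambda>x. w N x \<bullet> e - v x \<bullet> e)) \<longlonglongrightarrow> 0"
  proof (rule tendsto_sandwich[OF _ _ tendsto_const])
    show "(\<lambda>N. sqn D (\<lambda>x. w N x - v x)) \<longlonglongrightarrow> 0" using assms by (simp add: L2_tendsto_iff)
    show "\<forall>\<^sub>F N in sequentially. sqn D (\<lambda>x. w N x \<bullet> e - v x \<bullet> e) \<le> sqn D (\<lambda>x. w N x - v x)"
      using c(2)[OF in_L2_diff[OF L]] by (simp add: inner_diff_left)
  qed auto
  then show ?thesis using c(1)[OF L(1)] c(1)[OF L(2)] by (simp add: L2_tendsto_iff)
qed

lemma L2_tendsto_unique:
  assumes "L2_tendsto D w v" "L2_tendsto D w v'"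
  shows "AE x in lebesgue_on D. v x = v' x"
proof -
  have L: "in_L2 D (w N)" "in_L2 D v" "in_L2 D v'" for N using assms by (auto simp: L2_tendsto_iff)
  then have m[measurable]: "w N \<in> borel_measurable (lebesgue_on D)" "v \<in> borel_measurable (lebesgue_on D)"
    "v' \<in> borel_measurable (lebesgue_on D)" for N by measurable
  have "(\<lambda>N. 2 * sqn D (\<lambda>x. w N x - v x) + 2 * sqn D (\<lambda>x. w N x - v' x)) \<longlonglongrightarrow> 2 * 0 + 2 * 0"
    using assms by (intro tendsto_add ennreal_tendsto_cmult) (auto simp: L2_tendsto_iff)
  moreover have "sqn D (\<lambda>x. v x - v' x) \<le> 2 * sqn D (\<lambda>x. w N x - v x) + 2 * sqn D (\<lambda>x. w N x - v' x)" for N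
  proof -
    have "sqn D (\<lambda>x. v x - w N x) = sqn D (\<lambda>x. w N x - v x)" by (simp add: sqn_def norm_minus_commute)
    then show ?thesis using sqn_triangle[of v D "w N" v'] by simp
  qed
  ultimately have "sqn D (\<lambda>x. v x - v' x) \<le> 0"
    by (intro LIMSEQ_le_const[of _ "0::ennreal"]) auto
  then have "AE x in lebesgue_on D. ennreal ((norm (v x - v' x))\<^sup>2) = 0"
    unfolding sqn_def by (subst nn_integral_0_iff_AE[symmetric]) (auto simp del: ennreal_eq_0_iff)
  then show ?thesis by eventually_elim simp
qed

lemma sqn_borel:
  assumes "D \<in> sets borel"
  shows "sqn D w = (\<integral>\<^sup>+x. ennreal ((norm (indicator D x *\<^sub>R w x))\<^sup>2) \<partial>lborel)"
  unfolding sqn_def nn_integral_lebesgue_on[OF assms]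
  by (intro nn_integral_cong) (auto simp: indicator_def)

subsection \<open>Parameter-dependent series of a Bessel system\<close>

lemma ennreal_term_le_suminf: "x i \<le> (\<Sum>i. x i)" for x :: "nat \<Rightarrow> ennreal"
  using sum_le_suminf[of x "{i}"] by simp

lemma summable_tail_ennreal:
  fixes x :: "nat \<Rightarrow> ennreal"
  assumes "(\<Sum>k. x k) < \<infinity>" "0 < e"
  shows "\<exists>N. \<forall>n\<ge>N. (\<Sum>k. x (k + n)) < ennreal e"
proof -
  have fin: "x k < \<infinity>" for k
    using assms(1) ennreal_term_le_suminf[of x k] by (rule le_less_trans[rotated])
  define r where "r k = enn2real (x k)" for k
  have x: "x k = ennreal (r k)" for k using fin[of k] by (simp add: r_def)
  have r0: "0 \<le> r k" for k by (simp add: r_def)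
  have "summable r"
    using assms(1) unfolding x by (intro summable_suminf_not_top) (auto simp: r0 less_top)
  then obtain N where N: "\<And>n. N \<le> n \<Longrightarrow> norm (\<Sum>k. r (k + n)) < e"
    using suminf_exist_split[OF assms(2)] by blast
  have "(\<Sum>k. x (k + n)) < ennreal e" if "N \<le> n" for n
  proof -
    have "summable (\<lambda>k. r (k + n))" using \<open>summable r\<close> by (simp add: summable_iff_shift)
    then have "(\<Sum>k. x (k + n)) = ennreal (\<Sum>k. r (k + n))"
      unfolding x by (intro suminf_ennreal2) (auto simp: r0)
    also have "\<dots> < ennreal e" using N[OF that] assms(2) by (intro ennreal_lessI) auto
    finally show ?thesis .
  qed
  then show ?thesis by blast
qed

text \<open>Each single term of the finite sum bounds one step by
  \<open>sqrt K * (1 / 2) ^ i\<close>; the weight \<open>4 ^ i\<close> is what makes the steps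
  geometric.\<close>

lemma convergent_of_square_summable_steps:
  fixes S :: "nat \<Rightarrow> 'b::euclidean_space"
  assumes "(\<Sum>i. ennreal (4 ^ i * (norm (S (Suc i) - S i))\<^sup>2)) < \<infinity>"
  shows "convergent S"
proof -
  define X where "X = (\<Sum>i. ennreal (4 ^ i * (norm (S (Suc i) - S i))\<^sup>2))"
  define K where "K = enn2real X"
  have K: "0 \<le> K" "X = ennreal K" using assms by (simp_all add: K_def X_def)
  have bd: "norm (S (Suc i) - S i) \<le> sqrt K * (1 / 2) ^ i" for i
  proof -
    have "ennreal (4 ^ i * (norm (S (Suc i) - S i))\<^sup>2) \<le> ennreal K"
      unfolding K(2)[symmetric] X_def by (rule ennreal_term_le_suminf)
    then have "4 ^ i * (norm (S (Suc i) - S i))\<^sup>2 \<le> K" using K by simp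
    moreover have "(4::real) ^ i = (2 ^ i)\<^sup>2"
      unfolding power2_eq_square power_mult_distrib[symmetric] by simp
    ultimately have "(2 ^ i * norm (S (Suc i) - S i))\<^sup>2 \<le> K" by (simp add: power_mult_distrib)
    then have "2 ^ i * norm (S (Suc i) - S i) \<le> sqrt K" by (rule real_le_rsqrt)
    then show ?thesis by (simp add: field_simps power_divide)
  qed
  have "summable (\<lambda>i. sqrt K * (1 / 2 :: real) ^ i)" by (intro summable_mult summable_geometric) simp
  then have "summable (\<lambda>i. S (Suc i) - S i)"
    by (rule summable_comparison_test'[where N = 0]) (use bd in simp)
  then have "(\<lambda>n. \<Sum>i<n. S (Suc i) - S i) \<longlonglongrightarrow> (\<Sum>i. S (Suc i) - S i)" by (rule summable_LIMSEQ)
  then have "(\<lambda>n. S n - S 0) \<longlonglongrightarrow> (\<Sum>i. S (Suc i) - S i)" by (simp add: sum_lessThan_telescope)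
  then have "(\<lambda>n. (S n - S 0) + S 0) \<longlonglongrightarrow> (\<Sum>i. S (Suc i) - S i) + S 0" by (intro tendsto_intros)
  then show ?thesis by (auto simp: convergent_def)
qed

text \<open>A Riesz-Fischer theorem with a parameter. Limits taken separately for each
  \<open>p\<close> would leave null sets depending on \<open>p\<close> and no joint measurability;
  instead one subsequence \<open>n i\<close>, chosen from tails integrated over \<open>p\<close>,
  converges almost everywhere, and Fatou's lemma returns the tail bound for all
  \<open>N\<close>.\<close>

lemma bessel_series:
  fixes \<Phi> :: "nat \<Rightarrow> 'a::euclidean_space \<Rightarrow> 'b::euclidean_space"
    and a :: "nat \<Rightarrow> 'p::euclidean_space \<Rightarrow> real"
  assumes \<Phi>: "\<And>k. \<Phi> k \<in> borel_measurable borel" and a: "\<And>k. a k \<in> borel_measurable borel"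
    and bessel: "\<And>m n c. (\<integral>\<^sup>+x. ennreal ((norm (\<Sum>k\<in>{m..<n}. c k *\<^sub>R \<Phi> k x))\<^sup>2) \<partial>lborel)
      \<le> ennreal (B * (\<Sum>k\<in>{m..<n}. (c k)\<^sup>2))"
    and B: "0 \<le> B" and fin: "(\<Sum>k. \<integral>\<^sup>+p. ennreal ((a k p)\<^sup>2) \<partial>lborel) < \<infinity>"
  obtains V where "V \<in> borel_measurable borel"
    "AE p in lborel. \<forall>N. (\<integral>\<^sup>+x. ennreal ((norm (V (x, p) - (\<Sum>k<N. a k p *\<^sub>R \<Phi> k x)))\<^sup>2) \<partial>lborel)
      \<le> ennreal B * (\<Sum>k. ennreal ((a (k + N) p)\<^sup>2))"
proof -
  note [measurable] = \<Phi> a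
  define tail where "tail N p = (\<Sum>k. ennreal ((a (k + N) p)\<^sup>2))" for N p
  have [measurable]: "tail N \<in> borel_measurable borel" for N unfolding tail_def[abs_def] by measurable
  have tail_le: "(\<Sum>k\<in>{N..<n}. ennreal ((a k p)\<^sup>2)) \<le> tail N p" for N n p
  proof -
    have "(\<Sum>k\<in>{N..<n}. ennreal ((a k p)\<^sup>2)) = (\<Sum>k<n - N. ennreal ((a (k + N) p)\<^sup>2))"
      by (rule sum.reindex_bij_witness[of _ "\<lambda>k. k + N" "\<lambda>k. k - N"]) auto
    also have "\<dots> \<le> tail N p" unfolding tail_def by (intro sum_le_suminf) auto
    finally show ?thesis .
  qed
  have bt: "(\<integral>\<^sup>+x. ennreal ((norm (\<Sum>k\<in>{N..<n}. a k p *\<^sub>R \<Phi> k x))\<^sup>2) \<partial>lborel) \<le> ennreal B * tail N p" for N n p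
  proof -
    have "(\<integral>\<^sup>+x. ennreal ((norm (\<Sum>k\<in>{N..<n}. a k p *\<^sub>R \<Phi> k x))\<^sup>2) \<partial>lborel)
        \<le> ennreal (B * (\<Sum>k\<in>{N..<n}. (a k p)\<^sup>2))" by (rule bessel)
    also have "\<dots> = ennreal B * (\<Sum>k\<in>{N..<n}. ennreal ((a k p)\<^sup>2))"
      using B by (simp add: ennreal_mult sum_nonneg)
    also have "\<dots> \<le> ennreal B * tail N p" by (intro mult_left_mono tail_le) auto
    finally show ?thesis .
  qed
  \<comment> \<open>Tails below \<open>(1 / 16) ^ i\<close> leave a summable
    \<open>(1 / 4) ^ i\<close> after multiplication by the weight \<open>4 ^ i\<close> of the
    steps.\<close>
  have "\<exists>N. \<forall>n\<ge>N. (\<Sum>k. \<integral>\<^sup>+p. ennreal ((a (k + n) p)\<^sup>2) \<partial>lborel) < ennreal ((1 / 16) ^ i)" for i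
    using summable_tail_ennreal[OF fin, of "(1 / 16) ^ i"] by simp
  then obtain N0 where N0: "\<And>i n. N0 i \<le> n \<Longrightarrow>
      (\<Sum>k. \<integral>\<^sup>+p. ennreal ((a (k + n) p)\<^sup>2) \<partial>lborel) < ennreal ((1 / 16) ^ i)"
    by metis
  define n where "n i = i + (\<Sum>j\<le>i. N0 j)" for i
  have n_ge: "N0 i \<le> n i" "i \<le> n i" for i
    unfolding n_def using member_le_sum[of i "{..i}" N0] by auto
  have n_mono: "n i \<le> n (Suc i)" for i unfolding n_def by simp
  have tail_int: "(\<integral>\<^sup>+p. tail (n i) p \<partial>lborel) \<le> ennreal ((1 / 16) ^ i)" for i
  proof -
    have "(\<integral>\<^sup>+p. tail (n i) p \<partial>lborel) = (\<Sum>k. \<integral>\<^sup>+p. ennreal ((a (k + n i) p)\<^sup>2) \<partial>lborel)"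
      unfolding tail_def by (rule nn_integral_suminf) measurable
    then show ?thesis using N0[OF n_ge(1)[of i]] by simp
  qed
  define S where "S i x p = (\<Sum>k<n i. a k p *\<^sub>R \<Phi> k x)" for i x p
  have [measurable]: "(\<lambda>(x, p). S i x p) \<in> borel_measurable (borel \<Otimes>\<^sub>M borel)" for i
    unfolding S_def by measurable
  have S_diff: "S j x p - (\<Sum>k<N. a k p *\<^sub>R \<Phi> k x) = (\<Sum>k\<in>{N..<n j}. a k p *\<^sub>R \<Phi> k x)" if "N \<le> n j" for j N x p
  proof -
    have "{..<n j} = {..<N} \<union> {N..<n j}" using that by auto
    then have "S j x p = (\<Sum>k<N. a k p *\<^sub>R \<Phi> k x) + (\<Sum>k\<in>{N..<n j}. a k p *\<^sub>R \<Phi> k x)"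
      unfolding S_def by (simp add: sum.union_disjoint ivl_disj_int)
    then show ?thesis by simp
  qed
  define Q where "Q x p = (\<Sum>i. ennreal (4 ^ i * (norm (S (Suc i) x p - S i x p))\<^sup>2))" for x p
  have [measurable]: "(\<lambda>(x, p). Q x p) \<in> borel_measurable (borel \<Otimes>\<^sub>M borel)"
    unfolding Q_def by measurable
  have Qx: "(\<integral>\<^sup>+x. Q x p \<partial>lborel) \<le> (\<Sum>i. ennreal (4 ^ i * B) * tail (n i) p)" for p
  proof -
    have "(\<integral>\<^sup>+x. Q x p \<partial>lborel) = (\<Sum>i. \<integral>\<^sup>+x. ennreal (4 ^ i * (norm (S (Suc i) x p - S i x p))\<^sup>2) \<partial>lborel)"
      unfolding Q_def by (rule nn_integral_suminf) measurable
    also have "\<dots> \<le> (\<Sum>i. ennreal (4 ^ i * B) * tail (n i) p)"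
    proof (intro suminf_le summableI allI)
      fix i
      have eq: "S (Suc i) x p - S i x p = (\<Sum>k\<in>{n i..<n (Suc i)}. a k p *\<^sub>R \<Phi> k x)" for x
        using S_diff[OF n_mono[of i], of x p] by (simp add: S_def)
      have "(\<integral>\<^sup>+x. ennreal (4 ^ i * (norm (S (Suc i) x p - S i x p))\<^sup>2) \<partial>lborel)
          = ennreal (4 ^ i) * (\<integral>\<^sup>+x. ennreal ((norm (\<Sum>k\<in>{n i..<n (Suc i)}. a k p *\<^sub>R \<Phi> k x))\<^sup>2) \<partial>lborel)"
        unfolding eq by (subst nn_integral_cmult[symmetric]) (auto simp: ennreal_mult)
      also have "\<dots> \<le> ennreal (4 ^ i) * (ennreal B * tail (n i) p)" by (intro mult_left_mono bt) auto
      also have "\<dots> = ennreal (4 ^ i * B) * tail (n i) p" using B by (simp add: ennreal_mult mult.assoc)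
      finally show "(\<integral>\<^sup>+x. ennreal (4 ^ i * (norm (S (Suc i) x p - S i x p))\<^sup>2) \<partial>lborel)
          \<le> ennreal (4 ^ i * B) * tail (n i) p" .
    qed
    finally show ?thesis .
  qed
  have "(\<integral>\<^sup>+p. (\<integral>\<^sup>+x. Q x p \<partial>lborel) \<partial>lborel) \<le> (\<integral>\<^sup>+p. (\<Sum>i. ennreal (4 ^ i * B) * tail (n i) p) \<partial>lborel)"
    by (intro nn_integral_mono Qx)
  also have "\<dots> = (\<Sum>i. ennreal (4 ^ i * B) * (\<integral>\<^sup>+p. tail (n i) p \<partial>lborel))"
    by (subst nn_integral_suminf) (auto simp: nn_integral_cmult)
  also have "\<dots> \<le> (\<Sum>i. ennreal (B * (1 / 4) ^ i))"
  proof (intro suminf_le summableI allI)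
    fix i
    have "ennreal (4 ^ i * B) * (\<integral>\<^sup>+p. tail (n i) p \<partial>lborel) \<le> ennreal (4 ^ i * B) * ennreal ((1 / 16) ^ i)"
      by (intro mult_left_mono tail_int) auto
    also have "\<dots> = ennreal (B * (4 ^ i * (1 / 16) ^ i))" using B by (simp add: mult_ac flip: ennreal_mult)
    also have "(4::real) ^ i * (1 / 16) ^ i = (1 / 4) ^ i" by (simp flip: power_mult_distrib)
    finally show "ennreal (4 ^ i * B) * (\<integral>\<^sup>+p. tail (n i) p \<partial>lborel) \<le> ennreal (B * (1 / 4) ^ i)" .
  qed
  also have "\<dots> = ennreal (\<Sum>i. B * (1 / 4) ^ i)"
    using B by (intro suminf_ennreal2 summable_mult summable_geometric) auto
  also have "\<dots> < \<infinity>" by simp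
  finally have "(\<integral>\<^sup>+p. (\<integral>\<^sup>+x. Q x p \<partial>lborel) \<partial>lborel) \<noteq> \<infinity>" by simp
  then have AEp: "AE p in lborel. (\<integral>\<^sup>+x. Q x p \<partial>lborel) \<noteq> \<infinity>"
    by (intro nn_integral_noteq_infinite) measurable
  \<comment> \<open>\<open>lim\<close> has an unspecified value where the sequence diverges, but it
    is measurable everywhere, and for almost every \<open>p\<close> divergence is confined to a null
    set of \<open>x\<close>.\<close>
  define V where "V = (\<lambda>(x, p). lim (\<lambda>i. S i x p))"
  have [measurable]: "V \<in> borel_measurable (borel \<Otimes>\<^sub>M borel)"
    unfolding V_def by measurable
  have "AE p in lborel. \<forall>N. (\<integral>\<^sup>+x. ennreal ((norm (V (x, p) - (\<Sum>k<N. a k p *\<^sub>R \<Phi> k x)))\<^sup>2) \<partial>lborel)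
      \<le> ennreal B * tail N p"
    using AEp
  proof eventually_elim
    case (elim p)
    have "AE x in lborel. Q x p \<noteq> \<infinity>"
      by (rule nn_integral_noteq_infinite) (use elim in auto)
    then have lim: "AE x in lborel. (\<lambda>i. S i x p) \<longlonglongrightarrow> V (x, p)"
    proof eventually_elim
      case (elim x)
      then have "convergent (\<lambda>i. S i x p)"
        unfolding Q_def by (intro convergent_of_square_summable_steps) (simp add: less_top)
      then show ?case unfolding V_def by (simp add: convergent_LIMSEQ_iff)
    qed
    show ?case
    proof
      fix N
      have "(\<integral>\<^sup>+x. ennreal ((norm (V (x, p) - (\<Sum>k<N. a k p *\<^sub>R \<Phi> k x)))\<^sup>2) \<partial>lborel)
          = (\<integral>\<^sup>+x. liminf (\<lambda>i. ennreal ((norm (S i x p - (\<Sum>k<N. a k p *\<^sub>R \<Phi> k x)))\<^sup>2)) \<partial>lborel)"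
      proof (intro nn_integral_cong_AE, use lim in eventually_elim)
        case (elim x)
        have "(\<lambda>i. ennreal ((norm (S i x p - (\<Sum>k<N. a k p *\<^sub>R \<Phi> k x)))\<^sup>2)) \<longlonglongrightarrow>
            ennreal ((norm (V (x, p) - (\<Sum>k<N. a k p *\<^sub>R \<Phi> k x)))\<^sup>2)"
          by (intro tendsto_intros elim)
        then show ?case by (rule lim_imp_Liminf[OF sequentially_bot, symmetric])
      qed
      also have "\<dots> \<le> liminf (\<lambda>i. \<integral>\<^sup>+x. ennreal ((norm (S i x p - (\<Sum>k<N. a k p *\<^sub>R \<Phi> k x)))\<^sup>2) \<partial>lborel)"
        by (rule nn_integral_liminf) measurable
      also have "\<dots> \<le> ennreal B * tail N p"
      proof (rule Liminf_le)
        show "\<forall>\<^sub>F i in sequentially. (\<integral>\<^sup>+x. ennreal ((norm (S i x p - (\<Sum>k<N. a k p *\<^sub>R \<Phi> k x)))\<^sup>2) \<partial>lborel)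
            \<le> ennreal B * tail N p"
          using eventually_ge_at_top[of N]
        proof eventually_elim
          case (elim i)
          then have "N \<le> n i" using n_ge(2)[of i] by simp
          then show ?case unfolding S_diff[OF \<open>N \<le> n i\<close>] by (intro bt)
        qed
      qed simp
      finally show "(\<integral>\<^sup>+x. ennreal ((norm (V (x, p) - (\<Sum>k<N. a k p *\<^sub>R \<Phi> k x)))\<^sup>2) \<partial>lborel)
          \<le> ennreal B * tail N p" .
    qed
  qed
  moreover have "V \<in> borel_measurable borel" by (simp flip: borel_prod)
  ultimately show ?thesis using that[of V] unfolding tail_def by blast
qed

subsection \<open>Test functions\<close>

lemma Ck_Suc_imp: "Ck (Suc k) f \<Longrightarrow> Ck k f"
proof (induction k arbitrary: f)
  case 0
  then obtain G where "\<And>x. GDERIV f x :> G x" by auto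
  then have "isCont f x" for x unfolding gderiv_def using has_derivative_continuous by blast
  then show ?case by (simp add: continuous_at_imp_continuous_on)
next
  case (Suc k)
  then obtain G where G: "\<And>x. GDERIV f x :> G x" "\<And>e. e \<in> Basis \<Longrightarrow> Ck (Suc k) (\<lambda>x. G x \<bullet> e)"
    unfolding Ck.simps(2)[of "Suc k"] by blast
  then have "\<forall>e\<in>Basis. Ck k (\<lambda>x. G x \<bullet> e)" using Suc.IH by blast
  then show ?case unfolding Ck.simps(2)[of k] using G(1) by blast
qed

lemma Ck_SucI:
  "(\<And>x. GDERIV f x :> G x) \<Longrightarrow> (\<And>e. e \<in> Basis \<Longrightarrow> Ck k (\<lambda>x. G x \<bullet> e)) \<Longrightarrow> Ck (Suc k) f"
  unfolding Ck.simps(2) by blast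

lemma Ck_add: "Ck k f \<Longrightarrow> Ck k g \<Longrightarrow> Ck k (\<lambda>x. f x + g x)"
proof (induction k arbitrary: f g)
  case 0
  then show ?case by (auto intro: continuous_intros)
next
  case (Suc k)
  from Suc.prems obtain F G where FG: "\<And>x. GDERIV f x :> F x" "\<And>e. e \<in> Basis \<Longrightarrow> Ck k (\<lambda>x. F x \<bullet> e)"
    "\<And>x. GDERIV g x :> G x" "\<And>e. e \<in> Basis \<Longrightarrow> Ck k (\<lambda>x. G x \<bullet> e)"
    unfolding Ck.simps by blast
  have "GDERIV (\<lambda>x. f x + g x) x :> F x + G x" for x using FG by (intro GDERIV_add)
  moreover have "Ck k (\<lambda>x. (F x + G x) \<bullet> e)" if "e \<in> Basis" for e
    using Suc.IH FG that by (simp add: inner_add_left)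
  ultimately show ?case by (rule Ck_SucI)
qed

lemma Ck_mult: "Ck k f \<Longrightarrow> Ck k g \<Longrightarrow> Ck k (\<lambda>x. f x * g x)"
proof (induction k arbitrary: f g)
  case 0
  then show ?case by (auto intro: continuous_intros)
next
  case (Suc k)
  from Suc.prems obtain F G where FG: "\<And>x. GDERIV f x :> F x" "\<And>e. e \<in> Basis \<Longrightarrow> Ck k (\<lambda>x. F x \<bullet> e)"
    "\<And>x. GDERIV g x :> G x" "\<And>e. e \<in> Basis \<Longrightarrow> Ck k (\<lambda>x. G x \<bullet> e)"
    unfolding Ck.simps by blast
  have fg: "Ck k f" "Ck k g" using Suc.prems Ck_Suc_imp by auto
  have "GDERIV (\<lambda>x. f x * g x) x :> f x *\<^sub>R G x + g x *\<^sub>R F x" for x using FG by (intro GDERIV_mult)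
  moreover have "Ck k (\<lambda>x. (f x *\<^sub>R G x + g x *\<^sub>R F x) \<bullet> e)" if "e \<in> Basis" for e
  proof -
    have "Ck k (\<lambda>x. f x * (G x \<bullet> e) + g x * (F x \<bullet> e))"
      using FG that fg by (intro Ck_add Suc.IH) auto
    then show ?thesis by (simp add: inner_add_left)
  qed
  ultimately show ?case by (rule Ck_SucI)
qed

lemma Ck_const: "Ck k (\<lambda>x. c)"
proof (induction k arbitrary: c)
  case (Suc k)
  have "GDERIV (\<lambda>x. c) x :> 0" for x :: 'a by (rule GDERIV_const)
  then show ?case using Suc by (auto intro!: exI[of _ "\<lambda>x. 0"])
qed simp

lemma Ck_prod: "(\<And>i. i \<in> I \<Longrightarrow> Ck k (f i)) \<Longrightarrow> Ck k (\<lambda>x. \<Prod>i\<in>I. f i x)"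
  by (induction I rule: infinite_finite_induct) (auto intro: Ck_mult Ck_const)

text \<open>Each component of the gradient is again of this form, with \<open>i + 1\<close> in place
  of \<open>i\<close> and a new factor; both are therefore left free in the induction.\<close>

lemma Ck_compose_affine:
  fixes d :: "nat \<Rightarrow> real \<Rightarrow> real"
  assumes d: "\<And>i x. (d i has_real_derivative d (Suc i) x) (at x)"
  shows "Ck k (\<lambda>x. m * d i (c * (x \<bullet> b) + e))"
proof (induction k arbitrary: i m)
  case 0
  have "continuous_on UNIV (d i)"
    using d by (meson DERIV_isCont continuous_at_imp_continuous_on)
  then have "continuous_on UNIV (\<lambda>x. d i (c * (x \<bullet> b) + e))"
    by (rule continuous_on_compose2) (auto intro!: continuous_intros)
  then show ?case by (auto intro!: continuous_intros)
next
  case (Suc k)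
  have "GDERIV (\<lambda>x. m * d i (c * (x \<bullet> b) + e)) x :> (m * d (Suc i) (c * (x \<bullet> b) + e) * c) *\<^sub>R b" for x
  proof -
    have "((\<lambda>x. c * (x \<bullet> b) + e) has_derivative (\<lambda>h. c * (h \<bullet> b))) (at x)"
      by (auto intro!: derivative_eq_intros)
    moreover have "((\<lambda>z. m * d i z) has_derivative (\<lambda>h. h * (m * d (Suc i) (c * (x \<bullet> b) + e)))) (at (c * (x \<bullet> b) + e))"
      using DERIV_cmult[OF d, of m i "c * (x \<bullet> b) + e"] by (simp add: has_field_derivative_def mult_commute_abs)
    ultimately have "((\<lambda>x. m * d i (c * (x \<bullet> b) + e)) has_derivative
        (\<lambda>h. (c * (h \<bullet> b)) * (m * d (Suc i) (c * (x \<bullet> b) + e)))) (at x)"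
      using has_derivative_compose by blast
    then show ?thesis unfolding gderiv_def by (simp add: mult_ac)
  qed
  moreover have "Ck k (\<lambda>x. ((m * d (Suc i) (c * (x \<bullet> b) + e) * c) *\<^sub>R b) \<bullet> e')" for e'
    using Suc[of "m * c * (b \<bullet> e')" "Suc i"] by (simp add: mult_ac)
  ultimately show ?case by (rule Ck_SucI)
qed

lemma grad_eq: "GDERIV \<eta> x :> D \<Longrightarrow> grad \<eta> x = D"
  unfolding grad_def
proof (rule the_equality)
  fix E assume "GDERIV \<eta> x :> D" "GDERIV \<eta> x :> E"
  then have "(\<lambda>h. h \<bullet> E) = (\<lambda>h. h \<bullet> D)"
    unfolding gderiv_def by (rule has_derivative_unique[rotated])
  then show "E = D" by (simp add: fun_eq_iff vector_eq_ldot)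
qed

lemma test_function_grad:
  fixes \<eta> :: "'a::euclidean_space \<Rightarrow> real"
  assumes "test_function D \<eta>"
  shows "GDERIV \<eta> x :> grad \<eta> x" "continuous_on UNIV (grad \<eta>)" "continuous_on UNIV \<eta>"
    "x \<notin> closure {x. \<eta> x \<noteq> 0} \<Longrightarrow> grad \<eta> x = 0" "x \<notin> closure {x. \<eta> x \<noteq> 0} \<Longrightarrow> \<eta> x = 0"
proof -
  have "Ck (Suc 0) \<eta>" using assms unfolding test_function_def by blast
  then obtain G where G: "\<And>x. GDERIV \<eta> x :> G x" "\<And>e. e \<in> Basis \<Longrightarrow> continuous_on UNIV (\<lambda>x. G x \<bullet> e)"
    by auto
  then have "grad \<eta> = G" using grad_eq by blast
  then show gd: "GDERIV \<eta> x :> grad \<eta> x" and "continuous_on UNIV (grad \<eta>)"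
    using G by (auto simp: continuous_on_componentwise[of UNIV G])
  have "Ck 0 \<eta>" using assms unfolding test_function_def by blast
  then show "continuous_on UNIV \<eta>" by simp
  show \<eta>0: "\<eta> x = 0" if "x \<notin> closure {x. \<eta> x \<noteq> 0}" for x
    using that closure_subset[of "{x. \<eta> x \<noteq> 0}"] by auto
  show "grad \<eta> x = 0" if x: "x \<notin> closure {x. \<eta> x \<noteq> 0}"
  proof -
    have "((\<lambda>x. 0) has_derivative (\<lambda>h. h \<bullet> (0::'a))) (at x)" by simp
    then have "(\<eta> has_derivative (\<lambda>h. h \<bullet> 0)) (at x)"
    proof (rule has_derivative_transform_within_open[of _ _ _ _ "- closure {x. \<eta> x \<noteq> 0}"])
      show "open (- closure {x. \<eta> x \<noteq> 0})" by (intro open_Compl closed_closure)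
      show "x \<in> - closure {x. \<eta> x \<noteq> 0}" using x by simp
      fix y assume "y \<in> - closure {x. \<eta> x \<noteq> 0}"
      then show "0 = \<eta> y" using \<eta>0[of y] by (metis ComplD)
    qed
    then show ?thesis by (intro grad_eq) (simp add: gderiv_def)
  qed
qed

subsection \<open>A smooth bump\<close>

text \<open>With \<open>u = 1 / x\<close> one has \<open>du / dx = - u^2\<close>, so the derivative
  of \<open>p(u) * exp (- u)\<close> is \<open>u^2 * (p - p')(u) * exp (- u)\<close>; hence
  \<open>bump i\<close> is the \<open>i\<close>-th derivative of the smooth function that is
  \<open>exp (- 1 / x)\<close> for positive \<open>x\<close> and 0 elsewhere.\<close>

fun bump_poly :: "nat \<Rightarrow> real poly" where
  "bump_poly 0 = 1"
| "bump_poly (Suc i) = [:0, 0, 1:] * (bump_poly i - pderiv (bump_poly i))"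

definition bump :: "nat \<Rightarrow> real \<Rightarrow> real" where
  "bump i x = (if 0 < x then poly (bump_poly i) (1 / x) * exp (- 1 / x) else 0)"

lemma poly_times_exp_tendsto_0:
  fixes p :: "real poly"
  shows "((\<lambda>u. u ^ k * poly p u * exp (- u)) \<longlongrightarrow> 0) at_top"
proof (induction p arbitrary: k)
  case (pCons a p)
  have "((\<lambda>u. a * (u ^ k / exp u) + u ^ Suc k * poly p u * exp (- u)) \<longlongrightarrow> a * 0 + 0) at_top"
    by (intro tendsto_intros tendsto_power_div_exp_0 pCons)
  then show ?case by (simp add: algebra_simps exp_minus divide_inverse)
qed simp

text \<open>At 0 the right difference quotient is a polynomial in \<open>1 / h\<close> times
  \<open>exp (- 1 / h)\<close>, which tends to 0; the left one is 0.\<close>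

lemma bump_DERIV: "(bump i has_real_derivative bump (Suc i) x) (at x)"
proof -
  consider "0 < x" | "x < 0" | "x = 0" by linarith
  then show ?thesis
  proof cases
    case 1
    have "((\<lambda>x. poly (bump_poly i) (1 / x) * exp (- 1 / x)) has_real_derivative bump (Suc i) x) (at x)"
      using 1 by (auto intro!: derivative_eq_intros DERIV_chain2[OF poly_DERIV] simp: bump_def field_simps power2_eq_square)
    then show ?thesis
      by (rule has_field_derivative_transform_within_open[of _ _ _ "{0<..}"]) (use 1 in \<open>auto simp: bump_def\<close>)
  next
    case 2
    have "((\<lambda>x. 0) has_real_derivative bump (Suc i) x) (at x)" using 2 by (simp add: bump_def)
    then show ?thesis
      by (rule has_field_derivative_transform_within_open[of _ _ _ "{..<0}"]) (use 2 in \<open>auto simp: bump_def\<close>)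
  next
    case 3
    have "((\<lambda>h. bump i h / h) \<longlongrightarrow> 0) (at_right 0)"
    proof -
      have "((\<lambda>h. (inverse h) ^ 1 * poly (bump_poly i) (inverse h) * exp (- inverse h)) \<longlongrightarrow> 0) (at_right (0::real))"
        by (rule filterlim_compose[OF poly_times_exp_tendsto_0 filterlim_inverse_at_top_right])
      then show ?thesis
        by (rule Lim_transform_eventually)
          (auto simp: bump_def divide_inverse eventually_at_filter)
    qed
    moreover have "((\<lambda>h. bump i h / h) \<longlongrightarrow> 0) (at_left 0)"
      by (rule Lim_transform_eventually[OF tendsto_const]) (auto simp: bump_def eventually_at_filter)
    ultimately have "((\<lambda>h. bump i h / h) \<longlongrightarrow> 0) (at 0)" by (simp add: filterlim_at_split)
    then show ?thesis using 3 by (simp add: DERIV_def bump_def)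
  qed
qed

text \<open>The factor \<open>Suc n\<close> sharpens the profile: inside the box the arguments of
  \<open>bump 0\<close> tend to infinity and its values to 1, while the positivity set is the open
  box for every \<open>n\<close>.\<close>

definition box_bump :: "'a::euclidean_space \<Rightarrow> 'a \<Rightarrow> nat \<Rightarrow> 'a \<Rightarrow> real" where
  "box_bump a b n x = (\<Prod>i\<in>Basis. bump 0 (real (Suc n) * (x \<bullet> i - a \<bullet> i)) * bump 0 (real (Suc n) * (b \<bullet> i - x \<bullet> i)))"

lemma bump0: "bump 0 x = (if 0 < x then exp (- 1 / x) else 0)"
  by (simp add: bump_def)

lemma box_bump_bounds: "0 \<le> box_bump a b n x" "box_bump a b n x \<le> 1"
proof -
  have b: "0 \<le> bump 0 y" "bump 0 y \<le> 1" for y by (auto simp: bump0)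
  show "0 \<le> box_bump a b n x" unfolding box_bump_def using b by (intro prod_nonneg) auto
  show "box_bump a b n x \<le> 1" unfolding box_bump_def using b by (intro prod_le_1) (auto intro: mult_le_one)
qed

lemma box_bump_eq_0_iff: "box_bump a b n x \<noteq> 0 \<longleftrightarrow> x \<in> box a b"
proof -
  have "bump 0 (real (Suc n) * y) = 0 \<longleftrightarrow> \<not> 0 < y" for y
    by (simp add: bump0 zero_less_mult_iff)
  then show ?thesis by (auto simp: box_bump_def mem_box simp del: of_nat_Suc)
qed

lemma box_bump_tendsto: "(\<lambda>n. box_bump a b n x) \<longlonglongrightarrow> indicator (box a b) x"
proof (cases "x \<in> box a b")
  case True
  have lim: "(\<lambda>n. bump 0 (real (Suc n) * y)) \<longlonglongrightarrow> 1" if "0 < y" for y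
  proof -
    have "(\<lambda>n. exp (- 1 / (real (Suc n) * y))) \<longlonglongrightarrow> 1" using that by real_asymp
    then show ?thesis using that by (simp add: bump0)
  qed
  have "(\<lambda>n. box_bump a b n x) \<longlonglongrightarrow> (\<Prod>i\<in>(Basis::'a set). 1 * 1)"
    unfolding box_bump_def using True by (intro tendsto_prod tendsto_mult lim) (auto simp: mem_box)
  then show ?thesis using True by simp
next
  case False
  then have "box_bump a b n x = 0" for n using box_bump_eq_0_iff by blast
  then show ?thesis using False by simp
qed

lemma test_function_box_bump:
  assumes "cbox a b \<subseteq> D"
  shows "test_function D (box_bump a b n)"
proof -
  have sub: "closure {x. box_bump a b n x \<noteq> 0} \<subseteq> cbox a b"
    unfolding box_bump_eq_0_iff by (rule closure_minimal) (auto simp: mem_box less_imp_le)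
  have "Ck k (box_bump a b n)" for k
  proof -
    have 1: "real (Suc n) * (x \<bullet> i - a \<bullet> i) = real (Suc n) * (x \<bullet> i) + (- real (Suc n) * (a \<bullet> i))" for x i
      by (simp add: algebra_simps)
    have 2: "real (Suc n) * (b \<bullet> i - x \<bullet> i) = (- real (Suc n)) * (x \<bullet> i) + real (Suc n) * (b \<bullet> i)" for x i
      by (simp add: algebra_simps)
    have "Ck k (\<lambda>x. (1 * bump 0 (real (Suc n) * (x \<bullet> i) + (- real (Suc n) * (a \<bullet> i)))) *
        (1 * bump 0 ((- real (Suc n)) * (x \<bullet> i) + real (Suc n) * (b \<bullet> i))))" for i
      by (intro Ck_mult Ck_compose_affine[where d = bump] bump_DERIV)
    then have "Ck k (\<lambda>x. bump 0 (real (Suc n) * (x \<bullet> i - a \<bullet> i)) * bump 0 (real (Suc n) * (b \<bullet> i - x \<bullet> i)))" for i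
      unfolding 1 2 by (simp only: mult_1_left)
    then show ?thesis unfolding box_bump_def[abs_def] by (intro Ck_prod)
  qed
  moreover have "compact (closure {x. box_bump a b n x \<noteq> 0})"
    using sub by (meson bounded_cbox bounded_subset closed_closure compact_eq_bounded_closed)
  ultimately show ?thesis using sub assms unfolding test_function_def by blast
qed

subsection \<open>Weak derivatives\<close>

lemma locally_integrable_mult:
  fixes v \<zeta> :: "'a::euclidean_space \<Rightarrow> real"
  assumes v: "locally_integrable D v" and D: "open D" and K: "compact K" "K \<subseteq> D"
    and \<zeta>: "\<zeta> \<in> borel_measurable borel" "\<And>x. \<bar>\<zeta> x\<bar> \<le> B" "\<And>x. x \<notin> K \<Longrightarrow> \<zeta> x = 0"
  shows "integrable (lebesgue_on D) (\<lambda>x. v x * \<zeta> x)"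
    "(\<integral>x. v x * \<zeta> x \<partial>lebesgue_on D) = (\<integral>x. v x * \<zeta> x \<partial>lebesgue_on K)"
proof -
  have Kb: "K \<inter> space lebesgue \<in> sets lebesgue" "D \<inter> space lebesgue \<in> sets lebesgue"
    using K D by (auto simp: borel_compact intro: sets_completionI_sets)
  have vK: "integrable (lebesgue_on K) v" using v K unfolding locally_integrable_def by blast
  have \<zeta>m: "\<zeta> \<in> borel_measurable (lebesgue_on K)" by (rule borel_measurable_lebesgue_on_borel[OF \<zeta>(1)])
  have iK: "integrable (lebesgue_on K) (\<lambda>x. v x * \<zeta> x)"
  proof (rule Bochner_Integration.integrable_bound[of _ "\<lambda>x. B * v x"])
    show "AE x in lebesgue_on K. norm (v x * \<zeta> x) \<le> norm (B * v x)"
    proof (rule AE_I2)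
      fix x
      have "\<bar>\<zeta> x\<bar> \<le> \<bar>B\<bar>" using \<zeta>(2)[of x] by linarith
      then show "norm (v x * \<zeta> x) \<le> norm (B * v x)"
        by (simp add: abs_mult mult.commute mult_right_mono)
    qed
  qed (use vK \<zeta>m in auto)
  have eq: "indicator D x *\<^sub>R (v x * \<zeta> x) = indicator K x *\<^sub>R (v x * \<zeta> x)" for x
    using \<zeta>(3)[of x] K by (auto simp: indicator_def)
  show "integrable (lebesgue_on D) (\<lambda>x. v x * \<zeta> x)"
    using iK integrable_restrict_space[OF Kb(1), of "\<lambda>x. v x * \<zeta> x"]
      integrable_restrict_space[OF Kb(2), of "\<lambda>x. v x * \<zeta> x"] by (simp only: eq)
  show "(\<integral>x. v x * \<zeta> x \<partial>lebesgue_on D) = (\<integral>x. v x * \<zeta> x \<partial>lebesgue_on K)"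
    using integral_restrict_space[OF Kb(1), of "\<lambda>x. v x * \<zeta> x"]
      integral_restrict_space[OF Kb(2), of "\<lambda>x. v x * \<zeta> x"] by (simp only: eq)
qed

lemma bounded_of_compact_support:
  fixes \<zeta> :: "'a::euclidean_space \<Rightarrow> 'b::euclidean_space"
  assumes "continuous_on UNIV \<zeta>" "compact K" "\<And>x. x \<notin> K \<Longrightarrow> \<zeta> x = 0"
  obtains B where "0 \<le> B" "\<And>x. norm (\<zeta> x) \<le> B"
proof -
  have "compact (\<zeta> ` K)" using assms by (intro compact_continuous_image) (auto intro: continuous_on_subset)
  then obtain B where "\<And>x. x \<in> K \<Longrightarrow> norm (\<zeta> x) \<le> B" using compact_imp_bounded bounded_iff by (metis imageI)
  then have "norm (\<zeta> x) \<le> max B 0" for x using assms(3)[of x] by (cases "x \<in> K") (auto intro: max.coboundedI1)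
  then show ?thesis using that[of "max B 0"] by simp
qed

lemma test_function_integrable:
  assumes "open D" "test_function D \<eta>" "locally_integrable D v"
  shows "integrable (lebesgue_on D) (\<lambda>x. v x * \<eta> x)"
    "integrable (lebesgue_on D) (\<lambda>x. v x * (grad \<eta> x \<bullet> e))"
proof -
  let ?K = "closure {x. \<eta> x \<noteq> 0}"
  have K: "compact ?K" "?K \<subseteq> D" using assms unfolding test_function_def by auto
  note tf = test_function_grad[OF assms(2)]
  have c: "continuous_on UNIV (\<lambda>x. grad \<eta> x \<bullet> e)" using tf(2) by (intro continuous_intros)
  have z: "grad \<eta> x \<bullet> e = 0" if "x \<notin> ?K" for x using tf(4)[OF that] by simp
  obtain B where B: "\<And>x. norm (\<eta> x) \<le> B"
    using bounded_of_compact_support[OF tf(3) K(1) tf(5)] by blast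
  obtain B' where B': "\<And>x. norm (grad \<eta> x \<bullet> e) \<le> B'"
    using bounded_of_compact_support[OF c K(1) z] by blast
  show "integrable (lebesgue_on D) (\<lambda>x. v x * \<eta> x)"
    using B unfolding real_norm_def
    by (rule locally_integrable_mult(1)[OF assms(3,1) K borel_measurable_continuous_onI[OF tf(3)] _ tf(5)])
  show "integrable (lebesgue_on D) (\<lambda>x. v x * (grad \<eta> x \<bullet> e))"
    using B' unfolding real_norm_def
    by (rule locally_integrable_mult(1)[OF assms(3,1) K borel_measurable_continuous_onI[OF c] _ z])
qed

text \<open>Boxes are stable under intersection and generate the Borel sets, so the vanishing of the
  integral spreads by the Dynkin argument. Boxes are bounded; \<open>whole\<close> supplies the
  complement step.\<close>

lemma AE_eq_0_of_boxes:
  fixes v :: "'a::euclidean_space \<Rightarrow> real"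
  assumes v: "integrable lborel v" and box: "\<And>a b. (\<integral>x. indicator (box a b) x * v x \<partial>lborel) = 0"
    and whole: "(\<integral>x. v x \<partial>lborel) = 0"
  shows "AE x in lborel. v x = 0"
proof (rule density_unique_real)
  fix A assume "A \<in> sets (lborel :: 'a measure)"
  then have A: "A \<in> sigma_sets UNIV (range (\<lambda>(a, b). box a b))"
    using borel_eq_box[where 'a = 'a] by (metis sets_lborel sets_measure_of subset_UNIV Pow_UNIV)
  have stable: "Int_stable (range (\<lambda>(a, b). box a b :: 'a set))"
    unfolding Int_stable_def by (auto simp: box_Int_box intro!: rev_image_eqI)
  have "range (\<lambda>(a, b). box a b :: 'a set) \<subseteq> Pow UNIV" by simp
  from stable this A have "(\<integral>x. indicator A x * v x \<partial>lborel) = 0"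
  proof (induction rule: sigma_sets_induct_disjoint)
    case (basic A)
    then show ?case using box by auto
  next
    case empty
    then show ?case by simp
  next
    case (compl A)
    then have A: "A \<in> sets lborel"
      using borel_eq_box[where 'a = 'a] by (metis sets_lborel sets_measure_of subset_UNIV Pow_UNIV)
    have "(\<integral>x. indicator (UNIV - A) x * v x \<partial>lborel) = (\<integral>x. v x - indicator A x * v x \<partial>lborel)"
      by (intro Bochner_Integration.integral_cong) (auto simp: indicator_def)
    also have "\<dots> = 0" using compl whole v A
      by (subst Bochner_Integration.integral_diff) (auto intro: integrable_real_mult_indicator simp: mult.commute)
    finally show ?case .
  next
    case (union A)
    have A: "A i \<in> sets lborel" for i
      using union borel_eq_box[where 'a = 'a] by (metis sets_lborel sets_measure_of subset_UNIV Pow_UNIV range_subsetD)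
    have "set_integrable lborel (\<Union>i. A i) v"
      unfolding set_integrable_def using A v by (intro integrable_mult_indicator) auto
    from lebesgue_integral_countable_add[OF A _ this] union(1)
    have "(LINT x:(\<Union>i. A i)|lborel. v x) = (\<Sum>i. LINT x:A i|lborel. v x)"
      by (auto simp: disjoint_family_on_def)
    then show ?case using union(3) by (simp add: set_lebesgue_integral_def)
  qed
  then show "(LINT x:A|lborel. v x) = (LINT x:A|lborel. 0)" by (simp add: set_lebesgue_integral_def)
qed (use v in auto)

text \<open>The fundamental lemma of the calculus of variations: \<open>box_bump a b n\<close>
  converges boundedly to the indicator of the box, so \<open>v\<close> has vanishing integral over
  every box whose closure lies in a closed box inside \<open>D\<close>. A countable cover then makes
  the null sets fit together.\<close>

lemma weak_zero:
  fixes v :: "'a::euclidean_space \<Rightarrow> real"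
  assumes D: "open D" and v: "locally_integrable D v"
    and zero: "\<And>\<eta>. test_function D \<eta> \<Longrightarrow> (\<integral>x. v x * \<eta> x \<partial>lebesgue_on D) = 0"
  shows "AE x in lebesgue_on D. v x = 0"
proof -
  have box: "AE x in lborel. x \<in> box a0 b0 \<longrightarrow> v x = 0" if cb: "cbox a0 b0 \<subseteq> D" for a0 b0
  proof -
    have iv: "integrable (lebesgue_on (cbox a0 b0)) v" using v cb unfolding locally_integrable_def by auto
    have cS: "cbox a0 b0 \<in> sets borel" by simp
    obtain w where w[measurable]: "w \<in> borel_measurable borel" and wv: "AE x in lborel. x \<in> cbox a0 b0 \<longrightarrow> v x = w x"
      and w0: "\<And>x. x \<notin> cbox a0 b0 \<Longrightarrow> w x = 0"
      using borel_version[OF borel_measurable_integrable[OF iv] cS] by blast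
    have conv: "(\<integral>x. v x * \<zeta> x \<partial>lebesgue_on (cbox a0 b0)) = (\<integral>x. w x * \<zeta> x \<partial>lborel)"
      if \<zeta>: "\<zeta> \<in> borel_measurable borel" for \<zeta>
    proof -
      have "(\<integral>x. v x * \<zeta> x \<partial>lebesgue_on (cbox a0 b0)) = (\<integral>x. w x * \<zeta> x \<partial>lebesgue_on (cbox a0 b0))"
      proof (rule integral_cong_AE)
        show "AE x in lebesgue_on (cbox a0 b0). v x * \<zeta> x = w x * \<zeta> x"
          unfolding AE_lebesgue_on_iff[OF cS] using wv by eventually_elim auto
        show "(\<lambda>x. v x * \<zeta> x) \<in> borel_measurable (lebesgue_on (cbox a0 b0))"
          by (intro borel_measurable_times borel_measurable_integrable[OF iv] borel_measurable_lebesgue_on_borel \<zeta>)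
        show "(\<lambda>x. w x * \<zeta> x) \<in> borel_measurable (lebesgue_on (cbox a0 b0))"
          by (intro borel_measurable_times borel_measurable_lebesgue_on_borel \<zeta> w)
      qed
      also have "\<dots> = (\<integral>x. indicator (cbox a0 b0) x *\<^sub>R (w x * \<zeta> x) \<partial>lborel)"
        using \<zeta> by (intro integral_lebesgue_on_borel) auto
      also have "\<dots> = (\<integral>x. w x * \<zeta> x \<partial>lborel)"
        using w0 by (intro Bochner_Integration.integral_cong) (auto simp: indicator_def)
      finally show ?thesis .
    qed
    have iw: "integrable lborel w"
    proof -
      have "integrable (lebesgue_on (cbox a0 b0)) w"
      proof (rule integrable_cong_AE_imp[OF iv])
        show "AE x in lebesgue_on (cbox a0 b0). v x = w x"
          unfolding AE_lebesgue_on_iff[OF cS] by (rule wv)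
      qed (use w in \<open>auto intro: borel_measurable_lebesgue_on_borel\<close>)
      then have "integrable lebesgue (\<lambda>x. indicator (cbox a0 b0) x *\<^sub>R w x)"
        using integrable_restrict_space[OF sets_lebesgue_borel[OF cS]] by blast
      moreover have "(\<lambda>x. indicator (cbox a0 b0) x *\<^sub>R w x) = w" using w0 by (auto simp: indicator_def fun_eq_iff)
      ultimately show ?thesis using integrable_completion[of w lborel] by simp
    qed
    have zb: "(\<integral>x. w x * indicator (box a b) x \<partial>lborel) = 0" if ab: "cbox a b \<subseteq> cbox a0 b0" for a b
    proof -
      have tf: "test_function D (box_bump a b n)" for n using ab cb by (intro test_function_box_bump) auto
      have bm: "box_bump a b n \<in> borel_measurable borel" for n
        using test_function_grad(3)[OF tf] by (rule borel_measurable_continuous_onI)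
      have "(\<integral>x. w x * box_bump a b n x \<partial>lborel) = 0" for n
      proof -
        have "box_bump a b n x = 0" if "x \<notin> cbox a0 b0" for x
          using that ab box_bump_eq_0_iff[of a b n x] box_subset_cbox[of a b] by blast
        then have "(\<integral>x. v x * box_bump a b n x \<partial>lebesgue_on D) = (\<integral>x. v x * box_bump a b n x \<partial>lebesgue_on (cbox a0 b0))"
          using box_bump_bounds[of a b n] bm
          by (intro locally_integrable_mult(2)[OF v D, of _ _ 1] cb) (auto simp: compact_cbox)
        then show ?thesis using zero[OF tf] conv[OF bm] by simp
      qed
      moreover have "(\<lambda>n. \<integral>x. w x * box_bump a b n x \<partial>lborel) \<longlonglongrightarrow> (\<integral>x. w x * indicator (box a b) x \<partial>lborel)"
      proof (rule integral_dominated_convergence[where w = "\<lambda>x. \<bar>w x\<bar>"])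
        show "AE x in lborel. (\<lambda>n. w x * box_bump a b n x) \<longlonglongrightarrow> w x * indicator (box a b) x"
          by (intro AE_I2 tendsto_mult tendsto_const box_bump_tendsto)
        show "AE x in lborel. norm (w x * box_bump a b n x) \<le> \<bar>w x\<bar>" for n
          using box_bump_bounds[of a b n] by (intro AE_I2) (simp add: abs_mult mult_left_le)
      qed (use iw bm in \<open>auto intro: borel_measurable_times\<close>)
      ultimately show ?thesis by (simp add: LIMSEQ_const_iff)
    qed
    \<comment> \<open>Cut down to one open box: an arbitrary box then acts through its intersection
      with \<open>box a0 b0\<close>, again a box, and its closure lies in
      \<open>cbox a0 b0\<close>.\<close>
    define w' where "w' x = indicator (box a0 b0) x * w x" for x
    have iw': "integrable lborel w'"
      unfolding w'_def using integrable_mult_indicator[OF _ iw, of "box a0 b0"] by simp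
    have "AE x in lborel. w' x = 0"
    proof (rule AE_eq_0_of_boxes[OF iw'])
      fix a b
      obtain a' b' where ab': "box a b \<inter> box a0 b0 = box a' b'" by (simp add: box_Int_box)
      have "(\<integral>x. w x * indicator (box a' b') x \<partial>lborel) = 0"
      proof (cases "box a' b' = {}")
        case False
        have "cbox a' b' = closure (box a' b')" using closure_box[OF False] by simp
        also have "\<dots> \<subseteq> closure (box a0 b0)" using ab' by (intro closure_mono) auto
        also have "\<dots> \<subseteq> cbox a0 b0" by (intro closure_minimal) (auto simp: mem_box less_imp_le)
        finally show ?thesis by (rule zb)
      qed simp
      moreover have "indicator (box a b) x * w' x = w x * indicator (box a' b') x" for x
        using ab' by (auto simp: w'_def indicator_def)
      ultimately show "(\<integral>x. indicator (box a b) x * w' x \<partial>lborel) = 0" by simp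
    next
      show "(\<integral>x. w' x \<partial>lborel) = 0" using zb[of a0 b0] by (simp add: w'_def mult.commute)
    qed
    with wv show ?thesis
      by eventually_elim (auto simp: w'_def dest: box_subset_cbox[THEN subsetD])
  qed
  obtain \<D> where \<D>: "countable \<D>" "\<D> \<subseteq> Pow D" "\<And>X. X \<in> \<D> \<Longrightarrow> \<exists>a b. X = cbox a b" "\<Union>\<D> = D"
    using open_countable_Union_open_cbox[OF D] by blast
  have "AE x in lborel. x \<in> X \<longrightarrow> v x = 0" if X: "X \<in> \<D>" for X
  proof -
    obtain a b where ab: "X = cbox a b" using \<D>(3)[OF X] by blast
    \<comment> \<open>Only open boxes were treated; the faces of the closed ones in the cover are
      null sets.\<close>
    have "AE x in lebesgue. x \<notin> cbox a b - box a b"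
      using negligible_frontier_interval[of a b] by (intro AE_not_in) (simp add: negligible_iff_null_sets)
    then have "AE x in lborel. x \<notin> cbox a b - box a b" by (simp only: AE_completion_iff)
    moreover have "AE x in lborel. x \<in> box a b \<longrightarrow> v x = 0"
      using \<D>(2) X ab by (intro box) auto
    ultimately show ?thesis by eventually_elim (auto simp: ab)
  qed
  then have "AE x in lborel. \<forall>X\<in>\<D>. x \<in> X \<longrightarrow> v x = 0"
    by (subst AE_ball_countable[OF \<D>(1)]) blast
  then have "AE x in lborel. x \<in> D \<longrightarrow> v x = 0"
    by eventually_elim (use \<D>(4) in auto)
  then show ?thesis using D by (subst AE_lebesgue_on_iff) auto
qed

lemma weak_deriv_unique:
  assumes D: "open D" and "weak_deriv D e u v1" "weak_deriv D e u v2"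
  shows "AE x in lebesgue_on D. v1 x = v2 x"
proof -
  have v: "locally_integrable D v1" "locally_integrable D v2"
    using assms unfolding weak_deriv_def by auto
  have "AE x in lebesgue_on D. v1 x - v2 x = 0"
  proof (rule weak_zero[OF D])
    show "locally_integrable D (\<lambda>x. v1 x - v2 x)" using v unfolding locally_integrable_def by auto
    fix \<eta> assume t: "test_function D \<eta>"
    have "(\<integral>x. (v1 x - v2 x) * \<eta> x \<partial>lebesgue_on D) =
        (\<integral>x. v1 x * \<eta> x \<partial>lebesgue_on D) - (\<integral>x. v2 x * \<eta> x \<partial>lebesgue_on D)"
      unfolding left_diff_distrib using v
      by (intro Bochner_Integration.integral_diff test_function_integrable[OF D t])
    also have "\<dots> = 0" using assms t unfolding weak_deriv_def by simp
    finally show "(\<integral>x. (v1 x - v2 x) * \<eta> x \<partial>lebesgue_on D) = 0" .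
  qed
  then show ?thesis by eventually_elim simp
qed

subsection \<open>Closure properties of weak derivatives\<close>

lemma lebesgue_on_subset_integral:
  fixes f :: "'a::euclidean_space \<Rightarrow> real"
  assumes "S \<in> sets borel" "D \<in> sets borel" "S \<subseteq> D" "\<And>x. x \<in> D - S \<Longrightarrow> f x = 0"
  shows "(\<integral>x. f x \<partial>lebesgue_on D) = (\<integral>x. f x \<partial>lebesgue_on S)"
proof -
  have "(\<lambda>x. indicator D x *\<^sub>R f x) = (\<lambda>x. indicator S x *\<^sub>R f x)"
    using assms(3,4) by (auto simp: indicator_def fun_eq_iff)
  then show ?thesis
    using integral_restrict_space[OF sets_lebesgue_borel[OF assms(1)], of f]
      integral_restrict_space[OF sets_lebesgue_borel[OF assms(2)], of f] by (simp only:)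
qed

lemma integrable_lebesgue_on_subset:
  fixes f :: "'a::euclidean_space \<Rightarrow> real"
  assumes "integrable (lebesgue_on D) f" "S \<in> sets borel" "D \<in> sets borel" "S \<subseteq> D"
  shows "integrable (lebesgue_on S) f"
proof -
  have "integrable lebesgue (\<lambda>x. indicator D x *\<^sub>R f x)"
    using assms integrable_restrict_space[OF sets_lebesgue_borel[OF assms(3)], of f] by blast
  then have "integrable lebesgue (\<lambda>x. indicator S x *\<^sub>R (indicator D x *\<^sub>R f x))"
    by (rule integrable_mult_indicator[rotated]) (use assms(2) in \<open>simp add: sets_completionI_sets\<close>)
  moreover have "(\<lambda>x. indicator S x *\<^sub>R (indicator D x *\<^sub>R f x)) = (\<lambda>x. indicator S x *\<^sub>R f x)"
    using assms(4) by (auto simp: indicator_def fun_eq_iff)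
  ultimately show ?thesis
    using integrable_restrict_space[OF sets_lebesgue_borel[OF assms(2)], of f] by (simp only:)
qed

lemma in_L2_integrable_compact:
  fixes v :: "'a::euclidean_space \<Rightarrow> real"
  assumes "in_L2 S v" "S \<in> sets borel" "compact K" "K \<subseteq> S"
  shows "integrable (lebesgue_on K) v"
proof -
  have K: "K \<in> sets borel" using assms(3) by (rule borel_compact)
  have fin: "emeasure lborel K < \<infinity>" using assms(3) emeasure_compact_finite by blast
  define f where "f x = (indicator K x :: real)" for x :: 'a
  have "in_L2 S f"
    unfolding in_L2_iff
  proof
    show "f \<in> borel_measurable (lebesgue_on S)"
      unfolding f_def using K by (intro borel_measurable_lebesgue_on_borel borel_measurable_indicator)
    have "sqn S f \<le> (\<integral>\<^sup>+x. indicator K x \<partial>lborel)"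
      unfolding sqn_def nn_integral_lebesgue_on[OF assms(2)]
      by (intro nn_integral_mono) (auto simp: f_def indicator_def)
    then show "sqn S f < \<infinity>" using fin K by (simp add: le_less_trans)
  qed
  from L2_inner_bound(1)[OF assms(1) this]
  have "integrable (lebesgue_on S) (\<lambda>x. v x * f x)" by simp
  then have "integrable (lebesgue_on K) (\<lambda>x. v x * f x)"
    by (rule integrable_lebesgue_on_subset[OF _ K assms(2,4)])
  then show ?thesis
    by (rule Bochner_Integration.integrable_cong[OF refl, THEN iffD1, rotated]) (simp add: f_def)
qed

lemma locally_integrable_L2:
  fixes v :: "'a::euclidean_space \<Rightarrow> real"
  assumes "\<And>K. compact K \<Longrightarrow> K \<subseteq> D \<Longrightarrow> \<exists>S\<in>sets borel. K \<subseteq> S \<and> in_L2 S v"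
  shows "locally_integrable D v"
  unfolding locally_integrable_def using assms in_L2_integrable_compact by blast

lemma in_L2_compact_support:
  fixes \<zeta> :: "'a::euclidean_space \<Rightarrow> 'b::euclidean_space"
  assumes "continuous_on UNIV \<zeta>" "compact K" "\<And>x. x \<notin> K \<Longrightarrow> \<zeta> x = 0" "S \<in> sets borel"
  shows "in_L2 S \<zeta>"
  unfolding in_L2_iff
proof
  show "\<zeta> \<in> borel_measurable (lebesgue_on S)"
    using assms(1) by (intro borel_measurable_lebesgue_on_borel borel_measurable_continuous_onI)
  obtain B where B: "0 \<le> B" "\<And>x. norm (\<zeta> x) \<le> B" using bounded_of_compact_support[OF assms(1-3)] by blast
  have "sqn S \<zeta> \<le> (\<integral>\<^sup>+x. ennreal (B\<^sup>2) * indicator K x \<partial>lborel)"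
    unfolding sqn_def nn_integral_lebesgue_on[OF assms(4)]
  proof (intro nn_integral_mono)
    fix x
    have "(norm (\<zeta> x))\<^sup>2 \<le> B\<^sup>2" using B by (intro power_mono) auto
    then show "ennreal ((norm (\<zeta> x))\<^sup>2) * indicator S x \<le> ennreal (B\<^sup>2) * indicator K x"
      using assms(3)[of x] by (cases "x \<in> K") (auto simp: indicator_def ennreal_leI)
  qed
  also have "\<dots> = ennreal (B\<^sup>2) * emeasure lborel K"
    using assms(2) by (intro nn_integral_cmult_indicator) (simp add: borel_compact)
  also have "\<dots> < \<infinity>" using emeasure_compact_finite[OF assms(2)] by (simp add: ennreal_mult_less_top)
  finally show "sqn S \<zeta> < \<infinity>" .
qed

lemma test_function_in_L2:
  assumes "test_function D \<eta>" "S \<in> sets borel"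
  shows "in_L2 S \<eta>" "in_L2 S (grad \<eta>)" "in_L2 S (\<lambda>x. grad \<eta> x \<bullet> e)"
proof -
  have K: "compact (closure {x. \<eta> x \<noteq> 0})" using assms unfolding test_function_def by auto
  note tf = test_function_grad[OF assms(1)]
  show "in_L2 S \<eta>" by (rule in_L2_compact_support[OF tf(3) K tf(5) assms(2)])
  show "in_L2 S (grad \<eta>)" by (rule in_L2_compact_support[OF tf(2) K tf(4) assms(2)])
  have "continuous_on UNIV (\<lambda>x. grad \<eta> x \<bullet> e)" using tf(2) by (intro continuous_intros)
  then show "in_L2 S (\<lambda>x. grad \<eta> x \<bullet> e)"
    by (rule in_L2_compact_support[OF _ K _ assms(2)]) (simp add: tf(4))
qed

text \<open>A test function sees only a neighbourhood of its compact support, so convergence is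
  asked on a Borel set around each compact set. On the cylinder these sets will be slabs
  \<open>\<Omega> \<times> {a..b}\<close> with \<open>a > 0\<close>, away from the singularity of
  the profiles at \<open>y = 0\<close>.\<close>

lemma weak_deriv_limit:
  fixes w v :: "'a::euclidean_space \<Rightarrow> real"
  assumes D: "open D" and wd: "\<And>N. weak_deriv D e (w' N) (v' N)"
    and lim: "\<And>K. compact K \<Longrightarrow> K \<subseteq> D \<Longrightarrow> \<exists>S\<in>sets borel. K \<subseteq> S \<and> S \<subseteq> D \<and> L2_tendsto S w' w \<and> L2_tendsto S v' v"
  shows "weak_deriv D e w v"
  unfolding weak_deriv_def
proof (intro conjI allI impI)
  have ex: "\<exists>S\<in>sets borel. K \<subseteq> S \<and> in_L2 S w" "\<exists>S\<in>sets borel. K \<subseteq> S \<and> in_L2 S v"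
    if "compact K" "K \<subseteq> D" for K
  proof -
    from lim[OF that] obtain S where S: "S \<in> sets borel" "K \<subseteq> S" "L2_tendsto S w' w" "L2_tendsto S v' v"
      by blast
    then have "in_L2 S w" "in_L2 S v" by (simp_all add: L2_tendsto_def)
    then show "\<exists>S\<in>sets borel. K \<subseteq> S \<and> in_L2 S w" "\<exists>S\<in>sets borel. K \<subseteq> S \<and> in_L2 S v"
      using S by blast+
  qed
  show "locally_integrable D w" "locally_integrable D v"
    by (rule locally_integrable_L2, rule ex, assumption+)+
  fix \<eta> assume t: "test_function D \<eta>"
  let ?K = "closure {x. \<eta> x \<noteq> 0}"
  have "compact ?K" "?K \<subseteq> D" using t unfolding test_function_def by auto
  from lim[OF this] obtain S where S: "S \<in> sets borel" "?K \<subseteq> S" "S \<subseteq> D" "L2_tendsto S w' w" "L2_tendsto S v' v"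
    by blast
  have D': "D \<in> sets borel" using D by simp
  note tf = test_function_grad[OF t]
  have out: "grad \<eta> x = 0" "\<eta> x = 0" if "x \<in> D - S" for x
  proof -
    have "x \<notin> ?K" using that S(2) by blast
    then show "grad \<eta> x = 0" "\<eta> x = 0" by (rule tf(4), rule tf(5))
  qed
  have r1: "(\<integral>x. u x * (grad \<eta> x \<bullet> e) \<partial>lebesgue_on D) = (\<integral>x. u x * (grad \<eta> x \<bullet> e) \<partial>lebesgue_on S)" for u
    by (rule lebesgue_on_subset_integral[OF S(1) D' S(3)]) (simp add: out)
  have r2: "(\<integral>x. u x * \<eta> x \<partial>lebesgue_on D) = (\<integral>x. u x * \<eta> x \<partial>lebesgue_on S)" for u
    by (rule lebesgue_on_subset_integral[OF S(1) D' S(3)]) (simp add: out)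
  have "(\<lambda>N. \<integral>x. w' N x * (grad \<eta> x \<bullet> e) \<partial>lebesgue_on D) \<longlonglongrightarrow> (\<integral>x. w x * (grad \<eta> x \<bullet> e) \<partial>lebesgue_on D)"
    unfolding r1 by (rule L2_tendsto_mult[OF S(4) test_function_in_L2(3)[OF t S(1)]])
  moreover have "(\<lambda>N. - (\<integral>x. v' N x * \<eta> x \<partial>lebesgue_on D)) \<longlonglongrightarrow> - (\<integral>x. v x * \<eta> x \<partial>lebesgue_on D)"
    unfolding r2 by (rule tendsto_minus[OF L2_tendsto_mult[OF S(5) test_function_in_L2(1)[OF t S(1)]]])
  moreover have "(\<integral>x. w' N x * (grad \<eta> x \<bullet> e) \<partial>lebesgue_on D) = - (\<integral>x. v' N x * \<eta> x \<partial>lebesgue_on D)" for N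
    using wd[of N] t unfolding weak_deriv_def by blast
  ultimately show "(\<integral>x. w x * (grad \<eta> x \<bullet> e) \<partial>lebesgue_on D) = - (\<integral>x. v x * \<eta> x \<partial>lebesgue_on D)"
    using LIMSEQ_unique by simp
qed

lemma weak_deriv_add:
  assumes D: "open D" and "weak_deriv D e w v" "weak_deriv D e w' v'"
  shows "weak_deriv D e (\<lambda>x. w x + w' x) (\<lambda>x. v x + v' x)"
  unfolding weak_deriv_def
proof (intro conjI allI impI)
  have L: "locally_integrable D w" "locally_integrable D w'" "locally_integrable D v" "locally_integrable D v'"
    using assms unfolding weak_deriv_def by auto
  show "locally_integrable D (\<lambda>x. w x + w' x)" "locally_integrable D (\<lambda>x. v x + v' x)"
    using L unfolding locally_integrable_def by auto
  fix \<eta> assume t: "test_function D \<eta>"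
  note i = test_function_integrable[OF D t]
  show "(\<integral>x. (w x + w' x) * (grad \<eta> x \<bullet> e) \<partial>lebesgue_on D) = - (\<integral>x. (v x + v' x) * \<eta> x \<partial>lebesgue_on D)"
    unfolding distrib_right using assms(2,3) t L
    by (subst (1 2) Bochner_Integration.integral_add) (auto simp: weak_deriv_def i)
qed

lemma weak_deriv_cmult:
  assumes "weak_deriv D e w v"
  shows "weak_deriv D e (\<lambda>x. c * w x) (\<lambda>x. c * v x)"
  using assms unfolding weak_deriv_def locally_integrable_def by (auto simp: mult.assoc)

lemma weak_deriv_zero: "weak_deriv D e (\<lambda>x. 0) (\<lambda>x. 0)"
  by (simp add: weak_deriv_def locally_integrable_def)

lemma weak_deriv_sum:
  assumes "open D" "\<And>k. k \<in> I \<Longrightarrow> weak_deriv D e (w k) (v k)"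
  shows "weak_deriv D e (\<lambda>x. \<Sum>k\<in>I. w k x) (\<lambda>x. \<Sum>k\<in>I. v k x)"
  using assms(2)
  by (induction I rule: infinite_finite_induct) (auto intro: weak_deriv_add[OF assms(1)] weak_deriv_zero)

lemma weak_grad_sum:
  assumes "open D" "\<And>k. k \<in> I \<Longrightarrow> weak_grad D (w k) (G k)"
  shows "weak_grad D (\<lambda>x. \<Sum>k\<in>I. c k * w k x) (\<lambda>x. \<Sum>k\<in>I. c k *\<^sub>R G k x)"
  unfolding weak_grad_def
proof
  fix e :: 'a assume e: "e \<in> Basis"
  have "weak_deriv D e (\<lambda>x. \<Sum>k\<in>I. c k * w k x) (\<lambda>x. \<Sum>k\<in>I. c k * (G k x \<bullet> e))"
    using assms e by (intro weak_deriv_sum weak_deriv_cmult) (auto simp: weak_grad_def)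
  then show "weak_deriv D e (\<lambda>x. \<Sum>k\<in>I. c k * w k x) (\<lambda>x. (\<Sum>k\<in>I. c k *\<^sub>R G k x) \<bullet> e)"
    by (simp add: inner_sum_left)
qed

lemma weak_grad_limit:
  assumes D: "open D" and "\<And>N. weak_grad D (w' N) (G' N)" "L2_tendsto D w' w" "L2_tendsto D G' G"
  shows "weak_grad D w G"
  unfolding weak_grad_def
proof
  fix e :: 'a assume e: "e \<in> Basis"
  show "weak_deriv D e w (\<lambda>x. G x \<bullet> e)"
  proof (rule weak_deriv_limit[OF D])
    show "weak_deriv D e (w' N) (\<lambda>x. G' N x \<bullet> e)" for N using assms e unfolding weak_grad_def by blast
    fix K assume "K \<subseteq> D"
    then show "\<exists>S\<in>sets borel. K \<subseteq> S \<and> S \<subseteq> D \<and> L2_tendsto S w' w \<and> L2_tendsto S (\<lambda>N x. G' N x \<bullet> e) (\<lambda>x. G x \<bullet> e)"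
      using assms e L2_tendsto_component by (intro bexI[of _ D]) auto
  qed
qed

subsection \<open>The derivative in the cylinder direction\<close>

lemma compact_in_cylinder:
  fixes K :: "('a::euclidean_space \<times> real) set"
  assumes "compact K" "K \<subseteq> \<Omega> \<times> {0<..}"
  obtains a b where "0 < a" "a \<le> b" "K \<subseteq> \<Omega> \<times> {a..b}"
proof (cases "K = {}")
  case False
  have c: "compact (snd ` K)" "snd ` K \<noteq> {}"
    using assms False by (auto intro!: compact_continuous_image continuous_intros)
  obtain a where a: "a \<in> snd ` K" "\<And>y. y \<in> snd ` K \<Longrightarrow> a \<le> y" using compact_attains_inf[OF c] by blast
  obtain b where b: "b \<in> snd ` K" "\<And>y. y \<in> snd ` K \<Longrightarrow> y \<le> b" using compact_attains_sup[OF c] by blast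
  have "K \<subseteq> \<Omega> \<times> {a..b}" using assms(2) a(2) b(2) by force
  then show ?thesis using that[of a b] a b assms(2) by auto
qed (use that[of 1 1] in auto)

lemma nn_integral_cylinder:
  fixes f :: "'a::euclidean_space \<times> real \<Rightarrow> ennreal"
  assumes "f \<in> borel_measurable borel" "\<Omega> \<in> sets borel" "J \<in> sets borel"
  shows "(\<integral>\<^sup>+p. f p \<partial>lebesgue_on (\<Omega> \<times> J)) = (\<integral>\<^sup>+y. (\<integral>\<^sup>+x. f (x, y) \<partial>lebesgue_on \<Omega>) \<partial>lebesgue_on J)"
proof -
  have S: "\<Omega> \<times> J \<in> sets borel" using assms by (simp add: borel_Times)
  have [measurable]: "f \<in> borel_measurable (borel \<Otimes>\<^sub>M borel)" using assms(1) by (simp add: borel_prod)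
  note [measurable] = assms(2,3)
  have "(\<integral>\<^sup>+p. f p \<partial>lebesgue_on (\<Omega> \<times> J)) = (\<integral>\<^sup>+p. f p * indicator (\<Omega> \<times> J) p \<partial>(lborel \<Otimes>\<^sub>M lborel))"
    by (simp add: nn_integral_lebesgue_on[OF S] lborel_prod)
  also have "\<dots> = (\<integral>\<^sup>+y. (\<integral>\<^sup>+x. f (x, y) * indicator (\<Omega> \<times> J) (x, y) \<partial>lborel) \<partial>lborel)"
    by (rule lborel_pair.nn_integral_snd[symmetric]) measurable
  also have "\<dots> = (\<integral>\<^sup>+y. (\<integral>\<^sup>+x. f (x, y) * indicator \<Omega> x \<partial>lborel) * indicator J y \<partial>lborel)"
    by (intro nn_integral_cong) (auto simp: indicator_def nn_integral_cmult)
  finally show ?thesis by (simp add: nn_integral_lebesgue_on assms)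
qed

lemma in_L2_cylinder_product:
  fixes \<phi> :: "'a::euclidean_space \<Rightarrow> real" and p :: "real \<Rightarrow> real"
  assumes [measurable]: "\<phi> \<in> borel_measurable borel" "p \<in> borel_measurable borel"
    and \<Omega>: "\<Omega> \<in> sets borel" and \<phi>: "in_L2 \<Omega> \<phi>" and p: "continuous_on {a..b} p"
  shows "in_L2 (\<Omega> \<times> {a..b}) (\<lambda>(x, y). \<phi> x * p y)"
  unfolding in_L2_iff
proof
  have m: "(\<lambda>(x, y). \<phi> x * p y) \<in> borel_measurable (borel :: ('a \<times> real) measure)"
    unfolding borel_prod[symmetric] by measurable
  then show "(\<lambda>(x, y). \<phi> x * p y) \<in> borel_measurable (lebesgue_on (\<Omega> \<times> {a..b}))"
    by (rule borel_measurable_lebesgue_on_borel)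
  obtain B where B: "\<And>y. y \<in> {a..b} \<Longrightarrow> \<bar>p y\<bar> \<le> B"
    using compact_imp_bounded[OF compact_continuous_image[OF p compact_Icc]] unfolding bounded_iff by fastforce
  have J: "{a..b} \<in> sets borel" by simp
  have "sqn (\<Omega> \<times> {a..b}) (\<lambda>(x, y). \<phi> x * p y) =
      (\<integral>\<^sup>+y. (\<integral>\<^sup>+x. ennreal ((norm (case (x, y) of (x, y) \<Rightarrow> \<phi> x * p y))\<^sup>2) \<partial>lebesgue_on \<Omega>) \<partial>lebesgue_on {a..b})"
    unfolding sqn_def by (rule nn_integral_cylinder[OF _ \<Omega> J]) (use m in measurable)
  also have "\<dots> \<le> (\<integral>\<^sup>+y. ennreal (B\<^sup>2) * sqn \<Omega> \<phi> \<partial>lebesgue_on {a..b})"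
    unfolding nn_integral_lebesgue_on[OF J]
  proof (intro nn_integral_mono)
    fix y
    show "(\<integral>\<^sup>+x. ennreal ((norm (case (x, y) of (x, y) \<Rightarrow> \<phi> x * p y))\<^sup>2) \<partial>lebesgue_on \<Omega>) * indicator {a..b} y
        \<le> ennreal (B\<^sup>2) * sqn \<Omega> \<phi> * indicator {a..b} y"
    proof (cases "y \<in> {a..b}")
      case True
      have "sqn \<Omega> (\<lambda>x. \<phi> x * p y) \<le> ennreal (B\<^sup>2) * sqn \<Omega> \<phi>"
      proof (intro in_L2_bounded_mult(2)[OF \<phi>] AE_I2)
        show "(\<lambda>x. \<phi> x * p y) \<in> borel_measurable (lebesgue_on \<Omega>)"
          using in_L2_measurable[OF \<phi>] by simp
        show "norm (\<phi> x * p y) \<le> B * norm (\<phi> x)" for x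
          using mult_right_mono[OF B[OF True], of "\<bar>\<phi> x\<bar>"] by (simp add: abs_mult mult.commute)
      qed
      then show ?thesis using True by (simp add: sqn_def)
    qed simp
  qed
  also have "\<dots> = ennreal (B\<^sup>2) * sqn \<Omega> \<phi> * emeasure lborel {a..b}"
    unfolding nn_integral_lebesgue_on[OF J] by (rule nn_integral_cmult_indicator) simp
  also have "\<dots> < \<infinity>" using in_L2_finite[OF \<phi>] by (simp add: ennreal_mult_less_top emeasure_lborel_Icc_eq)
  finally show "sqn (\<Omega> \<times> {a..b}) (\<lambda>(x, y). \<phi> x * p y) < \<infinity>" .
qed

text \<open>Fubini with \<open>y\<close> innermost: for fixed \<open>x\<close> the integrand is
  \<open>\<phi> x\<close> times the derivative of \<open>p y * \<eta> (x, y)\<close> and integrates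
  to 0. As only \<open>y\<close> is differentiated, square integrability of \<open>\<phi>\<close>
  suffices.\<close>

lemma weak_deriv_cylinder_product:
  fixes \<phi> :: "'a::euclidean_space \<Rightarrow> real" and p p' :: "real \<Rightarrow> real"
  assumes \<Omega>: "open \<Omega>" and \<phi>m[measurable]: "\<phi> \<in> borel_measurable borel" and \<phi>: "in_L2 \<Omega> \<phi>"
    and pm[measurable]: "p \<in> borel_measurable borel" "p' \<in> borel_measurable borel"
    and p: "\<And>y. 0 < y \<Longrightarrow> (p has_real_derivative p' y) (at y)" and p': "\<And>y. 0 < y \<Longrightarrow> isCont p' y"
  shows "weak_deriv (\<Omega> \<times> {0<..}) (0, 1) (\<lambda>(x, y). \<phi> x * p y) (\<lambda>(x, y). \<phi> x * p' y)"
  unfolding weak_deriv_def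
proof (intro conjI allI impI)
  let ?D = "\<Omega> \<times> {0<..} :: ('a \<times> real) set"
  have \<Omega>': "\<Omega> \<in> sets borel" and Do: "open ?D" using \<Omega> by (auto intro: open_Times)
  have D': "?D \<in> sets borel" using Do by simp
  have loc: "locally_integrable ?D (\<lambda>(x, y). \<phi> x * q y)"
    if [measurable]: "q \<in> borel_measurable borel" and q: "\<And>y. 0 < y \<Longrightarrow> isCont q y" for q
  proof (rule locally_integrable_L2)
    fix K assume "compact K" "K \<subseteq> ?D"
    then obtain a b where ab: "0 < a" "a \<le> b" "K \<subseteq> \<Omega> \<times> {a..b}" by (rule compact_in_cylinder)
    have "continuous_on {a..b} q" using ab q by (intro continuous_at_imp_continuous_on) auto
    from in_L2_cylinder_product[OF \<phi>m that(1) \<Omega>' \<phi> this]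
    show "\<exists>S\<in>sets borel. K \<subseteq> S \<and> in_L2 S (\<lambda>(x, y). \<phi> x * q y)"
      using ab \<Omega>' by (intro bexI[of _ "\<Omega> \<times> {a..b}"]) (auto simp: borel_Times)
  qed
  have pc: "isCont p y" if "0 < y" for y using p[OF that] by (rule DERIV_isCont)
  show lp: "locally_integrable ?D (\<lambda>(x, y). \<phi> x * p y)" by (rule loc[OF pm(1) pc])
  show lp': "locally_integrable ?D (\<lambda>(x, y). \<phi> x * p' y)" by (rule loc[OF pm(2) p'])
  fix \<eta> :: "'a \<times> real \<Rightarrow> real" assume t: "test_function ?D \<eta>"
  note tf = test_function_grad[OF t]
  have tm[measurable]: "\<eta> \<in> borel_measurable (borel \<Otimes>\<^sub>M borel)"
    "(\<lambda>z. grad \<eta> z \<bullet> (0, 1)) \<in> borel_measurable (borel \<Otimes>\<^sub>M borel)"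
    unfolding borel_prod using tf(2,3) by (auto intro!: borel_measurable_continuous_onI continuous_intros)
  define Y where "Y z = grad \<eta> z \<bullet> (0, 1)" for z
  have [measurable]: "Y \<in> borel_measurable (borel \<Otimes>\<^sub>M borel)" unfolding Y_def[abs_def] by (rule tm(2))
  define F where "F = (\<lambda>(x, y). \<phi> x * p y * Y (x, y) + \<phi> x * p' y * \<eta> (x, y))"
  have Fm: "F \<in> borel_measurable borel" unfolding F_def borel_prod[symmetric] by measurable
  have i1: "integrable (lebesgue_on ?D) (\<lambda>z. (case z of (x, y) \<Rightarrow> \<phi> x * p y) * Y z)"
    unfolding Y_def by (rule test_function_integrable(2)[OF Do t lp])
  have i2: "integrable (lebesgue_on ?D) (\<lambda>z. (case z of (x, y) \<Rightarrow> \<phi> x * p' y) * \<eta> z)"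
    by (rule test_function_integrable(1)[OF Do t lp'])
  have F_eq: "F = (\<lambda>z. (case z of (x, y) \<Rightarrow> \<phi> x * p y) * Y z + (case z of (x, y) \<Rightarrow> \<phi> x * p' y) * \<eta> z)"
    by (auto simp: F_def)
  have "integrable (lebesgue_on ?D) F" unfolding F_eq by (intro Bochner_Integration.integrable_add i1 i2)
  then have "integrable lebesgue (\<lambda>z. indicator ?D z *\<^sub>R F z)"
    using integrable_restrict_space[OF sets_lebesgue_borel[OF D'], of F] by blast
  moreover have "(\<lambda>z. indicator ?D z *\<^sub>R F z) \<in> borel_measurable lborel"
    using Fm D' by simp
  ultimately have FI: "integrable (lborel \<Otimes>\<^sub>M lborel) (\<lambda>z. indicator ?D z *\<^sub>R F z)"
    by (simp add: integrable_completion lborel_prod)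
  obtain a b where ab: "0 < a" "a \<le> b" "closure {z. \<eta> z \<noteq> 0} \<subseteq> \<Omega> \<times> {a..b}"
    using t compact_in_cylinder unfolding test_function_def by metis
  have \<eta>0: "\<eta> (x, y) = 0" "Y (x, y) = 0" if "y \<notin> {a..b}" for x y
  proof -
    have "(x, y) \<notin> closure {z. \<eta> z \<noteq> 0}" using ab(3) that by blast
    note o = this
    show "\<eta> (x, y) = 0" by (rule tf(5)[OF o])
    show "Y (x, y) = 0" unfolding Y_def tf(4)[OF o] by simp
  qed
  have inner: "(\<integral>y. indicator ?D (x, y) *\<^sub>R F (x, y) \<partial>lborel) = 0" for x
  proof -
    \<comment> \<open>An interval that exceeds the \<open>y\<close>-support of \<open>\<eta>\<close>
      on both sides but stays in \<open>{0<..}\<close>: both boundary terms vanish and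
      \<open>p\<close> is differentiable throughout.\<close>
    define a' where "a' = a / 2"
    define b' where "b' = b + 1"
    have ab': "0 < a'" "a' < a" "a' \<le> b'" "b < b'" using ab by (auto simp: a'_def b'_def)
    define H where "H y = p y * Y (x, y) + p' y * \<eta> (x, y)" for y
    have dy: "((\<lambda>y. \<eta> (x, y)) has_real_derivative Y (x, y)) (at y)" for y
    proof -
      have "((\<lambda>y. (x, y)) has_derivative (\<lambda>h. (0, h))) (at y)" by (auto intro!: derivative_eq_intros)
      moreover have "(\<eta> has_derivative (\<lambda>h. h \<bullet> grad \<eta> (x, y))) (at (x, y))" using tf(1) by (simp add: gderiv_def)
      ultimately have "((\<lambda>y. \<eta> (x, y)) has_derivative (\<lambda>h. (0, h) \<bullet> grad \<eta> (x, y))) (at y)"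
        by (rule has_derivative_compose)
      moreover have "(0, h) \<bullet> grad \<eta> (x, y) = Y (x, y) * h" for h :: real
        by (cases "grad \<eta> (x, y)") (simp add: Y_def)
      ultimately show ?thesis by (simp add: has_field_derivative_def)
    qed
    have "(\<integral>y. H y * indicator {a'..b'} y \<partial>lborel) = p b' * \<eta> (x, b') - p a' * \<eta> (x, a')"
    proof (rule integral_FTC_Icc_real[OF ab'(3)])
      fix y assume "a' \<le> y" "y \<le> b'"
      then have y: "0 < y" using ab' by simp
      show "((\<lambda>y. p y * \<eta> (x, y)) has_real_derivative H y) (at y)"
        unfolding H_def using DERIV_mult[OF p[OF y] dy[of y]] by (simp add: algebra_simps)
      have c: "continuous_on UNIV (\<lambda>z. Y z)" unfolding Y_def using tf(2) by (intro continuous_intros)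
      have "isCont (\<lambda>y. Y (x, y)) y"
        using continuous_on_compose2[OF c, of UNIV "\<lambda>y. (x, y)"]
        by (auto simp: continuous_on_eq_continuous_at intro!: continuous_intros)
      moreover have "isCont (\<lambda>y. \<eta> (x, y)) y" using dy by (rule DERIV_isCont)
      ultimately show "isCont H y" unfolding H_def using pc[OF y] p'[OF y] by (intro continuous_intros)
    qed
    also have "\<dots> = 0" using \<eta>0[of b' x] \<eta>0[of a' x] ab' by simp
    finally have "(\<integral>y. indicator \<Omega> x * \<phi> x * (H y * indicator {a'..b'} y) \<partial>lborel) = 0" by simp
    moreover have "indicator ?D (x, y) *\<^sub>R F (x, y) = indicator \<Omega> x * \<phi> x * (H y * indicator {a'..b'} y)" for y
    proof (cases "y \<in> {a'..b'}")
      case True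
      then show ?thesis using ab' by (auto simp: indicator_def F_def H_def algebra_simps)
    next
      case False
      then have "y \<notin> {a..b}" using ab' by auto
      then show ?thesis using \<eta>0[of y x] False by (simp add: F_def)
    qed
    ultimately show ?thesis by simp
  qed
  have "(\<integral>z. F z \<partial>lebesgue_on ?D) = (\<integral>z. indicator ?D z *\<^sub>R F z \<partial>(lborel \<Otimes>\<^sub>M lborel))"
    using integral_lebesgue_on_borel[OF D' Fm] by (simp add: lborel_prod)
  also have "\<dots> = (\<integral>x. (\<integral>y. indicator ?D (x, y) *\<^sub>R F (x, y) \<partial>lborel) \<partial>lborel)"
    by (rule lborel_pair.integral_fst'[symmetric]) (rule FI)
  also have "\<dots> = 0" unfolding inner by simp
  finally have "(\<integral>z. (case z of (x, y) \<Rightarrow> \<phi> x * p y) * Y z \<partial>lebesgue_on ?D)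
      + (\<integral>z. (case z of (x, y) \<Rightarrow> \<phi> x * p' y) * \<eta> z \<partial>lebesgue_on ?D) = 0"
    unfolding F_eq by (simp add: Bochner_Integration.integral_add[OF i1 i2])
  then show "(\<integral>z. (case z of (x, y) \<Rightarrow> \<phi> x * p y) * (grad \<eta> z \<bullet> (0, 1)) \<partial>lebesgue_on ?D)
      = - (\<integral>z. (case z of (x, y) \<Rightarrow> \<phi> x * p' y) * \<eta> z \<partial>lebesgue_on ?D)"
    unfolding Y_def by simp
qed

subsection \<open>Gradients of the eigenfunctions\<close>

text \<open>Approximation up to every \<open>e\<close>, with the gradient carried along. In this
  form stability under limits follows without a diagonal choice, and sequences can be recovered from
  it.\<close>

definition H10_approx :: "'a::euclidean_space set \<Rightarrow> ('a \<Rightarrow> real) \<Rightarrow> ('a \<Rightarrow> 'a) \<Rightarrow> bool" where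
  "H10_approx D u G \<longleftrightarrow> in_L2 D u \<and> in_L2 D G \<and>
     (\<forall>e>0. \<exists>\<eta>. test_function D \<eta> \<and> sqn D (\<lambda>x. \<eta> x - u x) < ennreal e \<and> sqn D (\<lambda>x. grad \<eta> x - G x) < ennreal e)"

lemma H10_imp_approx:
  assumes "H10 D u"
  obtains G where "weak_grad D u G" "H10_approx D u G"
proof -
  from assms obtain G \<eta> where G: "weak_grad D u G" "\<And>j. test_function D (\<eta> j)"
    "L2_tendsto D \<eta> u" "L2_tendsto D (\<lambda>j. grad (\<eta> j)) G"
    unfolding H10_def by blast
  have "H10_approx D u G"
    unfolding H10_approx_def
  proof (intro conjI allI impI)
    show "in_L2 D u" "in_L2 D G" using G by (auto simp: L2_tendsto_iff)
    fix e :: real assume e: "0 < e"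
    have "(\<lambda>N. sqn D (\<lambda>x. \<eta> N x - u x)) \<longlonglongrightarrow> 0" "(\<lambda>N. sqn D (\<lambda>x. grad (\<eta> N) x - G x)) \<longlonglongrightarrow> 0"
      using G by (auto simp: L2_tendsto_iff)
    then have "\<forall>\<^sub>F N in sequentially. sqn D (\<lambda>x. \<eta> N x - u x) < ennreal e"
      "\<forall>\<^sub>F N in sequentially. sqn D (\<lambda>x. grad (\<eta> N) x - G x) < ennreal e"
      using e by (auto intro!: order_tendstoD(2)[of _ 0])
    then have "\<forall>\<^sub>F N in sequentially. sqn D (\<lambda>x. \<eta> N x - u x) < ennreal e \<and> sqn D (\<lambda>x. grad (\<eta> N) x - G x) < ennreal e"
      by eventually_elim simp
    then show "\<exists>\<eta>. test_function D \<eta> \<and> sqn D (\<lambda>x. \<eta> x - u x) < ennreal e \<and> sqn D (\<lambda>x. grad \<eta> x - G x) < ennreal e"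
      using G(2) by (auto simp: eventually_sequentially)
  qed
  then show ?thesis using that G(1) by blast
qed

lemma H10_approx_imp_sequence:
  assumes D: "D \<in> sets borel" and H: "H10_approx D u G"
  obtains \<eta> where "\<And>j. test_function D (\<eta> j)" "L2_tendsto D \<eta> u" "L2_tendsto D (\<lambda>j. grad (\<eta> j)) G"
proof -
  have "\<forall>j. \<exists>\<eta>. test_function D \<eta> \<and> sqn D (\<lambda>x. \<eta> x - u x) < ennreal (1 / real (Suc j))
      \<and> sqn D (\<lambda>x. grad \<eta> x - G x) < ennreal (1 / real (Suc j))"
    using H unfolding H10_approx_def by simp
  from choice[OF this] obtain \<eta> where \<eta>: "\<And>j. test_function D (\<eta> j)"
    "\<And>j. sqn D (\<lambda>x. \<eta> j x - u x) < ennreal (1 / real (Suc j))"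
    "\<And>j. sqn D (\<lambda>x. grad (\<eta> j) x - G x) < ennreal (1 / real (Suc j))" by blast
  have z: "(\<lambda>j. ennreal (1 / real (Suc j))) \<longlonglongrightarrow> 0"
  proof -
    have "(\<lambda>j. 1 / real (Suc j)) \<longlonglongrightarrow> 0" by (rule LIMSEQ_Suc[OF lim_1_over_n])
    then have "(\<lambda>j. ennreal (1 / real (Suc j))) \<longlonglongrightarrow> ennreal 0" by (intro tendsto_ennrealI)
    then show ?thesis by simp
  qed
  have "(\<lambda>j. sqn D (\<lambda>x. \<eta> j x - u x)) \<longlonglongrightarrow> 0"
    by (rule tendsto_sandwich[OF _ _ tendsto_const z]) (use \<eta>(2) in \<open>auto intro!: always_eventually less_imp_le\<close>)
  moreover have "(\<lambda>j. sqn D (\<lambda>x. grad (\<eta> j) x - G x)) \<longlonglongrightarrow> 0"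
    by (rule tendsto_sandwich[OF _ _ tendsto_const z]) (use \<eta>(3) in \<open>auto intro!: always_eventually less_imp_le\<close>)
  ultimately have "L2_tendsto D \<eta> u" "L2_tendsto D (\<lambda>j. grad (\<eta> j)) G"
    using H test_function_in_L2[OF \<eta>(1) D] by (auto simp: L2_tendsto_iff H10_approx_def)
  then show ?thesis using that \<eta>(1) by blast
qed

lemma H10_approx_limit:
  assumes H: "\<And>N. H10_approx D (u' N) (G' N)" and u: "L2_tendsto D u' u" and G: "L2_tendsto D G' G"
    and D: "D \<in> sets borel"
  shows "H10_approx D u G"
  unfolding H10_approx_def
proof (intro conjI allI impI)
  show L: "in_L2 D u" "in_L2 D G" using u G by (auto simp: L2_tendsto_iff)
  fix e :: real assume e: "0 < e"
  have "(\<lambda>N. sqn D (\<lambda>x. u' N x - u x)) \<longlonglongrightarrow> 0" "(\<lambda>N. sqn D (\<lambda>x. G' N x - G x)) \<longlonglongrightarrow> 0"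
    using u G by (auto simp: L2_tendsto_iff)
  then have "\<forall>\<^sub>F N in sequentially. sqn D (\<lambda>x. u' N x - u x) < ennreal (e / 4)"
    "\<forall>\<^sub>F N in sequentially. sqn D (\<lambda>x. G' N x - G x) < ennreal (e / 4)"
    using e by (auto intro!: order_tendstoD(2)[of _ 0])
  then have "\<forall>\<^sub>F N in sequentially. sqn D (\<lambda>x. u' N x - u x) < ennreal (e / 4) \<and> sqn D (\<lambda>x. G' N x - G x) < ennreal (e / 4)"
    by eventually_elim simp
  then obtain N where N: "sqn D (\<lambda>x. u' N x - u x) < ennreal (e / 4)" "sqn D (\<lambda>x. G' N x - G x) < ennreal (e / 4)"
    by (auto simp: eventually_sequentially)
  obtain \<eta> where \<eta>: "test_function D \<eta>" "sqn D (\<lambda>x. \<eta> x - u' N x) < ennreal (e / 4)"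
    "sqn D (\<lambda>x. grad \<eta> x - G' N x) < ennreal (e / 4)"
    using H[of N] e unfolding H10_approx_def by (meson divide_pos_pos zero_less_numeral)
  \<comment> \<open>The triangle inequality for squared norms has a factor 2 on both terms, hence
    the fourth parts of \<open>e\<close>.\<close>
  have quarter: "2 * a + 2 * b < ennreal e" if "a < ennreal (e / 4)" "b < ennreal (e / 4)" for a b
  proof -
    define x where "x = enn2real a"
    define y where "y = enn2real b"
    have "a < top" "b < top" using that ennreal_less_top less_trans by blast+
    then have xy: "a = ennreal x" "b = ennreal y" "0 \<le> x" "0 \<le> y" by (simp_all add: x_def y_def)
    then have "x < e / 4" "y < e / 4" using that e by (auto simp: ennreal_less_iff)
    then have "2 * x + 2 * y < e" by simp
    then have "ennreal (2 * x + 2 * y) < ennreal e" using xy by (intro ennreal_lessI) (use e in auto)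
    then show ?thesis using xy by (simp add: ennreal_mult)
  qed
  note m = in_L2_measurable
  have Lu: "in_L2 D (u' N)" "in_L2 D (G' N)" using u G by (auto simp: L2_tendsto_iff)
  note t = test_function_in_L2[OF \<eta>(1) D]
  have "sqn D (\<lambda>x. \<eta> x - u x) < ennreal e"
    using sqn_triangle[OF m[OF t(1)] m[OF Lu(1)] m[OF L(1)]] quarter[OF \<eta>(2) N(1)] by (rule le_less_trans)
  moreover have "sqn D (\<lambda>x. grad \<eta> x - G x) < ennreal e"
    using sqn_triangle[OF m[OF t(2)] m[OF Lu(2)] m[OF L(2)]] quarter[OF \<eta>(3) N(2)] by (rule le_less_trans)
  ultimately show "\<exists>\<eta>. test_function D \<eta> \<and> sqn D (\<lambda>x. \<eta> x - u x) < ennreal e \<and> sqn D (\<lambda>x. grad \<eta> x - G x) < ennreal e"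
    using \<eta>(1) by blast
qed

section \<open>Finite sums in the closure of the test functions\<close>

lemma GDERIV_sum_scaled:
  assumes "finite I" "\<And>k. k \<in> I \<Longrightarrow> GDERIV (f k) x :> D k"
  shows "GDERIV (\<lambda>x. \<Sum>k\<in>I. c k * f k x) x :> (\<Sum>k\<in>I. c k *\<^sub>R D k)"
  using assms
proof (induction I)
  case empty
  then show ?case by (simp add: gderiv_def)
next
  case (insert i I)
  have "((\<lambda>x. c i * f i x) has_derivative (\<lambda>h. c i * (h \<bullet> D i))) (at x)"
    using insert by (auto simp: gderiv_def intro!: derivative_eq_intros)
  then have "GDERIV (\<lambda>x. c i * f i x) x :> c i *\<^sub>R D i" by (simp add: gderiv_def)
  from GDERIV_add[OF this insert.IH] insert show ?case by simp
qed

lemma test_function_sum: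
  assumes D: "finite I" "\<And>k. k \<in> I \<Longrightarrow> test_function D (\<eta> k)"
  shows "test_function D (\<lambda>x. \<Sum>k\<in>I. c k * \<eta> k x)"
    "grad (\<lambda>x. \<Sum>k\<in>I. c k * \<eta> k x) = (\<lambda>x. \<Sum>k\<in>I. c k *\<^sub>R grad (\<eta> k) x)"
proof -
  have "Ck n (\<lambda>x. \<Sum>k\<in>I. c k * \<eta> k x)" for n
    using D by (induction I rule: finite_induct) (auto intro!: Ck_add Ck_mult Ck_const simp: test_function_def)
  moreover have sub: "closure {x. (\<Sum>k\<in>I. c k * \<eta> k x) \<noteq> 0} \<subseteq> (\<Union>k\<in>I. closure {x. \<eta> k x \<noteq> 0})"
  proof (rule closure_minimal)
    show "{x. (\<Sum>k\<in>I. c k * \<eta> k x) \<noteq> 0} \<subseteq> (\<Union>k\<in>I. closure {x. \<eta> k x \<noteq> 0})"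
    proof
      fix x assume "x \<in> {x. (\<Sum>k\<in>I. c k * \<eta> k x) \<noteq> 0}"
      then obtain k where "k \<in> I" "\<eta> k x \<noteq> 0" by (metis (mono_tags, lifting) mem_Collect_eq mult_zero_right sum.neutral)
      then show "x \<in> (\<Union>k\<in>I. closure {x. \<eta> k x \<noteq> 0})" using closure_subset[of "{x. \<eta> k x \<noteq> 0}"] by blast
    qed
    show "closed (\<Union>k\<in>I. closure {x. \<eta> k x \<noteq> 0})" using D(1) by (intro closed_UN) auto
  qed
  have "compact (\<Union>k\<in>I. closure {x. \<eta> k x \<noteq> 0})"
    using D by (intro compact_UN) (auto simp: test_function_def)
  then have "compact (closure {x. (\<Sum>k\<in>I. c k * \<eta> k x) \<noteq> 0})"
    using bounded_subset[OF compact_imp_bounded sub] by (simp add: compact_eq_bounded_closed)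
  moreover have "(\<Union>k\<in>I. closure {x. \<eta> k x \<noteq> 0}) \<subseteq> D" using D by (auto simp: test_function_def)
  ultimately show "test_function D (\<lambda>x. \<Sum>k\<in>I. c k * \<eta> k x)"
    unfolding test_function_def using sub by blast
  show "grad (\<lambda>x. \<Sum>k\<in>I. c k * \<eta> k x) = (\<lambda>x. \<Sum>k\<in>I. c k *\<^sub>R grad (\<eta> k) x)"
  proof
    fix x
    show "grad (\<lambda>x. \<Sum>k\<in>I. c k * \<eta> k x) x = (\<Sum>k\<in>I. c k *\<^sub>R grad (\<eta> k) x)"
      by (intro grad_eq GDERIV_sum_scaled D(1) test_function_grad(1)[OF D(2)])
  qed
qed

lemma L2_tendsto_add:
  assumes "L2_tendsto D u' u" "L2_tendsto D w' w"
  shows "L2_tendsto D (\<lambda>N x. u' N x + w' N x) (\<lambda>x. u x + w x)"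
proof -
  have L: "in_L2 D (u' N)" "in_L2 D u" "in_L2 D (w' N)" "in_L2 D w" for N
    using assms by (auto simp: L2_tendsto_iff)
  have "(\<lambda>N. 2 * sqn D (\<lambda>x. u' N x - u x) + 2 * sqn D (\<lambda>x. w' N x - w x)) \<longlonglongrightarrow> 2 * 0 + 2 * 0"
    using assms by (intro tendsto_add ennreal_tendsto_cmult) (auto simp: L2_tendsto_iff)
  then have z: "(\<lambda>N. 2 * sqn D (\<lambda>x. u' N x - u x) + 2 * sqn D (\<lambda>x. w' N x - w x)) \<longlonglongrightarrow> 0" by simp
  have "sqn D (\<lambda>x. u' N x + w' N x - (u x + w x)) \<le> 2 * sqn D (\<lambda>x. u' N x - u x) + 2 * sqn D (\<lambda>x. w' N x - w x)" for N
    using sqn_add_le[OF in_L2_measurable[OF in_L2_diff[OF L(1,2)]] in_L2_measurable[OF in_L2_diff[OF L(3,4)]]]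
    by (simp add: algebra_simps)
  then have "(\<lambda>N. sqn D (\<lambda>x. u' N x + w' N x - (u x + w x))) \<longlonglongrightarrow> 0"
    by (intro tendsto_sandwich[OF _ _ tendsto_const z] always_eventually allI) auto
  then show ?thesis using L by (simp add: L2_tendsto_iff in_L2_add)
qed

lemma L2_tendsto_scaleR:
  assumes "L2_tendsto D u' u"
  shows "L2_tendsto D (\<lambda>N x. c *\<^sub>R u' N x) (\<lambda>x. c *\<^sub>R u x)"
proof -
  have L: "in_L2 D (u' N)" "in_L2 D u" for N using assms by (auto simp: L2_tendsto_iff)
  have "(\<lambda>N. ennreal (c\<^sup>2) * sqn D (\<lambda>x. u' N x - u x)) \<longlonglongrightarrow> ennreal (c\<^sup>2) * 0"
    using assms by (intro ennreal_tendsto_cmult) (auto simp: L2_tendsto_iff)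
  moreover have "sqn D (\<lambda>x. c *\<^sub>R u' N x - c *\<^sub>R u x) = ennreal (c\<^sup>2) * sqn D (\<lambda>x. u' N x - u x)" for N
    using sqn_scaleR[OF in_L2_measurable[OF in_L2_diff[OF L]]] by (simp add: scaleR_diff_right)
  ultimately show ?thesis using L by (simp add: L2_tendsto_iff in_L2_scaleR)
qed

lemma L2_tendsto_const: "in_L2 D u \<Longrightarrow> L2_tendsto D (\<lambda>N. u) u"
  by (simp add: L2_tendsto_iff sqn_def)

lemma L2_tendsto_sum:
  assumes "\<And>k. k \<in> I \<Longrightarrow> L2_tendsto D (u' k) (u k)"
  shows "L2_tendsto D (\<lambda>N x. \<Sum>k\<in>I. u' k N x) (\<lambda>x. \<Sum>k\<in>I. u k x)"
  using assms
  by (induction I rule: infinite_finite_induct) (auto intro: L2_tendsto_add L2_tendsto_const in_L2_zero)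

lemma H10_approx_sum:
  assumes D: "D \<in> sets borel" and I: "finite I" and H: "\<And>k. k \<in> I \<Longrightarrow> H10_approx D (u k) (G k)"
  shows "H10_approx D (\<lambda>x. \<Sum>k\<in>I. c k * u k x) (\<lambda>x. \<Sum>k\<in>I. c k *\<^sub>R G k x)"
proof -
  have "\<forall>k. \<exists>\<eta>. k \<in> I \<longrightarrow> (\<forall>j. test_function D (\<eta> j)) \<and> L2_tendsto D \<eta> (u k) \<and> L2_tendsto D (\<lambda>j. grad (\<eta> j)) (G k)"
    using H10_approx_imp_sequence[OF D H] by metis
  from choice[OF this] obtain \<eta> where \<eta>: "\<And>k j. k \<in> I \<Longrightarrow> test_function D (\<eta> k j)"
    "\<And>k. k \<in> I \<Longrightarrow> L2_tendsto D (\<eta> k) (u k)" "\<And>k. k \<in> I \<Longrightarrow> L2_tendsto D (\<lambda>j. grad (\<eta> k j)) (G k)"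
    by blast
  have t: "test_function D (\<lambda>x. \<Sum>k\<in>I. c k * \<eta> k j x)"
    "grad (\<lambda>x. \<Sum>k\<in>I. c k * \<eta> k j x) = (\<lambda>x. \<Sum>k\<in>I. c k *\<^sub>R grad (\<eta> k j) x)" for j
    by (rule test_function_sum[OF I], rule \<eta>(1), assumption)+
  have 1: "L2_tendsto D (\<lambda>j x. \<Sum>k\<in>I. c k * \<eta> k j x) (\<lambda>x. \<Sum>k\<in>I. c k * u k x)"
  proof -
    have "L2_tendsto D (\<lambda>j x. \<Sum>k\<in>I. c k *\<^sub>R \<eta> k j x) (\<lambda>x. \<Sum>k\<in>I. c k *\<^sub>R u k x)"
      using \<eta>(2) by (intro L2_tendsto_sum L2_tendsto_scaleR)
    then show ?thesis by simp
  qed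
  have 2: "L2_tendsto D (\<lambda>j x. \<Sum>k\<in>I. c k *\<^sub>R grad (\<eta> k j) x) (\<lambda>x. \<Sum>k\<in>I. c k *\<^sub>R G k x)"
    using \<eta>(3) by (intro L2_tendsto_sum L2_tendsto_scaleR)
  have tL: "H10_approx D (\<lambda>x. \<Sum>k\<in>I. c k * \<eta> k j x) (\<lambda>x. \<Sum>k\<in>I. c k *\<^sub>R grad (\<eta> k j) x)" for j
    unfolding H10_approx_def
  proof (intro conjI allI impI)
    show "in_L2 D (\<lambda>x. \<Sum>k\<in>I. c k * \<eta> k j x)" "in_L2 D (\<lambda>x. \<Sum>k\<in>I. c k *\<^sub>R grad (\<eta> k j) x)"
      using 1 2 by (auto simp: L2_tendsto_iff)
    fix e :: real assume "0 < e"
    then show "\<exists>\<zeta>. test_function D \<zeta> \<and> sqn D (\<lambda>x. \<zeta> x - (\<Sum>k\<in>I. c k * \<eta> k j x)) < ennreal e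
        \<and> sqn D (\<lambda>x. grad \<zeta> x - (\<Sum>k\<in>I. c k *\<^sub>R grad (\<eta> k j) x)) < ennreal e"
      using t[of j] by (intro exI[of _ "\<lambda>x. \<Sum>k\<in>I. c k * \<eta> k j x"]) (simp add: sqn_def)
  qed
  show ?thesis by (rule H10_approx_limit[OF tL 1 2 D])
qed

text \<open>Completeness of Lebesgue measure; it transfers measurability between integrands built
  from two versions of a weak gradient.\<close>

lemma borel_measurable_AE_cong:
  fixes f g :: "'a::euclidean_space \<Rightarrow> 'b::euclidean_space"
  assumes S: "S \<in> sets borel" and f: "f \<in> borel_measurable (lebesgue_on S)"
    and eq: "AE x in lebesgue_on S. f x = g x"
  shows "g \<in> borel_measurable (lebesgue_on S)"
  unfolding borel_measurable_lebesgue_on_iff[OF S]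
proof (rule measurableI)
  let ?f = "\<lambda>x. indicator S x *\<^sub>R f x" and ?g = "\<lambda>x. indicator S x *\<^sub>R g x"
  have ae: "AE x in lebesgue. ?f x = ?g x"
    using eq unfolding AE_lebesgue_on_iff[OF S] AE_completion_iff by eventually_elim (auto simp: indicator_def)
  fix B :: "'b set" assume B: "B \<in> sets borel"
  have 1: "?f -` B \<inter> space lebesgue \<in> sets lebesgue"
    using f B unfolding borel_measurable_lebesgue_on_iff[OF S] by (rule measurable_sets)
  have 2: "AE x in lebesgue. x \<in> ?f -` B \<inter> space lebesgue \<longleftrightarrow> x \<in> ?g -` B \<inter> space lebesgue"
    using ae by eventually_elim (simp only: vimage_eq Int_iff)
  show "?g -` B \<inter> space lebesgue \<in> sets lebesgue"
    by (rule completion.in_sets_AE[OF 2 1]) simp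
qed simp

section \<open>The coefficients as multipliers, and the energy form\<close>

lemma norm_matrix_vector_mult_le:
  fixes A :: "real^'n^'m"
  shows "norm (A *v x) \<le> real CARD('m) * norm A * norm x"
proof -
  have "norm (A *v x) \<le> (\<Sum>i\<in>UNIV. \<bar>(A *v x) $ i\<bar>)" by (rule norm_le_l1_cart)
  also have "\<dots> \<le> (\<Sum>i\<in>(UNIV :: 'm set). norm A * norm x)"
  proof (rule sum_mono)
    fix i
    have "\<bar>(A *v x) $ i\<bar> = \<bar>A $ i \<bullet> x\<bar>" by (simp add: matrix_vector_mul_component)
    also have "\<dots> \<le> norm (A $ i) * norm x" by (rule Cauchy_Schwarz_ineq2)
    also have "\<dots> \<le> norm A * norm x" by (intro mult_right_mono Finite_Cartesian_Product.norm_nth_le) auto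
    finally show "\<bar>(A *v x) $ i\<bar> \<le> norm A * norm x" .
  qed
  finally show ?thesis by simp
qed

text \<open>A Lipschitz matrix field on a bounded set is continuous and bounded, and
  \<open>c\<close> is bounded almost everywhere; one constant \<open>K\<close> serves both
  multiplications.\<close>

lemma coefficient_multipliers:
  fixes \<Omega> :: "(real^'n) set"
  assumes \<Omega>: "open \<Omega>" "bounded \<Omega>" and adm: "admissible_coefficients \<Omega> A c"
  obtains K where "\<And>G. in_L2 \<Omega> G \<Longrightarrow> in_L2 \<Omega> (\<lambda>x. A x *v G x)"
    "\<And>G. in_L2 \<Omega> G \<Longrightarrow> sqn \<Omega> (\<lambda>x. A x *v G x) \<le> ennreal (K\<^sup>2) * sqn \<Omega> G"
    "\<And>w. in_L2 \<Omega> w \<Longrightarrow> in_L2 \<Omega> (\<lambda>x. c x * w x)"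
    "\<And>w. in_L2 \<Omega> w \<Longrightarrow> sqn \<Omega> (\<lambda>x. c x * w x) \<le> ennreal (K\<^sup>2) * sqn \<Omega> w"
proof -
  have \<Omega>b: "\<Omega> \<in> sets borel" using \<Omega> by simp
  obtain L where L: "L-lipschitz_on \<Omega> A" using adm unfolding admissible_coefficients_def by blast
  obtain M where M: "AE x in lebesgue_on \<Omega>. 0 \<le> c x \<and> c x \<le> M"
    using adm unfolding admissible_coefficients_def by blast
  have cm: "c \<in> borel_measurable (lebesgue_on \<Omega>)" using adm unfolding admissible_coefficients_def by blast
  have "\<exists>B. \<forall>x\<in>\<Omega>. norm (A x) \<le> B"
  proof -
    have "bounded (A ` \<Omega>)"
      by (rule bounded_uniformly_continuous_image[OF lipschitz_on_uniformly_continuous[OF L] \<Omega>(2)])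
    then show ?thesis by (auto simp: bounded_iff)
  qed
  then obtain B where B: "\<And>x. x \<in> \<Omega> \<Longrightarrow> norm (A x) \<le> B" by blast
  define K where "K = real CARD('n) * \<bar>B\<bar> + \<bar>M\<bar>"
  have Am: "A \<in> borel_measurable (lebesgue_on \<Omega>)"
    by (rule continuous_imp_measurable_on_sets_lebesgue[OF lipschitz_on_continuous_on[OF L]])
      (use \<Omega>b in \<open>simp add: sets_completionI_sets\<close>)
  have Kle: "norm (A x *v \<xi>) \<le> K * norm \<xi>" if "x \<in> \<Omega>" for x \<xi>
  proof -
    have "norm (A x *v \<xi>) \<le> real CARD('n) * norm (A x) * norm \<xi>" by (rule norm_matrix_vector_mult_le)
    also have "\<dots> \<le> K * norm \<xi>"
      using B[OF that] unfolding K_def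
      by (intro mult_right_mono order_trans[OF mult_left_mono[of "norm (A x)" "\<bar>B\<bar>"]]) auto
    finally show ?thesis .
  qed
  have m1: "(\<lambda>x. A x *v G x) \<in> borel_measurable (lebesgue_on \<Omega>)" if "in_L2 \<Omega> G" for G
  proof (rule borel_measurable_continuous_Pair[OF Am in_L2_measurable[OF that]])
    show "continuous_on UNIV (\<lambda>x :: (real^'n^'n) \<times> (real^'n). fst x *v snd x)"
      unfolding matrix_vector_mult_def by (intro continuous_intros continuous_on_vec_lambda)
  qed
  have ae1: "AE x in lebesgue_on \<Omega>. norm (A x *v G x) \<le> K * norm (G x)" for G
    unfolding AE_lebesgue_on_iff[OF \<Omega>b] using Kle by auto
  have ae2: "AE x in lebesgue_on \<Omega>. norm (c x * w x) \<le> K * norm (w x)" for w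
    using M
  proof eventually_elim
    case (elim x)
    then have "\<bar>c x\<bar> \<le> K" unfolding K_def by (auto intro: order_trans[OF _ le_add_same_cancel2[THEN iffD2]])
    then show ?case by (simp add: abs_mult mult_right_mono)
  qed
  have m2: "(\<lambda>x. c x * w x) \<in> borel_measurable (lebesgue_on \<Omega>)" if "in_L2 \<Omega> w" for w
    using cm in_L2_measurable[OF that] by (rule borel_measurable_times)
  show ?thesis
    by (rule that[of K]) (use in_L2_bounded_mult m1 m2 ae1 ae2 in blast)+
qed

lemma L2_tendsto_multiplier:
  assumes L: "L2_tendsto D w v" and T: "\<And>u. in_L2 D u \<Longrightarrow> in_L2 D (T u)"
    and K: "\<And>u. in_L2 D u \<Longrightarrow> sqn D (T u) \<le> ennreal K * sqn D u"
    and lin: "\<And>u u'. T (\<lambda>x. u x - u' x) = (\<lambda>x. T u x - T u' x)"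
  shows "L2_tendsto D (\<lambda>N. T (w N)) (T v)"
proof -
  have i: "in_L2 D (w N)" "in_L2 D v" for N using L by (auto simp: L2_tendsto_iff)
  have "(\<lambda>N. ennreal K * sqn D (\<lambda>x. w N x - v x)) \<longlonglongrightarrow> ennreal K * 0"
    using L by (intro ennreal_tendsto_cmult) (auto simp: L2_tendsto_iff)
  then have z: "(\<lambda>N. ennreal K * sqn D (\<lambda>x. w N x - v x)) \<longlonglongrightarrow> 0" by simp
  have "sqn D (\<lambda>x. T (w N) x - T v x) \<le> ennreal K * sqn D (\<lambda>x. w N x - v x)" for N
    using K[OF in_L2_diff[OF i]] by (simp add: lin)
  then have "(\<lambda>N. sqn D (\<lambda>x. T (w N) x - T v x)) \<longlonglongrightarrow> 0"
    by (intro tendsto_sandwich[OF _ _ tendsto_const z] always_eventually allI) auto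
  then show ?thesis using i T by (simp add: L2_tendsto_iff)
qed

text \<open>The gradients are separate arguments because weak gradients are determined only up to
  null sets and are carried along with their functions.\<close>

definition energy_form ::
    "(real^'n) set \<Rightarrow> (real^'n \<Rightarrow> real^'n^'n) \<Rightarrow> (real^'n \<Rightarrow> real) \<Rightarrow>
     (real^'n \<Rightarrow> real) \<Rightarrow> (real^'n \<Rightarrow> real^'n) \<Rightarrow> (real^'n \<Rightarrow> real) \<Rightarrow> (real^'n \<Rightarrow> real^'n) \<Rightarrow> real" where
  "energy_form \<Omega> A c w G u H = (\<integral>x. (A x *v G x) \<bullet> H x + c x * w x * u x \<partial>lebesgue_on \<Omega>)"

text \<open>\<open>elliptic_eq\<close> provides two gradients, one as a limit of gradients of test
  functions and one in the weak equation. Uniqueness of weak derivatives makes them equal almost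
  everywhere, so a single \<open>G\<close> has both properties.\<close>

lemma eigen_gradient_exists:
  fixes \<Omega> :: "(real^'n) set"
  assumes \<Omega>: "open \<Omega>" "bounded \<Omega>" and adm: "admissible_coefficients \<Omega> A c"
    and ell: "elliptic_eq \<Omega> A c w v"
  obtains G where "weak_grad \<Omega> w G" "H10_approx \<Omega> w G"
    "\<And>\<eta>. test_function \<Omega> \<eta> \<Longrightarrow> energy_form \<Omega> A c w G \<eta> (grad \<eta>) = (\<integral>x. v x * \<eta> x \<partial>lebesgue_on \<Omega>)"
proof -
  have \<Omega>b: "\<Omega> \<in> sets borel" using \<Omega> by simp
  have "H10 \<Omega> w" using ell unfolding elliptic_eq_def by blast
  then obtain G where G: "weak_grad \<Omega> w G" "H10_approx \<Omega> w G" by (rule H10_imp_approx)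
  obtain G' where G': "weak_grad \<Omega> w G'"
    "\<And>\<eta>. test_function \<Omega> \<eta> \<Longrightarrow> (\<integral>x. (A x *v G' x) \<bullet> grad \<eta> x + c x * w x * \<eta> x \<partial>lebesgue_on \<Omega>)
            = (\<integral>x. v x * \<eta> x \<partial>lebesgue_on \<Omega>)"
    using ell unfolding elliptic_eq_def by blast
  have "AE x in lebesgue_on \<Omega>. \<forall>e\<in>Basis. G x \<bullet> e = G' x \<bullet> e"
  proof (subst AE_ball_countable)
    show "\<forall>e\<in>Basis. AE x in lebesgue_on \<Omega>. G x \<bullet> e = G' x \<bullet> e"
      using G(1) G'(1) weak_deriv_unique[OF \<Omega>(1)] unfolding weak_grad_def by blast
  qed (auto intro: countable_finite)
  then have eq: "AE x in lebesgue_on \<Omega>. G x = G' x"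
    by eventually_elim (auto intro: euclidean_eqI)
  from coefficient_multipliers[OF \<Omega> adm] obtain K where K: "\<And>G. in_L2 \<Omega> G \<Longrightarrow> in_L2 \<Omega> (\<lambda>x. A x *v G x)"
    "\<And>w. in_L2 \<Omega> w \<Longrightarrow> in_L2 \<Omega> (\<lambda>x. c x * w x)" by blast
  have L: "in_L2 \<Omega> w" "in_L2 \<Omega> G" using G(2) unfolding H10_approx_def by auto
  have "energy_form \<Omega> A c w G \<eta> (grad \<eta>) = (\<integral>x. v x * \<eta> x \<partial>lebesgue_on \<Omega>)" if t: "test_function \<Omega> \<eta>" for \<eta>
  proof -
    let ?f = "\<lambda>G x. (A x *v G x) \<bullet> grad \<eta> x + c x * w x * \<eta> x"
    have m: "?f G \<in> borel_measurable (lebesgue_on \<Omega>)"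
      using in_L2_measurable[OF K(1)[OF L(2)]] in_L2_measurable[OF K(2)[OF L(1)]]
        in_L2_measurable[OF test_function_in_L2(1)[OF t \<Omega>b]] in_L2_measurable[OF test_function_in_L2(2)[OF t \<Omega>b]]
      by measurable
    have ae: "AE x in lebesgue_on \<Omega>. ?f G x = ?f G' x" using eq by eventually_elim simp
    have "(\<integral>x. ?f G x \<partial>lebesgue_on \<Omega>) = (\<integral>x. ?f G' x \<partial>lebesgue_on \<Omega>)"
      by (rule integral_cong_AE[OF m borel_measurable_AE_cong[OF \<Omega>b m ae] ae])
    then show ?thesis using G'(2)[OF t] unfolding energy_form_def by simp
  qed
  then show ?thesis using that G by blast
qed

lemma energy_form_split:
  assumes "in_L2 \<Omega> (\<lambda>x. A x *v G x)" "in_L2 \<Omega> (\<lambda>x. c x * w x)" "in_L2 \<Omega> u" "in_L2 \<Omega> H"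
  shows "integrable (lebesgue_on \<Omega>) (\<lambda>x. (A x *v G x) \<bullet> H x + c x * w x * u x)"
    "energy_form \<Omega> A c w G u H = (\<integral>x. (A x *v G x) \<bullet> H x \<partial>lebesgue_on \<Omega>) + (\<integral>x. c x * w x * u x \<partial>lebesgue_on \<Omega>)"
proof -
  have 1: "integrable (lebesgue_on \<Omega>) (\<lambda>x. (A x *v G x) \<bullet> H x)" by (rule L2_inner_bound(1)[OF assms(1,4)])
  have 2: "integrable (lebesgue_on \<Omega>) (\<lambda>x. c x * w x * u x)" using L2_inner_bound(1)[OF assms(2,3)] by simp
  show "integrable (lebesgue_on \<Omega>) (\<lambda>x. (A x *v G x) \<bullet> H x + c x * w x * u x)" using 1 2 by simp
  show "energy_form \<Omega> A c w G u H = (\<integral>x. (A x *v G x) \<bullet> H x \<partial>lebesgue_on \<Omega>) + (\<integral>x. c x * w x * u x \<partial>lebesgue_on \<Omega>)"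
    unfolding energy_form_def using 1 2 by simp
qed

text \<open>Both sides are continuous in the tested function and its gradient, so density of the
  test functions extends the weak equation. This permits testing with the eigenfunctions
  themselves.\<close>

lemma energy_form_H10:
  assumes \<Omega>b: "\<Omega> \<in> sets borel" and L: "in_L2 \<Omega> (\<lambda>x. A x *v G x)" "in_L2 \<Omega> (\<lambda>x. c x * w x)" "in_L2 \<Omega> v"
    and weak: "\<And>\<eta>. test_function \<Omega> \<eta> \<Longrightarrow> energy_form \<Omega> A c w G \<eta> (grad \<eta>) = (\<integral>x. v x * \<eta> x \<partial>lebesgue_on \<Omega>)"
    and H: "H10_approx \<Omega> u U"
  shows "energy_form \<Omega> A c w G u U = (\<integral>x. v x * u x \<partial>lebesgue_on \<Omega>)"
proof -
  obtain \<eta> where \<eta>: "\<And>j. test_function \<Omega> (\<eta> j)" "L2_tendsto \<Omega> \<eta> u" "L2_tendsto \<Omega> (\<lambda>j. grad (\<eta> j)) U"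
    using H10_approx_imp_sequence[OF \<Omega>b H] by blast
  have uU: "in_L2 \<Omega> u" "in_L2 \<Omega> U" using H unfolding H10_approx_def by auto
  note t = test_function_in_L2[OF \<eta>(1) \<Omega>b]
  have "(\<lambda>j. \<integral>x. (A x *v G x) \<bullet> grad (\<eta> j) x \<partial>lebesgue_on \<Omega>) \<longlonglongrightarrow> (\<integral>x. (A x *v G x) \<bullet> U x \<partial>lebesgue_on \<Omega>)"
    using L2_tendsto_inner[OF \<eta>(3) L(1)] by (simp add: inner_commute)
  moreover have "(\<lambda>j. \<integral>x. c x * w x * \<eta> j x \<partial>lebesgue_on \<Omega>) \<longlonglongrightarrow> (\<integral>x. c x * w x * u x \<partial>lebesgue_on \<Omega>)"
    using L2_tendsto_mult[OF \<eta>(2) L(2)] by (simp add: mult.commute)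
  ultimately have "(\<lambda>j. energy_form \<Omega> A c w G (\<eta> j) (grad (\<eta> j))) \<longlonglongrightarrow> energy_form \<Omega> A c w G u U"
    unfolding energy_form_split(2)[OF L(1,2) uU] energy_form_split(2)[OF L(1,2) t(1,2)] by (rule tendsto_add)
  moreover have "(\<lambda>j. \<integral>x. v x * \<eta> j x \<partial>lebesgue_on \<Omega>) \<longlonglongrightarrow> (\<integral>x. v x * u x \<partial>lebesgue_on \<Omega>)"
    using L2_tendsto_mult[OF \<eta>(2) L(3)] by (simp add: mult.commute)
  ultimately show ?thesis unfolding weak[OF \<eta>(1)] by (rule LIMSEQ_unique)
qed

lemma matrix_vector_mult_sum_scaleR:
  fixes A :: "real^'n^'m"
  shows "A *v (\<Sum>k\<in>I. c k *\<^sub>R G k) = (\<Sum>k\<in>I. c k *\<^sub>R (A *v G k))"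
  using linear_sum[OF matrix_vector_mul_linear[of A], of "\<lambda>k. c k *\<^sub>R G k" I]
  by (simp add: matrix_vector_mult_scaleR)

text \<open>The Bessel inequality of the gradients comes from the ellipticity and from the orthogonality of the
  eigenfunctions in the energy form.\<close>

lemma eigenbasis_gradients:
  fixes \<Omega> :: "(real^'n) set"
  assumes \<Omega>: "open \<Omega>" "bounded \<Omega>" and adm: "admissible_coefficients \<Omega> A c"
    and eb: "eigenbasis \<Omega> A c lam \<phi>"
  obtains G a where "0 < a" "\<And>k. weak_grad \<Omega> (\<phi> k) (G k)" "\<And>k. H10_approx \<Omega> (\<phi> k) (G k)"
    "\<And>k \<eta>. test_function \<Omega> \<eta> \<Longrightarrow> energy_form \<Omega> A c (\<phi> k) (G k) \<eta> (grad \<eta>) = (\<integral>x. lam k * \<phi> k x * \<eta> x \<partial>lebesgue_on \<Omega>)"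
    "\<And>I b. finite I \<Longrightarrow> sqn \<Omega> (\<lambda>x. \<Sum>k\<in>I. b k *\<^sub>R G k x) \<le> ennreal (a * (\<Sum>k\<in>I. lam k * (b k)\<^sup>2))"
proof -
  have \<Omega>b: "\<Omega> \<in> sets borel" using \<Omega> by simp
  have ell: "elliptic_eq \<Omega> A c (\<phi> k) (\<lambda>x. lam k * \<phi> k x)" for k using eb unfolding eigenbasis_def by blast
  have orth: "(\<integral>x. \<phi> j x * \<phi> k x \<partial>lebesgue_on \<Omega>) = (if j = k then 1 else 0)" for j k
    using eb unfolding eigenbasis_def by blast
  have "\<forall>k. \<exists>G. weak_grad \<Omega> (\<phi> k) G \<and> H10_approx \<Omega> (\<phi> k) G \<and> (\<forall>\<eta>. test_function \<Omega> \<eta> \<longrightarrow>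
      energy_form \<Omega> A c (\<phi> k) G \<eta> (grad \<eta>) = (\<integral>x. lam k * \<phi> k x * \<eta> x \<partial>lebesgue_on \<Omega>))"
    using eigen_gradient_exists[OF \<Omega> adm ell] by metis
  from choice[OF this] obtain G where G: "\<And>k. weak_grad \<Omega> (\<phi> k) (G k)" "\<And>k. H10_approx \<Omega> (\<phi> k) (G k)"
    "\<And>k \<eta>. test_function \<Omega> \<eta> \<Longrightarrow> energy_form \<Omega> A c (\<phi> k) (G k) \<eta> (grad \<eta>) = (\<integral>x. lam k * \<phi> k x * \<eta> x \<partial>lebesgue_on \<Omega>)"
    by blast
  from coefficient_multipliers[OF \<Omega> adm] obtain K where K: "\<And>G. in_L2 \<Omega> G \<Longrightarrow> in_L2 \<Omega> (\<lambda>x. A x *v G x)"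
    "\<And>w. in_L2 \<Omega> w \<Longrightarrow> in_L2 \<Omega> (\<lambda>x. c x * w x)" by blast
  have L: "in_L2 \<Omega> (\<phi> k)" "in_L2 \<Omega> (G k)" for k using G(2) unfolding H10_approx_def by auto
  \<comment> \<open>The weak equation of \<open>\<phi> k\<close> tested with
    \<open>\<phi> j\<close>: the energy form is diagonal with entries \<open>lam k\<close>.\<close>
  have B: "energy_form \<Omega> A c (\<phi> k) (G k) (\<phi> j) (G j) = (if j = k then lam k else 0)" for j k
  proof -
    have "energy_form \<Omega> A c (\<phi> k) (G k) (\<phi> j) (G j) = (\<integral>x. lam k * \<phi> k x * \<phi> j x \<partial>lebesgue_on \<Omega>)"
      by (rule energy_form_H10[OF \<Omega>b K(1)[OF L(2)] K(2)[OF L(1)] in_L2_cmult[OF L(1)] G(3) G(2)])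
    also have "\<dots> = lam k * (\<integral>x. \<phi> k x * \<phi> j x \<partial>lebesgue_on \<Omega>)" by (simp add: mult.assoc)
    finally show ?thesis unfolding orth by auto
  qed
  obtain a where a: "0 < a" "\<And>x \<xi>. x \<in> \<Omega> \<Longrightarrow> a * (norm \<xi>)\<^sup>2 \<le> \<xi> \<bullet> (A x *v \<xi>)"
    using adm unfolding admissible_coefficients_def by blast
  obtain M where M: "AE x in lebesgue_on \<Omega>. 0 \<le> c x \<and> c x \<le> M"
    using adm unfolding admissible_coefficients_def by blast
  have bessel: "sqn \<Omega> (\<lambda>x. \<Sum>k\<in>I. b k *\<^sub>R G k x) \<le> ennreal (1 / a * (\<Sum>k\<in>I. lam k * (b k)\<^sup>2))"
    if I: "finite I" for I b
  proof -
    define S where "S x = (\<Sum>k\<in>I. b k *\<^sub>R G k x)" for x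
    define s where "s x = (\<Sum>k\<in>I. b k * \<phi> k x)" for x
    have S: "in_L2 \<Omega> S" unfolding S_def using L by (intro in_L2_sum in_L2_scaleR)
    have s: "in_L2 \<Omega> s" unfolding s_def using L by (intro in_L2_sum in_L2_cmult)
    have nS: "integrable (lebesgue_on \<Omega>) (\<lambda>x. (norm (S x))\<^sup>2)" using S unfolding in_L2_def by blast
    \<comment> \<open>The zero-order term of the energy is nonnegative, as \<open>c \<ge> 0\<close>
      almost everywhere, and only helps the lower bound.\<close>
    have "(\<integral>x. a * (norm (S x))\<^sup>2 \<partial>lebesgue_on \<Omega>) \<le> energy_form \<Omega> A c s S s S"
      unfolding energy_form_def
    proof (rule integral_mono_AE)
      show "integrable (lebesgue_on \<Omega>) (\<lambda>x. a * (norm (S x))\<^sup>2)" using nS by simp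
      show "integrable (lebesgue_on \<Omega>) (\<lambda>x. (A x *v S x) \<bullet> S x + c x * s x * s x)"
        by (rule energy_form_split(1)[OF K(1)[OF S] K(2)[OF s] s S])
      have "AE x in lebesgue_on \<Omega>. x \<in> \<Omega>" unfolding AE_lebesgue_on_iff[OF \<Omega>b] by simp
      then show "AE x in lebesgue_on \<Omega>. a * (norm (S x))\<^sup>2 \<le> (A x *v S x) \<bullet> S x + c x * s x * s x"
        using M
      proof eventually_elim
        case (elim x)
        then have "0 \<le> c x * (s x * s x)" by (intro mult_nonneg_nonneg[OF _ zero_le_square]) auto
        moreover have "a * (norm (S x))\<^sup>2 \<le> S x \<bullet> (A x *v S x)" using a(2) elim by blast
        ultimately show ?case unfolding inner_commute[of "A x *v S x"] mult.assoc by linarith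
      qed
    qed
    also have "energy_form \<Omega> A c s S s S = (\<Sum>k\<in>I. \<Sum>j\<in>I. b k * b j * energy_form \<Omega> A c (\<phi> k) (G k) (\<phi> j) (G j))"
    proof -
      have pt: "(A x *v S x) \<bullet> S x + c x * s x * s x =
          (\<Sum>k\<in>I. \<Sum>j\<in>I. b k * b j * ((A x *v G k x) \<bullet> G j x + c x * \<phi> k x * \<phi> j x))" for x
      proof -
        have "(A x *v S x) \<bullet> S x = (\<Sum>k\<in>I. (b k *\<^sub>R (A x *v G k x)) \<bullet> (\<Sum>j\<in>I. b j *\<^sub>R G j x))"
          unfolding S_def matrix_vector_mult_sum_scaleR by (rule inner_sum_left)
        also have "\<dots> = (\<Sum>k\<in>I. \<Sum>j\<in>I. b k * b j * ((A x *v G k x) \<bullet> G j x))"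
          unfolding inner_sum_right inner_scaleR_left inner_scaleR_right by (simp add: mult.assoc mult.left_commute)
        finally have "(A x *v S x) \<bullet> S x = (\<Sum>k\<in>I. \<Sum>j\<in>I. b k * b j * ((A x *v G k x) \<bullet> G j x))" .
        moreover have "c x * s x * s x = (\<Sum>k\<in>I. \<Sum>j\<in>I. b k * b j * (c x * \<phi> k x * \<phi> j x))"
          unfolding s_def by (simp add: sum_distrib_left sum_distrib_right mult_ac)
        ultimately show ?thesis by (simp add: distrib_left sum.distrib)
      qed
      have int: "integrable (lebesgue_on \<Omega>) (\<lambda>x. (A x *v G k x) \<bullet> G j x + c x * \<phi> k x * \<phi> j x)" for k j
        by (rule energy_form_split(1)[OF K(1)[OF L(2)] K(2)[OF L(1)] L])
      show ?thesis unfolding energy_form_def[of \<Omega> A c s S s S] pt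
        using int by (simp add: Bochner_Integration.integral_sum energy_form_def)
    qed
    also have "\<dots> = (\<Sum>k\<in>I. lam k * (b k)\<^sup>2)"
      unfolding B using I by (intro sum.cong refl) (simp add: if_distrib[of "\<lambda>z. _ * z"] power2_eq_square mult_ac cong: if_cong)
    finally have "(\<integral>x. (norm (S x))\<^sup>2 \<partial>lebesgue_on \<Omega>) \<le> 1 / a * (\<Sum>k\<in>I. lam k * (b k)\<^sup>2)"
      using a(1) by (simp add: field_simps)
    moreover have "sqn \<Omega> S = ennreal (\<integral>x. (norm (S x))\<^sup>2 \<partial>lebesgue_on \<Omega>)"
      unfolding sqn_def by (rule nn_integral_eq_integral[OF nS]) simp
    ultimately show ?thesis unfolding S_def[abs_def] by (simp add: ennreal_leI)
  qed
  show ?thesis by (rule that[of "1 / a" G]) (use a(1) G bessel in auto)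
qed

lemma eigenbasis_bessel:
  assumes eb: "eigenbasis \<Omega> A c lam \<phi>" and I: "finite I" and L: "\<And>k. in_L2 \<Omega> (\<phi> k)"
  shows "sqn \<Omega> (\<lambda>x. \<Sum>k\<in>I. b k *\<^sub>R \<phi> k x) = ennreal (\<Sum>k\<in>I. (b k)\<^sup>2)"
proof -
  have orth: "(\<integral>x. \<phi> j x * \<phi> k x \<partial>lebesgue_on \<Omega>) = (if j = k then 1 else 0)" for j k
    using eb unfolding eigenbasis_def by blast
  have int: "integrable (lebesgue_on \<Omega>) (\<lambda>x. \<phi> j x * \<phi> k x)" for j k using L2_inner_bound(1)[OF L L, of j k] by simp
  have S: "in_L2 \<Omega> (\<lambda>x. \<Sum>k\<in>I. b k *\<^sub>R \<phi> k x)" using L by (intro in_L2_sum in_L2_scaleR)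
  then have nS: "integrable (lebesgue_on \<Omega>) (\<lambda>x. (norm (\<Sum>k\<in>I. b k *\<^sub>R \<phi> k x))\<^sup>2)" unfolding in_L2_def by blast
  have pt: "(norm (\<Sum>k\<in>I. b k *\<^sub>R \<phi> k x))\<^sup>2 = (\<Sum>k\<in>I. \<Sum>j\<in>I. b k * b j * (\<phi> k x * \<phi> j x))" for x
    by (simp add: power2_eq_square sum_product mult_ac)
  have "sqn \<Omega> (\<lambda>x. \<Sum>k\<in>I. b k *\<^sub>R \<phi> k x) = ennreal (\<integral>x. (norm (\<Sum>k\<in>I. b k *\<^sub>R \<phi> k x))\<^sup>2 \<partial>lebesgue_on \<Omega>)"
    unfolding sqn_def by (rule nn_integral_eq_integral[OF nS]) simp
  also have "(\<integral>x. (norm (\<Sum>k\<in>I. b k *\<^sub>R \<phi> k x))\<^sup>2 \<partial>lebesgue_on \<Omega>) = (\<Sum>k\<in>I. \<Sum>j\<in>I. b k * b j * (if k = j then 1 else 0))"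
    unfolding pt using int by (simp add: Bochner_Integration.integral_sum orth)
  also have "\<dots> = (\<Sum>k\<in>I. (b k)\<^sup>2)"
    using I by (intro sum.cong refl) (simp add: if_distrib[of "\<lambda>z. _ * z"] power2_eq_square cong: if_cong)
  finally show ?thesis .
qed

text \<open>Convergence of the gradient series, beyond that of \<open>V\<close>, places the limit in
  \<open>H10\<close>; the third series is the right side in the weak equations of the partial sums.
  These pass to the limit because the coefficients act as bounded multipliers.\<close>

lemma eigen_expansion_elliptic:
  fixes \<Omega> :: "(real^'n) set"
  assumes \<Omega>: "open \<Omega>" "bounded \<Omega>" and adm: "admissible_coefficients \<Omega> A c"
    and G: "\<And>k. weak_grad \<Omega> (\<phi> k) (G k)" "\<And>k. H10_approx \<Omega> (\<phi> k) (G k)"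
      "\<And>k \<eta>. test_function \<Omega> \<eta> \<Longrightarrow> energy_form \<Omega> A c (\<phi> k) (G k) \<eta> (grad \<eta>) = (\<integral>x. lam k * \<phi> k x * \<eta> x \<partial>lebesgue_on \<Omega>)"
    and V: "L2_tendsto \<Omega> (\<lambda>N x. \<Sum>k<N. b k * \<phi> k x) V"
    and Gr: "L2_tendsto \<Omega> (\<lambda>N x. \<Sum>k<N. b k *\<^sub>R G k x) Gr"
    and W: "L2_tendsto \<Omega> (\<lambda>N x. \<Sum>k<N. b k * lam k * \<phi> k x) W"
  shows "elliptic_eq \<Omega> A c V W"
  unfolding elliptic_eq_def
proof (intro conjI exI[of _ Gr] allI impI)
  have \<Omega>b: "\<Omega> \<in> sets borel" using \<Omega> by simp
  show wg: "weak_grad \<Omega> V Gr"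
    by (rule weak_grad_limit[OF \<Omega>(1) _ V Gr]) (intro weak_grad_sum \<Omega> G)
  show "in_L2 \<Omega> W" using W by (simp add: L2_tendsto_iff)
  have "H10_approx \<Omega> V Gr"
    by (rule H10_approx_limit[OF _ V Gr \<Omega>b]) (intro H10_approx_sum \<Omega>b G(2) finite_lessThan)
  then show "H10 \<Omega> V" unfolding H10_def using H10_approx_imp_sequence[OF \<Omega>b] wg by metis
  fix \<eta> assume t: "test_function \<Omega> \<eta>"
  note tL = test_function_in_L2[OF t \<Omega>b]
  from coefficient_multipliers[OF \<Omega> adm] obtain K where K: "\<And>G. in_L2 \<Omega> G \<Longrightarrow> in_L2 \<Omega> (\<lambda>x. A x *v G x)"
    "\<And>G. in_L2 \<Omega> G \<Longrightarrow> sqn \<Omega> (\<lambda>x. A x *v G x) \<le> ennreal (K\<^sup>2) * sqn \<Omega> G"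
    "\<And>w. in_L2 \<Omega> w \<Longrightarrow> in_L2 \<Omega> (\<lambda>x. c x * w x)"
    "\<And>w. in_L2 \<Omega> w \<Longrightarrow> sqn \<Omega> (\<lambda>x. c x * w x) \<le> ennreal (K\<^sup>2) * sqn \<Omega> w" by blast
  have L: "in_L2 \<Omega> (\<phi> k)" "in_L2 \<Omega> (G k)" for k using G(2) unfolding H10_approx_def by auto
  have VG: "in_L2 \<Omega> V" "in_L2 \<Omega> Gr" using V Gr by (auto simp: L2_tendsto_iff)
  have AG: "L2_tendsto \<Omega> (\<lambda>N x. A x *v (\<Sum>k<N. b k *\<^sub>R G k x)) (\<lambda>x. A x *v Gr x)"
    using L2_tendsto_multiplier[OF Gr, of "\<lambda>u x. A x *v u x" "K\<^sup>2"] K(1,2)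
    by (simp add: matrix_vector_mult_diff_distrib)
  have cV: "L2_tendsto \<Omega> (\<lambda>N x. c x * (\<Sum>k<N. b k * \<phi> k x)) (\<lambda>x. c x * V x)"
    using L2_tendsto_multiplier[OF V, of "\<lambda>u x. c x * u x" "K\<^sup>2"] K(3,4) by (simp add: right_diff_distrib)
  have "(\<lambda>N. (\<integral>x. (A x *v (\<Sum>k<N. b k *\<^sub>R G k x)) \<bullet> grad \<eta> x \<partial>lebesgue_on \<Omega>)
      + (\<integral>x. c x * (\<Sum>k<N. b k * \<phi> k x) * \<eta> x \<partial>lebesgue_on \<Omega>)) \<longlonglongrightarrow>
      (\<integral>x. (A x *v Gr x) \<bullet> grad \<eta> x \<partial>lebesgue_on \<Omega>) + (\<integral>x. c x * V x * \<eta> x \<partial>lebesgue_on \<Omega>)"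
    by (intro tendsto_add L2_tendsto_inner[OF AG tL(2)] L2_tendsto_mult[OF cV tL(1)])
  moreover have "(\<integral>x. (A x *v (\<Sum>k<N. b k *\<^sub>R G k x)) \<bullet> grad \<eta> x \<partial>lebesgue_on \<Omega>)
      + (\<integral>x. c x * (\<Sum>k<N. b k * \<phi> k x) * \<eta> x \<partial>lebesgue_on \<Omega>)
      = (\<integral>x. (\<Sum>k<N. b k * lam k * \<phi> k x) * \<eta> x \<partial>lebesgue_on \<Omega>)" for N
  proof -
    have i1: "integrable (lebesgue_on \<Omega>) (\<lambda>x. (A x *v G k x) \<bullet> grad \<eta> x)" for k
      by (rule L2_inner_bound(1)[OF K(1)[OF L(2)] tL(2)])
    have i2: "integrable (lebesgue_on \<Omega>) (\<lambda>x. c x * \<phi> k x * \<eta> x)" for k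
      using L2_inner_bound(1)[OF K(3)[OF L(1)] tL(1)] by simp
    have i3: "integrable (lebesgue_on \<Omega>) (\<lambda>x. \<phi> k x * \<eta> x)" for k
      using L2_inner_bound(1)[OF L(1) tL(1)] by simp
    have "(\<integral>x. (A x *v (\<Sum>k<N. b k *\<^sub>R G k x)) \<bullet> grad \<eta> x \<partial>lebesgue_on \<Omega>)
        = (\<Sum>k<N. b k * (\<integral>x. (A x *v G k x) \<bullet> grad \<eta> x \<partial>lebesgue_on \<Omega>))"
      unfolding matrix_vector_mult_sum_scaleR inner_sum_left inner_scaleR_left using i1 by simp
    moreover have "(\<integral>x. c x * (\<Sum>k<N. b k * \<phi> k x) * \<eta> x \<partial>lebesgue_on \<Omega>)
        = (\<Sum>k<N. b k * (\<integral>x. c x * \<phi> k x * \<eta> x \<partial>lebesgue_on \<Omega>))"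
    proof -
      have "c x * (\<Sum>k<N. b k * \<phi> k x) * \<eta> x = (\<Sum>k<N. b k * (c x * \<phi> k x * \<eta> x))" for x
        by (simp add: sum_distrib_left sum_distrib_right mult_ac)
      then show ?thesis using i2 by simp
    qed
    moreover have "(\<integral>x. (\<Sum>k<N. b k * lam k * \<phi> k x) * \<eta> x \<partial>lebesgue_on \<Omega>)
        = (\<Sum>k<N. b k * (\<integral>x. lam k * \<phi> k x * \<eta> x \<partial>lebesgue_on \<Omega>))"
    proof -
      have "(\<Sum>k<N. b k * lam k * \<phi> k x) * \<eta> x = (\<Sum>k<N. b k * (lam k * (\<phi> k x * \<eta> x)))" for x
        by (simp add: sum_distrib_left sum_distrib_right mult_ac)
      then show ?thesis using i3 by (simp add: mult.assoc)
    qed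
    moreover have "(\<integral>x. (A x *v G k x) \<bullet> grad \<eta> x \<partial>lebesgue_on \<Omega>) + (\<integral>x. c x * \<phi> k x * \<eta> x \<partial>lebesgue_on \<Omega>)
        = (\<integral>x. lam k * \<phi> k x * \<eta> x \<partial>lebesgue_on \<Omega>)" for k
      using G(3)[OF t, of k] energy_form_split(2)[OF K(1)[OF L(2)] K(3)[OF L(1)] tL(1,2)] by simp
    ultimately show ?thesis by (simp flip: sum.distrib distrib_left)
  qed
  moreover have "(\<lambda>N. \<integral>x. (\<Sum>k<N. b k * lam k * \<phi> k x) * \<eta> x \<partial>lebesgue_on \<Omega>) \<longlonglongrightarrow> (\<integral>x. W x * \<eta> x \<partial>lebesgue_on \<Omega>)"
    by (rule L2_tendsto_mult[OF W tL(1)])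
  ultimately have "(\<integral>x. (A x *v Gr x) \<bullet> grad \<eta> x \<partial>lebesgue_on \<Omega>) + (\<integral>x. c x * V x * \<eta> x \<partial>lebesgue_on \<Omega>)
      = (\<integral>x. W x * \<eta> x \<partial>lebesgue_on \<Omega>)"
    using LIMSEQ_unique by simp
  then show "(\<integral>x. (A x *v Gr x) \<bullet> grad \<eta> x + c x * V x * \<eta> x \<partial>lebesgue_on \<Omega>) = (\<integral>x. W x * \<eta> x \<partial>lebesgue_on \<Omega>)"
    using energy_form_split(2)[OF K(1)[OF VG(2)] K(3)[OF VG(1)] tL(1,2)] by (simp add: energy_form_def)
qed

subsection \<open>Series of separated functions on the cylinder\<close>

lemma nn_integral_exp_square: "(\<integral>\<^sup>+y. ennreal ((indicator {0<..} y * exp (- y))\<^sup>2) \<partial>lborel) < \<infinity>"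
proof -
  have "(\<integral>\<^sup>+y. ennreal ((indicator {0<..} y * exp (- y))\<^sup>2) \<partial>lborel)
      \<le> (\<integral>\<^sup>+y. ennreal (indicator {0..} y * y powr (1 - 1) / exp y) \<partial>lborel)"
  proof (intro nn_integral_mono ennreal_leI)
    fix y :: real
    show "(indicator {0<..} y * exp (- y))\<^sup>2 \<le> indicator {0..} y * y powr (1 - 1) / exp y"
    proof (cases "0 < y")
      case True
      then have "exp (- y) * exp (- y) \<le> 1 * exp (- y)" by (intro mult_right_mono) auto
      then show ?thesis using True by (simp add: power2_eq_square exp_minus divide_inverse)
    qed (auto simp: indicator_def)
  qed
  also have "\<dots> = ennreal (Gamma 1)" using Gamma_conv_nn_integral_real[of 1] by simp
  finally show ?thesis by (simp add: le_less_trans)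
qed

lemma nn_integral_lborel_iterated:
  fixes f :: "'a::euclidean_space \<times> real \<times> real \<Rightarrow> ennreal"
  assumes f: "f \<in> borel_measurable borel"
  shows "(\<integral>\<^sup>+p. f p \<partial>lborel) = (\<integral>\<^sup>+t. (\<integral>\<^sup>+y. (\<integral>\<^sup>+x. f (x, y, t) \<partial>lborel) \<partial>lborel) \<partial>lborel)"
    "(\<integral>\<^sup>+p. f p \<partial>lborel) = (\<integral>\<^sup>+t. (\<integral>\<^sup>+z. f (fst z, snd z, t) \<partial>lborel) \<partial>lborel)"
proof -
  have [measurable]: "f \<in> borel_measurable (borel \<Otimes>\<^sub>M (borel \<Otimes>\<^sub>M borel))" using f by (simp add: borel_prod)
  have "(\<integral>\<^sup>+p. f p \<partial>lborel) = (\<integral>\<^sup>+p. f p \<partial>(lborel \<Otimes>\<^sub>M (lborel \<Otimes>\<^sub>M lborel)))"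
    by (simp add: lborel_prod)
  also have "\<dots> = (\<integral>\<^sup>+q. (\<integral>\<^sup>+x. f (x, q) \<partial>lborel) \<partial>(lborel \<Otimes>\<^sub>M lborel))"
    unfolding lborel_prod by (subst lborel_prod[symmetric], rule lborel_pair.nn_integral_snd[symmetric]) (simp add: lborel_prod f)
  also have "\<dots> = (\<integral>\<^sup>+t. (\<integral>\<^sup>+y. (\<integral>\<^sup>+x. f (x, y, t) \<partial>lborel) \<partial>lborel) \<partial>lborel)"
    by (rule lborel_pair.nn_integral_snd[symmetric]) measurable
  finally show 1: "(\<integral>\<^sup>+p. f p \<partial>lborel) = (\<integral>\<^sup>+t. (\<integral>\<^sup>+y. (\<integral>\<^sup>+x. f (x, y, t) \<partial>lborel) \<partial>lborel) \<partial>lborel)" .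
  have "(\<integral>\<^sup>+y. (\<integral>\<^sup>+x. f (x, y, t) \<partial>lborel) \<partial>lborel) = (\<integral>\<^sup>+z. f (fst z, snd z, t) \<partial>lborel)" for t
  proof -
    have "(\<integral>\<^sup>+y. (\<integral>\<^sup>+x. (\<lambda>z. f (fst z, snd z, t)) (x, y) \<partial>lborel) \<partial>lborel) = (\<integral>\<^sup>+z. f (fst z, snd z, t) \<partial>(lborel \<Otimes>\<^sub>M lborel))"
      by (rule lborel_pair.nn_integral_snd) measurable
    then show ?thesis by (simp add: lborel_prod)
  qed
  then show "(\<integral>\<^sup>+p. f p \<partial>lborel) = (\<integral>\<^sup>+t. (\<integral>\<^sup>+z. f (fst z, snd z, t) \<partial>lborel) \<partial>lborel)"
    unfolding 1 by simp
qed

text \<open>Exceptional sets found one variable after another are combined into a single null set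
  through a Borel set \<open>E\<close>. The second part cuts \<open>E\<close> in the order that weak
  derivatives on the cylinder require: almost all \<open>t\<close> first, then \<open>(x, y)\<close>
  jointly.\<close>

lemma AE_iterated:
  fixes E :: "('a::euclidean_space \<times> real \<times> real) set"
  assumes E: "E \<in> sets borel"
  shows "(AE t in lborel. AE y in lborel. AE x in lborel. (x, y, t) \<notin> E) \<longleftrightarrow> E \<in> null_sets lborel"
    "E \<in> null_sets lborel \<Longrightarrow> AE t in lborel. AE z in lborel. (fst z, snd z, t) \<notin> E"
proof -
  have f: "(indicator E :: _ \<Rightarrow> ennreal) \<in> borel_measurable borel" using E by simp
  have [measurable]: "(indicator E :: _ \<Rightarrow> ennreal) \<in> borel_measurable (borel \<Otimes>\<^sub>M (borel \<Otimes>\<^sub>M borel))"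
    using f by (simp add: borel_prod)
  have null: "E \<in> null_sets lborel \<longleftrightarrow> (\<integral>\<^sup>+p. indicator E p \<partial>lborel) = 0" using E by (simp add: null_sets_def)
  have "(\<integral>\<^sup>+p. indicator E p \<partial>lborel) = 0 \<longleftrightarrow>
      (AE t in lborel. (\<integral>\<^sup>+y. (\<integral>\<^sup>+x. indicator E (x, y, t) \<partial>lborel) \<partial>lborel) = 0)"
    unfolding nn_integral_lborel_iterated(1)[OF f] by (rule nn_integral_0_iff_AE) measurable
  also have "\<dots> \<longleftrightarrow> (AE t in lborel. AE y in lborel. AE x in lborel. (indicator E (x, y, t) :: ennreal) = 0)"
  proof -
    have "(\<integral>\<^sup>+y. (\<integral>\<^sup>+x. indicator E (x, y, t) \<partial>lborel) \<partial>lborel) = 0 \<longleftrightarrow>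
        (AE y in lborel. (\<integral>\<^sup>+x. indicator E (x, y, t) \<partial>lborel) = 0)" for t
      by (rule nn_integral_0_iff_AE) measurable
    moreover have "(\<integral>\<^sup>+x. indicator E (x, y, t) \<partial>lborel) = 0 \<longleftrightarrow>
        (AE x in lborel. (indicator E (x, y, t) :: ennreal) = 0)" for y t
      by (rule nn_integral_0_iff_AE) measurable
    ultimately show ?thesis by simp
  qed
  finally show "(AE t in lborel. AE y in lborel. AE x in lborel. (x, y, t) \<notin> E) \<longleftrightarrow> E \<in> null_sets lborel"
    unfolding null by (simp add: indicator_eq_0_iff)
  assume "E \<in> null_sets lborel"
  then have "AE t in lborel. (\<integral>\<^sup>+z. indicator E (fst z, snd z, t) \<partial>lborel) = 0"
    unfolding null nn_integral_lborel_iterated(2)[OF f]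
  proof (subst (asm) nn_integral_0_iff_AE)
    have "(\<lambda>t. \<integral>\<^sup>+z. indicator E (fst z, snd z, t) \<partial>(lborel \<Otimes>\<^sub>M lborel)) \<in> borel_measurable lborel"
      by measurable
    then show "(\<lambda>t. \<integral>\<^sup>+z. indicator E (fst z, snd z, t) \<partial>lborel) \<in> borel_measurable lborel"
      by (simp add: lborel_prod)
  qed
  then show "AE t in lborel. AE z in lborel. (fst z, snd z, t) \<notin> E"
  proof eventually_elim
    case (elim t)
    have "(\<lambda>z. indicator E (fst z, snd z, t) :: ennreal) \<in> borel_measurable (borel \<Otimes>\<^sub>M borel)" by measurable
    then have "(\<lambda>z. indicator E (fst z, snd z, t) :: ennreal) \<in> borel_measurable lborel" by (simp add: borel_prod)
    from nn_integral_0_iff_AE[OF this] elim show ?case by (simp add: indicator_eq_0_iff)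
  qed
qed

text \<open>\<open>u\<close> is meant to vanish outside \<open>(0, T)\<close>, as \<open>q\<close>
  does for \<open>y \<le> 0\<close>, so that integrals run over the whole line. \<open>u_fin\<close>
  carries no power of \<open>lam k\<close> and will follow from each of the data norms in question.
  The quantity in \<open>q_bound\<close> is invariant under dilation of the profile, which is why
  one \<open>C\<close> works for all \<open>k\<close>; it gives control at every
  \<open>y > 0\<close> for all orders.\<close>

locale cylinder_series =
  fixes \<Omega> :: "'a::euclidean_space set" and lam :: "nat \<Rightarrow> real"
    and u :: "nat \<Rightarrow> real \<Rightarrow> real" and q :: "nat \<Rightarrow> nat \<Rightarrow> real \<Rightarrow> real"
  assumes \<Omega>: "open \<Omega>" and lam_pos: "\<And>k. 0 < lam k"
    and u_meas [measurable]: "\<And>k. u k \<in> borel_measurable borel"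
    and u_fin: "(\<Sum>k. \<integral>\<^sup>+t. ennreal ((u k t)\<^sup>2) \<partial>lborel) < \<infinity>"
    and q_meas [measurable]: "\<And>k j. q k j \<in> borel_measurable borel"
    and q_deriv: "\<And>k j y. 0 < y \<Longrightarrow> (q k j has_real_derivative q k (Suc j) y) (at y)"
    and q_nonpos: "\<And>k j y. y \<le> 0 \<Longrightarrow> q k j y = 0"
    and q_bound: "\<And>j m. \<exists>C. \<forall>k y. 0 < y \<longrightarrow> lam k powr (real m / 2) * \<bar>q k j y\<bar> * y ^ (j + m) \<le> C"
begin

lemma \<Omega>_borel: "\<Omega> \<in> sets borel"
  using \<Omega> by simp

text \<open>Here \<open>q k j\<close> is the \<open>j\<close>-th derivative of the profile \<open>\<psi>\<^sub>k\<close>, and \<open>m\<close> is the order of the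
  operator in \<open>x\<close>: each order contributes a factor \<open>lam k powr (1/2)\<close>.\<close>

definition cf :: "nat \<Rightarrow> nat \<Rightarrow> nat \<Rightarrow> real \<Rightarrow> real \<Rightarrow> real" where
  "cf m j k t y = u k t * (lam k powr (real m / 2) * q k j y)"

lemma AE_u_square_summable: "AE t in lborel. (\<Sum>k. ennreal ((u k t)\<^sup>2)) < \<infinity>"
proof -
  have "(\<integral>\<^sup>+t. (\<Sum>k. ennreal ((u k t)\<^sup>2)) \<partial>lborel) = (\<Sum>k. \<integral>\<^sup>+t. ennreal ((u k t)\<^sup>2) \<partial>lborel)"
    by (rule nn_integral_suminf) measurable
  then have "AE t in lborel. (\<Sum>k. ennreal ((u k t)\<^sup>2)) \<noteq> \<infinity>"
    using u_fin by (intro nn_integral_noteq_infinite) auto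
  then show ?thesis by eventually_elim (simp add: less_top)
qed

text \<open>The parameter is the pair \<open>(t, y)\<close>. At each such pair the tail bound is
  homogeneous in the coefficients, so the weight \<open>wt\<close> that made them square integrable
  divides out again and the bound comes out for the original coefficients.\<close>

lemma field_exists:
  fixes \<Phi> :: "nat \<Rightarrow> 'a \<Rightarrow> 'b::euclidean_space"
  assumes L: "\<And>k. in_L2 \<Omega> (\<Phi> k)" and B: "0 \<le> B"
    and bessel: "\<And>I b. finite I \<Longrightarrow> sqn \<Omega> (\<lambda>x. \<Sum>k\<in>I. b k *\<^sub>R \<Phi> k x) \<le> ennreal (B * (\<Sum>k\<in>I. (b k)\<^sup>2))"
  obtains V where "(\<lambda>(x, y, t). V x y t) \<in> borel_measurable borel"
    "AE t in lborel. AE y in lborel. 0 < y \<longrightarrow> (\<forall>N. sqn \<Omega> (\<lambda>x. V x y t - (\<Sum>k<N. cf m j k t y *\<^sub>R \<Phi> k x))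
      \<le> ennreal B * (\<Sum>k. ennreal ((cf m j (k + N) t y)\<^sup>2)))"
proof -
  \<comment> \<open>Borel versions that vanish off \<open>\<Omega>\<close> turn norms on
    \<open>\<Omega>\<close> into integrals over the whole space, the form in which
    \<open>bessel_series\<close> is stated.\<close>
  have "\<forall>k. \<exists>\<Psi>. \<Psi> \<in> borel_measurable borel \<and> (AE x in lborel. x \<in> \<Omega> \<longrightarrow> \<Phi> k x = \<Psi> x) \<and> (\<forall>x. x \<notin> \<Omega> \<longrightarrow> \<Psi> x = 0)"
    using borel_version[OF in_L2_measurable[OF L] \<Omega>_borel] by metis
  from choice[OF this] obtain \<Psi> where \<Psi>: "\<And>k. \<Psi> k \<in> borel_measurable borel"
    "\<And>k. AE x in lborel. x \<in> \<Omega> \<longrightarrow> \<Phi> k x = \<Psi> k x" "\<And>k x. x \<notin> \<Omega> \<Longrightarrow> \<Psi> k x = 0" by blast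
  have ae: "AE x in lborel. \<forall>k. x \<in> \<Omega> \<longrightarrow> \<Phi> k x = \<Psi> k x"
    using \<Psi>(2) by (subst AE_all_countable) blast
  define wt where "wt y = y ^ (j + m) * exp (- y)" for y :: real \<comment> \<open>makes the coefficients square integrable in \<open>y\<close> at \<open>0\<close> and at infinity\<close>
  have wt: "0 < wt y" if "0 < y" for y using that by (simp add: wt_def)
  define a where "a k p = (if 0 < snd p then cf m j k (fst p) (snd p) * wt (snd p) else 0)" for k and p :: "real \<times> real"
  have am: "a k \<in> borel_measurable borel" for k
    unfolding a_def[abs_def] cf_def wt_def borel_prod[symmetric] by measurable
  obtain C where C: "\<And>k y. 0 < y \<Longrightarrow> lam k powr (real m / 2) * \<bar>q k j y\<bar> * y ^ (j + m) \<le> C"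
    using q_bound by blast
  have C0: "0 \<le> C" using C[of 1 0] by (auto intro: order_trans[rotated])
  have a_le: "ennreal ((a k (t, y))\<^sup>2) \<le> ennreal (C\<^sup>2) * ennreal ((u k t)\<^sup>2) * ennreal ((indicator {0<..} y * exp (- y))\<^sup>2)" for k t y
  proof (cases "0 < y")
    case True
    have "\<bar>a k (t, y)\<bar> = \<bar>u k t\<bar> * (lam k powr (real m / 2) * \<bar>q k j y\<bar> * y ^ (j + m)) * exp (- y)"
      using True by (simp add: a_def cf_def wt_def abs_mult)
    also have "\<dots> \<le> \<bar>u k t\<bar> * C * exp (- y)" using C[OF True] by (intro mult_right_mono mult_left_mono) auto
    finally have "\<bar>a k (t, y)\<bar>\<^sup>2 \<le> (\<bar>u k t\<bar> * C * exp (- y))\<^sup>2" by (intro power_mono) auto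
    then have "(a k (t, y))\<^sup>2 \<le> C\<^sup>2 * (u k t)\<^sup>2 * (indicator {0<..} y * exp (- y))\<^sup>2"
      using True by (simp add: power_mult_distrib mult_ac)
    then show ?thesis by (simp add: ennreal_leI flip: ennreal_mult)
  qed (simp add: a_def)
  define Z where "Z = (\<integral>\<^sup>+y. ennreal ((indicator {0<..} y * exp (- y))\<^sup>2) \<partial>lborel)"
  have fin: "(\<Sum>k. \<integral>\<^sup>+p. ennreal ((a k p)\<^sup>2) \<partial>lborel) < \<infinity>"
  proof -
    have "(\<integral>\<^sup>+p. ennreal ((a k p)\<^sup>2) \<partial>lborel) \<le> ennreal (C\<^sup>2) * Z * (\<integral>\<^sup>+t. ennreal ((u k t)\<^sup>2) \<partial>lborel)" for k
    proof -
      have [measurable]: "a k \<in> borel_measurable (borel \<Otimes>\<^sub>M borel)" using am by (simp add: borel_prod)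
      have "(\<integral>\<^sup>+p. ennreal ((a k p)\<^sup>2) \<partial>lborel) = (\<integral>\<^sup>+p. ennreal ((a k p)\<^sup>2) \<partial>(lborel \<Otimes>\<^sub>M lborel))" by (simp add: lborel_prod)
      also have "\<dots> = (\<integral>\<^sup>+t. (\<integral>\<^sup>+y. ennreal ((a k (t, y))\<^sup>2) \<partial>lborel) \<partial>lborel)"
        by (rule lborel.nn_integral_fst[symmetric]) measurable
      also have "\<dots> \<le> (\<integral>\<^sup>+t. (\<integral>\<^sup>+y. ennreal (C\<^sup>2) * ennreal ((u k t)\<^sup>2) * ennreal ((indicator {0<..} y * exp (- y))\<^sup>2) \<partial>lborel) \<partial>lborel)"
        by (intro nn_integral_mono a_le)
      also have "\<dots> = (\<integral>\<^sup>+t. (ennreal (C\<^sup>2) * Z) * ennreal ((u k t)\<^sup>2) \<partial>lborel)"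
        unfolding Z_def by (subst nn_integral_cmult) (measurable, simp add: mult_ac)
      also have "\<dots> = ennreal (C\<^sup>2) * Z * (\<integral>\<^sup>+t. ennreal ((u k t)\<^sup>2) \<partial>lborel)" by (rule nn_integral_cmult) measurable
      finally show ?thesis .
    qed
    then have "(\<Sum>k. \<integral>\<^sup>+p. ennreal ((a k p)\<^sup>2) \<partial>lborel) \<le> (\<Sum>k. ennreal (C\<^sup>2) * Z * (\<integral>\<^sup>+t. ennreal ((u k t)\<^sup>2) \<partial>lborel))"
      by (intro suminf_le summableI) auto
    also have "\<dots> < \<infinity>"
      using u_fin nn_integral_exp_square by (simp add: Z_def ennreal_mult_less_top)
    finally show ?thesis .
  qed
  have bes: "(\<integral>\<^sup>+x. ennreal ((norm (\<Sum>k\<in>{n0..<n}. b k *\<^sub>R \<Psi> k x))\<^sup>2) \<partial>lborel) \<le> ennreal (B * (\<Sum>k\<in>{n0..<n}. (b k)\<^sup>2))" for n0 n b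
  proof -
    have "(\<integral>\<^sup>+x. ennreal ((norm (\<Sum>k\<in>{n0..<n}. b k *\<^sub>R \<Psi> k x))\<^sup>2) \<partial>lborel) = sqn \<Omega> (\<lambda>x. \<Sum>k\<in>{n0..<n}. b k *\<^sub>R \<Phi> k x)"
      unfolding sqn_borel[OF \<Omega>_borel]
    proof (intro nn_integral_cong_AE, use ae in eventually_elim)
      case (elim x)
      show ?case by (cases "x \<in> \<Omega>") (use elim \<Psi>(3) in auto)
    qed
    then show ?thesis using bessel[of "{n0..<n}" b] by simp
  qed
  obtain V' where V'm: "V' \<in> borel_measurable borel"
    and V': "AE p in lborel. \<forall>N. (\<integral>\<^sup>+x. ennreal ((norm (V' (x, p) - (\<Sum>k<N. a k p *\<^sub>R \<Psi> k x)))\<^sup>2) \<partial>lborel)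
      \<le> ennreal B * (\<Sum>k. ennreal ((a (k + N) p)\<^sup>2))"
    using bessel_series[OF \<Psi>(1) am bes B fin] by blast
  define V where "V x y t = (1 / wt y) *\<^sub>R V' (x, t, y)" for x y t
  have Vm: "(\<lambda>(x, y, t). V x y t) \<in> borel_measurable borel"
  proof -
    have [measurable]: "V' \<in> borel_measurable (borel \<Otimes>\<^sub>M (borel \<Otimes>\<^sub>M borel))" using V'm by (simp add: borel_prod)
    have "(\<lambda>(x, y, t). V x y t) \<in> borel_measurable (borel \<Otimes>\<^sub>M (borel \<Otimes>\<^sub>M borel))"
      unfolding V_def wt_def by measurable
    then show ?thesis by (simp add: borel_prod)
  qed
  have "AE t in lborel. AE y in lborel. \<forall>N. (\<integral>\<^sup>+x. ennreal ((norm (V' (x, t, y) - (\<Sum>k<N. a k (t, y) *\<^sub>R \<Psi> k x)))\<^sup>2) \<partial>lborel)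
      \<le> ennreal B * (\<Sum>k. ennreal ((a (k + N) (t, y))\<^sup>2))"
    using V' unfolding lborel_prod[symmetric] by (rule lborel_pair.AE_pair)
  then have "AE t in lborel. AE y in lborel. 0 < y \<longrightarrow> (\<forall>N. sqn \<Omega> (\<lambda>x. V x y t - (\<Sum>k<N. cf m j k t y *\<^sub>R \<Phi> k x))
      \<le> ennreal B * (\<Sum>k. ennreal ((cf m j (k + N) t y)\<^sup>2)))"
  proof eventually_elim
    case (elim t)
    then show ?case
    proof eventually_elim
      case (elim y)
      note H = this
      show ?case
      proof (intro impI allI)
    fix N
    assume y: "0 < y"
    have w: "0 < wt y" by (rule wt[OF y])
    have a_eq: "a k (t, y) = wt y * cf m j k t y" for k using y by (simp add: a_def)
    have "sqn \<Omega> (\<lambda>x. V x y t - (\<Sum>k<N. cf m j k t y *\<^sub>R \<Phi> k x))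
        \<le> (\<integral>\<^sup>+x. ennreal ((1 / wt y)\<^sup>2) * ennreal ((norm (V' (x, t, y) - (\<Sum>k<N. a k (t, y) *\<^sub>R \<Psi> k x)))\<^sup>2) \<partial>lborel)"
      unfolding sqn_borel[OF \<Omega>_borel]
    proof (intro nn_integral_mono_AE, use ae in eventually_elim)
      case (elim x)
      have "V x y t - (\<Sum>k<N. cf m j k t y *\<^sub>R \<Phi> k x) = (1 / wt y) *\<^sub>R (V' (x, t, y) - (\<Sum>k<N. a k (t, y) *\<^sub>R \<Psi> k x))"
        if "x \<in> \<Omega>"
        using elim that w by (simp add: V_def a_eq scaleR_diff_right scaleR_sum_right)
      then have "(norm (indicator \<Omega> x *\<^sub>R (V x y t - (\<Sum>k<N. cf m j k t y *\<^sub>R \<Phi> k x))))\<^sup>2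
          \<le> (1 / wt y)\<^sup>2 * (norm (V' (x, t, y) - (\<Sum>k<N. a k (t, y) *\<^sub>R \<Psi> k x)))\<^sup>2"
        by (cases "x \<in> \<Omega>") (simp_all add: power_mult_distrib power_divide)
      then show ?case by (simp add: ennreal_leI flip: ennreal_mult)
    qed
    also have "\<dots> = ennreal ((1 / wt y)\<^sup>2) * (\<integral>\<^sup>+x. ennreal ((norm (V' (x, t, y) - (\<Sum>k<N. a k (t, y) *\<^sub>R \<Psi> k x)))\<^sup>2) \<partial>lborel)"
    proof (rule nn_integral_cmult)
      have [measurable]: "V' \<in> borel_measurable (borel \<Otimes>\<^sub>M (borel \<Otimes>\<^sub>M borel))" using V'm by (simp add: borel_prod)
      note [measurable] = \<Psi>(1)
      show "(\<lambda>x. ennreal ((norm (V' (x, t, y) - (\<Sum>k<N. a k (t, y) *\<^sub>R \<Psi> k x)))\<^sup>2)) \<in> borel_measurable lborel" by measurable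
    qed
    also have "\<dots> \<le> ennreal ((1 / wt y)\<^sup>2) * (ennreal B * (\<Sum>k. ennreal ((a (k + N) (t, y))\<^sup>2)))"
      using H by (intro mult_left_mono) auto
    also have "\<dots> = ennreal B * (\<Sum>k. ennreal ((1 / wt y)\<^sup>2) * ennreal ((a (k + N) (t, y))\<^sup>2))"
      by (simp add: mult_ac)
    also have "(\<lambda>k. ennreal ((1 / wt y)\<^sup>2) * ennreal ((a (k + N) (t, y))\<^sup>2)) = (\<lambda>k. ennreal ((cf m j (k + N) t y)\<^sup>2))"
      using w by (simp add: a_eq power_mult_distrib power_divide flip: ennreal_mult)
    finally show "sqn \<Omega> (\<lambda>x. V x y t - (\<Sum>k<N. cf m j k t y *\<^sub>R \<Phi> k x)) \<le> ennreal B * (\<Sum>k. ennreal ((cf m j (k + N) t y)\<^sup>2))" .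
      qed
    qed
  qed
  then show ?thesis using that Vm by blast
qed

text \<open>Uniformity of \<open>q_bound\<close> in \<open>k\<close> leaves only the tail of the
  time coefficients, with a factor that is finite for \<open>y > 0\<close>.\<close>

lemma cf_tail:
  obtains C where "0 \<le> C" "\<And>N t y. 0 < y \<Longrightarrow>
    (\<Sum>k. ennreal ((cf m j (k + N) t y)\<^sup>2)) \<le> ennreal ((C / y ^ (j + m))\<^sup>2) * (\<Sum>k. ennreal ((u (k + N) t)\<^sup>2))"
proof -
  obtain C where C: "\<And>k y. 0 < y \<Longrightarrow> lam k powr (real m / 2) * \<bar>q k j y\<bar> * y ^ (j + m) \<le> C"
    using q_bound by blast
  have C0: "0 \<le> C" using C[of 1 0] by (auto intro: order_trans[rotated])
  have "(\<Sum>k. ennreal ((cf m j (k + N) t y)\<^sup>2)) \<le> ennreal ((C / y ^ (j + m))\<^sup>2) * (\<Sum>k. ennreal ((u (k + N) t)\<^sup>2))"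
    if y: "0 < y" for N t y
  proof -
    have "(\<Sum>k. ennreal ((cf m j (k + N) t y)\<^sup>2)) \<le> (\<Sum>k. ennreal ((C / y ^ (j + m))\<^sup>2) * ennreal ((u (k + N) t)\<^sup>2))"
    proof (intro suminf_le summableI)
      fix k
      have "lam (k + N) powr (real m / 2) * \<bar>q (k + N) j y\<bar> \<le> C / y ^ (j + m)"
        using C[OF y, of "k + N"] y by (simp add: pos_le_divide_eq)
      then have "\<bar>u (k + N) t\<bar> * (lam (k + N) powr (real m / 2) * \<bar>q (k + N) j y\<bar>) \<le> \<bar>u (k + N) t\<bar> * (C / y ^ (j + m))"
        by (rule mult_left_mono) simp
      then have "\<bar>cf m j (k + N) t y\<bar>\<^sup>2 \<le> (\<bar>u (k + N) t\<bar> * (C / y ^ (j + m)))\<^sup>2"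
        by (intro power_mono) (auto simp: cf_def abs_mult)
      then have "(cf m j (k + N) t y)\<^sup>2 \<le> (C / y ^ (j + m))\<^sup>2 * (u (k + N) t)\<^sup>2"
        unfolding power_mult_distrib[of "\<bar>u (k + N) t\<bar>"] power2_abs by (simp only: mult.commute)
      then show "ennreal ((cf m j (k + N) t y)\<^sup>2) \<le> ennreal ((C / y ^ (j + m))\<^sup>2) * ennreal ((u (k + N) t)\<^sup>2)"
        by (metis ennreal_leI ennreal_mult zero_le_power2)
    qed
    then show ?thesis by simp
  qed
  then show ?thesis using that C0 by blast
qed

lemma u_tail_tendsto_0:
  assumes "(\<Sum>k. ennreal ((u k t)\<^sup>2)) < \<infinity>"
  shows "(\<lambda>N. \<Sum>k. ennreal ((u (k + N) t)\<^sup>2)) \<longlonglongrightarrow> 0"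
proof (rule order_tendstoI)
  fix e :: ennreal assume "0 < e"
  then obtain r where r: "0 < r" "ennreal r \<le> e"
    by (cases e) (auto intro: that[of 1])
  from summable_tail_ennreal[OF assms r(1)] obtain N where "\<And>n. N \<le> n \<Longrightarrow> (\<Sum>k. ennreal ((u (k + n) t)\<^sup>2)) < ennreal r"
    by blast
  then show "\<forall>\<^sub>F N in sequentially. (\<Sum>k. ennreal ((u (k + N) t)\<^sup>2)) < e"
    using r(2) by (auto simp: eventually_sequentially intro: less_le_trans)
qed simp

lemma field_L2_tendsto:
  fixes \<Phi> :: "nat \<Rightarrow> 'a \<Rightarrow> 'b::euclidean_space"
  assumes L: "\<And>k. in_L2 \<Omega> (\<Phi> k)" and V: "(\<lambda>(x, y, t). V x y t) \<in> borel_measurable borel"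
    and est: "\<And>N. sqn \<Omega> (\<lambda>x. V x y t - (\<Sum>k<N. cf m j k t y *\<^sub>R \<Phi> k x)) \<le> ennreal B * (\<Sum>k. ennreal ((cf m j (k + N) t y)\<^sup>2))"
    and fin: "(\<Sum>k. ennreal ((u k t)\<^sup>2)) < \<infinity>" and y: "0 < y"
  shows "L2_tendsto \<Omega> (\<lambda>N x. \<Sum>k<N. cf m j k t y *\<^sub>R \<Phi> k x) (\<lambda>x. V x y t)"
proof -
  obtain C where C: "0 \<le> C" "\<And>N t y. 0 < y \<Longrightarrow>
    (\<Sum>k. ennreal ((cf m j (k + N) t y)\<^sup>2)) \<le> ennreal ((C / y ^ (j + m))\<^sup>2) * (\<Sum>k. ennreal ((u (k + N) t)\<^sup>2))"
    using cf_tail by blast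
  have [measurable]: "(\<lambda>(x, y, t). V x y t) \<in> borel_measurable (borel \<Otimes>\<^sub>M (borel \<Otimes>\<^sub>M borel))" using V by (simp add: borel_prod)
  have Vm: "(\<lambda>x. V x y t) \<in> borel_measurable (lebesgue_on \<Omega>)"
  proof (rule borel_measurable_lebesgue_on_borel)
    have "(\<lambda>x. (\<lambda>(x, y, t). V x y t) (x, y, t)) \<in> borel_measurable borel" by measurable
    then show "(\<lambda>x. V x y t) \<in> borel_measurable borel" by simp
  qed
  have S: "in_L2 \<Omega> (\<lambda>x. \<Sum>k<N. cf m j k t y *\<^sub>R \<Phi> k x)" for N using L by (intro in_L2_sum in_L2_scaleR)
  have le: "sqn \<Omega> (\<lambda>x. V x y t - (\<Sum>k<N. cf m j k t y *\<^sub>R \<Phi> k x))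
      \<le> ennreal B * ennreal ((C / y ^ (j + m))\<^sup>2) * (\<Sum>k. ennreal ((u (k + N) t)\<^sup>2))" for N
  proof -
    have "sqn \<Omega> (\<lambda>x. V x y t - (\<Sum>k<N. cf m j k t y *\<^sub>R \<Phi> k x)) \<le> ennreal B * (\<Sum>k. ennreal ((cf m j (k + N) t y)\<^sup>2))"
      by (rule est)
    also have "\<dots> \<le> ennreal B * (ennreal ((C / y ^ (j + m))\<^sup>2) * (\<Sum>k. ennreal ((u (k + N) t)\<^sup>2)))"
      by (intro mult_left_mono C(2) y) simp
    finally show ?thesis by (simp add: mult.assoc)
  qed
  have "(\<lambda>N. ennreal B * ennreal ((C / y ^ (j + m))\<^sup>2) * (\<Sum>k. ennreal ((u (k + N) t)\<^sup>2))) \<longlonglongrightarrow>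
      ennreal B * ennreal ((C / y ^ (j + m))\<^sup>2) * 0"
    by (intro ennreal_tendsto_cmult u_tail_tendsto_0 fin) (simp add: ennreal_mult_less_top)
  then have z: "(\<lambda>N. ennreal B * ennreal ((C / y ^ (j + m))\<^sup>2) * (\<Sum>k. ennreal ((u (k + N) t)\<^sup>2))) \<longlonglongrightarrow> 0" by simp
  have "(\<lambda>N. sqn \<Omega> (\<lambda>x. V x y t - (\<Sum>k<N. cf m j k t y *\<^sub>R \<Phi> k x))) \<longlonglongrightarrow> 0"
    by (rule tendsto_sandwich[OF _ _ tendsto_const z]) (use le in \<open>auto intro!: always_eventually\<close>)
  then have lim: "(\<lambda>N. sqn \<Omega> (\<lambda>x. (\<Sum>k<N. cf m j k t y *\<^sub>R \<Phi> k x) - V x y t)) \<longlonglongrightarrow> 0"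
    by (simp add: sqn_def norm_minus_commute)
  have "sqn \<Omega> (\<lambda>x. V x y t) < \<infinity>"
    using le[of 0] fin by (auto simp: ennreal_mult_less_top intro: le_less_trans)
  then show ?thesis using S Vm lim by (simp add: L2_tendsto_iff in_L2_iff)
qed

text \<open>The partial sums are finite sums of products, whose \<open>y\<close>-derivatives are
  known; on a slab \<open>a \<le> y \<le> b\<close> the factor \<open>C / y ^ i\<close> is at most
  \<open>C / a ^ i\<close>, so both they and their derivatives converge there in the mean
  square.\<close>

lemma field_weak_deriv:
  fixes \<phi> :: "nat \<Rightarrow> 'a \<Rightarrow> real"
  assumes L: "\<And>k. in_L2 \<Omega> (\<phi> k)"
    and V: "\<And>j. (\<lambda>(x, y, t). V j x y t) \<in> borel_measurable borel"
    and est: "\<And>j. AE y in lborel. 0 < y \<longrightarrow> (\<forall>N. sqn \<Omega> (\<lambda>x. V j x y t - (\<Sum>k<N. cf 0 j k t y *\<^sub>R \<phi> k x))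
      \<le> ennreal B * (\<Sum>k. ennreal ((cf 0 j (k + N) t y)\<^sup>2)))"
    and fin: "(\<Sum>k. ennreal ((u k t)\<^sup>2)) < \<infinity>"
  shows "weak_deriv (\<Omega> \<times> {0<..}) (0, 1) (\<lambda>(x, y). V j x y t) (\<lambda>(x, y). V (Suc j) x y t)"
proof -
  have "\<forall>k. \<exists>\<Psi>. \<Psi> \<in> borel_measurable borel \<and> (AE x in lborel. x \<in> \<Omega> \<longrightarrow> \<phi> k x = \<Psi> x)"
    using borel_version[OF in_L2_measurable[OF L] \<Omega>_borel] by metis
  from choice[OF this] obtain \<Psi> where \<Psi>: "\<And>k. \<Psi> k \<in> borel_measurable borel"
    "\<And>k. AE x in lborel. x \<in> \<Omega> \<longrightarrow> \<phi> k x = \<Psi> k x" by blast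
  have ae: "AE x in lebesgue_on \<Omega>. \<forall>k. \<phi> k x = \<Psi> k x"
    using \<Psi>(2) unfolding AE_all_countable AE_lebesgue_on_iff[OF \<Omega>_borel] by blast
  have L\<Psi>: "in_L2 \<Omega> (\<Psi> k)" for k
  proof -
    have "sqn \<Omega> (\<phi> k) = sqn \<Omega> (\<Psi> k)"
      by (rule sqn_cong_AE) (use ae in \<open>eventually_elim, blast\<close>)
    then show ?thesis using L[of k] borel_measurable_lebesgue_on_borel[OF \<Psi>(1)] by (simp add: in_L2_iff)
  qed
  define w where "w j N z = (\<Sum>k<N. u k t * (case z of (x, y) \<Rightarrow> \<Psi> k x * q k j y))" for j N z
  have qc: "isCont (q k j) y" if "0 < y" for k j y using q_deriv[OF that] by (rule DERIV_isCont)
  have wd: "weak_deriv (\<Omega> \<times> {0<..}) (0, 1) (w j N) (w (Suc j) N)" for N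
    unfolding w_def
    by (intro weak_deriv_sum weak_deriv_cmult weak_deriv_cylinder_product open_Times \<Omega> \<Psi>(1) L\<Psi> q_meas q_deriv qc)
      simp_all
  have conv: "L2_tendsto (\<Omega> \<times> {a..b}) (w i) (\<lambda>(x, y). V i x y t)" if ab: "0 < a" "a \<le> b" for i a b
  proof -
    have S: "\<Omega> \<times> {a..b} \<in> sets borel" and J: "{a..b} \<in> sets borel" using \<Omega>_borel by (simp_all add: borel_Times)
    have wL: "in_L2 (\<Omega> \<times> {a..b}) (w i N)" for N
      unfolding w_def
      by (intro in_L2_sum in_L2_cmult in_L2_cylinder_product \<Psi>(1) q_meas \<Omega>_borel L\<Psi> continuous_at_imp_continuous_on ballI qc)
        (use ab in auto)
    have wm: "w i N \<in> borel_measurable borel" for N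
    proof -
      note [measurable] = \<Psi>(1)
      have "w i N \<in> borel_measurable (borel \<Otimes>\<^sub>M borel)" unfolding w_def by measurable
      then show ?thesis by (simp add: borel_prod)
    qed
    have Vm: "(\<lambda>(x, y). V i x y t) \<in> borel_measurable borel"
    proof -
      have [measurable]: "(\<lambda>(x, y, t). V i x y t) \<in> borel_measurable (borel \<Otimes>\<^sub>M (borel \<Otimes>\<^sub>M borel))"
        using V[of i] by (simp add: borel_prod)
      have "(\<lambda>z. (\<lambda>(x, y, t). V i x y t) (fst z, snd z, t)) \<in> borel_measurable (borel \<Otimes>\<^sub>M borel)" by measurable
      then show ?thesis by (simp add: borel_prod case_prod_beta')
    qed
    obtain C where C: "0 \<le> C" "\<And>N t y. 0 < y \<Longrightarrow>
      (\<Sum>k. ennreal ((cf 0 i (k + N) t y)\<^sup>2)) \<le> ennreal ((C / y ^ (i + 0))\<^sup>2) * (\<Sum>k. ennreal ((u (k + N) t)\<^sup>2))"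
      using cf_tail by blast
    define K where "K = ennreal B * ennreal ((C / a ^ i)\<^sup>2) * ennreal (b - a)"
    have le: "sqn (\<Omega> \<times> {a..b}) (\<lambda>z. w i N z - (case z of (x, y) \<Rightarrow> V i x y t)) \<le> K * (\<Sum>k. ennreal ((u (k + N) t)\<^sup>2))" for N
    proof -
      let ?\<tau> = "\<Sum>k. ennreal ((u (k + N) t)\<^sup>2)"
      have "sqn (\<Omega> \<times> {a..b}) (\<lambda>z. w i N z - (case z of (x, y) \<Rightarrow> V i x y t))
          = (\<integral>\<^sup>+y. sqn \<Omega> (\<lambda>x. w i N (x, y) - V i x y t) \<partial>lebesgue_on {a..b})"
      proof -
        have "(\<lambda>z. w i N z - (case z of (x, y) \<Rightarrow> V i x y t)) \<in> borel_measurable borel"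
          by (intro borel_measurable_diff wm Vm)
        then have "(\<lambda>z. ennreal ((norm (w i N z - (case z of (x, y) \<Rightarrow> V i x y t)))\<^sup>2)) \<in> borel_measurable borel"
          by measurable
        from nn_integral_cylinder[OF this \<Omega>_borel J] show ?thesis unfolding sqn_def by simp
      qed
      also have "\<dots> \<le> (\<integral>\<^sup>+y. ennreal B * ennreal ((C / a ^ i)\<^sup>2) * ?\<tau> * indicator {a..b} y \<partial>lborel)"
        unfolding nn_integral_lebesgue_on[OF J]
      proof (intro nn_integral_mono_AE, use est[of i] in eventually_elim)
        case (elim y)
        show ?case
        proof (cases "y \<in> {a..b}")
          case True
          then have y: "0 < y" using ab by simp
          have "sqn \<Omega> (\<lambda>x. w i N (x, y) - V i x y t) = sqn \<Omega> (\<lambda>x. (\<Sum>k<N. cf 0 i k t y *\<^sub>R \<phi> k x) - V i x y t)"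
          proof (rule sqn_cong_AE, use ae in eventually_elim)
            case (elim x)
            then show ?case using lam_pos by (simp add: w_def cf_def less_imp_neq[symmetric] mult_ac)
          qed
          also have "\<dots> = sqn \<Omega> (\<lambda>x. V i x y t - (\<Sum>k<N. cf 0 i k t y *\<^sub>R \<phi> k x))"
            by (simp add: sqn_def power2_commute)
          also have "\<dots> \<le> ennreal B * (\<Sum>k. ennreal ((cf 0 i (k + N) t y)\<^sup>2))" using elim y by blast
          also have "\<dots> \<le> ennreal B * (ennreal ((C / y ^ (i + 0))\<^sup>2) * ?\<tau>)" by (intro mult_left_mono C(2) y) auto
          also have "\<dots> \<le> ennreal B * (ennreal ((C / a ^ i)\<^sup>2) * ?\<tau>)"
          proof (intro mult_left_mono mult_right_mono ennreal_leI power_mono)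
            show "C / y ^ (i + 0) \<le> C / a ^ i"
              using True ab C(1) by (intro divide_left_mono) (auto intro: power_mono)
          qed (use C(1) y in auto)
          finally show ?thesis using True by (simp add: mult.assoc)
        qed simp
      qed
      also have "\<dots> = K * ?\<tau>"
        using ab by (subst nn_integral_cmult_indicator) (simp_all add: K_def mult_ac)
      finally show ?thesis .
    qed
    have K: "K < top" by (simp add: K_def ennreal_mult_less_top)
    have "(\<lambda>N. K * (\<Sum>k. ennreal ((u (k + N) t)\<^sup>2))) \<longlonglongrightarrow> K * 0"
      by (intro ennreal_tendsto_cmult u_tail_tendsto_0 fin K)
    then have z: "(\<lambda>N. K * (\<Sum>k. ennreal ((u (k + N) t)\<^sup>2))) \<longlonglongrightarrow> 0" by simp
    have lim: "(\<lambda>N. sqn (\<Omega> \<times> {a..b}) (\<lambda>z. w i N z - (case z of (x, y) \<Rightarrow> V i x y t))) \<longlonglongrightarrow> 0"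
      by (rule tendsto_sandwich[OF _ _ tendsto_const z]) (use le in \<open>auto intro!: always_eventually\<close>)
    have w0: "w i 0 = (\<lambda>z. 0)" by (simp add: w_def fun_eq_iff)
    have "sqn (\<Omega> \<times> {a..b}) (\<lambda>(x, y). V i x y t) = sqn (\<Omega> \<times> {a..b}) (\<lambda>z. w i 0 z - (case z of (x, y) \<Rightarrow> V i x y t))"
      unfolding w0 by (simp add: sqn_def)
    also have "\<dots> < \<infinity>" using le[of 0] fin K by (auto simp: ennreal_mult_less_top intro: le_less_trans)
    finally have "in_L2 (\<Omega> \<times> {a..b}) (\<lambda>(x, y). V i x y t)"
      using borel_measurable_lebesgue_on_borel[OF Vm] by (simp add: in_L2_iff)
    then show ?thesis using wL lim by (simp add: L2_tendsto_iff)
  qed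
  show ?thesis
  proof (rule weak_deriv_limit[OF open_Times[OF \<Omega> open_greaterThan] wd])
    fix K :: "('a \<times> real) set" assume "compact K" "K \<subseteq> \<Omega> \<times> {0<..}"
    then obtain a b where ab: "0 < a" "a \<le> b" "K \<subseteq> \<Omega> \<times> {a..b}" by (rule compact_in_cylinder)
    show "\<exists>S\<in>sets borel. K \<subseteq> S \<and> S \<subseteq> \<Omega> \<times> {0<..} \<and> L2_tendsto S (w j) (\<lambda>(x, y). V j x y t) \<and>
        L2_tendsto S (w (Suc j)) (\<lambda>(x, y). V (Suc j) x y t)"
      using ab \<Omega>_borel conv[OF ab(1,2)] by (intro bexI[of _ "\<Omega> \<times> {a..b}"]) (auto simp: borel_Times)
  qed
qed

text \<open>The coefficients are products of a function of \<open>t\<close> and a function of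
  \<open>y\<close>, so after Bessel's inequality in \<open>x\<close> the remaining integral splits,
  for each \<open>k\<close>, into two one-dimensional ones.\<close>

lemma field_norm_bound:
  fixes \<Phi> :: "nat \<Rightarrow> 'a \<Rightarrow> 'b::euclidean_space"
  assumes Vm: "(\<lambda>(x, y, t). V x y t) \<in> borel_measurable borel"
    and est: "AE t in lborel. AE y in lborel. 0 < y \<longrightarrow> (\<forall>N. sqn \<Omega> (\<lambda>x. V x y t - (\<Sum>k<N. cf m j k t y *\<^sub>R \<Phi> k x))
      \<le> ennreal B * (\<Sum>k. ennreal ((cf m j (k + N) t y)\<^sup>2)))"
  shows "wnorm2 \<Omega> T \<beta> \<theta> V \<le> ennreal B * (\<Sum>k. (\<integral>\<^sup>+t. ennreal ((u k t)\<^sup>2) \<partial>lborel) *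
    (\<integral>\<^sup>+y. ennreal (indicator {0<..} y * (y powr \<beta> * exp (\<theta> * y) * (lam k powr (real m / 2) * q k j y)\<^sup>2)) \<partial>lborel))"
proof -
  let ?\<omega> = "\<lambda>y. y powr \<beta> * exp (\<theta> * y)"
  let ?g = "\<lambda>k y. ennreal (indicator {0<..} y * (?\<omega> y * (lam k powr (real m / 2) * q k j y)\<^sup>2))"
  have J: "{0<..} \<in> sets (borel :: real measure)" "{0<..<T} \<in> sets (borel :: real measure)" by auto
  have inner: "AE t in lborel. AE y in lborel. (\<integral>\<^sup>+x. ennreal (?\<omega> y * (norm (V x y t))\<^sup>2) \<partial>lebesgue_on \<Omega>) * indicator {0<..} y
      \<le> ennreal B * (\<Sum>k. ennreal ((u k t)\<^sup>2) * ?g k y)"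
    using est
  proof eventually_elim
    case (elim t)
    then show ?case
    proof eventually_elim
    case (elim y)
    note H = this
    show "(\<integral>\<^sup>+x. ennreal (?\<omega> y * (norm (V x y t))\<^sup>2) \<partial>lebesgue_on \<Omega>) * indicator {0<..} y
      \<le> ennreal B * (\<Sum>k. ennreal ((u k t)\<^sup>2) * ?g k y)"
    proof (cases "0 < y")
      case True
      \<comment> \<open>The tail estimate at \<open>N = 0\<close>, where the partial sum is
        empty.\<close>
      have "sqn \<Omega> (\<lambda>x. V x y t) \<le> ennreal B * (\<Sum>k. ennreal ((cf m j k t y)\<^sup>2))"
        using H[rule_format, OF True, of 0] by simp
      then have "ennreal (?\<omega> y) * sqn \<Omega> (\<lambda>x. V x y t) \<le> ennreal (?\<omega> y) * (ennreal B * (\<Sum>k. ennreal ((cf m j k t y)\<^sup>2)))"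
        by (rule mult_left_mono) simp
      also have "\<dots> = ennreal B * (\<Sum>k. ennreal (?\<omega> y) * ennreal ((cf m j k t y)\<^sup>2))" by (simp add: mult_ac)
      also have "(\<lambda>k. ennreal (?\<omega> y) * ennreal ((cf m j k t y)\<^sup>2)) = (\<lambda>k. ennreal ((u k t)\<^sup>2) * ?g k y)"
        using True by (simp add: cf_def power_mult_distrib mult_ac flip: ennreal_mult)
      finally have 1: "ennreal (?\<omega> y) * sqn \<Omega> (\<lambda>x. V x y t) \<le> ennreal B * (\<Sum>k. ennreal ((u k t)\<^sup>2) * ?g k y)" .
      have "(\<lambda>x. (\<lambda>(x, y, t). V x y t) (x, y, t)) \<in> borel_measurable borel"
      proof -
        have [measurable]: "(\<lambda>(x, y, t). V x y t) \<in> borel_measurable (borel \<Otimes>\<^sub>M (borel \<Otimes>\<^sub>M borel))"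
          using Vm by (simp add: borel_prod)
        show ?thesis by measurable
      qed
      then have "(\<lambda>x. V x y t) \<in> borel_measurable (lebesgue_on \<Omega>)"
        by (intro borel_measurable_lebesgue_on_borel) simp
      then have "(\<integral>\<^sup>+x. ennreal (?\<omega> y * (norm (V x y t))\<^sup>2) \<partial>lebesgue_on \<Omega>) = ennreal (?\<omega> y) * sqn \<Omega> (\<lambda>x. V x y t)"
        unfolding sqn_def by (subst nn_integral_cmult[symmetric]) (auto simp: ennreal_mult)
      then show ?thesis using 1 True by simp
    qed simp
    qed
  qed
  have gm[measurable]: "?g k \<in> borel_measurable borel" for k by measurable
  have "wnorm2 \<Omega> T \<beta> \<theta> V \<le> (\<integral>\<^sup>+t. (\<integral>\<^sup>+y. (\<integral>\<^sup>+x. ennreal (?\<omega> y * (norm (V x y t))\<^sup>2) \<partial>lebesgue_on \<Omega>) * indicator {0<..} y \<partial>lborel) \<partial>lborel)"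
    unfolding wnorm2_def nn_integral_lebesgue_on[OF J(1)] nn_integral_lebesgue_on[OF J(2)]
    by (intro nn_integral_mono) (simp add: indicator_def)
  also have "\<dots> \<le> (\<integral>\<^sup>+t. (\<integral>\<^sup>+y. ennreal B * (\<Sum>k. ennreal ((u k t)\<^sup>2) * ?g k y) \<partial>lborel) \<partial>lborel)"
    by (intro nn_integral_mono_AE) (use inner in \<open>eventually_elim, intro nn_integral_mono_AE\<close>)
  also have "\<dots> = (\<integral>\<^sup>+t. ennreal B * (\<Sum>k. ennreal ((u k t)\<^sup>2) * (\<integral>\<^sup>+y. ?g k y \<partial>lborel)) \<partial>lborel)"
    by (simp add: nn_integral_cmult nn_integral_suminf)
  also have "\<dots> = ennreal B * (\<Sum>k. (\<integral>\<^sup>+t. ennreal ((u k t)\<^sup>2) \<partial>lborel) * (\<integral>\<^sup>+y. ?g k y \<partial>lborel))"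
    by (simp add: nn_integral_cmult nn_integral_multc nn_integral_suminf)
  finally show ?thesis .
qed

end

subsection \<open>The extension profiles as a family\<close>

lemma nn_integral_powr_exp:
  fixes p c :: real
  assumes "0 < p" "0 < c"
  shows "(\<integral>\<^sup>+y. ennreal (indicator {0<..} y * (y powr (p - 1) * exp (- c * y))) \<partial>lborel) = ennreal (Gamma p / c powr p)"
proof -
  let ?f = "\<lambda>t. ennreal (indicator {0..} t * t powr (p - 1) / exp t)"
  have "ennreal (Gamma p) = (\<integral>\<^sup>+t. ?f t \<partial>lborel)" using Gamma_conv_nn_integral_real[OF assms(1)] by simp
  also have "\<dots> = ennreal c * (\<integral>\<^sup>+y. ?f (0 + c * y) \<partial>lborel)"
    using nn_integral_real_affine[of ?f c 0] assms by simp
  also have "(\<integral>\<^sup>+y. ?f (0 + c * y) \<partial>lborel) =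
      (\<integral>\<^sup>+y. ennreal (c powr (p - 1)) * ennreal (indicator {0<..} y * (y powr (p - 1) * exp (- c * y))) \<partial>lborel)"
  proof (intro nn_integral_cong)
    fix y :: real
    consider "0 < y" | "y = 0" | "y < 0" by linarith
    then show "?f (0 + c * y) = ennreal (c powr (p - 1)) * ennreal (indicator {0<..} y * (y powr (p - 1) * exp (- c * y)))"
    proof cases
      case 1
      then show ?thesis using assms
        by (simp add: powr_mult exp_minus divide_inverse mult_ac flip: ennreal_mult)
    next
      case 3
      then have "\<not> 0 \<le> c * y" using assms by (simp add: zero_le_mult_iff)
      then show ?thesis using 3 by simp
    qed simp
  qed
  also have "\<dots> = ennreal (c powr (p - 1)) * (\<integral>\<^sup>+y. ennreal (indicator {0<..} y * (y powr (p - 1) * exp (- c * y))) \<partial>lborel)"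
    by (rule nn_integral_cmult) measurable
  finally have *: "ennreal (Gamma p) = ennreal (c powr p) *
      (\<integral>\<^sup>+y. ennreal (indicator {0<..} y * (y powr (p - 1) * exp (- c * y))) \<partial>lborel)"
    using assms by (simp add: powr_diff flip: mult.assoc ennreal_mult)
  have "ennreal (Gamma p / c powr p) = ennreal (1 / c powr p) * ennreal (Gamma p)"
    using assms by (simp add: Gamma_real_nonneg flip: ennreal_mult)
  also have "\<dots> = (ennreal (1 / c powr p) * ennreal (c powr p)) *
      (\<integral>\<^sup>+y. ennreal (indicator {0<..} y * (y powr (p - 1) * exp (- c * y))) \<partial>lborel)"
    unfolding * by (simp add: mult.assoc)
  also have "ennreal (1 / c powr p) * ennreal (c powr p) = 1"
    using assms by (simp flip: ennreal_mult)
  finally show ?thesis by simp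
qed

text \<open>One profile and its dilations give constants common to all \<open>k\<close>; the
  dependence on \<open>k\<close> of each weighted integral is a single power of
  \<open>lam k\<close>.\<close>

lemma profile_family:
  fixes lam :: "nat \<Rightarrow> real"
  assumes lam: "\<And>k. 0 < lam k" "\<And>k. lam 0 \<le> lam k" and \<psi>: "\<And>k. extension_profile s (lam k) (\<psi> k)"
    and s: "0 < s" "s < 1" and \<theta>: "0 \<le> \<theta>" "\<theta> < 2 * sqrt (lam 0)"
  obtains q C \<kappa> \<delta> where "\<And>k j. q k j \<in> borel_measurable borel"
    "\<And>k j y. 0 < y \<Longrightarrow> (q k j has_real_derivative q k (Suc j) y) (at y)"
    "\<And>k j y. y \<le> 0 \<Longrightarrow> q k j y = 0" "\<And>k y. 0 < y \<Longrightarrow> q k 0 y = \<psi> k y"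
    "\<And>j m. \<exists>C. \<forall>k y. 0 < y \<longrightarrow> lam k powr (real m / 2) * \<bar>q k j y\<bar> * y ^ (j + m) \<le> C"
    "1 < \<kappa>" "0 < C" "0 < \<delta>"
    "\<And>k j m \<beta> p. 1 \<le> j \<Longrightarrow> 0 < p \<Longrightarrow> p = \<beta> + 4 * s - 2 * real j + 1 \<Longrightarrow>
      (\<integral>\<^sup>+y. ennreal (indicator {0<..} y * (y powr \<beta> * exp (\<theta> * y) * (lam k powr (real m / 2) * q k j y)\<^sup>2)) \<partial>lborel)
      \<le> ennreal (C\<^sup>2 * (Gamma p / \<delta> powr p) * (\<kappa> ^ (2 * j) * (fact j)\<^sup>2) * lam k powr (real m + 2 * s - p / 2))"
proof -
  \<comment> \<open>Rescaling \<open>\<psi> 0\<close> gives the profile for the eigenvalue 1, the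
    common template of the family.\<close>
  define P where "P z = \<psi> 0 (1 / sqrt (lam 0) * z)" for z
  have sl: "0 < sqrt (lam k)" for k using lam by simp
  have "lam 0 * (1 / sqrt (lam 0))\<^sup>2 = 1" using lam[of 0] by (simp add: power_divide)
  then have P: "extension_profile s 1 P"
    using extension_profile_scale[OF \<psi>[of 0], of "1 / sqrt (lam 0)"] sl[of 0] unfolding P_def by simp
  have \<psi>P: "\<psi> k y = P (sqrt (lam k) * y)" if "0 \<le> y" for k y
  proof -
    have "extension_profile s (lam k) (\<lambda>y. P (sqrt (lam k) * y))"
      using extension_profile_scale[OF P sl[of k]] lam[of k] by simp
    from extension_profile_unique[OF \<psi> this lam(1) that] show ?thesis .
  qed
  \<comment> \<open>The midpoint between \<open>\<theta> / (2 * sqrt (lam 0))\<close> and 1. Squared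
    profiles decay at the rate \<open>2 * b * sqrt (lam k)\<close>, and after the weight
    \<open>exp (\<theta> * y)\<close> at least the rate \<open>\<delta> * sqrt (lam k)\<close> is
    left, because \<open>lam 0 \<le> lam k\<close>.\<close>
  define b where "b = (1 + \<theta> / (2 * sqrt (lam 0))) / 2"
  define \<delta> where "\<delta> = 1 - \<theta> / (2 * sqrt (lam 0))"
  have th: "0 \<le> \<theta> / (2 * sqrt (lam 0))" "\<theta> / (2 * sqrt (lam 0)) < 1" using \<theta> sl[of 0] by (auto simp: field_simps)
  have b: "0 < b" "b < 1" and \<delta>: "0 < \<delta>" using th by (auto simp: b_def \<delta>_def)
  have decay: "\<delta> * sqrt (lam k) \<le> 2 * b * sqrt (lam k) - \<theta>" for k
  proof -
    have "\<theta> = \<theta> / sqrt (lam 0) * sqrt (lam 0)" using sl[of 0] by simp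
    also have "\<dots> \<le> \<theta> / sqrt (lam 0) * sqrt (lam k)"
      using \<theta>(1) lam(2) less_imp_le[OF sl[of 0]] by (intro mult_left_mono divide_nonneg_nonneg) auto
    finally have "\<theta> \<le> \<theta> / sqrt (lam 0) * sqrt (lam k)" .
    moreover have "\<delta> = 2 * b - \<theta> / sqrt (lam 0)" by (simp add: \<delta>_def b_def)
    then have "\<delta> * sqrt (lam k) = 2 * b * sqrt (lam k) - \<theta> / sqrt (lam 0) * sqrt (lam k)"
      by (simp only: left_diff_distrib)
    ultimately show ?thesis by linarith
  qed
  obtain D C \<kappa> where D: "D 0 = P" "1 < \<kappa>" "0 < C"
    "\<And>m z. 0 < z \<Longrightarrow> (D m has_real_derivative D (Suc m) z) (at z)"
    "\<And>z. 0 < z \<Longrightarrow> \<bar>P z\<bar> \<le> 1" "\<And>z. 0 < z \<Longrightarrow> \<bar>P z\<bar> \<le> C * exp (- b * z)"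
    "\<And>m z. 1 \<le> m \<Longrightarrow> 0 < z \<Longrightarrow> \<bar>D m z\<bar> \<le> C * \<kappa> ^ m * fact m * (z powr (2 * s - real m) * exp (- b * z))"
    by (rule extension_profile_bounds[OF P s b]) (rule that)
  \<comment> \<open>The power of \<open>lam k\<close> is the chain rule for
    \<open>P (sqrt (lam k) * y)\<close>.\<close>
  define q where "q k j y = (if 0 < y then lam k powr (real j / 2) * D j (sqrt (lam k) * y) else 0)" for k j y
  have dq: "((\<lambda>y. lam k powr (real j / 2) * D j (sqrt (lam k) * y)) has_real_derivative q k (Suc j) y) (at y)"
    if y: "0 < y" for k j y
  proof -
    have "((\<lambda>y. D j (sqrt (lam k) * y)) has_real_derivative D (Suc j) (sqrt (lam k) * y) * sqrt (lam k)) (at y)"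
      by (rule DERIV_chain2[OF D(4)]) (use sl y in \<open>auto intro!: derivative_eq_intros\<close>)
    from DERIV_cmult[OF this, of "lam k powr (real j / 2)"]
    have "((\<lambda>y. lam k powr (real j / 2) * D j (sqrt (lam k) * y)) has_real_derivative
        lam k powr (real j / 2) * (D (Suc j) (sqrt (lam k) * y) * sqrt (lam k))) (at y)" .
    moreover have "lam k powr (real j / 2) * (D (Suc j) (sqrt (lam k) * y) * sqrt (lam k)) = q k (Suc j) y"
    proof -
      have "lam k powr (real j / 2) * sqrt (lam k) = lam k powr (real j / 2) * lam k powr (1 / 2)"
        using lam[of k] by (simp add: powr_half_sqrt)
      also have "\<dots> = lam k powr (real (Suc j) / 2)" by (simp add: add_divide_distrib add.commute flip: powr_add)
      finally show ?thesis using y by (simp add: q_def mult_ac)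
    qed
    ultimately show ?thesis by simp
  qed
  have q_deriv: "(q k j has_real_derivative q k (Suc j) y) (at y)" if "0 < y" for k j y
    using dq[OF that] by (rule has_field_derivative_transform_within_open[of _ _ _ "{0<..}"])
      (use that in \<open>auto simp: q_def\<close>)
  have q_meas: "q k j \<in> borel_measurable borel" for k j
  proof -
    have "continuous_on {0<..} (\<lambda>y. lam k powr (real j / 2) * D j (sqrt (lam k) * y))"
      using dq by (intro continuous_at_imp_continuous_on ballI DERIV_isCont) auto
    then have "(\<lambda>y. indicator {0<..} y *\<^sub>R (lam k powr (real j / 2) * D j (sqrt (lam k) * y))) \<in> borel_measurable borel"
      by (intro borel_measurable_continuous_on_indicator) auto
    moreover have "(\<lambda>y. indicator {0<..} y *\<^sub>R (lam k powr (real j / 2) * D j (sqrt (lam k) * y))) = q k j"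
      by (auto simp: q_def indicator_def fun_eq_iff)
    ultimately show ?thesis by (simp only:)
  qed
  have scale: "(sqrt (lam k) * y) powr a = lam k powr (a / 2) * y powr a" if "0 < y" for k y a
    using lam[of k] that by (simp add: powr_mult powr_powr flip: powr_half_sqrt)
  have q_bound: "\<exists>C. \<forall>k y. 0 < y \<longrightarrow> lam k powr (real m / 2) * \<bar>q k j y\<bar> * y ^ (j + m) \<le> C" for j m
  proof -
    have eq: "lam k powr (real m / 2) * \<bar>q k j y\<bar> * y ^ (j + m) = (sqrt (lam k) * y) powr (real (j + m)) * \<bar>D j (sqrt (lam k) * y)\<bar>"
      if "0 < y" for k y
    proof -
      have "lam k powr (real (j + m) / 2) = lam k powr (real m / 2) * lam k powr (real j / 2)"
        by (simp add: add_divide_distrib add.commute flip: powr_add)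
      then have "(sqrt (lam k) * y) powr (real (j + m)) = lam k powr (real m / 2) * lam k powr (real j / 2) * y ^ (j + m)"
        unfolding scale[OF that] powr_realpow[OF that] by simp
      then show ?thesis using that by (simp add: q_def abs_mult mult_ac)
    qed
    have "\<exists>C. \<forall>z>0. z powr (real (j + m)) * \<bar>D j z\<bar> \<le> C"
    \<comment> \<open>The derivative bound starts at order 1, with the power
      \<open>z powr (2 * s - j)\<close>; \<open>P\<close> itself only has the exponential bound,
      which suits the power \<open>z powr m\<close>.\<close>
    proof (cases "j = 0")
      case True
      obtain K where K: "\<And>z. 0 < z \<Longrightarrow> z powr (real m) * exp (- b * z) \<le> K"
        using powr_exp_bounded[of "real m" b] b by auto
      have "z powr (real m) * \<bar>P z\<bar> \<le> C * K" if "0 < z" for z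
      proof -
        have "z powr (real m) * \<bar>P z\<bar> \<le> z powr (real m) * (C * exp (- b * z))" by (intro mult_left_mono D(6) that) simp
        also have "\<dots> = C * (z powr (real m) * exp (- b * z))" by simp
        also have "\<dots> \<le> C * K" using D(3) by (intro mult_left_mono K that) simp
        finally show ?thesis .
      qed
      then show ?thesis using True D(1) by auto
    next
      case False
      obtain K where K: "\<And>z. 0 < z \<Longrightarrow> z powr (real m + 2 * s) * exp (- b * z) \<le> K"
        using powr_exp_bounded[of "real m + 2 * s" b] b s by auto
      have "z powr (real (j + m)) * \<bar>D j z\<bar> \<le> C * \<kappa> ^ j * fact j * K" if "0 < z" for z
      proof -
        have "z powr (real (j + m)) * \<bar>D j z\<bar> \<le> z powr (real (j + m)) * (C * \<kappa> ^ j * fact j * (z powr (2 * s - real j) * exp (- b * z)))"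
          using False by (intro mult_left_mono D(7) that) auto
        also have "\<dots> = C * \<kappa> ^ j * fact j * ((z powr (real (j + m)) * z powr (2 * s - real j)) * exp (- b * z))" by (simp only: mult_ac)
        also have "z powr (real (j + m)) * z powr (2 * s - real j) = z powr (real m + 2 * s)" by (simp flip: powr_add)
        also have "C * \<kappa> ^ j * fact j * (z powr (real m + 2 * s) * exp (- b * z)) \<le> C * \<kappa> ^ j * fact j * K"
          using D(2,3) by (intro mult_left_mono K that) auto
        finally show ?thesis .
      qed
      then show ?thesis by blast
    qed
    then obtain C' where C': "\<And>z. 0 < z \<Longrightarrow> z powr (real (j + m)) * \<bar>D j z\<bar> \<le> C'" by blast
    show ?thesis
    proof (intro exI[of _ C'] allI impI)
      fix k y assume "0 < (y::real)"
      then show "lam k powr (real m / 2) * \<bar>q k j y\<bar> * y ^ (j + m) \<le> C'"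
        unfolding eq[OF \<open>0 < y\<close>] using sl by (intro C') simp
    qed
  qed
  have weighted: "(\<integral>\<^sup>+y. ennreal (indicator {0<..} y * (y powr \<beta> * exp (\<theta> * y) * (lam k powr (real m / 2) * q k j y)\<^sup>2)) \<partial>lborel)
      \<le> ennreal (C\<^sup>2 * (Gamma p / \<delta> powr p) * (\<kappa> ^ (2 * j) * (fact j)\<^sup>2) * lam k powr (real m + 2 * s - p / 2))"
    if j: "1 \<le> j" and p: "0 < p" "p = \<beta> + 4 * s - 2 * real j + 1" for k j m \<beta> p
  proof -
    define A where "A = C\<^sup>2 * (\<kappa> ^ (2 * j) * (fact j)\<^sup>2) * lam k powr (real m + 2 * s)"
    have A: "0 \<le> A" using D(2) by (auto simp: A_def)
    define c where "c = \<delta> * sqrt (lam k)"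
    have c: "0 < c" using \<delta> sl by (simp add: c_def)
    have pt: "y powr \<beta> * exp (\<theta> * y) * (lam k powr (real m / 2) * q k j y)\<^sup>2 \<le> A * (y powr (p - 1) * exp (- c * y))"
      if y: "0 < y" for y
    proof -
      define z where "z = sqrt (lam k) * y"
      have z: "0 < z" using sl y by (simp add: z_def)
      define Q where "Q = lam k powr (real m / 2) * lam k powr (real j / 2) * (C * \<kappa> ^ j * fact j * (z powr (2 * s - real j) * exp (- b * z)))"
      have "\<bar>lam k powr (real m / 2) * q k j y\<bar> \<le> Q"
        using D(7)[OF j z] y by (simp add: q_def Q_def abs_mult z_def mult.assoc mult_left_mono)
      then have "\<bar>lam k powr (real m / 2) * q k j y\<bar>\<^sup>2 \<le> Q\<^sup>2" by (intro power_mono) auto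
      then have "y powr \<beta> * exp (\<theta> * y) * (lam k powr (real m / 2) * q k j y)\<^sup>2 \<le> y powr \<beta> * exp (\<theta> * y) * Q\<^sup>2"
        by (intro mult_left_mono) auto
      also have "Q = C * \<kappa> ^ j * fact j * (lam k powr (real m / 2 + s) * y powr (2 * s - real j) * exp (- b * z))"
      proof -
        have "lam k powr (real m / 2) * lam k powr (real j / 2) * lam k powr ((2 * s - real j) / 2) = lam k powr (real m / 2 + s)"
          by (simp add: diff_divide_distrib flip: powr_add)
        then show ?thesis unfolding Q_def z_def scale[OF y] by (simp add: mult_ac)
      qed
      also have "y powr \<beta> * exp (\<theta> * y) * (C * \<kappa> ^ j * fact j * (lam k powr (real m / 2 + s) * y powr (2 * s - real j) * exp (- b * z)))\<^sup>2
          = A * ((y powr \<beta> * (y powr (2 * s - real j))\<^sup>2) * (exp (\<theta> * y) * (exp (- b * z))\<^sup>2))"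
      proof -
        have "(lam k powr (real m / 2 + s))\<^sup>2 = lam k powr (real m + 2 * s)"
          by (simp add: power2_eq_square flip: powr_add)
        then show ?thesis unfolding A_def power_mult_distrib power_even_eq by (simp only: mult_ac)
      qed
      \<comment> \<open>Weight and squared singularity together: \<open>p > 0\<close> is
        integrability at 0, and what remains is a Gamma integral with rate \<open>c\<close>.\<close>
      also have "y powr \<beta> * (y powr (2 * s - real j))\<^sup>2 = y powr (p - 1)"
        by (simp add: power2_eq_square p(2) algebra_simps flip: powr_add)
      also have "exp (\<theta> * y) * (exp (- b * z))\<^sup>2 \<le> exp (- c * y)"
      proof -
        have "exp (\<theta> * y) * (exp (- b * z))\<^sup>2 = exp (- ((2 * b * sqrt (lam k) - \<theta>) * y))"
          by (simp add: z_def power2_eq_square algebra_simps flip: exp_add)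
        also have "\<dots> \<le> exp (- (c * y))" using mult_right_mono[OF decay[of k], of y] y by (simp add: c_def)
        finally show ?thesis by simp
      qed
      finally show ?thesis using A by (simp add: mult_left_mono)
    qed
    have "(\<integral>\<^sup>+y. ennreal (indicator {0<..} y * (y powr \<beta> * exp (\<theta> * y) * (lam k powr (real m / 2) * q k j y)\<^sup>2)) \<partial>lborel)
        \<le> (\<integral>\<^sup>+y. ennreal A * ennreal (indicator {0<..} y * (y powr (p - 1) * exp (- c * y))) \<partial>lborel)"
    proof (intro nn_integral_mono)
      fix y
      show "ennreal (indicator {0<..} y * (y powr \<beta> * exp (\<theta> * y) * (lam k powr (real m / 2) * q k j y)\<^sup>2))
          \<le> ennreal A * ennreal (indicator {0<..} y * (y powr (p - 1) * exp (- c * y)))"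
        using pt[of y] A by (cases "0 < y") (auto simp: ennreal_leI simp flip: ennreal_mult)
    qed
    also have "\<dots> = ennreal A * ennreal (Gamma p / c powr p)"
      by (subst nn_integral_cmult) (simp_all add: nn_integral_powr_exp[OF p(1) c, simplified])
    also have "\<dots> = ennreal (A * (Gamma p / c powr p))"
      using A p(1) by (simp add: Gamma_real_nonneg flip: ennreal_mult)
    also have "A * (Gamma p / c powr p) = C\<^sup>2 * (Gamma p / \<delta> powr p) * (\<kappa> ^ (2 * j) * (fact j)\<^sup>2) * lam k powr (real m + 2 * s - p / 2)"
    proof -
      have "c powr p = \<delta> powr p * lam k powr (p / 2)"
        unfolding c_def using \<delta> lam[of k] by (simp add: powr_mult powr_powr flip: powr_half_sqrt)
      then show ?thesis by (simp add: A_def powr_diff)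
    qed
    finally show ?thesis .
  qed
  have "lam k \<noteq> 0" for k using lam(1)[of k] by simp
  then show ?thesis
    by (intro that[OF q_meas q_deriv _ _ q_bound D(2) D(3) \<delta> weighted]) (simp_all add: q_def \<psi>P D(1))
qed

subsection \<open>The derivatives of the solution\<close>

context cylinder_series
begin

text \<open>\<open>U\<close> is Lebesgue measurable and determined only slice by slice. A Borel
  version \<open>Ub\<close> and a null set \<open>N\<close> that contains the places where the two
  differ reduce the comparison with \<open>V 0\<close> to the Borel set \<open>E\<close>, which is
  null by uniqueness of limits in each slice. Then the weak derivatives of \<open>U\<close> are
  obtained from \<open>V 0\<close>, one order at a time.\<close>

lemma solution_derivative_fields:
  fixes \<phi> :: "nat \<Rightarrow> 'a \<Rightarrow> real" and U :: "'a \<Rightarrow> real \<Rightarrow> real \<Rightarrow> real"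
  assumes L: "\<And>k. in_L2 \<Omega> (\<phi> k)"
    and bessel: "\<And>I b. finite I \<Longrightarrow> sqn \<Omega> (\<lambda>x. \<Sum>k\<in>I. b k *\<^sub>R \<phi> k x) \<le> ennreal (1 * (\<Sum>k\<in>I. (b k)\<^sup>2))"
    and U: "cyl_measurable \<Omega> T U"
    and series: "AE t in lborel. t \<in> {0<..<T} \<longrightarrow> (AE y in lborel. 0 < y \<longrightarrow>
        L2_tendsto \<Omega> (\<lambda>N x. \<Sum>k<N. cf 0 0 k t y *\<^sub>R \<phi> k x) (\<lambda>x. U x y t))"
  obtains V where "\<And>j. (\<lambda>(x, y, t). V j x y t) \<in> borel_measurable borel"
    "\<And>j. AE t in lborel. AE y in lborel. 0 < y \<longrightarrow> (\<forall>N. sqn \<Omega> (\<lambda>x. V j x y t - (\<Sum>k<N. cf 0 j k t y *\<^sub>R \<phi> k x))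
      \<le> ennreal 1 * (\<Sum>k. ennreal ((cf 0 j (k + N) t y)\<^sup>2)))"
    "\<And>j. dy_power \<Omega> T j U (V j)"
proof -
  have "\<forall>j. \<exists>V. (\<lambda>(x, y, t). V x y t) \<in> borel_measurable borel \<and>
    (AE t in lborel. AE y in lborel. 0 < y \<longrightarrow> (\<forall>N. sqn \<Omega> (\<lambda>x. V x y t - (\<Sum>k<N. cf 0 j k t y *\<^sub>R \<phi> k x))
      \<le> ennreal 1 * (\<Sum>k. ennreal ((cf 0 j (k + N) t y)\<^sup>2))))"
  proof
    fix j
    show "\<exists>V. (\<lambda>(x, y, t). V x y t) \<in> borel_measurable borel \<and>
      (AE t in lborel. AE y in lborel. 0 < y \<longrightarrow> (\<forall>N. sqn \<Omega> (\<lambda>x. V x y t - (\<Sum>k<N. cf 0 j k t y *\<^sub>R \<phi> k x))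
        \<le> ennreal 1 * (\<Sum>k. ennreal ((cf 0 j (k + N) t y)\<^sup>2))))"
      by (rule field_exists[of \<phi> 1 0 j, OF L zero_le_one bessel], assumption) blast
  qed
  from choice[OF this] obtain V where Vm: "\<And>j. (\<lambda>(x, y, t). V j x y t) \<in> borel_measurable borel"
    and Vest: "\<And>j. AE t in lborel. AE y in lborel. 0 < y \<longrightarrow> (\<forall>N. sqn \<Omega> (\<lambda>x. V j x y t - (\<Sum>k<N. cf 0 j k t y *\<^sub>R \<phi> k x))
      \<le> ennreal 1 * (\<Sum>k. ennreal ((cf 0 j (k + N) t y)\<^sup>2)))"
    by blast
  let ?S3 = "\<Omega> \<times> {0::real<..} \<times> {0<..<T}"
  have S3: "?S3 \<in> sets borel" by (intro borel_Times \<Omega>_borel) auto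
  have S2: "\<Omega> \<times> {0<..} \<in> sets (borel :: ('a \<times> real) measure)" by (intro borel_Times \<Omega>_borel) auto
  have T: "{0<..<T} \<in> sets (borel :: real measure)" by simp
  obtain Ub where Ub: "Ub \<in> borel_measurable borel"
    and UUb: "AE p in lborel. p \<in> ?S3 \<longrightarrow> (\<lambda>(x, y, t). U x y t) p = Ub p"
    using borel_version[OF U[unfolded cyl_measurable_def] S3] by blast
  from AE_E[OF UUb] obtain N where N: "{p \<in> space lborel. \<not> (p \<in> ?S3 \<longrightarrow> (\<lambda>(x, y, t). U x y t) p = Ub p)} \<subseteq> N"
    "emeasure lborel N = 0" "N \<in> sets lborel" by blast
  have Nb: "N \<in> sets borel" and Nnull: "N \<in> null_sets lborel" using N by auto
  have N_out: "U x y t = Ub (x, y, t)" if "(x, y, t) \<notin> N" "(x, y, t) \<in> ?S3" for x y t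
  proof (rule ccontr)
    assume "U x y t \<noteq> Ub (x, y, t)"
    with that(2) have "(x, y, t) \<in> {p \<in> space lborel. \<not> (p \<in> ?S3 \<longrightarrow> (\<lambda>(x, y, t). U x y t) p = Ub p)}" by simp
    then show False using N(1) that(1) by blast
  qed
  define E where "E = {p. p \<in> ?S3 \<and> Ub p \<noteq> (\<lambda>(x, y, t). V 0 x y t) p}"
  have Eb: "E \<in> sets borel"
  proof -
    have "E = {p \<in> space borel. Ub p \<noteq> (\<lambda>(x, y, t). V 0 x y t) p} \<inter> ?S3" by (auto simp: E_def)
    also have "\<dots> \<in> sets borel" using Ub Vm[of 0] S3 by (intro sets.Int borel_measurable_neq) auto
    finally show ?thesis .
  qed
  have "AE t in lborel. AE y in lborel. AE x in lborel. (x, y, t) \<notin> E"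
    using series AE_iterated(1)[OF Nb, THEN iffD2, OF Nnull] Vest[of 0] AE_u_square_summable
  proof eventually_elim
    case (elim t)
    show ?case
    proof (cases "t \<in> {0<..<T}")
      case True
      then have "AE y in lborel. 0 < y \<longrightarrow> L2_tendsto \<Omega> (\<lambda>N x. \<Sum>k<N. cf 0 0 k t y *\<^sub>R \<phi> k x) (\<lambda>x. U x y t)"
        using elim by blast
      then show ?thesis using elim(2,3)
      proof eventually_elim
        case (elim y)
        show ?case
        proof (cases "0 < y")
          case y: True
          have "L2_tendsto \<Omega> (\<lambda>N x. \<Sum>k<N. cf 0 0 k t y *\<^sub>R \<phi> k x) (\<lambda>x. V 0 x y t)"
            by (rule field_L2_tendsto[OF L Vm _ \<open>(\<Sum>k. ennreal ((u k t)\<^sup>2)) < \<infinity>\<close> y]) (use elim y in blast)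
          from L2_tendsto_unique[OF elim(1)[rule_format, OF y] this]
          have "AE x in lborel. x \<in> \<Omega> \<longrightarrow> U x y t = V 0 x y t" unfolding AE_lebesgue_on_iff[OF \<Omega>_borel] .
          then show ?thesis using elim(2)
          proof eventually_elim
            case (elim x)
            show ?case
            proof
              assume "(x, y, t) \<in> E"
              then have "(x, y, t) \<in> ?S3" "Ub (x, y, t) \<noteq> V 0 x y t" by (auto simp: E_def)
              then show False using elim N_out[of x y t] by auto
            qed
          qed
        qed (simp add: E_def)
      qed
    qed (auto simp: E_def)
  qed
  then have Enull: "E \<in> null_sets lborel" using AE_iterated(1)[OF Eb] by blast
  have base: "AE t in lborel. t \<in> {0<..<T} \<longrightarrow> (AE z in lebesgue_on (\<Omega> \<times> {0<..}). (\<lambda>(x, y). U x y t) z = (\<lambda>(x, y). V 0 x y t) z)"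
    using AE_iterated(2)[OF Eb Enull] AE_iterated(2)[OF Nb Nnull]
  proof eventually_elim
    case (elim t)
    show ?case
    proof
      assume t: "t \<in> {0<..<T}"
      show "AE z in lebesgue_on (\<Omega> \<times> {0<..}). (\<lambda>(x, y). U x y t) z = (\<lambda>(x, y). V 0 x y t) z"
        unfolding AE_lebesgue_on_iff[OF S2] using elim
      proof eventually_elim
        case (elim z)
        obtain x y where z: "z = (x, y)" by (cases z)
        show ?case
        proof
          assume "z \<in> \<Omega> \<times> {0<..}"
          then have in3: "(x, y, t) \<in> ?S3" using t by (simp add: z)
          then have "Ub (x, y, t) = V 0 x y t" using elim by (auto simp: E_def z)
          moreover have "U x y t = Ub (x, y, t)" using N_out[OF _ in3] elim by (simp add: z)
          ultimately show "(\<lambda>(x, y). U x y t) z = (\<lambda>(x, y). V 0 x y t) z" by (simp add: z)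
        qed
      qed
    qed
  qed
  \<comment> \<open>One exceptional set of times for all orders, so that the induction on
    \<open>j\<close> runs at a fixed \<open>t\<close>.\<close>
  have all_est: "AE t in lborel. \<forall>j. AE y in lborel. 0 < y \<longrightarrow> (\<forall>N. sqn \<Omega> (\<lambda>x. V j x y t - (\<Sum>k<N. cf 0 j k t y *\<^sub>R \<phi> k x))
      \<le> ennreal 1 * (\<Sum>k. ennreal ((cf 0 j (k + N) t y)\<^sup>2)))"
    using Vest by (subst AE_all_countable) blast
  have iter: "AE t in lborel. t \<in> {0<..<T} \<longrightarrow>
      (\<forall>j. weak_deriv_iter (\<Omega> \<times> {0<..}) (0, 1) j (\<lambda>(x, y). U x y t) (\<lambda>(x, y). V j x y t))"
    using base all_est AE_u_square_summable
  proof eventually_elim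
    case (elim t)
    show ?case
    proof (intro impI allI)
      fix j assume t: "t \<in> {0<..<T}"
      have step: "weak_deriv (\<Omega> \<times> {0<..}) (0, 1) (\<lambda>(x, y). V j x y t) (\<lambda>(x, y). V (Suc j) x y t)" for j
        by (rule field_weak_deriv[OF L Vm elim(2)[rule_format] elim(3)])
      show "weak_deriv_iter (\<Omega> \<times> {0<..}) (0, 1) j (\<lambda>(x, y). U x y t) (\<lambda>(x, y). V j x y t)"
      proof (induction j)
        case 0
        then show ?case using elim(1) t by simp
      next
        case (Suc j)
        then show ?case using step[of j] by auto
      qed
    qed
  qed
  have "dy_power \<Omega> T j U (V j)" for j
    unfolding dy_power_def cyl_measurable_def
  proof
    show "(\<lambda>(x, y, t). V j x y t) \<in> borel_measurable (lebesgue_on ?S3)"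
      by (rule borel_measurable_lebesgue_on_borel[OF Vm])
    show "AE t in lebesgue_on {0<..<T}. weak_deriv_iter (\<Omega> \<times> {0<..}) (0, 1) j (\<lambda>(x, y). U x y t) (\<lambda>(x, y). V j x y t)"
      unfolding AE_lebesgue_on_iff[OF T] using iter by eventually_elim blast
  qed
  then show ?thesis using that Vm Vest by blast
qed

end

section \<open>Data norms and the bounds for the fields\<close>

lemma eigenfunction_in_Hspace:
  assumes eb: "eigenbasis \<Omega> A c lam \<phi>" and L: "in_L2 \<Omega> (\<phi> k)"
  shows "\<phi> k \<in> Hspace \<Omega> lam \<phi> s"
proof -
  have "coeff \<Omega> \<phi> (\<phi> k) = (\<lambda>i. if k = i then 1 else 0)"
    using eb unfolding eigenbasis_def coeff_def by (simp add: fun_eq_iff)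
  then have "Hnorm2 lam s (coeff \<Omega> \<phi> (\<phi> k)) = (\<Sum>i. if i = k then ennreal (lam k powr s) else 0)"
    unfolding Hnorm2_def by (intro suminf_cong) auto
  also have "\<dots> = ennreal (lam k powr s)" by (subst suminf_finite[of "{k}"]) auto
  finally show ?thesis using L unfolding Hspace_def by simp
qed

text \<open>The coefficientwise bound is summed with the weight \<open>lam k powr (r + s)\<close>;
  monotone convergence exchanges the sum over \<open>k\<close> with the time integral in the norm of
  the source.\<close>

lemma wave_coeff_data_bound:
  fixes s \<gamma> T \<mu> :: real
  assumes "1 < \<gamma>" "\<gamma> < 2" "0 < T" "0 < \<mu>" "\<mu> < 1"
  obtains C where "0 < C" "\<And>D lam \<phi> r f g h. (\<forall>k. 0 < lam k) \<Longrightarrow>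
     (\<forall>k. (\<lambda>t. f t (\<phi> k)) \<in> borel_measurable (lebesgue_on {0<..<T})) \<Longrightarrow>
     (\<Sum>k. ennreal (lam k powr (r + s)) * (\<integral>\<^sup>+t. ennreal ((wave_coeff s \<gamma> (lam k) (coeff D \<phi> g k) (coeff D \<phi> h k) (\<lambda>t. f t (\<phi> k)) t)\<^sup>2) \<partial>lebesgue_on {0<..<T}))
       \<le> ennreal C * data_norm2 D T lam (\<phi> :: nat \<Rightarrow> 'a::euclidean_space \<Rightarrow> real) s \<mu> r f g h"
proof -
  obtain C where C: "0 < C" "\<And>l g h f. 0 < l \<Longrightarrow> f \<in> borel_measurable (lebesgue_on {0<..<T}) \<Longrightarrow>
     (\<integral>\<^sup>+t. ennreal ((wave_coeff s \<gamma> l g h f t)\<^sup>2) \<partial>lebesgue_on {0<..<T})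
       \<le> ennreal C * (ennreal (g\<^sup>2) + ennreal (l powr (- s) * h\<^sup>2)
          + ennreal (l powr (2 * \<mu> * s - 2 * s)) * (\<integral>\<^sup>+t. ennreal ((f t)\<^sup>2) \<partial>lebesgue_on {0<..<T}))"
    using wave_coeff_L2_bound[OF assms, of s] by metis
  have "(\<Sum>k. ennreal (lam k powr (r + s)) * (\<integral>\<^sup>+t. ennreal ((wave_coeff s \<gamma> (lam k) (coeff D \<phi> g k) (coeff D \<phi> h k) (\<lambda>t. f t (\<phi> k)) t)\<^sup>2) \<partial>lebesgue_on {0<..<T}))
       \<le> ennreal C * data_norm2 D T lam \<phi> s \<mu> r f g h"
    if lam': "\<forall>k. 0 < lam k" and f': "\<forall>k. (\<lambda>t. f t (\<phi> k)) \<in> borel_measurable (lebesgue_on {0<..<T})"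
    for D lam r f g h and \<phi> :: "nat \<Rightarrow> 'a \<Rightarrow> real"
  proof -
    note lam = lam'[rule_format] and f = f'[rule_format]
    let ?F = "\<lambda>k. \<integral>\<^sup>+t. ennreal ((f t (\<phi> k))\<^sup>2) \<partial>lebesgue_on {0<..<T}"
    have "(\<Sum>k. ennreal (lam k powr (r + s)) * (\<integral>\<^sup>+t. ennreal ((wave_coeff s \<gamma> (lam k) (coeff D \<phi> g k) (coeff D \<phi> h k) (\<lambda>t. f t (\<phi> k)) t)\<^sup>2) \<partial>lebesgue_on {0<..<T}))
        \<le> (\<Sum>k. ennreal C * (ennreal (lam k powr (r + s) * (coeff D \<phi> g k)\<^sup>2) + ennreal (lam k powr r * (coeff D \<phi> h k)\<^sup>2)
          + ennreal (lam k powr (r - s + 2 * \<mu> * s)) * ?F k))"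
    proof (intro suminf_le summableI)
      fix k
      have "ennreal (lam k powr (r + s)) * (\<integral>\<^sup>+t. ennreal ((wave_coeff s \<gamma> (lam k) (coeff D \<phi> g k) (coeff D \<phi> h k) (\<lambda>t. f t (\<phi> k)) t)\<^sup>2) \<partial>lebesgue_on {0<..<T})
          \<le> ennreal (lam k powr (r + s)) * (ennreal C * (ennreal ((coeff D \<phi> g k)\<^sup>2) + ennreal (lam k powr (- s) * (coeff D \<phi> h k)\<^sup>2)
          + ennreal (lam k powr (2 * \<mu> * s - 2 * s)) * ?F k))"
        by (intro mult_left_mono C(2) lam f) simp
      also have "\<dots> = ennreal C * (ennreal (lam k powr (r + s)) * ennreal ((coeff D \<phi> g k)\<^sup>2)
          + ennreal (lam k powr (r + s)) * ennreal (lam k powr (- s) * (coeff D \<phi> h k)\<^sup>2)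
          + (ennreal (lam k powr (r + s)) * ennreal (lam k powr (2 * \<mu> * s - 2 * s))) * ?F k)"
        by (simp add: distrib_left mult_ac)
      also have "ennreal (lam k powr (r + s)) * ennreal ((coeff D \<phi> g k)\<^sup>2) = ennreal (lam k powr (r + s) * (coeff D \<phi> g k)\<^sup>2)"
        by (simp add: ennreal_mult)
      also have "ennreal (lam k powr (r + s)) * ennreal (lam k powr (- s) * (coeff D \<phi> h k)\<^sup>2) = ennreal (lam k powr r * (coeff D \<phi> h k)\<^sup>2)"
        by (simp flip: ennreal_mult mult.assoc powr_add)
      also have "ennreal (lam k powr (r + s)) * ennreal (lam k powr (2 * \<mu> * s - 2 * s)) = ennreal (lam k powr (r - s + 2 * \<mu> * s))"
        by (simp add: algebra_simps flip: ennreal_mult powr_add)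
      finally show "ennreal (lam k powr (r + s)) * (\<integral>\<^sup>+t. ennreal ((wave_coeff s \<gamma> (lam k) (coeff D \<phi> g k) (coeff D \<phi> h k) (\<lambda>t. f t (\<phi> k)) t)\<^sup>2) \<partial>lebesgue_on {0<..<T})
          \<le> ennreal C * (ennreal (lam k powr (r + s) * (coeff D \<phi> g k)\<^sup>2) + ennreal (lam k powr r * (coeff D \<phi> h k)\<^sup>2)
          + ennreal (lam k powr (r - s + 2 * \<mu> * s)) * ?F k)" .
    qed
    also have "\<dots> = ennreal C * ((\<Sum>k. ennreal (lam k powr (r + s) * (coeff D \<phi> g k)\<^sup>2)) + (\<Sum>k. ennreal (lam k powr r * (coeff D \<phi> h k)\<^sup>2))
          + (\<Sum>k. ennreal (lam k powr (r - s + 2 * \<mu> * s)) * ?F k))"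
      by (simp add: suminf_add[symmetric])
    also have "(\<Sum>k. ennreal (lam k powr (r - s + 2 * \<mu> * s)) * ?F k) = L2Hnorm2 T lam \<phi> (r - s + 2 * \<mu> * s) f"
    proof -
      have "L2Hnorm2 T lam \<phi> (r - s + 2 * \<mu> * s) f =
          (\<integral>\<^sup>+t. (\<Sum>k. ennreal (lam k powr (r - s + 2 * \<mu> * s)) * ennreal ((f t (\<phi> k))\<^sup>2)) \<partial>lebesgue_on {0<..<T})"
        unfolding L2Hnorm2_def Hnorm2_def by (simp add: ennreal_mult)
      also have "\<dots> = (\<Sum>k. ennreal (lam k powr (r - s + 2 * \<mu> * s)) * ?F k)"
        using f by (subst nn_integral_suminf) (auto simp: nn_integral_cmult)
      finally show ?thesis by simp
    qed
    finally show ?thesis unfolding data_norm2_def Hnorm2_def .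
  qed
  then show ?thesis using that C(1) by blast
qed

context cylinder_series
begin

text \<open>\<open>e\<close> is the power of \<open>lam k\<close> left by the \<open>y\<close>
  integral; matching it with the weight in the time estimate is the only link between the
  two.\<close>

lemma field_norm_data_bound:
  fixes \<Phi> :: "nat \<Rightarrow> 'a \<Rightarrow> 'b::euclidean_space"
  assumes Vm: "(\<lambda>(x, y, t). V x y t) \<in> borel_measurable borel"
    and est: "AE t in lborel. AE y in lborel. 0 < y \<longrightarrow> (\<forall>N. sqn \<Omega> (\<lambda>x. V x y t - (\<Sum>k<N. cf m j k t y *\<^sub>R \<Phi> k x))
      \<le> ennreal B * (\<Sum>k. ennreal ((cf m j (k + N) t y)\<^sup>2)))"
    and weighted: "\<And>k. (\<integral>\<^sup>+y. ennreal (indicator {0<..} y * (y powr \<beta> * exp (\<theta> * y) * (lam k powr (real m / 2) * q k j y)\<^sup>2)) \<partial>lborel)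
      \<le> ennreal (K * lam k powr e)"
    and data: "(\<Sum>k. ennreal (lam k powr e) * (\<integral>\<^sup>+t. ennreal ((u k t)\<^sup>2) \<partial>lborel)) \<le> ennreal C * D"
    and pos: "0 \<le> B" "0 \<le> K" "0 \<le> C"
  shows "wnorm2 \<Omega> T \<beta> \<theta> V \<le> ennreal (B * C * K) * D"
proof -
  let ?I = "\<lambda>k. \<integral>\<^sup>+t. ennreal ((u k t)\<^sup>2) \<partial>lborel"
  have "wnorm2 \<Omega> T \<beta> \<theta> V \<le> ennreal B * (\<Sum>k. ?I k *
    (\<integral>\<^sup>+y. ennreal (indicator {0<..} y * (y powr \<beta> * exp (\<theta> * y) * (lam k powr (real m / 2) * q k j y)\<^sup>2)) \<partial>lborel))"
    by (rule field_norm_bound[OF Vm est])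
  also have "\<dots> \<le> ennreal B * (\<Sum>k. ?I k * ennreal (K * lam k powr e))"
    by (intro mult_left_mono suminf_le summableI weighted) auto
  also have "(\<lambda>k. ?I k * ennreal (K * lam k powr e)) = (\<lambda>k. ennreal K * (ennreal (lam k powr e) * ?I k))"
    using pos by (simp add: ennreal_mult mult_ac)
  also have "ennreal B * (\<Sum>k. ennreal K * (ennreal (lam k powr e) * ?I k)) =
      ennreal B * ennreal K * (\<Sum>k. ennreal (lam k powr e) * ?I k)" by (simp add: mult.assoc)
  also have "\<dots> \<le> ennreal B * ennreal K * (ennreal C * D)" by (intro mult_left_mono data) simp
  also have "\<dots> = ennreal (B * C * K) * D" using pos by (simp add: ennreal_mult mult_ac)
  finally show ?thesis .
qed

lemma field_AE_L2_tendsto: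
  fixes \<Phi> :: "nat \<Rightarrow> 'a \<Rightarrow> 'b::euclidean_space"
  assumes L: "\<And>k. in_L2 \<Omega> (\<Phi> k)" and V: "(\<lambda>(x, y, t). V x y t) \<in> borel_measurable borel"
    and est: "AE t in lborel. AE y in lborel. 0 < y \<longrightarrow> (\<forall>N. sqn \<Omega> (\<lambda>x. V x y t - (\<Sum>k<N. cf m j k t y *\<^sub>R \<Phi> k x))
      \<le> ennreal B * (\<Sum>k. ennreal ((cf m j (k + N) t y)\<^sup>2)))"
  shows "AE t in lborel. AE y in lborel. 0 < y \<longrightarrow>
    L2_tendsto \<Omega> (\<lambda>N x. \<Sum>k<N. cf m j k t y *\<^sub>R \<Phi> k x) (\<lambda>x. V x y t)"
  using est AE_u_square_summable
proof eventually_elim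
  case (elim t)
  note fin = elim(2)
  from elim(1) show ?case
  proof eventually_elim
    case (elim y)
    show ?case
    proof
      assume y: "0 < y"
      show "L2_tendsto \<Omega> (\<lambda>N x. \<Sum>k<N. cf m j k t y *\<^sub>R \<Phi> k x) (\<lambda>x. V x y t)"
        by (rule field_L2_tendsto[OF L V elim[rule_format, OF y] fin y])
    qed
  qed
qed

lemma L2_tendsto_weak_grad:
  fixes \<phi> :: "nat \<Rightarrow> 'a \<Rightarrow> real"
  assumes "\<And>k. weak_grad \<Omega> (\<phi> k) (G k)"
    and "L2_tendsto \<Omega> (\<lambda>N x. \<Sum>k<N. b k * \<phi> k x) V" "L2_tendsto \<Omega> (\<lambda>N x. \<Sum>k<N. b k *\<^sub>R G k x) H"
  shows "weak_grad \<Omega> V H"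
  by (rule weak_grad_limit[OF \<Omega> _ assms(2,3)]) (intro weak_grad_sum \<Omega> assms(1))

end

theorem corollary4p6:
  fixes \<Omega> :: "(real^'n) set"
    and A :: "real^'n \<Rightarrow> real^'n^'n"
    and c :: "real^'n \<Rightarrow> real"
    and lam :: "nat \<Rightarrow> real"
    and \<phi> :: "nat \<Rightarrow> real^'n \<Rightarrow> real"
    and \<psi> :: "nat \<Rightarrow> real \<Rightarrow> real"
    and s \<gamma> T \<theta> \<sigma> \<nu> :: real
  assumes "open \<Omega>" and "bounded \<Omega>" and "convex \<Omega>"
    and "admissible_coefficients \<Omega> A c"
    and "eigenbasis \<Omega> A c lam \<phi>"
    and "\<And>k. extension_profile s (lam k) (\<psi> k)"
    and "0 < s" and "s < 1" and "1 < \<gamma>" and "\<gamma> < 2" and "0 < T"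
    and "0 \<le> \<theta>" and "\<theta> < 2 * sqrt (lam 0)"
    and "0 \<le> \<sigma>" and "\<sigma> < s" and "0 \<le> \<nu>" and "\<nu> < 1 + s"
  shows "\<exists>\<mu>\<^sub>0>0. \<forall>\<mu>. 0 < \<mu> \<and> \<mu> < \<mu>\<^sub>0 \<longrightarrow> (\<exists>\<kappa>>1. \<exists>C>0.
    \<forall>f g h U. source_family \<Omega> T lam \<phi> s f \<and> in_L2 \<Omega> g \<and> in_L2 \<Omega> h \<and>
        extended_solution \<Omega> T lam \<phi> \<psi> s \<gamma> f g h U \<longrightarrow>
      (\<forall>l::nat.
        (data_norm2 \<Omega> T lam \<phi> s \<mu> \<sigma> f g h < \<infinity> \<longrightarrow>
          (\<exists>V. dy_power \<Omega> T (l + 1) U V \<and>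
            wnorm2 \<Omega> T (1 - 2 * s + 2 * real l - 2 * \<sigma>) \<theta> V
              \<le> ennreal (C * \<kappa> ^ (2 * (l + 1)) * (fact (l + 1))\<^sup>2)
                * data_norm2 \<Omega> T lam \<phi> s \<mu> \<sigma> f g h)) \<and>
        (data_norm2 \<Omega> T lam \<phi> s \<mu> \<nu> f g h < \<infinity> \<longrightarrow>
          (\<exists>V G. dy_power \<Omega> T (l + 1) U V \<and> grad_x \<Omega> T V G \<and>
            wnorm2 \<Omega> T (1 - 2 * s + 2 * real (l + 1) - 2 * \<nu>) \<theta> G
              \<le> ennreal (C * \<kappa> ^ (2 * (l + 1)) * (fact (l + 1))\<^sup>2)
                * data_norm2 \<Omega> T lam \<phi> s \<mu> \<nu> f g h)) \<and>
        (data_norm2 \<Omega> T lam \<phi> s \<mu> (1 + \<nu>) f g h < \<infinity> \<longrightarrow>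
          (\<exists>V W. dy_power \<Omega> T (l + 1) U V \<and> elliptic_x \<Omega> A c T V W \<and>
            wnorm2 \<Omega> T (1 - 2 * s + 2 * real (l + 1) - 2 * \<nu>) \<theta> W
              \<le> ennreal (C * \<kappa> ^ (2 * (l + 1)) * (fact (l + 1))\<^sup>2)
                * data_norm2 \<Omega> T lam \<phi> s \<mu> (1 + \<nu>) f g h))))"
proof -
  note \<Omega> = assms(1,2) and adm = assms(4) and eb = assms(5) and \<psi> = assms(6)
  have lam: "0 < lam k" "lam 0 \<le> lam k" for k using eb unfolding eigenbasis_def by auto
  obtain G a where a: "0 < a" and G: "\<And>k. weak_grad \<Omega> (\<phi> k) (G k)" "\<And>k. H10_approx \<Omega> (\<phi> k) (G k)"
    "\<And>k \<eta>. test_function \<Omega> \<eta> \<Longrightarrow> energy_form \<Omega> A c (\<phi> k) (G k) \<eta> (grad \<eta>) = (\<integral>x. lam k * \<phi> k x * \<eta> x \<partial>lebesgue_on \<Omega>)"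
    and Gb: "\<And>I b. finite I \<Longrightarrow> sqn \<Omega> (\<lambda>x. \<Sum>k\<in>I. b k *\<^sub>R G k x) \<le> ennreal (a * (\<Sum>k\<in>I. lam k * (b k)\<^sup>2))"
    by (rule eigenbasis_gradients[OF \<Omega> adm eb]) (rule that)
  have L: "in_L2 \<Omega> (\<phi> k)" "in_L2 \<Omega> (G k)" for k using G(2) unfolding H10_approx_def by auto
  have \<phi>b: "sqn \<Omega> (\<lambda>x. \<Sum>k\<in>I. b k *\<^sub>R \<phi> k x) \<le> ennreal (1 * (\<Sum>k\<in>I. (b k)\<^sup>2))" if "finite I" for I b
    using eigenbasis_bessel[OF eb that L(1), of b] by simp
  \<comment> \<open>Normalised so that the Bessel constant \<open>a\<close> is the same for all
    \<open>k\<close>; the factor \<open>sqrt (lam k)\<close> reappears in the coefficients of order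
    \<open>m = 1\<close>.\<close>
  define \<Gamma> where "\<Gamma> k x = (1 / sqrt (lam k)) *\<^sub>R G k x" for k x
  have L\<Gamma>: "in_L2 \<Omega> (\<Gamma> k)" for k unfolding \<Gamma>_def[abs_def] by (intro in_L2_scaleR L)
  have \<Gamma>b: "sqn \<Omega> (\<lambda>x. \<Sum>k\<in>I. b k *\<^sub>R \<Gamma> k x) \<le> ennreal (a * (\<Sum>k\<in>I. (b k)\<^sup>2))" if "finite I" for I b
  proof -
    have "lam k * (b k / sqrt (lam k))\<^sup>2 = (b k)\<^sup>2" for k using lam(1)[of k] by (simp add: power_divide)
    then show ?thesis using Gb[OF that, of "\<lambda>k. b k / sqrt (lam k)"] by (simp add: \<Gamma>_def)
  qed
  obtain q C0 \<kappa> \<delta> where q: "\<And>k j. q k j \<in> borel_measurable borel"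
    "\<And>k j y. 0 < y \<Longrightarrow> (q k j has_real_derivative q k (Suc j) y) (at y)"
    "\<And>k j y. y \<le> 0 \<Longrightarrow> q k j y = 0" "\<And>k y. 0 < y \<Longrightarrow> q k 0 y = \<psi> k y"
    "\<And>j m. \<exists>C. \<forall>k y. 0 < y \<longrightarrow> lam k powr (real m / 2) * \<bar>q k j y\<bar> * y ^ (j + m) \<le> C"
    and \<kappa>: "1 < \<kappa>" and C0: "0 < C0" and \<delta>: "0 < \<delta>" and weighted:
    "\<And>k j m \<beta> p. 1 \<le> j \<Longrightarrow> 0 < p \<Longrightarrow> p = \<beta> + 4 * s - 2 * real j + 1 \<Longrightarrow>
      (\<integral>\<^sup>+y. ennreal (indicator {0<..} y * (y powr \<beta> * exp (\<theta> * y) * (lam k powr (real m / 2) * q k j y)\<^sup>2)) \<partial>lborel)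
      \<le> ennreal (C0\<^sup>2 * (Gamma p / \<delta> powr p) * (\<kappa> ^ (2 * j) * (fact j)\<^sup>2) * lam k powr (real m + 2 * s - p / 2))"
    by (rule profile_family[where lam = lam and \<psi> = \<psi> and s = s and \<theta> = \<theta>]) (use lam \<psi> assms(7-) in \<open>blast+\<close>)
  have T: "{0<..<T} \<in> sets (borel :: real measure)" "{0<..} \<in> sets (borel :: real measure)" by auto
  show ?thesis
  \<comment> \<open>For \<open>\<mu> < 1\<close> the exponent \<open>1 - \<mu>\<close> lies in the
    range of the Mittag-Leffler bound, hence the threshold 1.\<close>
  proof (rule exI[of _ 1], intro conjI allI impI, simp, elim conjE)
    fix \<mu> :: real assume \<mu>: "0 < \<mu>" "\<mu> < 1"
    obtain Cu where Cu: "0 < Cu" and data: "\<And>D lam \<phi> r f g h. (\<forall>k. 0 < lam k) \<Longrightarrow>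
     (\<forall>k. (\<lambda>t. f t (\<phi> k)) \<in> borel_measurable (lebesgue_on {0<..<T})) \<Longrightarrow>
     (\<Sum>k. ennreal (lam k powr (r + s)) * (\<integral>\<^sup>+t. ennreal ((wave_coeff s \<gamma> (lam k) (coeff D \<phi> g k) (coeff D \<phi> h k) (\<lambda>t. f t (\<phi> k)) t)\<^sup>2) \<partial>lebesgue_on {0<..<T}))
       \<le> ennreal Cu * data_norm2 D T lam (\<phi> :: nat \<Rightarrow> real^'n \<Rightarrow> real) s \<mu> r f g h"
      by (rule wave_coeff_data_bound[OF assms(9,10,11) \<mu>, where s = s]) (rule that)
    \<comment> \<open>The values of \<open>p\<close> in \<open>weighted\<close> for the weights of
      the theorem; \<open>p2\<close> serves both the gradient and the operator, whose weights
      agree.\<close>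
    define p1 where "p1 = 2 * s - 2 * \<sigma>"
    define p2 where "p2 = 2 + 2 * s - 2 * \<nu>"
    have p: "0 < p1" "0 < p2" using assms by (auto simp: p1_def p2_def)
    define K1 where "K1 = C0\<^sup>2 * (Gamma p1 / \<delta> powr p1)"
    define K2 where "K2 = C0\<^sup>2 * (Gamma p2 / \<delta> powr p2)"
    have K: "0 \<le> K1" "0 \<le> K2" using p by (auto simp: K1_def K2_def Gamma_real_nonneg)
    \<comment> \<open>The last summand secures \<open>C > 0\<close>, as \<open>K1\<close> and
      \<open>K2\<close> are only known to be nonnegative.\<close>
    define C where "C = Cu * K1 + a * Cu * K2 + Cu * K2 + 1"
    have C: "0 < C" "Cu * K1 \<le> C" "a * Cu * K2 \<le> C" "Cu * K2 \<le> C"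
      using Cu a K by (auto simp: C_def intro!: add_nonneg_pos add_nonneg_nonneg mult_nonneg_nonneg)
    show "\<exists>\<kappa>>1. \<exists>C>0. \<forall>f g h U. source_family \<Omega> T lam \<phi> s f \<and> in_L2 \<Omega> g \<and> in_L2 \<Omega> h \<and>
        extended_solution \<Omega> T lam \<phi> \<psi> s \<gamma> f g h U \<longrightarrow>
      (\<forall>l::nat.
        (data_norm2 \<Omega> T lam \<phi> s \<mu> \<sigma> f g h < \<infinity> \<longrightarrow>
          (\<exists>V. dy_power \<Omega> T (l + 1) U V \<and>
            wnorm2 \<Omega> T (1 - 2 * s + 2 * real l - 2 * \<sigma>) \<theta> V
              \<le> ennreal (C * \<kappa> ^ (2 * (l + 1)) * (fact (l + 1))\<^sup>2)
                * data_norm2 \<Omega> T lam \<phi> s \<mu> \<sigma> f g h)) \<and>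
        (data_norm2 \<Omega> T lam \<phi> s \<mu> \<nu> f g h < \<infinity> \<longrightarrow>
          (\<exists>V G. dy_power \<Omega> T (l + 1) U V \<and> grad_x \<Omega> T V G \<and>
            wnorm2 \<Omega> T (1 - 2 * s + 2 * real (l + 1) - 2 * \<nu>) \<theta> G
              \<le> ennreal (C * \<kappa> ^ (2 * (l + 1)) * (fact (l + 1))\<^sup>2)
                * data_norm2 \<Omega> T lam \<phi> s \<mu> \<nu> f g h)) \<and>
        (data_norm2 \<Omega> T lam \<phi> s \<mu> (1 + \<nu>) f g h < \<infinity> \<longrightarrow>
          (\<exists>V W. dy_power \<Omega> T (l + 1) U V \<and> elliptic_x \<Omega> A c T V W \<and>
            wnorm2 \<Omega> T (1 - 2 * s + 2 * real (l + 1) - 2 * \<nu>) \<theta> W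
              \<le> ennreal (C * \<kappa> ^ (2 * (l + 1)) * (fact (l + 1))\<^sup>2)
                * data_norm2 \<Omega> T lam \<phi> s \<mu> (1 + \<nu>) f g h)))"
    proof (rule exI[of _ \<kappa>], intro conjI \<kappa>, rule exI[of _ C], intro conjI C(1) allI impI)
      fix f :: "real \<Rightarrow> (real^'n \<Rightarrow> real) \<Rightarrow> real" and g h U and l :: nat
      assume "source_family \<Omega> T lam \<phi> s f \<and> in_L2 \<Omega> g \<and> in_L2 \<Omega> h \<and> extended_solution \<Omega> T lam \<phi> \<psi> s \<gamma> f g h U"
      then have src: "source_family \<Omega> T lam \<phi> s f" and sol: "extended_solution \<Omega> T lam \<phi> \<psi> s \<gamma> f g h U" by blast+
      define j where "j = l + 1"
      have j: "1 \<le> j" "real j = real l + 1" by (auto simp: j_def)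
      \<comment> \<open>The source is measurable in time against elements of \<open>Hspace\<close>,
        to which the eigenfunctions belong.\<close>
      have fm: "(\<lambda>t. f t (\<phi> k)) \<in> borel_measurable (lebesgue_on {0<..<T})" for k
        using src eigenfunction_in_Hspace[OF eb L(1)] unfolding source_family_def by blast
      let ?w = "\<lambda>k t. wave_coeff s \<gamma> (lam k) (coeff \<Omega> \<phi> g k) (coeff \<Omega> \<phi> h k) (\<lambda>t. f t (\<phi> k)) t"
      have "\<forall>k. \<exists>ub. ub \<in> borel_measurable borel \<and> (\<forall>t. 0 < t \<longrightarrow> t < T \<longrightarrow> ?w k t = ub t)"
      proof
        fix k
        show "\<exists>ub. ub \<in> borel_measurable borel \<and> (\<forall>t. 0 < t \<longrightarrow> t < T \<longrightarrow> ?w k t = ub t)"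
          by (rule wave_coeff_measurable[OF assms(11) fm[of k]]) blast
      qed
      from choice[OF this] obtain ub where ub: "\<And>k. ub k \<in> borel_measurable borel"
        "\<And>k t. 0 < t \<Longrightarrow> t < T \<Longrightarrow> ?w k t = ub k t" by blast
      \<comment> \<open>Cut off outside \<open>(0, T)\<close>, where \<open>ub\<close> and
        \<open>wave_coeff\<close> need not agree.\<close>
      define u where "u k t = indicator {0<..<T} t * ub k t" for k t
      have um: "u k \<in> borel_measurable borel" for k unfolding u_def[abs_def] using ub(1) by measurable
      have u_int: "(\<integral>\<^sup>+t. ennreal ((u k t)\<^sup>2) \<partial>lborel) = (\<integral>\<^sup>+t. ennreal ((?w k t)\<^sup>2) \<partial>lebesgue_on {0<..<T})" for k
        unfolding nn_integral_lebesgue_on[OF T(1)]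
        by (intro nn_integral_cong) (use ub(2) in \<open>auto simp: u_def indicator_def\<close>)
      have u_data: "(\<Sum>k. ennreal (lam k powr (r + s)) * (\<integral>\<^sup>+t. ennreal ((u k t)\<^sup>2) \<partial>lborel))
          \<le> ennreal Cu * data_norm2 \<Omega> T lam \<phi> s \<mu> r f g h" for r
        unfolding u_int by (rule data) (use lam(1) fm in simp_all)
      \<comment> \<open>As \<open>r + s > 0\<close>, the weights \<open>lam k powr (r + s)\<close>
        are bounded below by the one at \<open>lam 0\<close>, so a finite data norm gives the
        unweighted summability.\<close>
      have cyl: "cylinder_series \<Omega> lam u q" if r: "0 \<le> r" and fin: "data_norm2 \<Omega> T lam \<phi> s \<mu> r f g h < \<infinity>" for r
      proof
        define k0 where "k0 = lam 0 powr (r + s)"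
        have k0: "0 < k0" using lam(1)[of 0] by (simp add: k0_def)
        have "ennreal k0 * (\<Sum>k. \<integral>\<^sup>+t. ennreal ((u k t)\<^sup>2) \<partial>lborel) =
            (\<Sum>k. ennreal k0 * (\<integral>\<^sup>+t. ennreal ((u k t)\<^sup>2) \<partial>lborel))" by simp
        also have "\<dots> \<le> (\<Sum>k. ennreal (lam k powr (r + s)) * (\<integral>\<^sup>+t. ennreal ((u k t)\<^sup>2) \<partial>lborel))"
          unfolding k0_def using r assms(7) lam(1)[of 0] lam(2)
          by (intro suminf_le summableI mult_right_mono ennreal_leI powr_mono2) auto
        also have "\<dots> \<le> ennreal Cu * data_norm2 \<Omega> T lam \<phi> s \<mu> r f g h" by (rule u_data)
        also have "\<dots> < \<infinity>" using fin by (simp add: ennreal_mult_less_top)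
        finally show "(\<Sum>k. \<integral>\<^sup>+t. ennreal ((u k t)\<^sup>2) \<partial>lborel) < \<infinity>"
          using k0 by (auto simp: ennreal_mult_less_top)
      qed (use \<Omega> lam um q in auto)
      have U: "cyl_measurable \<Omega> T U" using sol unfolding extended_solution_def by blast
      have sol': "AE t in lborel. t \<in> {0<..<T} \<longrightarrow> (AE y in lborel. 0 < y \<longrightarrow>
          L2_tendsto \<Omega> (\<lambda>N x. \<Sum>k<N. ?w k t * \<phi> k x * \<psi> k y) (\<lambda>x. U x y t))"
        using sol unfolding extended_solution_def AE_lebesgue_on_iff[OF T(1)] AE_lebesgue_on_iff[OF T(2)]
        by (simp only: greaterThan_iff)
      let ?X = "\<kappa> ^ (2 * j) * (fact j)\<^sup>2"
      have X: "0 \<le> ?X" using \<kappa> by simp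
      have const: "ennreal (B * Cu * (K * ?X)) * D \<le> ennreal (C * \<kappa> ^ (2 * (l + 1)) * (fact (l + 1))\<^sup>2) * D"
        if "B * Cu * K \<le> C" for B K D
      proof -
        have "B * Cu * (K * ?X) = (B * Cu * K) * ?X" by (simp only: mult_ac)
        also have "\<dots> \<le> C * ?X" by (rule mult_right_mono[OF that X])
        finally have "B * Cu * (K * ?X) \<le> C * \<kappa> ^ (2 * (l + 1)) * (fact (l + 1))\<^sup>2" by (simp only: j_def mult.assoc)
        then show ?thesis by (intro mult_right_mono ennreal_leI) simp_all
      qed
      have cyl_meas: "cyl_measurable \<Omega> T V" if "(\<lambda>(x, y, t). V x y t) \<in> borel_measurable borel"
        for V :: "real^'n \<Rightarrow> real \<Rightarrow> real \<Rightarrow> 'b::euclidean_space"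
        unfolding cyl_measurable_def by (rule borel_measurable_lebesgue_on_borel[OF that])
      let ?cf = "cylinder_series.cf lam u q"
      \<comment> \<open>Stated for a free index \<open>r\<close>, as the three bounds assume three
        different data norms to be finite.\<close>
      have y_derivative: "\<exists>V. (\<lambda>(x, y, t). V x y t) \<in> borel_measurable borel \<and>
          (AE t in lborel. AE y in lborel. 0 < y \<longrightarrow> (\<forall>N. sqn \<Omega> (\<lambda>x. V x y t - (\<Sum>k<N. ?cf 0 j k t y *\<^sub>R \<phi> k x))
            \<le> ennreal 1 * (\<Sum>k. ennreal ((?cf 0 j (k + N) t y)\<^sup>2)))) \<and>
          dy_power \<Omega> T j U V \<and>
          (AE t in lborel. AE y in lborel. 0 < y \<longrightarrow>
            L2_tendsto \<Omega> (\<lambda>N x. \<Sum>k<N. ?cf 0 j k t y * \<phi> k x) (\<lambda>x. V x y t))"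
        if "0 \<le> r" "data_norm2 \<Omega> T lam \<phi> s \<mu> r f g h < \<infinity>" for r
      proof -
        interpret cylinder_series \<Omega> lam u q by (rule cyl[OF that])
        have series: "AE t in lborel. t \<in> {0<..<T} \<longrightarrow> (AE y in lborel. 0 < y \<longrightarrow>
            L2_tendsto \<Omega> (\<lambda>N x. \<Sum>k<N. cf 0 0 k t y *\<^sub>R \<phi> k x) (\<lambda>x. U x y t))"
          using sol'
        proof eventually_elim
          case (elim t)
          show ?case
          proof
            assume t: "t \<in> {0<..<T}"
            from elim[rule_format, OF t] show "AE y in lborel. 0 < y \<longrightarrow>
              L2_tendsto \<Omega> (\<lambda>N x. \<Sum>k<N. cf 0 0 k t y *\<^sub>R \<phi> k x) (\<lambda>x. U x y t)"
            proof eventually_elim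
              case (elim y)
              show ?case
              proof
                assume y: "0 < y"
                have "cf 0 0 k t y *\<^sub>R \<phi> k x = ?w k t * \<phi> k x * \<psi> k y" for k x
                  using lam(1)[of k] t ub(2)[of t k] q(4)[OF y] by (simp add: cf_def u_def)
                then show "L2_tendsto \<Omega> (\<lambda>N x. \<Sum>k<N. cf 0 0 k t y *\<^sub>R \<phi> k x) (\<lambda>x. U x y t)"
                  using elim[rule_format, OF y] by (simp only:)
              qed
            qed
          qed
        qed
        obtain V where V: "\<And>j. (\<lambda>(x, y, t). V j x y t) \<in> borel_measurable borel"
          "\<And>j. AE t in lborel. AE y in lborel. 0 < y \<longrightarrow> (\<forall>N. sqn \<Omega> (\<lambda>x. V j x y t - (\<Sum>k<N. cf 0 j k t y *\<^sub>R \<phi> k x))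
            \<le> ennreal 1 * (\<Sum>k. ennreal ((cf 0 j (k + N) t y)\<^sup>2)))"
          "\<And>j. dy_power \<Omega> T j U (V j)"
          by (rule solution_derivative_fields[OF L(1) \<phi>b U series]) (assumption | rule that)+
        from field_AE_L2_tendsto[OF L(1) V(1,2), of j]
        have "AE t in lborel. AE y in lborel. 0 < y \<longrightarrow>
            L2_tendsto \<Omega> (\<lambda>N x. \<Sum>k<N. ?cf 0 j k t y * \<phi> k x) (\<lambda>x. V j x y t)" by (simp only: real_scaleR_def)
        then show ?thesis using V by blast
      qed
      have gradient: "\<exists>H. (\<lambda>(x, y, t). H x y t) \<in> borel_measurable borel \<and>
          (AE t in lborel. AE y in lborel. 0 < y \<longrightarrow> (\<forall>N. sqn \<Omega> (\<lambda>x. H x y t - (\<Sum>k<N. ?cf 1 j k t y *\<^sub>R \<Gamma> k x))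
            \<le> ennreal a * (\<Sum>k. ennreal ((?cf 1 j (k + N) t y)\<^sup>2)))) \<and>
          (AE t in lborel. AE y in lborel. 0 < y \<longrightarrow>
            L2_tendsto \<Omega> (\<lambda>N x. \<Sum>k<N. ?cf 0 j k t y *\<^sub>R G k x) (\<lambda>x. H x y t))"
        if "0 \<le> r" "data_norm2 \<Omega> T lam \<phi> s \<mu> r f g h < \<infinity>" for r
      proof -
        interpret cylinder_series \<Omega> lam u q by (rule cyl[OF that])
        obtain H where H: "(\<lambda>(x, y, t). H x y t) \<in> borel_measurable borel"
          "AE t in lborel. AE y in lborel. 0 < y \<longrightarrow> (\<forall>N. sqn \<Omega> (\<lambda>x. H x y t - (\<Sum>k<N. cf 1 j k t y *\<^sub>R \<Gamma> k x))
            \<le> ennreal a * (\<Sum>k. ennreal ((cf 1 j (k + N) t y)\<^sup>2)))"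
          by (rule field_exists[of \<Gamma> a 1 j, OF L\<Gamma> less_imp_le[OF a] \<Gamma>b]) (assumption | rule that)+
        \<comment> \<open>The normalisation of \<open>\<Gamma>\<close> cancels, so the limit is the
          gradient series with the same coefficients as \<open>V\<close>.\<close>
        have "cf 1 j k t y *\<^sub>R \<Gamma> k x = cf 0 j k t y *\<^sub>R G k x" for k t y x
          using lam(1)[of k] by (simp add: cf_def \<Gamma>_def powr_half_sqrt)
        with field_AE_L2_tendsto[OF L\<Gamma> H]
        have "AE t in lborel. AE y in lborel. 0 < y \<longrightarrow>
            L2_tendsto \<Omega> (\<lambda>N x. \<Sum>k<N. ?cf 0 j k t y *\<^sub>R G k x) (\<lambda>x. H x y t)" by (simp only:)
        then show ?thesis using H by blast
      qed
      show "\<exists>V. dy_power \<Omega> T (l + 1) U V \<and> wnorm2 \<Omega> T (1 - 2 * s + 2 * real l - 2 * \<sigma>) \<theta> V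
          \<le> ennreal (C * \<kappa> ^ (2 * (l + 1)) * (fact (l + 1))\<^sup>2) * data_norm2 \<Omega> T lam \<phi> s \<mu> \<sigma> f g h"
        if fin: "data_norm2 \<Omega> T lam \<phi> s \<mu> \<sigma> f g h < \<infinity>"
      proof -
        interpret cylinder_series \<Omega> lam u q by (rule cyl[OF assms(14) fin])
        obtain V where Vm: "(\<lambda>(x, y, t). V x y t) \<in> borel_measurable borel"
          and Vest: "AE t in lborel. AE y in lborel. 0 < y \<longrightarrow> (\<forall>N. sqn \<Omega> (\<lambda>x. V x y t - (\<Sum>k<N. cf 0 j k t y *\<^sub>R \<phi> k x))
            \<le> ennreal 1 * (\<Sum>k. ennreal ((cf 0 j (k + N) t y)\<^sup>2)))"
          and V: "dy_power \<Omega> T j U V"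
          using y_derivative[OF assms(14) fin] by blast
        \<comment> \<open>The first identity is the exponent as prescribed by
          \<open>weighted\<close>; the second matches the leftover power of \<open>lam k\<close>
          with the one in \<open>u_data\<close>.\<close>
        have e: "p1 = 1 - 2 * s + 2 * real l - 2 * \<sigma> + 4 * s - 2 * real j + 1" "real 0 + 2 * s - p1 / 2 = \<sigma> + s"
          by (simp_all add: p1_def j(2) field_simps)
        have "wnorm2 \<Omega> T (1 - 2 * s + 2 * real l - 2 * \<sigma>) \<theta> V \<le> ennreal (1 * Cu * (K1 * ?X)) * data_norm2 \<Omega> T lam \<phi> s \<mu> \<sigma> f g h"
          using weighted[OF j(1) p(1) e(1), where m = 0, unfolded e(2), folded K1_def] X K Cu
          by (intro field_norm_data_bound[OF Vm Vest _ u_data[of \<sigma>]]) (simp_all add: mult.assoc)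
        also have "\<dots> \<le> ennreal (C * \<kappa> ^ (2 * (l + 1)) * (fact (l + 1))\<^sup>2) * data_norm2 \<Omega> T lam \<phi> s \<mu> \<sigma> f g h"
          by (rule const) (use C(2) in simp)
        finally show ?thesis using V unfolding j_def by blast
      qed
      show "\<exists>V G. dy_power \<Omega> T (l + 1) U V \<and> grad_x \<Omega> T V G \<and> wnorm2 \<Omega> T (1 - 2 * s + 2 * real (l + 1) - 2 * \<nu>) \<theta> G
          \<le> ennreal (C * \<kappa> ^ (2 * (l + 1)) * (fact (l + 1))\<^sup>2) * data_norm2 \<Omega> T lam \<phi> s \<mu> \<nu> f g h"
        if fin: "data_norm2 \<Omega> T lam \<phi> s \<mu> \<nu> f g h < \<infinity>"
      proof -
        interpret cylinder_series \<Omega> lam u q by (rule cyl[OF assms(16) fin])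
        obtain V where V: "dy_power \<Omega> T j U V"
          and Vlim: "AE t in lborel. AE y in lborel. 0 < y \<longrightarrow>
            L2_tendsto \<Omega> (\<lambda>N x. \<Sum>k<N. cf 0 j k t y * \<phi> k x) (\<lambda>x. V x y t)"
          using y_derivative[OF assms(16) fin] by blast
        obtain H where Hm: "(\<lambda>(x, y, t). H x y t) \<in> borel_measurable borel"
          and Hest: "AE t in lborel. AE y in lborel. 0 < y \<longrightarrow> (\<forall>N. sqn \<Omega> (\<lambda>x. H x y t - (\<Sum>k<N. cf 1 j k t y *\<^sub>R \<Gamma> k x))
            \<le> ennreal a * (\<Sum>k. ennreal ((cf 1 j (k + N) t y)\<^sup>2)))"
          and Hlim: "AE t in lborel. AE y in lborel. 0 < y \<longrightarrow>
            L2_tendsto \<Omega> (\<lambda>N x. \<Sum>k<N. cf 0 j k t y *\<^sub>R G k x) (\<lambda>x. H x y t)"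
          using gradient[OF assms(16) fin] by blast
        have "AE t in lborel. AE y in lborel. 0 < y \<longrightarrow> weak_grad \<Omega> (\<lambda>x. V x y t) (\<lambda>x. H x y t)"
          using Vlim Hlim
        proof eventually_elim
          case (elim t)
          then show ?case
            by eventually_elim (intro impI, rule L2_tendsto_weak_grad[OF G(1)], simp_all)
        qed
        then have "AE t in lborel. t \<in> {0<..<T} \<longrightarrow> (AE y in lborel. y \<in> {0<..} \<longrightarrow> weak_grad \<Omega> (\<lambda>x. V x y t) (\<lambda>x. H x y t))"
          by eventually_elim simp
        then have "grad_x \<Omega> T V H"
          unfolding grad_x_def AE_lebesgue_on_iff[OF T(1)] AE_lebesgue_on_iff[OF T(2)]
          using cyl_meas[OF Hm] by blast
        have e: "p2 = 1 - 2 * s + 2 * real (l + 1) - 2 * \<nu> + 4 * s - 2 * real j + 1" "real 1 + 2 * s - p2 / 2 = \<nu> + s"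
          by (simp_all add: p2_def j(2) field_simps)
        have "wnorm2 \<Omega> T (1 - 2 * s + 2 * real (l + 1) - 2 * \<nu>) \<theta> H \<le> ennreal (a * Cu * (K2 * ?X)) * data_norm2 \<Omega> T lam \<phi> s \<mu> \<nu> f g h"
          using weighted[OF j(1) p(2) e(1), where m = 1, unfolded e(2), folded K2_def] X K Cu a
          by (intro field_norm_data_bound[OF Hm Hest _ u_data[of \<nu>]]) (simp_all add: mult.assoc)
        also have "\<dots> \<le> ennreal (C * \<kappa> ^ (2 * (l + 1)) * (fact (l + 1))\<^sup>2) * data_norm2 \<Omega> T lam \<phi> s \<mu> \<nu> f g h"
          by (rule const[OF C(3)])
        finally show ?thesis using V \<open>grad_x \<Omega> T V H\<close> unfolding j_def by blast
      qed
      show "\<exists>V W. dy_power \<Omega> T (l + 1) U V \<and> elliptic_x \<Omega> A c T V W \<and> wnorm2 \<Omega> T (1 - 2 * s + 2 * real (l + 1) - 2 * \<nu>) \<theta> W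
          \<le> ennreal (C * \<kappa> ^ (2 * (l + 1)) * (fact (l + 1))\<^sup>2) * data_norm2 \<Omega> T lam \<phi> s \<mu> (1 + \<nu>) f g h"
        if fin: "data_norm2 \<Omega> T lam \<phi> s \<mu> (1 + \<nu>) f g h < \<infinity>"
      proof -
        have \<nu>1: "0 \<le> 1 + \<nu>" using assms(16) by simp
        interpret cylinder_series \<Omega> lam u q by (rule cyl[OF \<nu>1 fin])
        obtain V where V: "dy_power \<Omega> T j U V"
          and Vlim: "AE t in lborel. AE y in lborel. 0 < y \<longrightarrow>
            L2_tendsto \<Omega> (\<lambda>N x. \<Sum>k<N. cf 0 j k t y * \<phi> k x) (\<lambda>x. V x y t)"
          using y_derivative[OF \<nu>1 fin] by blast
        obtain H where Hlim: "AE t in lborel. AE y in lborel. 0 < y \<longrightarrow>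
            L2_tendsto \<Omega> (\<lambda>N x. \<Sum>k<N. cf 0 j k t y *\<^sub>R G k x) (\<lambda>x. H x y t)"
          using gradient[OF \<nu>1 fin] by blast
        obtain W where Wm: "(\<lambda>(x, y, t). W x y t) \<in> borel_measurable borel"
          and West: "AE t in lborel. AE y in lborel. 0 < y \<longrightarrow> (\<forall>N. sqn \<Omega> (\<lambda>x. W x y t - (\<Sum>k<N. cf 2 j k t y *\<^sub>R \<phi> k x))
            \<le> ennreal 1 * (\<Sum>k. ennreal ((cf 2 j (k + N) t y)\<^sup>2)))"
          by (rule field_exists[of \<phi> 1 2 j, OF L(1) zero_le_one \<phi>b]) (assumption | rule that)+
        \<comment> \<open>Order \<open>m = 2\<close> amounts to one full factor
          \<open>lam k\<close>, the action of the operator on \<open>\<phi> k\<close>.\<close>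
        have "cf 2 j k t y *\<^sub>R \<phi> k x = cf 0 j k t y * lam k * \<phi> k x" for k t y x
          using lam(1)[of k] by (simp add: cf_def)
        with field_AE_L2_tendsto[OF L(1) Wm West]
        have Wlim: "AE t in lborel. AE y in lborel. 0 < y \<longrightarrow>
            L2_tendsto \<Omega> (\<lambda>N x. \<Sum>k<N. cf 0 j k t y * lam k * \<phi> k x) (\<lambda>x. W x y t)" by (simp only:)
        have "AE t in lborel. AE y in lborel. 0 < y \<longrightarrow> elliptic_eq \<Omega> A c (\<lambda>x. V x y t) (\<lambda>x. W x y t)"
          using Vlim Hlim Wlim
        proof eventually_elim
          case (elim t)
          then show ?case
          proof eventually_elim
            case (elim y)
            show ?case
            proof
              assume y: "0 < y"
              show "elliptic_eq \<Omega> A c (\<lambda>x. V x y t) (\<lambda>x. W x y t)"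
                by (rule eigen_expansion_elliptic[OF assms(1,2) adm G elim(1)[rule_format, OF y] elim(2)[rule_format, OF y]
                  elim(3)[rule_format, OF y]])
            qed
          qed
        qed
        then have "AE t in lborel. t \<in> {0<..<T} \<longrightarrow> (AE y in lborel. y \<in> {0<..} \<longrightarrow> elliptic_eq \<Omega> A c (\<lambda>x. V x y t) (\<lambda>x. W x y t))"
          by eventually_elim simp
        then have "elliptic_x \<Omega> A c T V W"
          unfolding elliptic_x_def AE_lebesgue_on_iff[OF T(1)] AE_lebesgue_on_iff[OF T(2)]
          using cyl_meas[OF Wm] by blast
        have e: "p2 = 1 - 2 * s + 2 * real (l + 1) - 2 * \<nu> + 4 * s - 2 * real j + 1" "real 2 + 2 * s - p2 / 2 = 1 + \<nu> + s"
          by (simp_all add: p2_def j(2) field_simps)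
        have "wnorm2 \<Omega> T (1 - 2 * s + 2 * real (l + 1) - 2 * \<nu>) \<theta> W \<le> ennreal (1 * Cu * (K2 * ?X)) * data_norm2 \<Omega> T lam \<phi> s \<mu> (1 + \<nu>) f g h"
          using weighted[OF j(1) p(2) e(1), where m = 2, unfolded e(2), folded K2_def] X K Cu
          by (intro field_norm_data_bound[OF Wm West _ u_data[of "1 + \<nu>"]]) (simp_all add: mult.assoc)
        also have "\<dots> \<le> ennreal (C * \<kappa> ^ (2 * (l + 1)) * (fact (l + 1))\<^sup>2) * data_norm2 \<Omega> T lam \<phi> s \<mu> (1 + \<nu>) f g h"
          by (rule const) (use C(4) in simp)
        finally show ?thesis using V \<open>elliptic_x \<Omega> A c T V W\<close> unfolding j_def by blast
      qed
    qed
  qed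
qed

end
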